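(* Let $\Phi$ be the random dynamical system associated to the stochastic Fokker-Planck equation $$dp = \Big[\nabla\cdot(p\,\nabla V) + \tfrac12\sigma^2\Delta p\Big]dt - \eta\nabla p\circ dB(t),$$ let $p_\rho$ be the Lebesgue density of the stationary measure $\rho$ of the SDE $dx(t)=-\nabla V(x(t))dt+\sigma dW(t)+\eta dB(t)$ in $\mathbb{R}^d$, and let $$\mu_\beta:=\int_{\Omega_W}\mu_{\omega,\beta}\,\mathbb{P}_W(d\omega),\qquad \mu_{\omega,\beta}:=\lim_{\tau\to\infty}\phi(\tau,\theta_{-\tau}\omega,\theta_{-\tau}\beta)_*\rho .$$ Then, $\mathbb{P}_B$-almost surely, $\mu_\beta$ is a probability measure on $\mathscr{B}(\mathbb{R}^d)$ with Lebesgue density $p_\beta$, where $$p_\beta=\lim_{\tau\to\infty}\Phi(\tau,\theta_{-\tau}\beta)p_\rho,$$ and $$\int_{\Omega_B}p_\beta\,\mathbb{P}_B(d\beta)=p_\rho.$$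
   Context: Setting: $V:\mathbb{R}^d\to\mathbb{R}$ is $C^\infty$ and $\sigma,\eta$ are constant positive definite $d\times d$ matrices; there is $C>0$ with $\nabla V(x+\eta b)\cdot x\,\|x\|^2\ge\frac12\|x\|^6-C|b|^6$ for all $x,b\in\mathbb{R}^d$ (Euclidean norms). For matrix $\sigma$, $\sigma^2\Delta$ means $\sum_{i,j}(\sigma\sigma^\top)_{ij}\partial_i\partial_j$. Noise: $\Omega=\Omega_W\times\Omega_B$ with $\Omega_W=\Omega_B=C_0(\mathbb{R},\mathbb{R}^d)$ (continuous paths vanishing at $0$), $\mathbb{P}=\mathbb{P}_W\otimes\mathbb{P}_B$ the product of Wiener measures, so that $W$ (intrinsic noise, paths $\omega$) and $B$ (common noise, paths $\beta$) are independent two-sided $d$-dimensional Brownian motions; $(\theta_t\xi)(s)=\xi(s+t)-\xi(t)$ is the Wiener shift on each factor. $\phi(t,\omega,\beta):\mathbb{R}^d\to\mathbb{R}^d$, $t\ge0$, is the random dynamical system (flow) generated by the SDE with noise paths $(\omega,\beta)$; $\phi(\cdot)_*\rho$ is the push-forward of $\rho$. The SDE has a unique stationary measure $\rho$, and the (weak) limit $\mu_{\omega,\beta}$ exists as a probability measure for $\mathbb{P}$-a.e. $(\omega,\beta)$, with $\int_{\Omega_B}\int_{\Omega_W}\mu_{\omega,\beta}\,\mathbb{P}_W(d\omega)\mathbb{P}_B(d\beta)=\rho$ (standard correspondence between stationary measures and invariant Markov measures). $\Phi(t,\beta)p_0$ is the solution at time $t\ge0$ of the stochastic Fokker-Planck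 equation with initial density $p_0$ and common noise path $\beta$, understood pathwise: $\Phi(t,\beta)p_0(x)=q(x-\eta\beta(t),t)$, where $q$ is the unique weak $L^1$-probability solution (continuous in time with values in $L^1$, remaining a probability density) of $\partial_tq=\nabla\cdot(q\nabla U)+\frac12\sigma^2\Delta q$ with $U(x,t;\beta)=V(x+\eta\beta(t))$, $q(0)=p_0$. *)

theory Defs
  imports "HOL-Probability.Probability"
begin

definition partial_deriv :: "'n \<Rightarrow> (real^'n \<Rightarrow> real) \<Rightarrow> real^'n \<Rightarrow> real" where
  "partial_deriv i f x = frechet_derivative f (at x) (axis i 1)"

definition grad :: "(real^'n \<Rightarrow> real) \<Rightarrow> real^'n \<Rightarrow> real^'n" where
  "grad f x = (\<chi> i. partial_deriv i f x)"

primrec Ck :: "nat \<Rightarrow> (real^'n \<Rightarrow> real) \<Rightarrow> bool" where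
  "Ck 0 f \<longleftrightarrow> continuous_on UNIV f"
| "Ck (Suc k) f \<longleftrightarrow> (\<forall>x. f differentiable at x) \<and> (\<forall>i. Ck k (partial_deriv i f))"

definition smooth :: "(real^'n \<Rightarrow> real) \<Rightarrow> bool" where
  "smooth f \<longleftrightarrow> (\<forall>k. Ck k f)"

definition test_function :: "(real^'n \<Rightarrow> real) \<Rightarrow> bool" where
  "test_function f \<longleftrightarrow> smooth f \<and> compact (closure {x. f x \<noteq> 0})"

text \<open>Symmetry is not required, so that both conventions for real positive definite matrices
  are covered.\<close>
definition pos_def :: "real^'n^'n \<Rightarrow> bool" where
  "pos_def A \<longleftrightarrow> (\<forall>x. x \<noteq> 0 \<longrightarrow> x \<bullet> (A *v x) > 0)"

definition C0 :: "(real \<Rightarrow> real^'n) set" where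
  "C0 = {\<xi>. continuous_on UNIV \<xi> \<and> \<xi> 0 = 0}"

text \<open>The sigma-algebra generated by the evaluation maps is the Borel sigma-algebra of locally
  uniform convergence.\<close>
definition path_space :: "(real \<Rightarrow> real^'n) measure" where
  "path_space = restrict_space (PiM UNIV (\<lambda>_. borel)) C0"

text \<open>The law on \<^term>\<open>C0\<close> of a two-sided standard Brownian motion: the increments, over
  intervals anywhere in the real line, are independent and centred Gaussian with covariance matrix
  the length of the interval times the identity. Since paths vanish at 0, this determines all
  finite-dimensional distributions, hence the measure.\<close>
definition wiener_measure :: "(real \<Rightarrow> real^'n) measure \<Rightarrow> bool" where
  "wiener_measure P \<longleftrightarrow>
     prob_space P \<and> space P = space path_space \<and> sets P = sets path_space \<and>
     (\<forall>s t. s < t \<longrightarrow> distributed P lborel (\<lambda>\<xi>. \<xi> t - \<xi> s)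
        (\<lambda>x. ennreal (\<Prod>i\<in>UNIV. normal_density 0 (sqrt (t - s)) (x $ i)))) \<and>
     (\<forall>(n::nat) (t::nat \<Rightarrow> real). strict_mono_on {..n} t \<longrightarrow>
        prob_space.indep_vars P (\<lambda>_. borel) (\<lambda>i \<xi>. \<xi> (t (Suc i)) - \<xi> (t i)) {..<n})"

definition wiener_shift :: "real \<Rightarrow> (real \<Rightarrow> real^'n) \<Rightarrow> real \<Rightarrow> real^'n" where
  "wiener_shift t \<xi> = (\<lambda>s. \<xi> (s + t) - \<xi> t)"

text \<open>The noise is additive, so the equation
  \<open>dx = - grad V(x) dt + \<sigma> dW + \<eta> dB\<close> is an integral equation for each
  pair of noise paths. As \<open>grad V\<close> is locally Lipschitz for smooth \<open>V\<close>, this fixes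
  the values of \<open>phi\<close> at all nonnegative times.\<close>
definition sde_flow ::
  "(real^'n \<Rightarrow> real) \<Rightarrow> real^'n^'n \<Rightarrow> real^'n^'n \<Rightarrow>
   (real \<Rightarrow> (real \<Rightarrow> real^'n) \<Rightarrow> (real \<Rightarrow> real^'n) \<Rightarrow> real^'n \<Rightarrow> real^'n) \<Rightarrow> bool" where
  "sde_flow V \<sigma> \<eta> phi \<longleftrightarrow>
     (\<forall>\<omega>\<in>C0. \<forall>\<beta>\<in>C0. \<forall>x.
        continuous_on {0..} (\<lambda>t. phi t \<omega> \<beta> x) \<and>
        (\<forall>t\<ge>0. phi t \<omega> \<beta> x =
           x - integral {0..t} (\<lambda>s. grad V (phi s \<omega> \<beta> x)) + \<sigma> *v \<omega> t + \<eta> *v \<beta> t))"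

definition stationary_measure ::
  "(real \<Rightarrow> real^'n) measure \<Rightarrow> (real \<Rightarrow> real^'n) measure \<Rightarrow>
   (real \<Rightarrow> (real \<Rightarrow> real^'n) \<Rightarrow> (real \<Rightarrow> real^'n) \<Rightarrow> real^'n \<Rightarrow> real^'n) \<Rightarrow>
   (real^'n) measure \<Rightarrow> bool" where
  "stationary_measure PW PB phi \<rho> \<longleftrightarrow>
     prob_space \<rho> \<and> sets \<rho> = sets borel \<and>
     (\<forall>t\<ge>0. \<forall>A\<in>sets borel.
        emeasure \<rho> A =
          (\<integral>\<^sup>+x. emeasure (PW \<Otimes>\<^sub>M PB)
                  {(\<omega>, \<beta>) \<in> space (PW \<Otimes>\<^sub>M PB). phi t \<omega> \<beta> x \<in> A} \<partial>\<rho>))"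

definition weak_limit ::
  "('t \<Rightarrow> (real^'n) measure) \<Rightarrow> (real^'n) measure \<Rightarrow> 't filter \<Rightarrow> bool" where
  "weak_limit \<nu> \<mu> F \<longleftrightarrow>
     (\<forall>f::real^'n \<Rightarrow> real. continuous_on UNIV f \<and> bounded (range f) \<longrightarrow>
        ((\<lambda>\<tau>. \<integral>x. f x \<partial>(\<nu> \<tau>)) \<longlongrightarrow> (\<integral>x. f x \<partial>\<mu>)) F)"

definition mixture :: "'b measure \<Rightarrow> ('b \<Rightarrow> (real^'n) measure) \<Rightarrow> (real^'n) measure" where
  "mixture P \<kappa> = measure_of UNIV (sets borel) (\<lambda>A. \<integral>\<^sup>+\<omega>. emeasure (\<kappa> \<omega>) A \<partial>P)"

definition prob_density :: "(real^'n \<Rightarrow> real) \<Rightarrow> bool" where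
  "prob_density p \<longleftrightarrow>
     p \<in> borel_measurable borel \<and> (\<forall>x. 0 \<le> p x) \<and> (\<integral>\<^sup>+x. ennreal (p x) \<partial>lborel) = 1"

definition L1_dist :: "(real^'n \<Rightarrow> real) \<Rightarrow> (real^'n \<Rightarrow> real) \<Rightarrow> ennreal" where
  "L1_dist f g = (\<integral>\<^sup>+x. ennreal \<bar>f x - g x\<bar> \<partial>lborel)"

text \<open>The formal adjoint of the operator \<open>q \<mapsto> div (q grad U) + (1/2) \<sigma>^2 Laplace q\<close>
  with \<open>U x = V (x + h)\<close>, applied to a test function, where \<open>\<sigma>^2 Laplace\<close> has the
  coefficient matrix \<open>\<sigma> \<sigma>^T\<close>.\<close>
definition fp_generator ::
  "(real^'n \<Rightarrow> real) \<Rightarrow> real^'n^'n \<Rightarrow> real^'n \<Rightarrow> (real^'n \<Rightarrow> real) \<Rightarrow> real^'n \<Rightarrow> real" where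
  "fp_generator V \<sigma> h \<psi> x =
     - (grad \<psi> x \<bullet> grad V (x + h)) +
     1/2 * (\<Sum>i\<in>UNIV. \<Sum>j\<in>UNIV.
       (\<sigma> ** transpose \<sigma>) $ i $ j * partial_deriv i (partial_deriv j \<psi>) x)"

text \<open>Weak probability solutions of \<open>d/dt q = div (q grad U) + (1/2) \<sigma>^2 Laplace q\<close>,
  \<open>U x t = V (x + \<eta> \<beta>(t))\<close>, \<open>q(0) = p0\<close>, continuous in time with values in \<open>L^1\<close>.
  Elements of \<open>L^1\<close> are represented by functions.\<close>
definition fp_solution ::
  "(real^'n \<Rightarrow> real) \<Rightarrow> real^'n^'n \<Rightarrow> real^'n^'n \<Rightarrow> (real \<Rightarrow> real^'n) \<Rightarrow>
   (real^'n \<Rightarrow> real) \<Rightarrow> (real \<Rightarrow> real^'n \<Rightarrow> real) \<Rightarrow> bool" where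
  "fp_solution V \<sigma> \<eta> \<beta> p0 q \<longleftrightarrow>
     (\<forall>t\<ge>0. prob_density (q t)) \<and>
     (\<forall>t\<ge>0. ((\<lambda>s. L1_dist (q s) (q t)) \<longlongrightarrow> 0) (at t within {0..})) \<and>
     (AE x in lborel. q 0 x = p0 x) \<and>
     (\<forall>\<psi>. test_function \<psi> \<longrightarrow> (\<forall>t\<ge>0.
        (\<integral>x. \<psi> x * q t x \<partial>lborel) =
        (\<integral>x. \<psi> x * p0 x \<partial>lborel) +
        integral {0..t} (\<lambda>s. \<integral>x. fp_generator V \<sigma> (\<eta> *v \<beta> s) \<psi> x * q s x \<partial>lborel)))"

text \<open>The solution map of \<open>dp = [div (p grad V) + (1/2) \<sigma>^2 Laplace p] dt - \<eta> grad p o dB\<close>,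
  understood pathwise through the unique solution \<open>q(x, t) = p(x + \<eta> \<beta>(t), t)\<close> of the random
  equation above; uniqueness is that of elements of \<open>L^1\<close>.\<close>
definition stochastic_fp_flow ::
  "(real^'n \<Rightarrow> real) \<Rightarrow> real^'n^'n \<Rightarrow> real^'n^'n \<Rightarrow>
   (real \<Rightarrow> (real \<Rightarrow> real^'n) \<Rightarrow> (real^'n \<Rightarrow> real) \<Rightarrow> real^'n \<Rightarrow> real) \<Rightarrow> bool" where
  "stochastic_fp_flow V \<sigma> \<eta> Phi \<longleftrightarrow>
     (\<forall>\<beta>\<in>C0. \<forall>p0. prob_density p0 \<longrightarrow>
        (\<exists>q. fp_solution V \<sigma> \<eta> \<beta> p0 q \<and>
             (\<forall>q'. fp_solution V \<sigma> \<eta> \<beta> p0 q' \<longrightarrow>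
                (\<forall>t\<ge>0. AE x in lborel. q' t x = q t x)) \<and>
             (\<forall>t\<ge>0. \<forall>x. Phi t \<beta> p0 x = q t (x - \<eta> *v \<beta> t))))"

end

(*
  Fix the common noise beta and let X_t(beta) be the law, over the intrinsic noise alone, of the flow
  started from rho. A discrete Girsanov transformation of the Euler scheme gives a Harnack
  inequality for additive noise; in the limit it shows that the transition laws depend continuously,
  in total variation, on the starting point, on translations and on time. Hence X_t(beta) has a
  density that is continuous in time with values in L^1, and by Ito's formula (obtained from the
  one-step Taylor expansion of the Euler scheme) it solves the random Fokker-Planck equation.
  Uniqueness for that equation identifies the density with Phi(t, beta) p_rho. Averaging the pullback
  limits over the intrinsic noise, whose law is invariant under the Wiener shift, yields weak
  convergence of X_t(theta_{-t} beta) to mu_beta. The last unit of time acts through a transition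
  kernel that is continuous in total variation and does not depend on t, so the convergence
  holds in total variation, that is, in L^1 for the densities. Stationarity of rho gives the average
  over beta.
*)
theory Submission
  imports Defs
begin

section \<open>Wiener measure\<close>

text \<open>The gradient of \<open>V\<close> is only locally Lipschitz and may grow arbitrarily
  fast. Since the noise is additive, \<open>Y\<close>, the flow minus the common noise, solves an
  ordinary integral equation for each pair of paths, bounded in terms of the paths and the starting
  point. Estimates are therefore made for an Euler scheme whose drift is projected onto a large
  ball; the paths that may leave the ball cost a small probability, the same for all test functions
  bounded by 1. No stochastic integral occurs: Girsanov becomes N Gaussian translations, and Ito a
  telescoping sum of N Taylor expansions. The scheme converges pathwise, so its limit is passed
  through continuous test functions only; inner regularity returns from them to Borel sets. The
  Gaussian comparison degenerates at time zero, so L1 continuity there must come from elsewhere: by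
  stationarity \<open>\<rho>\<close> is an average of laws at time 1. Finally, \<open>\<mu>\<close>
  is given only almost everywhere, so a measurable version of it and a jointly measurable density
  have to be constructed.\<close>

definition gauss :: "real \<Rightarrow> (real^'n) measure" where
  "gauss h = density lborel (\<lambda>x. ennreal (\<Prod>i\<in>UNIV. normal_density 0 (sqrt h) (x $ i)))"

lemma sets_gauss [simp, measurable_cong]: "sets (gauss h) = sets borel"
  and space_gauss [simp]: "space (gauss h) = UNIV"
  by (simp_all add: gauss_def)

lemma measurable_gauss_density [measurable]:
  "(\<lambda>x::real^'n. \<Prod>i\<in>UNIV. normal_density 0 (sqrt h) (x $ i)) \<in> borel_measurable borel"
  by measurable

lemma nn_integral_prod_vec:
  fixes f :: "'n::finite \<Rightarrow> real \<Rightarrow> ennreal"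
  assumes [measurable]: "\<And>i. f i \<in> borel_measurable borel"
  shows "(\<integral>\<^sup>+x. (\<Prod>i\<in>UNIV. f i ((x::real^'n) $ i)) \<partial>lborel) = (\<Prod>i\<in>UNIV. \<integral>\<^sup>+x. f i x \<partial>lborel)"
proof -
  have inj: "inj (\<lambda>i::'n. axis i (1::real))"
    by (auto simp: inj_on_def axis_eq_axis)
  have B: "(Basis :: (real^'n) set) = range (\<lambda>i. axis i 1)"
    by (auto simp: Basis_vec_def)
  \<comment> \<open>Each basis vector is \<open>axis i 1\<close> for exactly one \<open>i\<close>,
    so \<open>THE\<close> recovers the index and the product over \<open>Basis\<close> becomes one
    over coordinates.\<close>
  define g where "g b = f (THE i. b = axis i (1::real))" for b :: "real^'n"
  have g: "g (axis i 1) = f i" for i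
    by (simp add: g_def axis_eq_axis)
  have gm: "g b \<in> borel_measurable borel" for b by (simp add: g_def)
  have "(\<integral>\<^sup>+x. (\<Prod>b\<in>Basis. g b ((x::real^'n) \<bullet> b)) \<partial>lborel) = (\<Prod>b\<in>Basis. \<integral>\<^sup>+x. g b x \<partial>lborel)"
    by (intro nn_integral_lborel_prod gm) auto
  then show ?thesis
    unfolding B by (subst (asm) (1 2) prod.reindex) (use inj in \<open>auto simp: inj_on_def g inner_axis\<close>)
qed

lemma prob_space_gauss:
  assumes "0 < h"
  shows "prob_space (gauss h :: (real^'n) measure)"
proof
  have *: "(\<integral>\<^sup>+x. ennreal (normal_density 0 (sqrt h) x) \<partial>lborel) = 1"
    using prob_space.emeasure_space_1[OF prob_space_normal_density[of "sqrt h" 0]] assms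
    by (simp add: emeasure_density)
  have "emeasure (gauss h) (space (gauss h :: (real^'n) measure)) =
      (\<integral>\<^sup>+x. (\<Prod>i\<in>UNIV. ennreal (normal_density 0 (sqrt h) ((x::real^'n) $ i))) \<partial>lborel)"
    by (simp add: gauss_def emeasure_density prod_ennreal normal_density_nonneg)
  also have "\<dots> = 1"
    by (subst nn_integral_prod_vec) (simp_all add: *)
  finally show "emeasure (gauss h) (space (gauss h :: (real^'n) measure)) = 1" .
qed

section \<open>Path space and finite-dimensional distributions\<close>

lemma space_path_space [simp]: "space path_space = C0"
  by (simp add: path_space_def space_restrict_space space_PiM)

lemma measurable_eval: "(\<lambda>\<xi>. \<xi> t) \<in> path_space \<rightarrow>\<^sub>M borel"
  unfolding path_space_def by (intro measurable_restrict_space1) (rule measurable_component_singleton, simp)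

lemma measurable_into_path_space:
  assumes "\<And>z. z \<in> space M \<Longrightarrow> T z \<in> C0" "\<And>t. (\<lambda>z. T z t) \<in> M \<rightarrow>\<^sub>M borel"
  shows "T \<in> M \<rightarrow>\<^sub>M path_space"
  unfolding path_space_def
  by (intro measurable_restrict_space2 measurable_PiM_single') (use assms in auto)

lemma path_spaceE:
  assumes "A \<in> sets path_space"
  obtains B where "B \<in> sets (PiM UNIV (\<lambda>_::real. borel :: (real^'n) measure))" "A = B \<inter> C0"
  using assms by (auto simp: path_space_def sets_restrict_space)

lemma wiener_measureD:
  assumes "wiener_measure P"
  shows "prob_space P" "space P = C0" "sets P = sets path_space"
  using assms by (simp_all add: wiener_measure_def)

lemma wiener_increment:
  assumes P: "wiener_measure P" and "s < t"
  shows "distr P borel (\<lambda>\<xi>. \<xi> t - \<xi> s) = gauss (t - s)"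
proof -
  have "distributed P lborel (\<lambda>\<xi>. \<xi> t - \<xi> s)
        (\<lambda>x. ennreal (\<Prod>i\<in>UNIV. normal_density 0 (sqrt (t - s)) (x $ i)))"
    using P \<open>s < t\<close> by (simp add: wiener_measure_def)
  then have "distr P lborel (\<lambda>\<xi>. \<xi> t - \<xi> s) = gauss (t - s)"
    by (simp add: distributed_def gauss_def)
  then show ?thesis by (simp cong: distr_cong)
qed

lemma wiener_rectangle:
  assumes P: "wiener_measure P" and t: "strict_mono_on {..n} t"
    and A: "\<And>i. i < n \<Longrightarrow> A i \<in> sets borel"
  shows "emeasure P {\<xi>\<in>space P. \<forall>i<n. \<xi> (t (Suc i)) - \<xi> (t i) \<in> A i} =
     (\<Prod>i<n. emeasure (gauss (t (Suc i) - t i)) (A i))"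
\<comment> \<open>\<open>indep_varsD\<close> asks for a nonempty index set; without increments both
  sides are 1.\<close>
proof (cases "n = 0")
  case True
  interpret prob_space P using P by (rule wiener_measureD)
  show ?thesis using True emeasure_space_1 by simp
next
  case False
  interpret prob_space P using P by (rule wiener_measureD)
  note [measurable] = measurable_eval
  note [measurable_cong] = wiener_measureD(3)[OF P]
  have ind: "indep_vars (\<lambda>_. borel) (\<lambda>i \<xi>. \<xi> (t (Suc i)) - \<xi> (t i)) {..<n}"
    using P t by (simp add: wiener_measure_def)
  have "prob (\<Inter>i\<in>{..<n}. (\<lambda>\<xi>. \<xi> (t (Suc i)) - \<xi> (t i)) -` A i \<inter> space P) =
     (\<Prod>i<n. prob ((\<lambda>\<xi>. \<xi> (t (Suc i)) - \<xi> (t i)) -` A i \<inter> space P))"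
    using False A by (intro indep_varsD[OF ind]) auto
  moreover have "(\<Inter>i\<in>{..<n}. (\<lambda>\<xi>. \<xi> (t (Suc i)) - \<xi> (t i)) -` A i \<inter> space P) =
     {\<xi>\<in>space P. \<forall>i<n. \<xi> (t (Suc i)) - \<xi> (t i) \<in> A i}" using False by auto
  ultimately have "emeasure P {\<xi>\<in>space P. \<forall>i<n. \<xi> (t (Suc i)) - \<xi> (t i) \<in> A i} =
     (\<Prod>i<n. emeasure P ((\<lambda>\<xi>. \<xi> (t (Suc i)) - \<xi> (t i)) -` A i \<inter> space P))"
    by (simp add: emeasure_eq_measure prod_ennreal)
  also have "\<dots> = (\<Prod>i<n. emeasure (gauss (t (Suc i) - t i)) (A i))"
  proof (intro prod.cong refl)
    fix i assume "i \<in> {..<n}"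
    then have "t i < t (Suc i)" using t by (auto simp: strict_mono_on_def)
    then show "emeasure P ((\<lambda>\<xi>. \<xi> (t (Suc i)) - \<xi> (t i)) -` A i \<inter> space P) =
        emeasure (gauss (t (Suc i) - t i)) (A i)"
      using \<open>i \<in> _\<close> A by (simp flip: wiener_increment[OF P] add: emeasure_distr)
  qed
  finally show ?thesis .
qed

lemma sorted_grid:
  assumes "finite J" "J \<noteq> {}"
  obtains n and t :: "nat \<Rightarrow> real" where "strict_mono_on {..n} t" "t ` {..n} = J"
proof
  let ?l = "sorted_list_of_set J"
  have len: "length ?l = card J" "card J > 0" using assms by (auto simp: card_gt_0_iff)
  show "strict_mono_on {..card J - 1} (\<lambda>i. ?l ! i)"
  proof (rule strict_mono_onI)
    fix i j assume "i \<in> {..card J - 1}" "j \<in> {..card J - 1}" "i < j"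
    then show "?l ! i < ?l ! j"
      using sorted_wrt_nth_less[OF strict_sorted_list_of_set[of J], of i j] len by simp
  qed
  have "set ?l = J" using assms by simp
  moreover have "{..card J - 1} = {0..<length ?l}" using len by auto
  ultimately show "(\<lambda>i. ?l ! i) ` {..card J - 1} = J"
    by (metis nth_image order_refl take_all)
qed

text \<open>Rectangles determine a product of probability measures, so the factorised rectangle
  probabilities fix the joint law of the increments along the grid.\<close>

lemma increments_distr:
  fixes T :: "'z \<Rightarrow> real \<Rightarrow> real^'n"
  assumes Q: "prob_space Q" and T: "T \<in> Q \<rightarrow>\<^sub>M path_space" and t: "strict_mono_on {..n} t"
    and rect: "\<And>A. (\<And>i. i < n \<Longrightarrow> A i \<in> sets borel) \<Longrightarrow>
      emeasure Q {z\<in>space Q. \<forall>i<n. T z (t (Suc i)) - T z (t i) \<in> A i} =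
      (\<Prod>i<n. emeasure (gauss (t (Suc i) - t i)) (A i))"
  shows "distr Q (PiM {..<n} (\<lambda>_. borel)) (\<lambda>z. \<lambda>i\<in>{..<n}. T z (t (Suc i)) - T z (t i)) =
     PiM {..<n} (\<lambda>i. gauss (if i < n then t (Suc i) - t i else 1))"
proof -
  note [measurable] = T measurable_eval
  \<comment> \<open>The variance 1 beyond \<open>n\<close> is a dummy: the product locale wants a
    probability space for every index, also outside \<open>{..<n}\<close>.\<close>
  have pos: "0 < (if i < n then t (Suc i) - t i else 1)" for i
    using t by (auto simp: strict_mono_on_def)
  interpret product_prob_space "\<lambda>i. gauss (if i < n then t (Suc i) - t i else 1)" "{..<n}"
    by (intro product_prob_spaceI prob_space_gauss pos)
  have inc [measurable]: "(\<lambda>z. \<lambda>i\<in>{..<n}. T z (t (Suc i)) - T z (t i)) \<in> Q \<rightarrow>\<^sub>M PiM {..<n} (\<lambda>_. borel)"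
    by (intro measurable_restrict) measurable
  show ?thesis
  proof (rule PiM_eqI)
    show "sets (distr Q (PiM {..<n} (\<lambda>_. borel)) (\<lambda>z. \<lambda>i\<in>{..<n}. T z (t (Suc i)) - T z (t i))) =
      sets (PiM {..<n} (\<lambda>i. gauss (if i < n then t (Suc i) - t i else 1)))"
      by (simp cong: sets_PiM_cong)
    fix A :: "nat \<Rightarrow> (real^'n) set" assume A: "\<And>i. i \<in> {..<n} \<Longrightarrow> A i \<in> sets (gauss (if i < n then t (Suc i) - t i else 1))"
    have "emeasure (distr Q (PiM {..<n} (\<lambda>_. borel)) (\<lambda>z. \<lambda>i\<in>{..<n}. T z (t (Suc i)) - T z (t i))) (Pi\<^sub>E {..<n} A)
       = emeasure Q ((\<lambda>z. \<lambda>i\<in>{..<n}. T z (t (Suc i)) - T z (t i)) -` Pi\<^sub>E {..<n} A \<inter> space Q)"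
      using A by (intro emeasure_distr inc sets_PiM_I_finite) simp_all
    also have "(\<lambda>z. \<lambda>i\<in>{..<n}. T z (t (Suc i)) - T z (t i)) -` Pi\<^sub>E {..<n} A \<inter> space Q =
        {z\<in>space Q. \<forall>i<n. T z (t (Suc i)) - T z (t i) \<in> A i}"
      by (simp add: set_eq_iff restrict_PiE_iff conj_commute Ball_def Pi_iff)
    also have "emeasure Q \<dots> = (\<Prod>i<n. emeasure (gauss (t (Suc i) - t i)) (A i))"
      by (rule rect) (use A in simp)
    also have "\<dots> = (\<Prod>i\<in>{..<n}. emeasure (gauss (if i < n then t (Suc i) - t i else 1)) (A i))"
      by (intro prod.cong) simp_all
    finally show "emeasure (distr Q (PiM {..<n} (\<lambda>_. borel)) (\<lambda>z. \<lambda>i\<in>{..<n}. T z (t (Suc i)) - T z (t i))) (Pi\<^sub>E {..<n} A) =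
      (\<Prod>i\<in>{..<n}. emeasure (gauss (if i < n then t (Suc i) - t i else 1)) (A i))" .
  qed simp
qed

text \<open>Values of a path vanishing at 0 are sums of increments along any grid through 0, so the
  laws of increments determine all finite-dimensional laws and hence the law on \<open>C0\<close>.
  The rectangle formula is demanded only for grids through the finite set \<open>S\<close>: the
  shift uses the empty set, and concatenation at \<open>s\<close> uses \<open>{s}\<close>, so that
  no increment straddles the gluing time.\<close>

lemma wiener_measure_unique:
  fixes T :: "'z \<Rightarrow> real \<Rightarrow> real^'n"
  assumes P: "wiener_measure P" and Q: "prob_space Q" and T: "T \<in> Q \<rightarrow>\<^sub>M path_space" and S: "finite S"
    and rect: "\<And>n t A. strict_mono_on {..n} t \<Longrightarrow> S \<subseteq> t ` {..n} \<Longrightarrow> (\<And>i. i < n \<Longrightarrow> A i \<in> sets borel) \<Longrightarrow>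
      emeasure Q {z\<in>space Q. \<forall>i<n. T z (t (Suc i)) - T z (t i) \<in> A i} =
      (\<Prod>i<n. emeasure (gauss (t (Suc i) - t i)) (A i))"
  shows "distr Q path_space T = P"
proof -
  let ?M = "\<lambda>_::real. borel :: (real^'n) measure"
  interpret P: prob_space P using P by (rule wiener_measureD)
  interpret Q: prob_space Q by fact
  note [measurable] = T
  note [measurable] = measurable_eval
  note [measurable_cong] = wiener_measureD(3)[OF P]
  have idm: "(\<lambda>\<xi>. \<xi>) \<in> P \<rightarrow>\<^sub>M path_space" by measurable
  have TC: "T z \<in> C0" if "z \<in> space Q" for z using measurable_space[OF T that] by simp
  have Pi: "(\<lambda>\<xi>. \<xi>) \<in> path_space \<rightarrow>\<^sub>M PiM UNIV ?M"
    unfolding path_space_def by (intro measurable_restrict_space1) simp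
  then have PT [measurable]: "T \<in> Q \<rightarrow>\<^sub>M PiM UNIV ?M" using measurable_compose[OF T] by blast
  have PP [measurable]: "(\<lambda>\<xi>. \<xi>) \<in> P \<rightarrow>\<^sub>M PiM UNIV ?M" using measurable_compose[OF idm Pi] by blast
  have val: "emeasure (distr Q (PiM UNIV ?M) T) (prod_emb UNIV ?M J (Pi\<^sub>E J A)) =
      emeasure (distr P (PiM UNIV ?M) (\<lambda>\<xi>. \<xi>)) (prod_emb UNIV ?M J (Pi\<^sub>E J A))"
    if J: "finite J" and A: "\<And>i. i \<in> J \<Longrightarrow> A i \<in> sets borel" for J A
  proof -
    \<comment> \<open>The grid contains the observation times, the prescribed points and the origin,
      where all paths are pinned.\<close>
    obtain n and t :: "nat \<Rightarrow> real" where t: "strict_mono_on {..n} t" and tJ: "t ` {..n} = J \<union> S \<union> {0::real}"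
      by (rule sorted_grid[of "J \<union> S \<union> {0}"]) (use J S in auto)
    obtain i0 where i0: "i0 \<le> n" "t i0 = 0" using tJ by (metis UnCI atMost_iff imageE singletonI)
    have "\<forall>s\<in>J. \<exists>j\<le>n. t j = s" using tJ by (metis Un_iff atMost_iff imageE)
    then obtain j where j: "\<And>s. s \<in> J \<Longrightarrow> j s \<le> n \<and> t (j s) = s" by metis
    \<comment> \<open>The cylinder event in terms of increments: since the path vanishes at
      \<open>t i0 = 0\<close>, its value at \<open>s\<close> is a difference of two partial
      sums.\<close>
    define B where "B = {y\<in>space (PiM {..<n} (\<lambda>_. borel :: (real^'n) measure)).
       \<forall>s\<in>J. (\<Sum>i<j s. y i) - (\<Sum>i<i0. y i) \<in> A s}"
    have B: "B \<in> sets (PiM {..<n} (\<lambda>_. borel))"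
      unfolding B_def
    proof (intro sets.sets_Collect_finite_All J)
      fix s assume s: "s \<in> J"
      have [measurable]: "(\<lambda>y. \<Sum>i<k. y i) \<in> PiM {..<n} (\<lambda>_. borel :: (real^'n) measure) \<rightarrow>\<^sub>M borel" if "k \<le> n" for k
        using that by (intro borel_measurable_sum measurable_component_singleton) auto
      have [measurable]: "(\<lambda>y. \<Sum>i<j s. y i) \<in> PiM {..<n} (\<lambda>_. borel :: (real^'n) measure) \<rightarrow>\<^sub>M borel"
        "(\<lambda>y. \<Sum>i<i0. y i) \<in> PiM {..<n} (\<lambda>_. borel :: (real^'n) measure) \<rightarrow>\<^sub>M borel" "A s \<in> sets borel"
        using j[OF s] i0 A[OF s] by auto
      show "{y \<in> space (PiM {..<n} (\<lambda>_. borel)). (\<Sum>i<j s. y i) - (\<Sum>i<i0. y i) \<in> A s} \<in> sets (PiM {..<n} (\<lambda>_. borel))"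
        by measurable
    qed
    have key: "(\<forall>s\<in>J. \<xi> s \<in> A s) \<longleftrightarrow> (\<lambda>i\<in>{..<n}. \<xi> (t (Suc i)) - \<xi> (t i)) \<in> B" if "\<xi> \<in> C0" for \<xi> :: "real \<Rightarrow> real^'n"
    proof -
      have "(\<Sum>i<j s. (\<lambda>i\<in>{..<n}. \<xi> (t (Suc i)) - \<xi> (t i)) i) - (\<Sum>i<i0. (\<lambda>i\<in>{..<n}. \<xi> (t (Suc i)) - \<xi> (t i)) i) = \<xi> s"
        if s: "s \<in> J" for s
      proof -
        have *: "(\<Sum>i<k. (\<lambda>i\<in>{..<n}. \<xi> (t (Suc i)) - \<xi> (t i)) i) = \<xi> (t k) - \<xi> (t 0)" if "k \<le> n" for k
        proof -
          have "(\<Sum>i<k. (\<lambda>i\<in>{..<n}. \<xi> (t (Suc i)) - \<xi> (t i)) i) = (\<Sum>i<k. \<xi> (t (Suc i)) - \<xi> (t i))"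
            using that by (intro sum.cong) auto
          then show ?thesis using sum_lessThan_telescope[of "\<lambda>i. \<xi> (t i)" k] by simp
        qed
        have "j s \<le> n" "t (j s) = s" using j[OF s] by auto
        then show ?thesis using i0 \<open>\<xi> \<in> C0\<close> by (simp only: * C0_def mem_Collect_eq) simp
      qed
      then show ?thesis by (auto simp: B_def space_PiM)
    qed
    have em: "prod_emb UNIV ?M J (Pi\<^sub>E J A) = {\<xi>. \<forall>s\<in>J. \<xi> s \<in> A s}"
      using J by (auto simp: prod_emb_def PiE_iff)
    have ems: "{\<xi>. \<forall>s\<in>J. \<xi> s \<in> A s} \<in> sets (PiM UNIV ?M)"
      unfolding em[symmetric] using J A by (intro sets_PiM_I) auto
    let ?D = "PiM {..<n} (\<lambda>i. gauss (if i < n then t (Suc i) - t i else 1)) :: (nat \<Rightarrow> real^'n) measure"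
    have "emeasure (distr Q (PiM UNIV ?M) T) (prod_emb UNIV ?M J (Pi\<^sub>E J A)) =
        emeasure Q ((\<lambda>z. \<lambda>i\<in>{..<n}. T z (t (Suc i)) - T z (t i)) -` B \<inter> space Q)"
      unfolding em by (subst emeasure_distr[OF PT ems]) (intro arg_cong[where f="emeasure Q"], use key[OF TC] in blast)
    also have "\<dots> = emeasure ?D B"
      using B tJ by (subst increments_distr[OF Q T t, symmetric]) (auto intro!: rect t simp: emeasure_distr)
    also have "\<dots> = emeasure P ((\<lambda>\<xi>. \<lambda>i\<in>{..<n}. \<xi> (t (Suc i)) - \<xi> (t i)) -` B \<inter> space P)"
      using B by (subst increments_distr[OF P.prob_space_axioms idm t, symmetric])
        (auto intro!: wiener_rectangle[OF P] t simp: emeasure_distr)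
    also have "\<dots> = emeasure (distr P (PiM UNIV ?M) (\<lambda>\<xi>. \<xi>)) (prod_emb UNIV ?M J (Pi\<^sub>E J A))"
      unfolding em
      by (subst emeasure_distr[OF PP ems]) (intro arg_cong[where f="emeasure P"], use key wiener_measureD(2)[OF P] in blast)
    finally show ?thesis .
  qed
  have eq: "distr Q (PiM UNIV ?M) T = distr P (PiM UNIV ?M) (\<lambda>\<xi>. \<xi>)"
  proof (rule measure_eqI_PiM_infinite[where I=UNIV and M="?M"])
    show "finite_measure (distr Q (PiM UNIV ?M) T)"
      using Q.prob_space_distr[OF PT] by (simp add: prob_space_def)
  qed (auto intro!: val)
  show ?thesis
  proof (rule measure_eqI)
    show "sets (distr Q path_space T) = sets P" by (simp add: wiener_measureD(3)[OF P])
    fix A assume "A \<in> sets (distr Q path_space T)"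
    then have A: "A \<in> sets path_space" by simp
    then obtain B where B: "B \<in> sets (PiM UNIV ?M)" "A = B \<inter> C0" by (rule path_spaceE)
    have "emeasure (distr Q path_space T) A = emeasure Q (T -` B \<inter> space Q)"
      using A TC by (simp add: emeasure_distr) (intro arg_cong[where f="emeasure Q"], auto simp: B)
    also have "\<dots> = emeasure (distr Q (PiM UNIV ?M) T) B" using B by (simp add: emeasure_distr)
    also have "\<dots> = emeasure P A" unfolding eq
      using B wiener_measureD(2)[OF P] by (simp add: emeasure_distr)
    finally show "emeasure (distr Q path_space T) A = emeasure P A" .
  qed
qed

section \<open>Shifts and concatenations of Brownian paths\<close>

lemma wiener_shift_C0: "\<xi> \<in> C0 \<Longrightarrow> wiener_shift s \<xi> \<in> C0"
  by (auto simp: C0_def wiener_shift_def intro!: continuous_intros continuous_on_compose2[of UNIV \<xi> UNIV])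

lemma measurable_wiener_shift [measurable]: "wiener_shift s \<in> path_space \<rightarrow>\<^sub>M path_space"
proof (rule measurable_into_path_space)
  show "(\<lambda>z. wiener_shift s z t) \<in> path_space \<rightarrow>\<^sub>M borel" for t
    unfolding wiener_shift_def by (intro borel_measurable_diff measurable_eval)
qed (simp add: wiener_shift_C0)

text \<open>Increments of the shifted path are increments at shifted times, and their law depends on
  the lengths of the intervals only.\<close>

lemma wiener_shift_invariant:
  fixes P :: "(real \<Rightarrow> real^'n) measure"
  assumes P: "wiener_measure P"
  shows "distr P path_space (wiener_shift s) = P"
proof (rule wiener_measure_unique[OF P _ _ finite.emptyI])
  note [measurable] = measurable_eval
  note [measurable_cong] = wiener_measureD(3)[OF P]
  show "prob_space P" using P by (rule wiener_measureD)
  show "wiener_shift s \<in> P \<rightarrow>\<^sub>M path_space" by measurable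
  fix n t and A :: "nat \<Rightarrow> (real^'n) set"
  assume t: "strict_mono_on {..n} (t::nat\<Rightarrow>real)" and A: "\<And>i. i < n \<Longrightarrow> A i \<in> sets borel"
  have "strict_mono_on {..n} (\<lambda>i. t i + s)" using t by (auto simp: strict_mono_on_def)
  from wiener_rectangle[OF P this A]
  show "emeasure P {z \<in> space P. \<forall>i<n. wiener_shift s z (t (Suc i)) - wiener_shift s z (t i) \<in> A i} =
       (\<Prod>i<n. emeasure (gauss (t (Suc i) - t i)) (A i))"
    by (simp add: wiener_shift_def)
qed

definition path_concat :: "real \<Rightarrow> (real \<Rightarrow> real^'n) \<Rightarrow> (real \<Rightarrow> real^'n) \<Rightarrow> real \<Rightarrow> real^'n" where
  "path_concat s \<xi> \<zeta> = (\<lambda>u. if u \<le> s then \<xi> u else \<xi> s + \<zeta> (u - s))"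

lemma path_concat_C0:
  assumes "\<xi> \<in> C0" "\<zeta> \<in> C0" "0 \<le> s"
  shows "path_concat s \<xi> \<zeta> \<in> C0"
proof -
  have "continuous_on ({..s} \<union> {s..}) (path_concat s \<xi> \<zeta>)"
    unfolding path_concat_def
  proof (rule continuous_on_cases)
    show "continuous_on {..s} \<xi>" using assms by (auto simp: C0_def intro: continuous_on_subset)
    show "continuous_on {s..} (\<lambda>u. \<xi> s + \<zeta> (u - s))"
      using assms by (auto simp: C0_def intro!: continuous_intros continuous_on_compose2[of UNIV \<zeta>])
  qed (use assms in \<open>auto simp: C0_def\<close>)
  moreover have "{..s} \<union> {s..} = UNIV" by auto
  ultimately show ?thesis using assms by (simp add: C0_def path_concat_def)
qed

lemma measurable_path_concat [measurable]:
  assumes "0 \<le> s"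
  shows "(\<lambda>(\<xi>, \<zeta>). path_concat s \<xi> \<zeta>) \<in> path_space \<Otimes>\<^sub>M path_space \<rightarrow>\<^sub>M path_space"
proof (rule measurable_into_path_space)
  show "(\<lambda>z. (case z of (\<xi>, \<zeta>) \<Rightarrow> path_concat s \<xi> \<zeta>) t) \<in> path_space \<Otimes>\<^sub>M path_space \<rightarrow>\<^sub>M borel" for t
    using measurable_compose[OF measurable_fst measurable_eval] measurable_compose[OF measurable_snd measurable_eval]
    by (cases "t \<le> s") (auto simp: path_concat_def split_beta' intro!: borel_measurable_add)
qed (use assms in \<open>auto simp: path_concat_C0 space_pair_measure\<close>)

text \<open>The Markov property of Brownian motion in pathwise form. On grids through
  \<open>s\<close>, the increments before \<open>s\<close> depend on the first path only and those
  after it on the second only, so the rectangle event is a product set and its probability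
  factorises.\<close>

lemma wiener_concat:
  fixes P :: "(real \<Rightarrow> real^'n) measure"
  assumes P: "wiener_measure P" and s: "0 \<le> s"
  shows "distr (P \<Otimes>\<^sub>M P) path_space (\<lambda>(\<xi>, \<zeta>). path_concat s \<xi> \<zeta>) = P"
proof (rule wiener_measure_unique[OF P, where S="{s}"])
  note [measurable] = measurable_eval
  note [measurable_cong] = wiener_measureD(3)[OF P]
  interpret P: prob_space P using P by (rule wiener_measureD)
  interpret PP: pair_prob_space P P ..
  show "prob_space (P \<Otimes>\<^sub>M P)" by (rule PP.prob_space_axioms)
  show "(\<lambda>(\<xi>, \<zeta>). path_concat s \<xi> \<zeta>) \<in> P \<Otimes>\<^sub>M P \<rightarrow>\<^sub>M path_space"
    using measurable_path_concat[OF s] measurable_cong_sets[OF sets_pair_measure_cong[OF wiener_measureD(3)[OF P] wiener_measureD(3)[OF P]] refl]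
    by blast
  have incm: "{\<xi> \<in> space P. \<xi> u - \<xi> v \<in> B} \<in> sets P" if "B \<in> sets borel" for u v B
  proof -
    have "(\<lambda>\<xi>. \<xi> u - \<xi> v) \<in> P \<rightarrow>\<^sub>M borel" by measurable
    from measurable_sets[OF this that] show ?thesis by (simp add: vimage_def Int_def conj_commute)
  qed
  fix n t and A :: "nat \<Rightarrow> (real^'n) set"
  assume t: "strict_mono_on {..n} (t::nat\<Rightarrow>real)" and A: "\<And>i. i < n \<Longrightarrow> A i \<in> sets borel"
    and "{s} \<subseteq> t ` {..n}"
  then obtain m where m: "m \<le> n" "t m = s" by auto
  have le: "t i \<le> s" if "i \<le> m" for i
    using strict_mono_on_leD[OF t, of i m] m that by auto
  have ge: "s \<le> t i" if "m \<le> i" "i \<le> n" for i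
    using strict_mono_on_leD[OF t, of m i] m that by auto
  let ?X = "{\<xi>\<in>space P. \<forall>i<m. \<xi> (t (Suc i)) - \<xi> (t i) \<in> A i}"
  let ?Y = "{\<zeta>\<in>space P. \<forall>i<n-m. \<zeta> (t (Suc (i + m)) - s) - \<zeta> (t (i + m) - s) \<in> A (i + m)}"
  have z0: "\<zeta> 0 = 0" if "\<zeta> \<in> space P" for \<zeta> using that wiener_measureD(2)[OF P] by (simp add: C0_def)
  have a: "(path_concat s \<xi> \<zeta> (t (Suc i)) - path_concat s \<xi> \<zeta> (t i)) = \<xi> (t (Suc i)) - \<xi> (t i)"
    if "i < m" for i and \<xi> \<zeta> :: "real \<Rightarrow> real^'n" using le[of i] le[of "Suc i"] that by (simp add: path_concat_def)
  have b: "(path_concat s \<xi> \<zeta> (t (Suc i)) - path_concat s \<xi> \<zeta> (t i)) = \<zeta> (t (Suc i) - s) - \<zeta> (t i - s)"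
    if "m \<le> i" "i < n" "\<zeta> \<in> space P" for i and \<xi> \<zeta> :: "real \<Rightarrow> real^'n"
  proof -
    have *: "path_concat s \<xi> \<zeta> u = \<xi> s + \<zeta> (u - s)" if "s \<le> u" for u
      using that z0[OF \<open>\<zeta> \<in> space P\<close>] by (auto simp: path_concat_def)
    show ?thesis using ge[of i] ge[of "Suc i"] that by (simp add: *)
  qed
  have "{z \<in> space (P \<Otimes>\<^sub>M P). \<forall>i<n. (case z of (\<xi>, \<zeta>) \<Rightarrow> path_concat s \<xi> \<zeta>) (t (Suc i)) -
          (case z of (\<xi>, \<zeta>) \<Rightarrow> path_concat s \<xi> \<zeta>) (t i) \<in> A i} = ?X \<times> ?Y" (is "?L = _")
  proof (intro set_eqI iffI)
    fix z assume zL: "z \<in> ?L"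
    obtain \<xi> \<zeta> where z: "z = (\<xi>, \<zeta>)" by fastforce
    have sp: "\<xi> \<in> space P" "\<zeta> \<in> space P" using zL by (simp_all add: z space_pair_measure)
    have inc: "path_concat s \<xi> \<zeta> (t (Suc i)) - path_concat s \<xi> \<zeta> (t i) \<in> A i" if "i < n" for i
      using zL that by (simp add: z)
    have "\<xi> (t (Suc i)) - \<xi> (t i) \<in> A i" if "i < m" for i
      using inc[of i] that m a[OF that] by simp
    moreover have "\<zeta> (t (Suc (i + m)) - s) - \<zeta> (t (i + m) - s) \<in> A (i + m)" if "i < n - m" for i
      using inc[of "i + m"] that b[of "i + m" \<zeta> \<xi>] sp by simp
    ultimately show "z \<in> ?X \<times> ?Y" using sp by (simp add: z)
  next
    fix z assume "z \<in> ?X \<times> ?Y"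
    then obtain \<xi> \<zeta> where z: "z = (\<xi>, \<zeta>)" "\<xi> \<in> ?X" "\<zeta> \<in> ?Y" by auto
    have "path_concat s \<xi> \<zeta> (t (Suc i)) - path_concat s \<xi> \<zeta> (t i) \<in> A i" if "i < n" for i
    proof (cases "i < m")
      case True then show ?thesis using z by (simp add: a)
    next
      case False
      then have "\<zeta> (t (Suc (i-m+m)) - s) - \<zeta> (t (i-m + m) - s) \<in> A (i-m + m)"
        using z that by (intro z(3)[simplified, THEN conjunct2, rule_format]) auto
      then show ?thesis using False that z by (simp add: b)
    qed
    then show "z \<in> ?L" using z by (auto simp: space_pair_measure)
  qed
  moreover have "emeasure (P \<Otimes>\<^sub>M P) (?X \<times> ?Y) = emeasure P ?X * emeasure P ?Y"
  proof (rule P.emeasure_pair_measure_Times)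
    have "{\<xi>\<in>space P. \<forall>i\<in>{..<m}. \<xi> (t (Suc i)) - \<xi> (t i) \<in> A i} \<in> sets P"
    proof (intro sets.sets_Collect_finite_All)
      fix i assume "i \<in> {..<m}" then have "A i \<in> sets borel" by (intro A) (use m in auto)
      show "{\<xi> \<in> space P. \<xi> (t (Suc i)) - \<xi> (t i) \<in> A i} \<in> sets P" by (rule incm) fact
    qed simp
    then show "?X \<in> sets P" by (simp only: Ball_def lessThan_iff)
    have "{\<zeta>\<in>space P. \<forall>i\<in>{..<n-m}. \<zeta> (t (Suc (i + m)) - s) - \<zeta> (t (i + m) - s) \<in> A (i + m)} \<in> sets P"
    proof (intro sets.sets_Collect_finite_All)
      fix i assume "i \<in> {..<n-m}" then have "A (i + m) \<in> sets borel" by (intro A) auto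
      show "{\<zeta> \<in> space P. \<zeta> (t (Suc (i + m)) - s) - \<zeta> (t (i + m) - s) \<in> A (i + m)} \<in> sets P" by (rule incm) fact
    qed simp
    then show "?Y \<in> sets P" by (simp only: Ball_def lessThan_iff)
  qed
  moreover have "emeasure P ?X = (\<Prod>i<m. emeasure (gauss (t (Suc i) - t i)) (A i))"
    using t m A by (intro wiener_rectangle[OF P]) (auto simp: strict_mono_on_def)
  moreover have "emeasure P ?Y = (\<Prod>i<n-m. emeasure (gauss (t (Suc (i+m)) - t (i+m))) (A (i+m)))"
  proof -
    have "strict_mono_on {..n-m} (\<lambda>i. t (i + m) - s)" 
      by (intro strict_mono_onI diff_strict_right_mono strict_mono_onD[OF t]) (use m(1) in auto)
    from wiener_rectangle[OF P this, of "\<lambda>i. A (i + m)"] show ?thesis using A by simp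
  qed
  moreover have "(\<Prod>i<m. emeasure (gauss (t (Suc i) - t i)) (A i)) *
     (\<Prod>i<n-m. emeasure (gauss (t (Suc (i+m)) - t (i+m))) (A (i+m))) =
     (\<Prod>i<n. emeasure (gauss (t (Suc i) - t i)) (A i))"
  proof -
    have "(\<Prod>i<n-m. emeasure (gauss (t (Suc (i+m)) - t (i+m))) (A (i+m))) =
        (\<Prod>i\<in>{m..<n}. emeasure (gauss (t (Suc i) - t i)) (A i))"
      by (rule prod.reindex_bij_witness[of _ "\<lambda>i. i - m" "\<lambda>i. i + m"]) auto
    moreover have "{..<n} = {..<m} \<union> {m..<n}" using m by auto
    moreover have "{..<m} \<inter> {m..<n} = {}" by auto
    ultimately show ?thesis by (simp only: prod.union_disjoint finite_lessThan finite_atLeastLessThan)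
  qed
  ultimately show "emeasure (P \<Otimes>\<^sub>M P) {z \<in> space (P \<Otimes>\<^sub>M P). \<forall>i<n. (case z of (\<xi>, \<zeta>) \<Rightarrow> path_concat s \<xi> \<zeta>) (t (Suc i)) -
          (case z of (\<xi>, \<zeta>) \<Rightarrow> path_concat s \<xi> \<zeta>) (t i) \<in> A i} =
       (\<Prod>i<n. emeasure (gauss (t (Suc i) - t i)) (A i))"
    by simp
qed simp

section \<open>Gaussian vectors\<close>

lemma gauss_density_eq:
  assumes "0 < h"
  shows "(\<Prod>i\<in>UNIV. normal_density 0 (sqrt h) ((x::real^'n) $ i)) =
     (1 / sqrt (2 * pi * h)) ^ CARD('n) * exp (- (norm x)\<^sup>2 / (2 * h))"
proof -
  have "(norm x)\<^sup>2 = (\<Sum>i\<in>UNIV. (x $ i)\<^sup>2)"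
    by (simp add: norm_vec_def L2_set_def sum_nonneg)
  then have "exp (- (norm x)\<^sup>2 / (2 * h)) = (\<Prod>i\<in>UNIV. exp (- (x $ i)\<^sup>2 / (2 * h)))"
    by (simp add: exp_sum[symmetric] sum_negf[symmetric] sum_divide_distrib)
  then show ?thesis
    using assms by (simp add: normal_density_def prod_dividef power_one_over)
qed

lemma emeasure_distr_indicator:
  assumes [measurable]: "f \<in> M \<rightarrow>\<^sub>M N" "A \<in> sets N"
  shows "emeasure (distr M N f) A = (\<integral>\<^sup>+z. indicator A (f z) \<partial>M)"
proof -
  have "emeasure (distr M N f) A = (\<integral>\<^sup>+z. indicator A z \<partial>distr M N f)" by simp
  then show ?thesis by (subst (asm) nn_integral_distr) auto
qed

lemma nn_integral_lborel_translate:
  fixes f :: "'a::euclidean_space \<Rightarrow> ennreal"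
  assumes [measurable]: "f \<in> borel_measurable borel"
  shows "(\<integral>\<^sup>+x. f (x + a) \<partial>lborel) = (\<integral>\<^sup>+x. f x \<partial>lborel)"
proof -
  have "(\<integral>\<^sup>+x. f x \<partial>lborel) = (\<integral>\<^sup>+x. f x \<partial>(distr lborel borel ((+) a)))"
    by (simp add: lborel_distr_plus)
  also have "\<dots> = (\<integral>\<^sup>+x. f (x + a) \<partial>lborel)"
    by (subst nn_integral_distr) (auto simp: add.commute)
  finally show ?thesis ..
qed

text \<open>The finite-dimensional Cameron--Martin formula, by completing the square in the
  exponent. It is the only source of the changes of measure used later.\<close>

lemma gauss_translate:
  fixes a :: "real^'n"
  assumes h: "0 < h"
  shows "distr (gauss h) borel (\<lambda>z. z + a) =
    density (gauss h) (\<lambda>z. ennreal (exp ((a \<bullet> z) / h - (norm a)\<^sup>2 / (2 * h))))"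
proof (rule measure_eqI)
  fix A assume "A \<in> sets (distr (gauss h) borel (\<lambda>z. z + a))"
  then have [measurable]: "A \<in> sets borel" by simp
  let ?n = "\<lambda>x::real^'n. \<Prod>i\<in>UNIV. normal_density 0 (sqrt h) (x $ i)"
  have n: "?n (x - a) = ?n x * exp ((a \<bullet> x) / h - (norm a)\<^sup>2 / (2 * h))" for x
  proof -
    have "- (norm (x - a))\<^sup>2 / (2 * h) = - (norm x)\<^sup>2 / (2 * h) + ((a \<bullet> x) / h - (norm a)\<^sup>2 / (2 * h))"
      using h unfolding power2_norm_eq_inner
      by (simp add: inner_diff_left inner_diff_right inner_commute field_simps)
    then show ?thesis unfolding gauss_density_eq[OF h] by (simp only: exp_add mult.assoc)
  qed
  have n0: "0 \<le> ?n x" for x by (simp add: prod_nonneg normal_density_nonneg)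
  have "emeasure (distr (gauss h) borel (\<lambda>z. z + a)) A = (\<integral>\<^sup>+z. indicator A (z + a) \<partial>gauss h)"
    by (rule emeasure_distr_indicator) measurable
  also have "\<dots> = (\<integral>\<^sup>+z. ennreal (?n (z + a - a)) * indicator A (z + a) \<partial>lborel)"
    by (simp add: gauss_def nn_integral_density)
  also have "\<dots> = (\<integral>\<^sup>+z. ennreal (?n (z - a)) * indicator A z \<partial>lborel)"
    by (rule nn_integral_lborel_translate) measurable
  also have "\<dots> = (\<integral>\<^sup>+z. ennreal (?n z) * (ennreal (exp ((a \<bullet> z) / h - (norm a)\<^sup>2 / (2 * h))) * indicator A z) \<partial>lborel)"
    unfolding n by (intro nn_integral_cong) (simp add: ennreal_mult'' n0 mult.assoc)
  also have "\<dots> = emeasure (density (gauss h) (\<lambda>z. ennreal (exp ((a \<bullet> z) / h - (norm a)\<^sup>2 / (2 * h))))) A"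
    by (subst emeasure_density) (auto simp: gauss_def nn_integral_density)
  finally show "emeasure (distr (gauss h) borel (\<lambda>z. z + a)) A = \<dots>" .
qed simp

text \<open>The exponential is the density of a translated probability measure, so its integral is 1
  without computation.\<close>

lemma gauss_exp_integrable:
  fixes a :: "real^'n"
  assumes h: "0 < h"
  shows "has_bochner_integral (gauss h) (\<lambda>z. exp ((a \<bullet> z) / h - (norm a)\<^sup>2 / (2 * h))) 1"
proof -
  interpret prob_space "gauss h :: (real^'n) measure" using h by (rule prob_space_gauss)
  interpret D: prob_space "distr (gauss h) borel (\<lambda>z. z + a)" by (rule prob_space_distr) measurable
  have "(\<integral>\<^sup>+z. ennreal (exp ((a \<bullet> z) / h - (norm a)\<^sup>2 / (2 * h))) \<partial>gauss h) = 1"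
    using D.emeasure_space_1 unfolding gauss_translate[OF h] by (simp add: emeasure_density)
  then show ?thesis by (intro has_bochner_integral_nn_integral) auto
qed

text \<open>Cauchy--Schwarz against the Cameron--Martin density \<open>?r\<close>, whose second
  moment is \<open>exp ((norm a)\<^sup>2 / h)\<close>.\<close>

lemma gauss_shift_harnack:
  fixes a :: "real^'n" and f :: "real^'n \<Rightarrow> real"
  assumes h: "0 < h" and f [measurable]: "f \<in> borel_measurable borel" and B: "\<And>z. \<bar>f z\<bar> \<le> B"
  shows "(\<integral>z. f (z + a) \<partial>gauss h)\<^sup>2 \<le> exp ((norm a)\<^sup>2 / h) * (\<integral>z. (f z)\<^sup>2 \<partial>gauss h)"
proof -
  interpret prob_space "gauss h :: (real^'n) measure" using h by (rule prob_space_gauss)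
  let ?r = "\<lambda>z. exp ((a \<bullet> z) / h - (norm a)\<^sup>2 / (2 * h))"
  let ?E = "exp ((norm a)\<^sup>2 / h)"
  have r [simp]: "integrable (gauss h) ?r" using gauss_exp_integrable[OF h, of a] by (auto simp: has_bochner_integral_iff)
  have f2 [simp]: "integrable (gauss h) (\<lambda>z. (f z)\<^sup>2)"
    by (rule integrable_const_bound[of _ "B\<^sup>2"]) (auto intro!: AE_I2 abs_le_square_iff[THEN iffD1] order_trans[OF B] simp flip: abs_le_square_iff)
  have fr [simp]: "integrable (gauss h) (\<lambda>z. f z * ?r z)"
    by (rule Bochner_Integration.integrable_bound[OF integrable_mult_right[OF r, of B]])
      (auto intro!: AE_I2 mult_right_mono order_trans[OF B] simp: abs_mult)
  have r2: "has_bochner_integral (gauss h) (\<lambda>z. (?r z)\<^sup>2) ?E"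
  proof -
    \<comment> \<open>The squared density is a constant times the density belonging to the doubled
      translation, so the previous lemma also yields the second moment.\<close>
    have "(?r z)\<^sup>2 = ?E * exp (((2 *\<^sub>R a) \<bullet> z) / h - (norm (2 *\<^sub>R a))\<^sup>2 / (2 * h))" for z
      using h by (simp add: exp_add[symmetric] power2_eq_square field_simps)
    then show ?thesis
      using has_bochner_integral_mult_right[OF gauss_exp_integrable[OF h, of "2 *\<^sub>R a"], of ?E] by simp
  qed
  then have r2' [simp]: "integrable (gauss h) (\<lambda>z. (?r z)\<^sup>2)" "(\<integral>z. (?r z)\<^sup>2 \<partial>gauss h) = ?E"
    by (auto simp: has_bochner_integral_iff)
  define F where "F = (\<integral>z. f z * ?r z \<partial>gauss h)"
  have "(\<integral>z. f (z + a) \<partial>gauss h) = (\<integral>z. f z \<partial>(distr (gauss h) borel (\<lambda>z. z + a)))"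
    by (subst integral_distr) auto
  also have "\<dots> = F"
    unfolding gauss_translate[OF h] F_def by (subst integral_density) (auto simp: mult.commute)
  finally have eq: "(\<integral>z. f (z + a) \<partial>gauss h) = F" .
  \<comment> \<open>This \<open>c\<close> minimises the integral of the square below, which turns
    its nonnegativity into Cauchy--Schwarz.\<close>
  define c where "c = F / ?E"
  have "0 \<le> (\<integral>z. (f z - c * ?r z)\<^sup>2 \<partial>gauss h)" by (rule integral_nonneg_AE) simp
  also have "\<dots> = (\<integral>z. (f z)\<^sup>2 - 2 * c * (f z * ?r z) + c\<^sup>2 * (?r z)\<^sup>2 \<partial>gauss h)"
    by (intro Bochner_Integration.integral_cong refl) (simp add: power2_eq_square algebra_simps)
  also have "\<dots> = (\<integral>z. (f z)\<^sup>2 \<partial>gauss h) - 2 * c * F + c\<^sup>2 * ?E"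
    unfolding F_def by (subst Bochner_Integration.integral_add, simp, simp) (subst Bochner_Integration.integral_diff, auto)
  also have "\<dots> = (\<integral>z. (f z)\<^sup>2 \<partial>gauss h) - F\<^sup>2 / ?E"
    by (simp add: c_def power2_eq_square)
  finally have "F\<^sup>2 / ?E \<le> (\<integral>z. (f z)\<^sup>2 \<partial>gauss h)" by simp
  then show ?thesis unfolding eq by (simp add: pos_divide_le_eq mult.commute)
qed

section \<open>Reflection symmetry and moments of Gaussian vectors\<close>

lemma gauss_coordinate:
  fixes i :: "'n::finite"
  assumes h: "0 < h"
  shows "distr (gauss h) borel (\<lambda>z::real^'n. z $ i) = density lborel (normal_density 0 (sqrt h))"
proof (rule measure_eqI)
  fix A assume "A \<in> sets (distr (gauss h) borel (\<lambda>z::real^'n. z $ i))"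
  then have [measurable]: "A \<in> sets borel" by simp
  let ?n = "\<lambda>x. ennreal (normal_density 0 (sqrt h) x)"
  have 1: "(\<integral>\<^sup>+x. ?n x \<partial>lborel) = 1"
    using prob_space.emeasure_space_1[OF prob_space_normal_density[of "sqrt h" 0]] h
    by (simp add: emeasure_density)
  have "emeasure (distr (gauss h) borel (\<lambda>z::real^'n. z $ i)) A = (\<integral>\<^sup>+z. indicator A ((z::real^'n) $ i) \<partial>gauss h)"
    by (rule emeasure_distr_indicator) measurable
  also have "\<dots> = (\<integral>\<^sup>+z. (\<Prod>j\<in>UNIV. ?n (z $ j)) * indicator A ((z::real^'n) $ i) \<partial>lborel)"
    by (simp add: gauss_def nn_integral_density prod_ennreal normal_density_nonneg)
  \<comment> \<open>The indicator becomes one more factor for coordinate \<open>i\<close>; the other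
    coordinates integrate to 1.\<close>
  also have "\<dots> = (\<integral>\<^sup>+z. (\<Prod>j\<in>UNIV. ?n (z $ j) * (if j = i then indicator A (z $ j) else 1)) \<partial>(lborel::(real^'n) measure))"
    by (intro nn_integral_cong) (simp add: prod.distrib)
  also have "\<dots> = (\<Prod>j\<in>UNIV. \<integral>\<^sup>+x. ?n x * (if j = i then indicator A x else 1) \<partial>lborel)"
    by (rule nn_integral_prod_vec) measurable
  also have "\<dots> = (\<Prod>j\<in>UNIV. if j = i then (\<integral>\<^sup>+x. ?n x * indicator A x \<partial>lborel) else 1)"
    by (intro prod.cong) (auto simp: 1)
  also have "\<dots> = (\<integral>\<^sup>+x. ?n x * indicator A x \<partial>lborel)" by simp
  finally show "emeasure (distr (gauss h) borel (\<lambda>z::real^'n. z $ i)) A = emeasure (density lborel ?n) A"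
    by (simp add: emeasure_density)
qed simp

lemma gauss_coordinate_integral:
  fixes i :: "'n::finite" and g :: "real \<Rightarrow> real"
  assumes h: "0 < h" and [measurable]: "g \<in> borel_measurable borel"
    and "has_bochner_integral lborel (\<lambda>x. normal_density 0 (sqrt h) x * g x) r"
  shows "has_bochner_integral (gauss h) (\<lambda>z::real^'n. g (z $ i)) r"
proof -
  have "has_bochner_integral (density lborel (normal_density 0 (sqrt h))) g r"
    using assms by (intro has_bochner_integral_density) (auto simp: normal_density_nonneg)
  then have "has_bochner_integral (distr (gauss h) borel (\<lambda>z::real^'n. z $ i)) g r"
    by (simp add: gauss_coordinate[OF h])
  then show ?thesis by (simp add: has_bochner_integral_iff integrable_distr_eq integral_distr)
qed

lemma measurable_reflect:
  fixes i :: "'n::finite"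
  shows "(\<lambda>z::real^'n. \<chi> j. if j = i then - z $ j else z $ j) \<in> borel \<rightarrow>\<^sub>M borel"
proof (intro borel_measurable_continuous_onI continuous_on_vec_lambda)
  show "continuous_on UNIV (\<lambda>z::real^'n. if j = i then - z $ j else z $ j)" for j
    by (cases "j = i") (auto intro!: continuous_intros)
qed

text \<open>Needed for the mixed second moments, which this symmetry forces to vanish.\<close>

lemma gauss_reflect:
  fixes i :: "'n::finite"
  assumes h: "0 < h"
  shows "distr (gauss h) borel (\<lambda>z::real^'n. \<chi> j. if j = i then - z $ j else z $ j) = gauss h"
proof -
  let ?T = "\<lambda>z::real^'n. \<chi> j. if j = i then - z $ j else z $ j"
  define c :: "real^'n \<Rightarrow> real" where "c b = (if b = axis i 1 then -1 else 1)" for b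
  have inj: "inj (\<lambda>i::'n. axis i (1::real))"
    by (auto simp: inj_on_def axis_eq_axis)
  have B: "(Basis :: (real^'n) set) = range (\<lambda>i. axis i 1)"
    by (auto simp: Basis_vec_def)
  \<comment> \<open>The reflection written as a diagonal map in the standard basis, the form in
    which the change of variables for \<open>lborel\<close> applies; its Jacobian is 1.\<close>
  have T: "0 + (\<Sum>b\<in>Basis. (c b * (x \<bullet> b)) *\<^sub>R b) = ?T x" for x
  proof (subst vec_eq_iff, intro allI)
    fix k
    have "(0 + (\<Sum>b\<in>Basis. (c b * (x \<bullet> b)) *\<^sub>R b)) $ k = (\<Sum>l\<in>UNIV. (c (axis l 1) * (x \<bullet> axis l 1)) * axis l 1 $ k)"
      unfolding B by (subst sum.reindex[OF inj]) simp
    also have "\<dots> = (\<Sum>l\<in>UNIV. if l = k then c (axis k 1) * (x $ k) else 0)"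
      by (intro sum.cong refl) (auto simp: axis_def[of _ 1] inner_axis[unfolded axis_def])
    also have "\<dots> = ?T x $ k" by (simp add: c_def axis_eq_axis)
    finally show "(0 + (\<Sum>b\<in>Basis. (c b * (x \<bullet> b)) *\<^sub>R b)) $ k = ?T x $ k" .
  qed
  have c1: "(\<Prod>b\<in>Basis. \<bar>c b\<bar>) = 1" by (intro prod.neutral) (simp add: c_def)
  note [measurable] = measurable_reflect[of i]
  have l: "distr lborel borel ?T = lborel"
    using lborel_affine_euclidean[of c 0] unfolding T c1 by (simp add: density_1 c_def)
  have n: "(\<Prod>j\<in>UNIV. normal_density 0 (sqrt h) (?T z $ j)) = (\<Prod>j\<in>UNIV. normal_density 0 (sqrt h) (z $ j))" for z
    by (intro prod.cong) (auto simp: normal_density_def)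
  show ?thesis
  proof (rule measure_eqI)
    fix A assume "A \<in> sets (distr (gauss h) borel ?T)"
    then have [measurable]: "A \<in> sets borel" by simp
    let ?n = "\<lambda>x. ennreal (\<Prod>j\<in>UNIV. normal_density 0 (sqrt h) ((x::real^'n) $ j))"
    have "emeasure (distr (gauss h) borel ?T) A = (\<integral>\<^sup>+z. indicator A (?T z) \<partial>gauss h)"
      by (rule emeasure_distr_indicator) measurable
    also have "\<dots> = (\<integral>\<^sup>+z. ?n (?T z) * indicator A (?T z) \<partial>lborel)"
      unfolding n by (simp add: gauss_def nn_integral_density)
    also have "\<dots> = (\<integral>\<^sup>+z. ?n z * indicator A z \<partial>(distr lborel borel ?T))"
      by (subst nn_integral_distr) auto
    also have "\<dots> = emeasure (gauss h) A" unfolding l by (simp add: gauss_def emeasure_density)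
    finally show "emeasure (distr (gauss h) borel ?T) A = emeasure (gauss h) A" .
  qed simp
qed

lemma gauss_moment1:
  fixes i :: "'n::finite"
  assumes h: "0 < h"
  shows "has_bochner_integral (gauss h) (\<lambda>z::real^'n. z $ i) 0"
  using normal_moment_odd[of "sqrt h" 0 0] h
  by (intro gauss_coordinate_integral[OF h, of "\<lambda>x. x"]) auto

lemma gauss_moment2_diag:
  fixes i :: "'n::finite"
  assumes h: "0 < h"
  shows "has_bochner_integral (gauss h) (\<lambda>z::real^'n. (z $ i)\<^sup>2) h"
  using normal_moment_even[of "sqrt h" 0 1] h
  by (intro gauss_coordinate_integral[OF h, of "\<lambda>x. x\<^sup>2"]) (auto simp: fact_numeral)

text \<open>Integrability follows from that of the squares. Off the diagonal, reflecting coordinate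
  \<open>i\<close> sends the integral to its negative.\<close>

lemma gauss_moment2:
  fixes i j :: "'n::finite"
  assumes h: "0 < h"
  shows "has_bochner_integral (gauss h) (\<lambda>z::real^'n. z $ i * z $ j) (if i = j then h else 0)"
proof -
  have int: "integrable (gauss h) (\<lambda>z::real^'n. z $ i * z $ j)"
  proof (rule Bochner_Integration.integrable_bound)
    show "integrable (gauss h) (\<lambda>z::real^'n. (z $ i)\<^sup>2 + (z $ j)\<^sup>2)"
      using gauss_moment2_diag[OF h] by (intro Bochner_Integration.integrable_add) (auto simp: has_bochner_integral_iff)
    show "AE z in gauss h. norm (z $ i * z $ j) \<le> norm ((z $ i)\<^sup>2 + (z $ j)\<^sup>2 :: real)"
    proof (rule AE_I2)
      fix z :: "real^'n"
      have "2 * (\<bar>z $ i\<bar> * \<bar>z $ j\<bar>) \<le> (z $ i)\<^sup>2 + (z $ j)\<^sup>2"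
        using sum_squares_bound[of "\<bar>z $ i\<bar>" "\<bar>z $ j\<bar>"] by simp
      moreover have "0 \<le> \<bar>z $ i\<bar> * \<bar>z $ j\<bar>" by simp
      moreover have "norm ((z $ i)\<^sup>2 + (z $ j)\<^sup>2) = (z $ i)\<^sup>2 + (z $ j)\<^sup>2" by simp
      moreover have "norm (z $ i * z $ j) = \<bar>z $ i\<bar> * \<bar>z $ j\<bar>" by (simp add: abs_mult)
      ultimately show "norm (z $ i * z $ j) \<le> norm ((z $ i)\<^sup>2 + (z $ j)\<^sup>2)"
        by linarith
    qed
  qed simp
  show ?thesis
  proof (cases "i = j")
    case True then show ?thesis using gauss_moment2_diag[OF h, of i] by (simp add: power2_eq_square)
  next
    case False
    let ?T = "\<lambda>z::real^'n. \<chi> j. if j = i then - z $ j else z $ j"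
    note [measurable] = measurable_reflect[of i]
    have "(\<integral>z. z $ i * z $ j \<partial>gauss h) = (\<integral>z. z $ i * z $ j \<partial>distr (gauss h) borel ?T)"
      by (simp add: gauss_reflect[OF h])
    also have "\<dots> = (\<integral>z. - (z $ i * z $ j) \<partial>gauss h)"
      using False by (subst integral_distr) auto
    finally have "(\<integral>z. z $ i * z $ j \<partial>(gauss h :: (real^'n) measure)) = 0" by simp
    then show ?thesis using int False by (simp add: has_bochner_integral_iff)
  qed
qed

lemma gauss_moment3:
  obtains C where "C \<ge> 0" "\<And>h. 0 < h \<Longrightarrow> integrable (gauss h) (\<lambda>z::real^'n. norm z ^ 3)"
    "\<And>h. 0 < h \<Longrightarrow> (\<integral>z. norm (z::real^'n) ^ 3 \<partial>gauss h) \<le> C * sqrt h ^ 3"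
proof
  \<comment> \<open>The norm is at most the sum of the \<open>CARD('n)\<close> coordinates in
    absolute value, hence at most \<open>CARD('n)\<close> times the largest; cubing gives this
    factor.\<close>
  define K where "K = real CARD('n) ^ 3"
  have le: "norm z ^ 3 \<le> K * (\<Sum>i\<in>UNIV. \<bar>z $ i\<bar> ^ 3)" for z :: "real^'n"
  proof -
    obtain i where i: "\<And>j. \<bar>z $ j\<bar> \<le> \<bar>z $ i\<bar>"
    proof -
      have "Max (range (\<lambda>j. \<bar>z $ j\<bar>)) \<in> range (\<lambda>j. \<bar>z $ j\<bar>)" by (rule Max_in) auto
      then obtain i where "Max (range (\<lambda>j. \<bar>z $ j\<bar>)) = \<bar>z $ i\<bar>" by (rule imageE)
      moreover have "\<bar>z $ j\<bar> \<le> Max (range (\<lambda>j. \<bar>z $ j\<bar>))" for j by (rule Max_ge) auto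
      ultimately show ?thesis using that by metis
    qed
    have "norm z \<le> (\<Sum>j\<in>UNIV. \<bar>z $ j\<bar>)" by (rule norm_le_l1_cart)
    also have "\<dots> \<le> real CARD('n) * \<bar>z $ i\<bar>" using sum_bounded_above[of UNIV "\<lambda>j. \<bar>z $ j\<bar>", OF i] by simp
    finally have "norm z ^ 3 \<le> (real CARD('n) * \<bar>z $ i\<bar>) ^ 3" by (intro power_mono) auto
    also have "\<dots> = K * \<bar>z $ i\<bar> ^ 3" by (simp add: K_def power_mult_distrib)
    also have "\<dots> \<le> K * (\<Sum>i\<in>UNIV. \<bar>z $ i\<bar> ^ 3)"
      by (intro mult_left_mono member_le_sum) (auto simp: K_def)
    finally show ?thesis .
  qed
  \<comment> \<open>The third absolute moment of one coordinate is
    \<open>2 * sqrt (2 / pi) * sqrt h ^ 3\<close>, summed here over the coordinates.\<close>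
  let ?C = "real CARD('n) * (2 * sqrt (2 / pi))"
  show "0 \<le> K * ?C" by (simp add: K_def)
  fix h :: real assume h: "0 < h"
  have m: "has_bochner_integral (gauss h) (\<lambda>z::real^'n. \<bar>z $ i\<bar> ^ 3) (2 * sqrt h ^ 3 * sqrt (2 / pi))" for i
    using normal_moment_abs_odd[of "sqrt h" 0 1] h
    by (intro gauss_coordinate_integral[OF h, of "\<lambda>x. \<bar>x\<bar> ^ 3"]) (auto simp: eval_nat_numeral)
  have s: "has_bochner_integral (gauss h) (\<lambda>z::real^'n. K * (\<Sum>i\<in>UNIV. \<bar>z $ i\<bar> ^ 3)) (K * (\<Sum>i\<in>(UNIV::'n set). 2 * sqrt h ^ 3 * sqrt (2 / pi)))"
    by (intro has_bochner_integral_mult_right has_bochner_integral_sum m)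
  show int: "integrable (gauss h) (\<lambda>z::real^'n. norm z ^ 3)"
  proof (rule Bochner_Integration.integrable_bound)
    show "integrable (gauss h) (\<lambda>z::real^'n. K * (\<Sum>i\<in>UNIV. \<bar>z $ i\<bar> ^ 3))" using s by (simp add: has_bochner_integral_iff)
    show "AE z in gauss h. norm (norm (z::real^'n) ^ 3) \<le> norm (K * (\<Sum>i\<in>UNIV. \<bar>z $ i\<bar> ^ 3))"
    proof (rule AE_I2)
      fix z :: "real^'n"
      have "norm (norm z ^ 3) = norm z ^ 3" by simp
      also have "\<dots> \<le> norm (K * (\<Sum>i\<in>UNIV. \<bar>z $ i\<bar> ^ 3))"
        by (rule order_trans[OF le[of z]]) (simp only: real_norm_def abs_ge_self)
      finally show "norm (norm z ^ 3) \<le> norm (K * (\<Sum>i\<in>UNIV. \<bar>z $ i\<bar> ^ 3))" .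
    qed
  qed simp
  have "(\<integral>z. norm (z::real^'n) ^ 3 \<partial>gauss h) \<le> (\<integral>z. K * (\<Sum>i\<in>UNIV. \<bar>(z::real^'n) $ i\<bar> ^ 3) \<partial>gauss h)"
    using s int le by (intro integral_mono) (auto simp: has_bochner_integral_iff)
  also have "\<dots> = K * ?C * sqrt h ^ 3" using s by (simp add: has_bochner_integral_iff algebra_simps)
  finally show "(\<integral>z. norm (z::real^'n) ^ 3 \<partial>gauss h) \<le> K * ?C * sqrt h ^ 3" .
qed

text \<open>Test the hypothesis on \<open>1 + s f\<close> with \<open>s = sqrt c\<close>.\<close>

lemma harnack_imp_total_variation:
  fixes X Y :: "'z \<Rightarrow> 'a::topological_space"
  assumes "prob_space P" and [measurable]: "X \<in> P \<rightarrow>\<^sub>M borel" "Y \<in> P \<rightarrow>\<^sub>M borel" and c: "0 < c"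
    and har: "\<And>g B. g \<in> borel_measurable borel \<Longrightarrow> (\<And>x. \<bar>g x\<bar> \<le> (B::real)) \<Longrightarrow>
       (\<integral>z. g (Y z) \<partial>P)\<^sup>2 \<le> exp c * (\<integral>z. (g (X z))\<^sup>2 \<partial>P)"
    and f: "f \<in> borel_measurable borel" "\<And>x. \<bar>f x\<bar> \<le> (1::real)"
  shows "\<bar>(\<integral>z. f (Y z) \<partial>P) - (\<integral>z. f (X z) \<partial>P)\<bar> \<le> 6 * sqrt c"
proof -
  interpret prob_space P by fact
  have int [simp]: "integrable P (\<lambda>z. g (X z))" "integrable P (\<lambda>z. g (Y z))"
    if "g \<in> borel_measurable borel" "\<And>x. \<bar>g x\<bar> \<le> (B::real)" for g B
  proof -
    note [measurable] = that(1)
    show "integrable P (\<lambda>z. g (X z))" "integrable P (\<lambda>z. g (Y z))"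
      using that by (auto intro!: integrable_const_bound[of _ B] AE_I2)
  qed
  have 1: "\<bar>\<integral>z. g (X z) \<partial>P\<bar> \<le> 1" "\<bar>\<integral>z. g (Y z) \<partial>P\<bar> \<le> 1"
    if "g \<in> borel_measurable borel" "\<And>x. \<bar>g x\<bar> \<le> (1::real)" for g
  proof -
    note [measurable] = that(1)
    have "g x \<le> 1" "-1 \<le> g x" for x using that(2)[of x] by (auto simp: abs_le_iff)
    then show "\<bar>\<integral>z. g (X z) \<partial>P\<bar> \<le> 1" "\<bar>\<integral>z. g (Y z) \<partial>P\<bar> \<le> 1"
      using int[OF that] integral_le_const[of "\<lambda>z. g (X z)" 1] integral_ge_const[of "\<lambda>z. g (X z)" "-1"]
        integral_le_const[of "\<lambda>z. g (Y z)" 1] integral_ge_const[of "\<lambda>z. g (Y z)" "-1"]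
      by (auto simp: abs_le_iff minus_le_iff)
  qed
  have main: "(\<integral>z. g (Y z) \<partial>P) - (\<integral>z. g (X z) \<partial>P) \<le> 6 * sqrt c"
    if g [measurable]: "g \<in> borel_measurable borel" and g1: "\<And>x. \<bar>g x\<bar> \<le> (1::real)" for g
  \<comment> \<open>The constant 6 makes the right-hand side equal to 2, the trivial bound, at
    \<open>c = 1/9\<close>. For smaller \<open>c\<close> also \<open>s \<le> 1\<close> and
    \<open>exp c - 1 \<le> 2 * c\<close>, which the linearisation uses.\<close>
  proof (cases "c \<le> 1/9")
    case False
    then have "sqrt (1/9) \<le> sqrt c" by (intro real_sqrt_le_mono) simp
    then have "1/3 \<le> sqrt c" by (simp add: real_sqrt_divide)
    then show ?thesis using 1[OF g g1] by linarith
  next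
    case True
    define s where "s = sqrt c"
    have s: "0 < s" "s\<^sup>2 = c" using c by (auto simp: s_def)
    define p q w where "p = (\<integral>z. g (X z) \<partial>P)" and "q = (\<integral>z. g (Y z) \<partial>P)" and "w = (\<integral>z. (g (X z))\<^sup>2 \<partial>P)"
    have g2: "(\<lambda>x. (g x)\<^sup>2) \<in> borel_measurable borel" "\<bar>(g x)\<^sup>2\<bar> \<le> 1" for x
      using g1[of x] by (simp_all add: abs_square_le_1)
    have iX [simp]: "integrable P (\<lambda>z. g (X z))" "integrable P (\<lambda>z. g (Y z))" "integrable P (\<lambda>z. (g (X z))\<^sup>2)"
      using int(1)[OF g g1] int(2)[OF g g1] int(1)[OF g2] by auto
    have w: "w \<le> 1" unfolding w_def using 1(1)[OF g2] by linarith
    have p: "\<bar>p\<bar> \<le> 1" unfolding p_def using 1(1)[OF g g1] .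
    have "\<bar>1 + s * g x\<bar> \<le> 1 + s" for x
    proof -
      have "\<bar>s * g x\<bar> \<le> s * 1" unfolding abs_mult using s g1[of x] by (intro mult_mono) auto
      then show ?thesis by linarith
    qed
    \<comment> \<open>With perturbation size \<open>s = sqrt c\<close> the linear terms have order
      \<open>s\<close> and all others order \<open>c = s\<^sup>2\<close>, so dividing by
      \<open>2 * s\<close> leaves a multiple of \<open>sqrt c\<close>.\<close>
    from har[of "\<lambda>x. 1 + s * g x", OF _ this]
    have "(\<integral>z. 1 + s * g (Y z) \<partial>P)\<^sup>2 \<le> exp c * (\<integral>z. (1 + s * g (X z))\<^sup>2 \<partial>P)" by simp
    also have "(\<integral>z. 1 + s * g (Y z) \<partial>P) = 1 + s * q" by (simp add: q_def prob_space)
    also have "(\<integral>z. (1 + s * g (X z))\<^sup>2 \<partial>P) = (\<integral>z. (1 + 2 * s * g (X z)) + s\<^sup>2 * (g (X z))\<^sup>2 \<partial>P)"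
      by (intro Bochner_Integration.integral_cong refl) (simp add: power2_eq_square algebra_simps)
    also have "\<dots> = 1 + 2 * s * p + c * w"
      by (subst Bochner_Integration.integral_add) (simp_all add: p_def w_def s prob_space)
    finally have A: "(1 + s * q)\<^sup>2 \<le> exp c * (1 + 2 * s * p + c * w)" .
    define e where "e = exp c - 1"
    have "exp c \<le> 1 + c + c\<^sup>2" using c True by (intro exp_bound) auto
    moreover have "c\<^sup>2 \<le> c * 1" unfolding power2_eq_square using c True by (intro mult_left_mono) auto
    ultimately have e: "0 \<le> e" "e \<le> 2 * c" using c by (auto simp: e_def)
    have cs: "c \<le> s" "s \<le> 1"
    proof -
      show "s \<le> 1" using True by (simp add: s_def)
      then have "s * s \<le> s * 1" using s by (intro mult_left_mono) auto
      then show "c \<le> s" using s(2) by (metis mult.right_neutral power2_eq_square)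
    qed
    have "exp c * (1 + 2 * s * p + c * w) = (1 + 2 * s * p + c * w) + e * (1 + 2 * s * p + c * w)"
      by (simp add: e_def algebra_simps)
    moreover have "c * w \<le> c * 1" using c w by (intro mult_left_mono) auto
    moreover have "s * p \<le> s * 1" using s p by (intro mult_left_mono) auto
    moreover have "e * (1 + 2 * s * p + c * w) \<le> e * (1 + 2 * s + c)"
      using e calculation by (intro mult_left_mono) auto
    moreover have "e * (1 + 2 * s + c) \<le> (2 * c) * (1 + 2 * s + c)"
      using e s c by (intro mult_right_mono) auto
    moreover have "(1 + s * q)\<^sup>2 \<ge> 1 + 2 * s * q"
      using zero_le_power2[of "s * q"] by (simp add: power2_sum power_mult_distrib)
    ultimately have "2 * s * q - 2 * s * p \<le> c + 2 * c * (1 + 2 * s + c)" using A by linarith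
    also have "\<dots> \<le> c + 2 * c * (1 + 2 * 1 + 1)" using cs c True
      by (intro add_left_mono mult_left_mono add_mono) auto
    also have "\<dots> = 9 * s\<^sup>2" using s by simp
    finally have "2 * s * (q - p) \<le> 2 * s * (9/2 * s)" by (simp add: algebra_simps power2_eq_square)
    then have "q - p \<le> 9/2 * s" using s by (simp only: mult_le_cancel_left_pos)
    then have "q - p \<le> 6 * s" using s by linarith
    then show ?thesis by (simp only: p_def q_def s_def)
  qed
  have "(\<lambda>x. - f x) \<in> borel_measurable borel" "\<And>x. \<bar>- f x\<bar> \<le> 1" using f by auto
  from main[OF f] main[OF this] show ?thesis by simp
qed

section \<open>The Euler scheme\<close>

text \<open>The drift receives the time because the common noise enters through it. The driving path
  is read at grid times only, which makes the scheme a function of finitely many increments.\<close>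

primrec eul :: "(real \<Rightarrow> 'a \<Rightarrow> 'a) \<Rightarrow> (real \<Rightarrow> 'a) \<Rightarrow> real \<Rightarrow> 'a \<Rightarrow> nat \<Rightarrow> 'a::real_normed_vector" where
  "eul g w h x 0 = x"
| "eul g w h x (Suc k) = eul g w h x k + h *\<^sub>R g (real k * h) (eul g w h x k) + (w (real (Suc k) * h) - w (real k * h))"

lemma eul_cong:
  "(\<And>j. j \<le> k \<Longrightarrow> w (real j * h) = w' (real j * h)) \<Longrightarrow> eul g w h x k = eul g w' h x k"
proof (induction k)
  case (Suc k)
  have "eul g w h x k = eul g w' h x k" by (rule Suc.IH) (use Suc.prems in auto)
  moreover have "w (real (Suc k) * h) = w' (real (Suc k) * h)" by (rule Suc.prems) simp
  moreover have "w (real k * h) = w' (real k * h)" by (rule Suc.prems) simp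
  ultimately show ?case by (simp only: eul.simps)
qed simp

text \<open>A discrete Gronwall argument. The additive noise cancels in the difference of scheme and
  solution; one step contributes at most \<open>L\<close> times the current error plus the
  oscillation \<open>e\<close> of the exact drift, both multiplied by \<open>h\<close>.\<close>

lemma eul_error:
  fixes g :: "real \<Rightarrow> 'a::euclidean_space \<Rightarrow> 'a"
  assumes T: "0 < T" and N: "0 < N" and h: "h = T / real N" and L: "0 \<le> L" and e: "0 \<le> e"
    and lip: "\<And>s y z. s \<in> {0..T} \<Longrightarrow> norm (g s y - g s z) \<le> L * norm (y - z)"
    and cont: "continuous_on {0..T} (\<lambda>s. g s (u s))"
    and sol: "\<And>t. t \<in> {0..T} \<Longrightarrow> u t = x + integral {0..t} (\<lambda>s. g s (u s)) + w t"
    and w0: "w 0 = 0"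
    and eps: "\<And>s s'. s \<in> {0..T} \<Longrightarrow> s' \<in> {0..T} \<Longrightarrow> \<bar>s - s'\<bar> \<le> h \<Longrightarrow> norm (g s (u s) - g s' (u s')) \<le> e"
    and k: "k \<le> N"
  shows "norm (eul g w h x k - u (real k * h)) \<le> exp (L * T) * T * e"
proof -
  have hp: "0 < h" "real N * h = T" using T N h by auto
  have kT: "real j * h \<in> {0..T}" if "j \<le> N" for j
    using mult_right_mono[of "real j" "real N" h] that hp by auto
  have "k \<le> N \<Longrightarrow> norm (eul g w h x k - u (real k * h)) \<le> (1 + L * h) ^ k * (real k * h * e)"
  proof (induction k)
    case 0
    show ?case using sol[of 0] T w0 by simp
  next
    case (Suc k)
    let ?a = "real k * h" and ?b = "real (Suc k) * h" and ?E = "eul g w h x k"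
    have a: "?a \<in> {0..T}" and b: "?b \<in> {0..T}" and ab: "?a \<le> ?b" "?b - ?a = h"
      using kT[of k] kT[of "Suc k"] Suc.prems hp by (auto simp: algebra_simps)
    have d: "norm (?E - u ?a) \<le> (1 + L * h) ^ k * (real k * h * e)" using Suc by simp
    have int: "(\<lambda>s. g s (u s)) integrable_on {0..?b}"
      by (rule integrable_continuous_real[OF continuous_on_subset[OF cont]]) (use b in auto)
    have split: "integral {0..?b} (\<lambda>s. g s (u s)) = integral {0..?a} (\<lambda>s. g s (u s)) + integral {?a..?b} (\<lambda>s. g s (u s))"
      using Henstock_Kurzweil_Integration.integral_combine[OF _ ab(1) int] a by simp
    have cab: "continuous_on {?a..?b} (\<lambda>s. g s (u s))"
      by (rule continuous_on_subset[OF cont]) (use a b in auto)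
    have "integral {?a..?b} (\<lambda>s. g ?a ?E - g s (u s)) = h *\<^sub>R g ?a ?E - integral {?a..?b} (\<lambda>s. g s (u s))"
      using ab by (subst Henstock_Kurzweil_Integration.integral_diff)
        (simp_all add: integrable_continuous_real[OF cab] integrable_const_ivl del: of_nat_Suc)
    then have eq: "eul g w h x (Suc k) - u ?b = (?E - u ?a) + integral {?a..?b} (\<lambda>s. g ?a ?E - g s (u s))"
      unfolding sol[OF b] sol[OF a] split by simp
    have "norm (integral {?a..?b} (\<lambda>s. g ?a ?E - g s (u s))) \<le> (L * norm (?E - u ?a) + e) * (?b - ?a)"
    proof (rule integral_bound[OF ab(1)])
      show "continuous_on {?a..?b} (\<lambda>s. g ?a ?E - g s (u s))" by (intro continuous_intros cab)
      fix s assume s: "s \<in> {?a..?b}"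
      have "0 \<le> ?a" "?b \<le> T" using hp(1) b by auto
      with s have sT: "s \<in> {0..T}" "\<bar>?a - s\<bar> \<le> h" using ab(2) unfolding atLeastAtMost_iff by linarith+
      have "norm (g ?a ?E - g s (u s)) \<le> norm (g ?a ?E - g ?a (u ?a)) + norm (g ?a (u ?a) - g s (u s))"
        by (metis norm_triangle_ineq diff_add_cancel add_diff_eq)
      also have "\<dots> \<le> L * norm (?E - u ?a) + e"
        by (intro add_mono lip a eps sT)
      finally show "norm (g ?a ?E - g s (u s)) \<le> L * norm (?E - u ?a) + e" .
    qed
    then have "norm (eul g w h x (Suc k) - u ?b) \<le> norm (?E - u ?a) + (L * norm (?E - u ?a) + e) * h"
      unfolding eq ab(2) by (intro norm_triangle_le add_left_mono) 
    also have "\<dots> = (1 + L * h) * norm (?E - u ?a) + h * e" by (simp add: algebra_simps)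
    \<comment> \<open>The factor \<open>(1 + L * h) ^ Suc k \<ge> 1\<close> in front of
      \<open>h * e\<close> is a loss, but it keeps the bound in the form power times elapsed time
      times \<open>e\<close>.\<close>
    also have "\<dots> \<le> (1 + L * h) * ((1 + L * h) ^ k * (real k * h * e)) + (1 + L * h) ^ Suc k * (h * e)"
    proof (intro add_mono mult_left_mono d)
      have "1 \<le> (1 + L * h) ^ Suc k" using L hp by (intro one_le_power) simp
      then show "h * e \<le> (1 + L * h) ^ Suc k * (h * e)"
        using mult_right_mono[of 1 "(1 + L * h) ^ Suc k" "h * e"] hp e by simp
    qed (use L hp in auto)
    also have "\<dots> = (1 + L * h) ^ Suc k * (real (Suc k) * h * e)" by (simp add: algebra_simps)
    finally show ?case .
  qed
  then have "norm (eul g w h x k - u (real k * h)) \<le> (1 + L * h) ^ k * (real k * h * e)" using k by simp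
  also have "\<dots> \<le> exp (L * T) * (T * e)"
  proof (intro mult_mono mult_right_mono e)
    have "(1 + L * h) ^ k \<le> exp (L * h) ^ k" using L hp by (intro power_mono exp_ge_add_one_self) auto
    also have "\<dots> = exp (L * (real k * h))" by (simp add: exp_of_nat_mult[symmetric] algebra_simps)
    also have "\<dots> \<le> exp (L * T)" using kT[OF k] L by (auto intro!: mult_left_mono)
    finally show "(1 + L * h) ^ k \<le> exp (L * T)" .
  qed (use kT[OF k] hp e in auto)
  finally show ?thesis by (simp add: mult.assoc)
qed

lemma eul_tendsto_uniform:
  fixes g :: "real \<Rightarrow> 'a::euclidean_space \<Rightarrow> 'a"
  assumes T: "0 < T" and L: "0 \<le> L"
    and lip: "\<And>s y z. s \<in> {0..T} \<Longrightarrow> norm (g s y - g s z) \<le> L * norm (y - z)"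
    and cont: "continuous_on {0..T} (\<lambda>s. g s (u s))"
    and sol: "\<And>t. t \<in> {0..T} \<Longrightarrow> u t = x + integral {0..t} (\<lambda>s. g s (u s)) + w t"
    and w0: "w 0 = 0" and e: "0 < e"
  shows "\<forall>\<^sub>F N in sequentially. \<forall>k\<le>N. norm (eul g w (T / real N) x k - u (real k * (T / real N))) < e"
proof -
  \<comment> \<open>With this choice the error bound \<open>exp (L * T) * T * e'\<close> equals
    \<open>e / 2\<close>, which makes the inequality strict.\<close>
  define e' where "e' = e / (2 * exp (L * T) * T)"
  have e': "0 < e'" using e T by (simp add: e'_def)
  have "uniformly_continuous_on {0..T} (\<lambda>s. g s (u s))"
    by (rule compact_uniformly_continuous[OF cont]) simp
  then obtain d where d: "0 < d" "\<And>s s'. s \<in> {0..T} \<Longrightarrow> s' \<in> {0..T} \<Longrightarrow> dist s' s < d \<Longrightarrow> dist (g s' (u s')) (g s (u s)) < e'"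
    unfolding uniformly_continuous_on_def using e' by metis
  have "(\<lambda>N. T / real N) \<longlonglongrightarrow> 0" by (rule lim_const_over_n)
  then have "\<forall>\<^sub>F N in sequentially. T / real N < d" using d(1) by (rule order_tendstoD)
  then show ?thesis using eventually_gt_at_top[of 0]
  proof eventually_elim
    case (elim N)
    show ?case
    proof (intro allI impI)
      fix k assume k: "k \<le> N"
      have "norm (eul g w (T / real N) x k - u (real k * (T / real N))) \<le> exp (L * T) * T * e'"
        using e' elim
        by (intro eul_error[OF T elim(2) refl L _ lip cont sol w0 _ k])
          (auto simp: dist_norm[symmetric] dist_real_def abs_minus_commute intro!: less_imp_le d(2))
      also have "\<dots> < e" using e T by (simp add: e'_def)
      finally show "norm (eul g w (T / real N) x k - u (real k * (T / real N))) < e" .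
    qed
  qed
qed

section \<open>Conditioning the scheme on one Gaussian increment\<close>

lemma measurable_eul:
  fixes \<sigma> :: "real^'n^'n"
  assumes g: "\<And>s y. y \<in> borel_measurable M \<Longrightarrow> (\<lambda>z. g z s (y z)) \<in> borel_measurable M"
    and w: "w \<in> M \<rightarrow>\<^sub>M path_space" and x: "x \<in> borel_measurable M"
  shows "(\<lambda>z. eul (g z) (\<lambda>s. \<sigma> *v w z s) h (x z) k) \<in> borel_measurable M"
proof (induction k)
  case (Suc k)
  have [measurable]: "(\<lambda>z. \<sigma> *v w z s) \<in> borel_measurable M" for s
    by (rule borel_measurable_continuous_on[OF matrix_vector_mult_linear_continuous_on[of UNIV] measurable_compose[OF w measurable_eval]])
  note [measurable] = Suc g[OF Suc]
  show ?case unfolding eul.simps by measurable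
qed (simp add: x)

lemma integral_wiener_concat:
  fixes F :: "(real \<Rightarrow> real^'n) \<Rightarrow> real"
  assumes P: "wiener_measure P" and s: "0 \<le> s" and F: "F \<in> borel_measurable path_space" and B: "\<And>\<xi>. \<xi> \<in> C0 \<Longrightarrow> \<bar>F \<xi>\<bar> \<le> B"
  shows "(\<integral>\<xi>. F \<xi> \<partial>P) = (\<integral>\<xi>. (\<integral>\<zeta>. F (path_concat s \<xi> \<zeta>) \<partial>P) \<partial>P)"
proof -
  interpret W: prob_space P using P by (rule wiener_measureD)
  interpret PP: pair_prob_space P P ..
  have m: "(\<lambda>(\<xi>, \<zeta>). path_concat s \<xi> \<zeta>) \<in> P \<Otimes>\<^sub>M P \<rightarrow>\<^sub>M path_space"
    using measurable_path_concat[OF s] measurable_cong_sets[OF sets_pair_measure_cong[OF wiener_measureD(3)[OF P] wiener_measureD(3)[OF P]] refl]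
    by blast
  have m2: "(\<lambda>(\<xi>, \<zeta>). F (path_concat s \<xi> \<zeta>)) \<in> borel_measurable (P \<Otimes>\<^sub>M P)"
    using measurable_compose[OF m F] by (simp add: split_beta')
  have "(\<integral>\<xi>. F \<xi> \<partial>P) = (\<integral>\<xi>. F \<xi> \<partial>distr (P \<Otimes>\<^sub>M P) path_space (\<lambda>(\<xi>, \<zeta>). path_concat s \<xi> \<zeta>))"
    by (simp add: wiener_concat[OF P s])
  also have "\<dots> = (\<integral>z. F (case z of (\<xi>, \<zeta>) \<Rightarrow> path_concat s \<xi> \<zeta>) \<partial>(P \<Otimes>\<^sub>M P))"
    by (rule integral_distr[OF m F])
  also have "\<dots> = (\<integral>(\<xi>, \<zeta>). F (path_concat s \<xi> \<zeta>) \<partial>(P \<Otimes>\<^sub>M P))" by (simp add: split_beta')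
  also have "\<dots> = (\<integral>\<xi>. (\<integral>\<zeta>. F (path_concat s \<xi> \<zeta>) \<partial>P) \<partial>P)"
  proof -
    have "integrable (P \<Otimes>\<^sub>M P) (\<lambda>(\<xi>, \<zeta>). F (path_concat s \<xi> \<zeta>))"
      using m2 by (intro PP.integrable_const_bound[of _ B])
        (auto intro!: AE_I2 B path_concat_C0 s simp: space_pair_measure wiener_measureD(2)[OF P])
    from PP.integral_fst'[OF this] show ?thesis by simp
  qed
  finally show ?thesis .
qed

lemma integral_wiener_marginal:
  fixes F :: "real^'n \<Rightarrow> real"
  assumes P: "wiener_measure P" and h: "0 < h" and F: "F \<in> borel_measurable borel"
  shows "(\<integral>\<xi>. F (\<xi> h) \<partial>P) = (\<integral>z. F z \<partial>gauss h)"
proof -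
  note [measurable] = measurable_eval F
  note [measurable_cong] = wiener_measureD(3)[OF P]
  have "(\<integral>z. F z \<partial>gauss h) = (\<integral>z. F z \<partial>distr P borel (\<lambda>\<xi>. \<xi> h - \<xi> 0))"
    using wiener_increment[OF P h] by simp
  also have "\<dots> = (\<integral>\<xi>. F (\<xi> h - \<xi> 0) \<partial>P)" by (rule integral_distr) measurable
  also have "\<dots> = (\<integral>\<xi>. F (\<xi> h) \<partial>P)"
    using wiener_measureD(2)[OF P] by (intro Bochner_Integration.integral_cong) (auto simp: C0_def)
  finally show ?thesis ..
qed

text \<open>After gluing at time \<open>k * h\<close>, the state after \<open>k\<close> steps
  depends on the first path only, and the next increment is the value at \<open>h\<close> of the
  second, fresh path. Integrating that path out leaves a Gaussian integral with the state
  frozen.\<close>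

lemma eul_step_integral:
  fixes F :: "real^'n \<Rightarrow> real^'n \<Rightarrow> real"
  assumes P: "wiener_measure P" and h: "0 < h" and g: "\<And>s. g s \<in> borel_measurable borel"
    and F: "(\<lambda>(y, z). F y z) \<in> borel_measurable (borel \<Otimes>\<^sub>M borel)" and B: "\<And>y z. \<bar>F y z\<bar> \<le> B"
  shows "(\<integral>\<xi>. F (eul g (\<lambda>s. \<sigma> *v \<xi> s) h x k) (\<xi> (real (Suc k) * h) - \<xi> (real k * h)) \<partial>P) =
     (\<integral>\<xi>. (\<integral>z. F (eul g (\<lambda>s. \<sigma> *v \<xi> s) h x k) z \<partial>gauss h) \<partial>P)"
proof -
  let ?s = "real k * h"
  have s: "0 \<le> ?s" using h by simp
  have [measurable]: "(\<lambda>\<xi>. eul g (\<lambda>s. \<sigma> *v \<xi> s) h x k) \<in> borel_measurable path_space"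
    by (rule measurable_eul) (use g in \<open>auto intro: measurable_compose\<close>)
  note [measurable] = measurable_eval
  have m: "(\<lambda>\<xi>. F (eul g (\<lambda>s. \<sigma> *v \<xi> s) h x k) (\<xi> (real (Suc k) * h) - \<xi> (real k * h))) \<in> borel_measurable path_space"
  proof -
    have "(\<lambda>\<xi>. (eul g (\<lambda>s. \<sigma> *v \<xi> s) h x k, \<xi> (real (Suc k) * h) - \<xi> (real k * h))) \<in> path_space \<rightarrow>\<^sub>M borel \<Otimes>\<^sub>M borel"
      by measurable
    from measurable_compose[OF this F] show ?thesis by simp
  qed
  have Fy: "F y \<in> borel_measurable borel" for y
    using measurable_compose[OF measurable_Pair1' F] by simp
  have c: "F (eul g (\<lambda>s. \<sigma> *v path_concat ?s \<xi> \<zeta> s) h x k)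
      (path_concat ?s \<xi> \<zeta> (real (Suc k) * h) - path_concat ?s \<xi> \<zeta> (real k * h)) =
     F (eul g (\<lambda>s. \<sigma> *v \<xi> s) h x k) (\<zeta> h)" for \<xi> \<zeta>
  proof -
    have "eul g (\<lambda>s. \<sigma> *v path_concat ?s \<xi> \<zeta> s) h x k = eul g (\<lambda>s. \<sigma> *v \<xi> s) h x k"
      by (rule eul_cong) (use h in \<open>auto simp: path_concat_def\<close>)
    moreover have "path_concat ?s \<xi> \<zeta> (real (Suc k) * h) - path_concat ?s \<xi> \<zeta> (real k * h) = \<zeta> h"
      using h by (simp add: path_concat_def algebra_simps)
    ultimately show ?thesis by simp
  qed
  show ?thesis
    by (subst integral_wiener_concat[OF P s m B]) (simp add: c integral_wiener_marginal[OF P h Fy] del: of_nat_Suc)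
qed

lemma borel_measurable_matrix_vector [measurable]:
  "(\<lambda>z. (\<sigma>::real^'n^'m) *v z) \<in> borel_measurable borel"
  by (intro borel_measurable_continuous_onI matrix_vector_mult_linear_continuous_on)

text \<open>A discrete Girsanov transformation: in each step, the difference of the two drifts and the
  change of the shift \<open>v\<close> are absorbed into a translation of the Gaussian increment.\<close>

lemma eul_harnack:
  fixes f :: "real^'n \<Rightarrow> real" and \<sigma> :: "real^'n^'n"
  assumes P: "wiener_measure P" and h: "0 < h"
    and g: "\<And>s. g s \<in> borel_measurable borel" and g': "\<And>s. g' s \<in> borel_measurable borel"
    and S: "\<And>y. \<sigma> *v S y = y"
    and \<kappa>: "\<And>k y. k < N \<Longrightarrow> (norm (S (h *\<^sub>R (g' (real k * h) (y + v k) - g (real k * h) y) + v k - v (Suc k))))\<^sup>2 \<le> \<kappa> * h"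
    and k: "k \<le> N" and f: "f \<in> borel_measurable borel" and B: "\<And>y. \<bar>f y\<bar> \<le> B"
  shows "(\<integral>\<xi>. f (eul g' (\<lambda>s. \<sigma> *v \<xi> s) h (x + v 0) k - v k) \<partial>P)\<^sup>2 \<le>
     exp (real k * \<kappa>) * (\<integral>\<xi>. (f (eul g (\<lambda>s. \<sigma> *v \<xi> s) h x k))\<^sup>2 \<partial>P)"
  using k f B
proof (induction k arbitrary: f)
  case 0
  interpret prob_space P using P by (rule wiener_measureD)
  show ?case by (simp add: prob_space)
next
  case (Suc k)
  interpret prob_space P using P by (rule wiener_measureD)
  interpret G: prob_space "gauss h :: (real^'n) measure" by (rule prob_space_gauss[OF h])
  note [measurable_cong] = wiener_measureD(3)[OF P]
  note [measurable] = g g' Suc.prems(2)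
  let ?e = "\<lambda>\<xi>. eul g (\<lambda>s. \<sigma> *v \<xi> s) h x k" and ?e' = "\<lambda>\<xi>. eul g' (\<lambda>s. \<sigma> *v \<xi> s) h (x + v 0) k"
  let ?t = "real k * h"
  have B: "0 \<le> B" using Suc.prems(3)[of 0] by simp
  have B2: "\<bar>(f y)\<^sup>2\<bar> \<le> B\<^sup>2" for y using Suc.prems(3)[of y] B by (simp add: abs_le_square_iff[symmetric] flip: abs_le_square_iff)
  \<comment> \<open>\<open>F\<close> and \<open>F2\<close> are the one-step conditional expectations
    of the two integrands. The argument of \<open>F\<close> is the primed state with its shift
    \<open>v k\<close> removed, so both are functions of the same \<open>y\<close>.\<close>
  define F where "F y = (\<integral>z. f (y + v k + h *\<^sub>R g' ?t (y + v k) + \<sigma> *v z - v (Suc k)) \<partial>gauss h)" for y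
  define F2 where "F2 y = (\<integral>z. (f (y + h *\<^sub>R g ?t y + \<sigma> *v z))\<^sup>2 \<partial>gauss h)" for y
  have Fm [measurable]: "F \<in> borel_measurable borel" unfolding F_def by measurable
  have F2m [measurable]: "F2 \<in> borel_measurable borel" unfolding F2_def by measurable
  have FB: "\<bar>F y\<bar> \<le> B" for y
  proof -
    let ?q = "\<lambda>z. f (y + v k + h *\<^sub>R g' ?t (y + v k) + \<sigma> *v z - v (Suc k))"
    have "integrable (gauss h) ?q" by (rule G.integrable_const_bound[of _ B]) (auto intro!: Suc.prems(3))
    then show ?thesis
      using G.integral_le_const[of ?q B] G.integral_ge_const[of ?q "-B"] Suc.prems(3)
      by (auto simp: F_def abs_le_iff minus_le_iff)
  qed
  have F2B: "0 \<le> F2 y" "F2 y \<le> B\<^sup>2" for y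
  proof -
    let ?q = "\<lambda>z. (f (y + h *\<^sub>R g ?t y + \<sigma> *v z))\<^sup>2"
    have "integrable (gauss h) ?q" by (rule G.integrable_const_bound[of _ "B\<^sup>2"]) (use B2 in auto)
    then show "0 \<le> F2 y" "F2 y \<le> B\<^sup>2"
      using G.integral_le_const[of ?q "B\<^sup>2"] B2 by (auto simp: F2_def)
  qed
  have FF2: "(F y)\<^sup>2 \<le> exp \<kappa> * F2 y" for y
  proof -
    \<comment> \<open>Chosen so that \<open>\<sigma> *v a\<close> is exactly the discrepancy of the
      two one-step maps.\<close>
    define a where "a = S (h *\<^sub>R (g' ?t (y + v k) - g ?t y) + v k - v (Suc k))"
    have "F y = (\<integral>z. f (y + h *\<^sub>R g ?t y + \<sigma> *v (z + a)) \<partial>gauss h)"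
      unfolding F_def
      by (intro Bochner_Integration.integral_cong refl arg_cong[where f=f])
        (simp add: matrix_vector_right_distrib a_def S algebra_simps)
    then have "(F y)\<^sup>2 \<le> exp ((norm a)\<^sup>2 / h) * F2 y"
      unfolding F2_def
      using gauss_shift_harnack[OF h, of "\<lambda>z. f (y + h *\<^sub>R g ?t y + \<sigma> *v z)" B a] Suc.prems(3) by simp
    also have "\<dots> \<le> exp \<kappa> * F2 y"
      using \<kappa>[of k y] Suc.prems(1) h F2B[of y] by (intro mult_right_mono) (auto simp: a_def pos_divide_le_eq)
    finally show ?thesis .
  qed
  have em: "?e \<in> borel_measurable P" "?e' \<in> borel_measurable P"
    by (auto intro!: measurable_eul simp: measurable_compose[OF _ g] measurable_compose[OF _ g'])
  note [measurable] = em
  have "(\<integral>\<xi>. f (eul g' (\<lambda>s. \<sigma> *v \<xi> s) h (x + v 0) (Suc k) - v (Suc k)) \<partial>P) =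
      (\<integral>\<xi>. (\<lambda>y z. f (y + h *\<^sub>R g' ?t y + \<sigma> *v z - v (Suc k))) (?e' \<xi>) (\<xi> (real (Suc k) * h) - \<xi> ?t) \<partial>P)"
    by (simp add: matrix_vector_mult_diff_distrib)
  also have "\<dots> = (\<integral>\<xi>. F (?e' \<xi> - v k) \<partial>P)"
    by (subst eul_step_integral[OF P h g', where B=B]) (auto simp: F_def Suc.prems(3))
  finally have 1: "(\<integral>\<xi>. f (eul g' (\<lambda>s. \<sigma> *v \<xi> s) h (x + v 0) (Suc k) - v (Suc k)) \<partial>P) = \<dots>" .
  have "(\<integral>\<xi>. (f (eul g (\<lambda>s. \<sigma> *v \<xi> s) h x (Suc k)))\<^sup>2 \<partial>P) =
      (\<integral>\<xi>. (\<lambda>y z. (f (y + h *\<^sub>R g ?t y + \<sigma> *v z))\<^sup>2) (?e \<xi>) (\<xi> (real (Suc k) * h) - \<xi> ?t) \<partial>P)"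
    by (simp add: matrix_vector_mult_diff_distrib)
  also have "\<dots> = (\<integral>\<xi>. F2 (?e \<xi>) \<partial>P)"
    by (subst eul_step_integral[OF P h g, where B="B\<^sup>2"]) (use B2 in \<open>auto simp: F2_def\<close>)
  finally have 2: "(\<integral>\<xi>. (f (eul g (\<lambda>s. \<sigma> *v \<xi> s) h x (Suc k)))\<^sup>2 \<partial>P) = \<dots>" .
  \<comment> \<open>The last step has been integrated out on both sides; the induction hypothesis is
    applied to \<open>F\<close> instead of \<open>f\<close>, and passing from \<open>F\<close> to
    \<open>F2\<close> costs one more factor \<open>exp \<kappa>\<close>.\<close>
  have "(\<integral>\<xi>. F (?e' \<xi> - v k) \<partial>P)\<^sup>2 \<le> exp (real k * \<kappa>) * (\<integral>\<xi>. (F (?e \<xi>))\<^sup>2 \<partial>P)"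
    using Suc.prems(1) by (intro Suc.IH Fm FB) simp
  also have "\<dots> \<le> exp (real k * \<kappa>) * (\<integral>\<xi>. exp \<kappa> * F2 (?e \<xi>) \<partial>P)"
  proof (intro mult_left_mono integral_mono FF2)
    show "integrable P (\<lambda>\<xi>. (F (?e \<xi>))\<^sup>2)"
      by (rule integrable_const_bound[of _ "B\<^sup>2"]) (use FB B in \<open>auto simp flip: abs_le_square_iff\<close>)
    show "integrable P (\<lambda>\<xi>. exp \<kappa> * F2 (?e \<xi>))"
      by (rule integrable_const_bound[of _ "exp \<kappa> * B\<^sup>2"]) (use F2B in \<open>auto simp: abs_mult\<close>)
  qed simp
  also have "\<dots> = exp (real (Suc k) * \<kappa>) * (\<integral>\<xi>. F2 (?e \<xi>) \<partial>P)"
    by (simp add: exp_add[symmetric] algebra_simps)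
  finally show ?case unfolding 1 2 .
qed

text \<open>Each of the \<open>N\<close> steps costs \<open>(c * D)\<^sup>2 * (T / N)\<close>, so
  the total cost \<open>(c * D)\<^sup>2 * T\<close> does not depend on the mesh and survives the
  limit of the scheme.\<close>

lemma eul_total_variation:
  fixes f :: "real^'n \<Rightarrow> real" and \<sigma> :: "real^'n^'n"
  assumes P: "wiener_measure P" and T: "0 < T" and N: "0 < N"
    and g: "\<And>s. g s \<in> borel_measurable borel" and g': "\<And>s. g' s \<in> borel_measurable borel"
    and S: "\<And>y. \<sigma> *v S y = y" and c: "0 < c" and D: "0 < D" "\<And>y. norm (S y) \<le> c * norm y"
    and diff: "\<And>k y. k < N \<Longrightarrow> norm ((T / N) *\<^sub>R (g' (real k * (T / N)) (y + v k) - g (real k * (T / N)) y) + v k - v (Suc k)) \<le> D * (T / N)"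
    and f: "f \<in> borel_measurable borel" and f1: "\<And>y. \<bar>f y\<bar> \<le> 1"
  shows "\<bar>(\<integral>\<xi>. f (eul g' (\<lambda>s. \<sigma> *v \<xi> s) (T / N) (x + v 0) N - v N) \<partial>P) -
     (\<integral>\<xi>. f (eul g (\<lambda>s. \<sigma> *v \<xi> s) (T / N) x N) \<partial>P)\<bar> \<le> 6 * (c * D * sqrt T)"
proof -
  let ?h = "T / N" and ?k = "(c * D)\<^sup>2 * (T / N)"
  have h: "0 < ?h" using T N by simp
  note [measurable_cong] = wiener_measureD(3)[OF P]
  note [measurable] = measurable_eval
  have em: "(\<lambda>\<xi>. eul g (\<lambda>s. \<sigma> *v \<xi> s) ?h x k) \<in> borel_measurable P" 
     "(\<lambda>\<xi>. eul g' (\<lambda>s. \<sigma> *v \<xi> s) ?h x' k) \<in> borel_measurable P" for k x'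
    by (auto intro!: measurable_eul simp: measurable_compose[OF _ g] measurable_compose[OF _ g'])
  have \<kappa>: "(norm (S (?h *\<^sub>R (g' (real k * ?h) (y + v k) - g (real k * ?h) y) + v k - v (Suc k))))\<^sup>2 \<le> ?k * ?h"
    if "k < N" for k y
  proof -
    have "norm (S (?h *\<^sub>R (g' (real k * ?h) (y + v k) - g (real k * ?h) y) + v k - v (Suc k))) \<le> c * (D * ?h)"
      by (rule order_trans[OF D(2) mult_left_mono[OF diff[OF that]]]) (use c in simp)
    then have "(norm (S (?h *\<^sub>R (g' (real k * ?h) (y + v k) - g (real k * ?h) y) + v k - v (Suc k))))\<^sup>2 \<le> (c * (D * ?h))\<^sup>2"
      by (intro power_mono) auto
    then show ?thesis by (simp add: power2_eq_square algebra_simps)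
  qed
  have Nk: "real N * ?k = (c * D)\<^sup>2 * T" using N by simp
  have sq: "sqrt (real N * ?k) = c * D * sqrt T" unfolding Nk using c D by (simp add: real_sqrt_mult)
  have "\<bar>(\<integral>\<xi>. f (eul g' (\<lambda>s. \<sigma> *v \<xi> s) ?h (x + v 0) N - v N) \<partial>P) -
     (\<integral>\<xi>. f (eul g (\<lambda>s. \<sigma> *v \<xi> s) ?h x N) \<partial>P)\<bar> \<le> 6 * sqrt (real N * ?k)"
  proof (rule harnack_imp_total_variation[where f=f and X="\<lambda>\<xi>. eul g (\<lambda>s. \<sigma> *v \<xi> s) ?h x N"
        and Y="\<lambda>\<xi>. eul g' (\<lambda>s. \<sigma> *v \<xi> s) ?h (x + v 0) N - v N"])
    show "prob_space P" using P by (rule wiener_measureD)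
    show "0 < real N * ?k" using N c D T by simp
    show "(\<integral>z. q (eul g' (\<lambda>s. \<sigma> *v z s) ?h (x + v 0) N - v N) \<partial>P)\<^sup>2
       \<le> exp (real N * ?k) * (\<integral>z. (q (eul g (\<lambda>s. \<sigma> *v z s) ?h x N))\<^sup>2 \<partial>P)"
      if "q \<in> borel_measurable borel" "\<And>x. \<bar>q x\<bar> \<le> B" for q :: "real^'n \<Rightarrow> real" and B
      by (rule eul_harnack[OF P h g g' S \<kappa> order_refl that]) 
  qed (use f f1 em in auto)
  then show ?thesis unfolding sq .
qed

section \<open>The flow of the stochastic differential equation\<close>

text \<open>Positive definiteness makes the kernel trivial, so a linear inverse exists. Its bound
  \<open>c\<close> converts a discrepancy in state space into the size of a translation of the
  noise.\<close>

lemma pos_def_right_inverse: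
  fixes A :: "real^'n^'n"
  assumes "pos_def A"
  obtains S c where "\<And>y. A *v S y = y" "0 < c" "\<And>y. norm (S y) \<le> c * norm y"
proof -
  have lin: "linear ((*v) A)" by (rule matrix_vector_mul_linear)
  have inj: "inj ((*v) A)"
  proof (rule linear_injective_0[OF lin, THEN iffD2], intro allI impI)
    fix x assume "A *v x = 0"
    then show "x = 0" using assms unfolding pos_def_def by (metis inner_zero_right less_irrefl)
  qed
  then obtain S where S: "linear S" "((*v) A) \<circ> S = id"
    using linear_surjective_right_inverse[OF lin linear_injective_imp_surjective[OF lin inj]] by auto
  then obtain c where "0 < c" "\<And>y. norm (S y) \<le> c * norm y"
    using linear_bounded_pos by blast
  moreover have "A *v S y = y" for y using S(2) by (metis comp_apply id_apply)
  ultimately show ?thesis using that by blast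
qed

lemma matrix_vector_norm_bound:
  fixes A :: "real^'n^'m"
  obtains c where "0 < c" "\<And>y. norm (A *v y) \<le> c * norm y"
  using linear_bounded_pos[OF matrix_vector_mul_linear[of A]] by blast

lemma continuous_on_mult_vec [continuous_intros]:
  fixes A :: "real^'n^'m"
  shows "continuous_on S f \<Longrightarrow> continuous_on S (\<lambda>x. A *v f x)"
  by (rule continuous_on_compose2[OF matrix_vector_mult_linear_continuous_on[of UNIV]]) auto

lemma C0_continuous_on [continuous_intros]: "\<xi> \<in> C0 \<Longrightarrow> continuous_on S \<xi>"
  by (auto simp: C0_def intro: continuous_on_subset)

lemma C0_zero: "\<xi> \<in> C0 \<Longrightarrow> \<xi> 0 = 0"
  by (simp add: C0_def)

text \<open>\<open>F\<close> will be \<open>- grad V\<close>. Local Lipschitz bounds and a one-sided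
  growth bound carry the whole pathwise theory, which is thus separated from the potential.\<close>

locale noisy_flow =
  fixes F :: "real^'n \<Rightarrow> real^'n" and \<sigma> \<eta> :: "real^'n^'n"
    and phi :: "real \<Rightarrow> (real \<Rightarrow> real^'n) \<Rightarrow> (real \<Rightarrow> real^'n) \<Rightarrow> real^'n \<Rightarrow> real^'n"
  assumes F_lip: "\<And>R. \<exists>L\<ge>0. \<forall>y\<in>cball 0 R. \<forall>z\<in>cball 0 R. norm (F y - F z) \<le> L * norm (y - z)"
    and growth: "\<exists>C>0. \<forall>x b. F (x + \<eta> *v b) \<bullet> x * norm x ^ 2 \<le> C * norm b ^ 6"
    and \<sigma>: "pos_def \<sigma>" and \<eta>: "pos_def \<eta>"
    and phi_cont: "\<And>\<omega> \<beta> x. \<omega> \<in> C0 \<Longrightarrow> \<beta> \<in> C0 \<Longrightarrow> continuous_on {0..} (\<lambda>t. phi t \<omega> \<beta> x)"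
    and phi_eq: "\<And>\<omega> \<beta> x t. \<omega> \<in> C0 \<Longrightarrow> \<beta> \<in> C0 \<Longrightarrow> 0 \<le> t \<Longrightarrow>
      phi t \<omega> \<beta> x = x + integral {0..t} (\<lambda>s. F (phi s \<omega> \<beta> x)) + \<sigma> *v \<omega> t + \<eta> *v \<beta> t"
begin

lemma F_continuous [continuous_intros]: "continuous_on S f \<Longrightarrow> continuous_on S (\<lambda>x. F (f x))"
proof -
  have "isCont F x" for x
  proof -
    obtain L where L: "0 \<le> L" "\<forall>y\<in>cball 0 (norm x + 1). \<forall>z\<in>cball 0 (norm x + 1). norm (F y - F z) \<le> L * norm (y - z)"
      using F_lip by blast
    have "L-lipschitz_on (ball 0 (norm x + 1)) F"
      by (rule lipschitz_onI) (use L in \<open>auto simp: dist_norm\<close>)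
    then have "continuous_on (ball 0 (norm x + 1)) F" by (rule lipschitz_on_continuous_on)
    then show ?thesis by (simp add: continuous_on_eq_continuous_at)
  qed
  then have "continuous_on UNIV F" by (simp add: continuous_at_imp_continuous_on)
  then show "continuous_on S f \<Longrightarrow> continuous_on S (\<lambda>x. F (f x))"
    by (rule continuous_on_compose2) auto
qed

text \<open>Removing the common noise leaves an equation driven by
  \<open>\<sigma> *v \<omega>\<close> alone, with \<open>\<beta>\<close> entering as a
  time-dependent drift. Its law is what the random Fokker--Planck equation for \<open>q\<close>
  describes.\<close>

definition Y :: "real \<Rightarrow> (real \<Rightarrow> real^'n) \<Rightarrow> (real \<Rightarrow> real^'n) \<Rightarrow> real^'n \<Rightarrow> real^'n" where
  "Y t \<omega> \<beta> x = phi t \<omega> \<beta> x - \<eta> *v \<beta> t"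

lemma Y_cont: "\<omega> \<in> C0 \<Longrightarrow> \<beta> \<in> C0 \<Longrightarrow> continuous_on {0..T} (\<lambda>t. Y t \<omega> \<beta> x)"
  unfolding Y_def by (intro continuous_intros continuous_on_subset[OF phi_cont]) auto

lemma Y_eq:
  assumes "\<omega> \<in> C0" "\<beta> \<in> C0" "0 \<le> t"
  shows "Y t \<omega> \<beta> x = x + integral {0..t} (\<lambda>s. F (Y s \<omega> \<beta> x + \<eta> *v \<beta> s)) + \<sigma> *v \<omega> t"
  using phi_eq[OF assms, of x] by (simp add: Y_def)

lemma Y_0: "\<omega> \<in> C0 \<Longrightarrow> \<beta> \<in> C0 \<Longrightarrow> Y 0 \<omega> \<beta> x = x"
  by (simp add: Y_eq C0_zero)

text \<open>By the growth condition, the fourth power of the norm of \<open>Y - \<sigma> \<omega>\<close> grows at most linearly.\<close>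

lemma a_priori_bound:
  obtains R where "0 < R" "\<And>\<omega> \<beta> x s. \<omega> \<in> C0 \<Longrightarrow> \<beta> \<in> C0 \<Longrightarrow>
    (\<And>s. s \<in> {0..T} \<Longrightarrow> norm (\<omega> s) \<le> M \<and> norm (\<beta> s) \<le> M) \<Longrightarrow> norm x \<le> r \<Longrightarrow> s \<in> {0..T} \<Longrightarrow> norm (Y s \<omega> \<beta> x) \<le> R"
proof -
  obtain S c where S: "\<And>y. \<eta> *v S y = y" "0 < c" "\<And>y. norm (S y) \<le> c * norm y"
    using pos_def_right_inverse[OF \<eta>] by metis
  obtain c' where c': "0 < c'" "\<And>y. norm (\<sigma> *v y) \<le> c' * norm y"
    using matrix_vector_norm_bound by blast
  obtain C where C: "0 < C" "\<And>x b. F (x + \<eta> *v b) \<bullet> x * norm x ^ 2 \<le> C * norm b ^ 6"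
    using growth by blast
  define b where "b = \<bar>M\<bar> + c * (c' * \<bar>M\<bar>)"
  have b0: "0 \<le> b" using S c' by (simp add: b_def)
  \<comment> \<open>For \<open>Z = Y - \<sigma> \<omega>\<close> with derivative \<open>D\<close>,
    the derivative of \<open>norm (Z s) ^ 4\<close> is
    \<open>4 * (D s \<bullet> Z s) * norm (Z s) ^ 2\<close>, which the growth condition bounds by
    this constant.\<close>
  define K where "K = 4 * C * b ^ 6"
  have K0: "0 \<le> K" using C b0 by (simp add: K_def)
  define R where "R = 1 + (\<bar>r\<bar> ^ 4 + K * \<bar>T\<bar>) + c' * \<bar>M\<bar>"
  have "0 < R" using K0 c' by (simp add: R_def add_pos_nonneg)
  moreover have "norm (Y t \<omega> \<beta> x) \<le> R"
    if \<omega>: "\<omega> \<in> C0" and \<beta>: "\<beta> \<in> C0"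
      and M: "\<And>s. s \<in> {0..T} \<Longrightarrow> norm (\<omega> s) \<le> M \<and> norm (\<beta> s) \<le> M" and x: "norm x \<le> r" and t: "t \<in> {0..T}" for \<omega> \<beta> x t
  proof -
    define D where "D s = F (Y s \<omega> \<beta> x + \<eta> *v \<beta> s)" for s
    define Z where "Z s = x + integral {0..s} D" for s
    have Dc: "continuous_on {0..T} D" unfolding D_def by (intro continuous_intros Y_cont \<omega> \<beta>)
    have YZ: "Y s \<omega> \<beta> x = Z s + \<sigma> *v \<omega> s" if "s \<in> {0..T}" for s
      using Y_eq[OF \<omega> \<beta>, of s x] that by (simp add: Z_def D_def[abs_def])
    have Zd: "(Z has_vector_derivative D s) (at s)" if "0 < s" "s < T" for s
    proof -
      have "((\<lambda>u. integral {0..u} D) has_vector_derivative D s) (at s within {0..T})"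
        by (rule integral_has_vector_derivative[OF Dc]) (use that in auto)
      then have "((\<lambda>u. integral {0..u} D) has_vector_derivative D s) (at s)"
        using that by (simp add: at_within_Icc_at)
      then show ?thesis unfolding Z_def by (auto intro!: derivative_eq_intros)
    qed
    have Zc: "continuous_on {0..T} Z"
      unfolding Z_def by (intro continuous_intros indefinite_integral_continuous_1 integrable_continuous_real Dc)
    have dec: "(Z t \<bullet> Z t)\<^sup>2 - K * t \<le> (Z 0 \<bullet> Z 0)\<^sup>2 - K * 0"
    proof (rule DERIV_nonpos_imp_decreasing_open[where f="\<lambda>s. (Z s \<bullet> Z s)\<^sup>2 - K * s" and a=0 and b=t])
      show "0 \<le> t" using t by simp
      show "continuous_on {0..t} (\<lambda>s. (Z s \<bullet> Z s)\<^sup>2 - K * s)"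
        by (intro continuous_intros continuous_on_subset[OF Zc]) (use t in auto)
      fix s assume s: "0 < s" "s < t"
      then have sT: "s \<in> {0..T}" "0 < s" "s < T" using t by auto
      have "((\<lambda>s. Z s \<bullet> Z s) has_real_derivative 2 * (Z s \<bullet> D s)) (at s)"
        using Zd[OF sT(2,3)] unfolding has_real_derivative_iff_has_vector_derivative has_vector_derivative_def
        by (auto intro!: derivative_eq_intros simp: inner_commute)
      then have "((\<lambda>s. (Z s \<bullet> Z s)\<^sup>2 - K * s) has_real_derivative 4 * (D s \<bullet> Z s * (Z s \<bullet> Z s)) - K) (at s)"
        by (auto intro!: derivative_eq_intros simp: inner_commute)
      moreover have "D s \<bullet> Z s * (Z s \<bullet> Z s) \<le> C * b ^ 6"
      proof -
        \<comment> \<open>Since \<open>\<eta> *v S y = y\<close>, the intrinsic noise is absorbed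
          into the argument \<open>b\<close> of the growth condition, which can then be applied at
          the differentiable part \<open>Z s\<close>.\<close>
        let ?b = "\<beta> s + S (\<sigma> *v \<omega> s)"
        have "norm ?b \<le> norm (\<beta> s) + c * (c' * norm (\<omega> s))"
          by (intro norm_triangle_le add_left_mono order_trans[OF S(3)] mult_left_mono c') (use S in auto)
        also have "\<dots> \<le> b"
          unfolding b_def using M[OF sT(1)] S c' by (intro add_mono mult_left_mono) auto
        finally have "norm ?b ^ 6 \<le> b ^ 6" by (intro power_mono) auto
        moreover have "D s = F (Z s + \<eta> *v ?b)"
          unfolding D_def YZ[OF sT(1)] matrix_vector_right_distrib S(1) by (simp add: algebra_simps)
        ultimately show ?thesis
          using C(2)[of "Z s" ?b] C(1) by (simp add: power2_norm_eq_inner) (smt (verit) mult_left_mono)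
      qed
      ultimately show "\<exists>y. ((\<lambda>s. (Z s \<bullet> Z s)\<^sup>2 - K * s) has_real_derivative y) (at s) \<and> y \<le> 0"
        by (intro exI conjI) (auto simp: K_def)
    qed
    have "norm (Z t) ^ 4 = (Z t \<bullet> Z t)\<^sup>2" by (simp add: power2_norm_eq_inner[symmetric])
    also have "\<dots> \<le> norm x ^ 4 + K * t" using dec by (simp add: Z_def power2_norm_eq_inner[symmetric])
    also have "\<dots> \<le> \<bar>r\<bar> ^ 4 + K * \<bar>T\<bar>"
      using x t K0 by (intro add_mono power_mono mult_left_mono) auto
    finally have Z4: "norm (Z t) ^ 4 \<le> \<bar>r\<bar> ^ 4 + K * \<bar>T\<bar>" .
    \<comment> \<open>A crude inequality that takes the place of a fourth root.\<close>
    have "norm (Z t) \<le> 1 + norm (Z t) ^ 4"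
    proof (cases "norm (Z t) \<le> 1")
      case False
      then show ?thesis using self_le_power[of "norm (Z t)" 4] by simp
    qed (simp add: add_increasing2)
    moreover have "norm (\<sigma> *v \<omega> t) \<le> c' * \<bar>M\<bar>"
      using M[OF t] c' by (intro order_trans[OF c'(2)] mult_left_mono) auto
    ultimately show ?thesis
      unfolding YZ[OF t] R_def using Z4 by (intro norm_triangle_le) linarith
  qed
  ultimately show ?thesis using that by blast
qed

text \<open>The state is projected onto a ball before \<open>F\<close> is applied. The projection is
  1-Lipschitz, so for bounded \<open>\<beta>\<close> this drift is globally Lipschitz and bounded,
  and it is unchanged along every solution that stays in the ball.\<close>

definition drift :: "real \<Rightarrow> (real \<Rightarrow> real^'n) \<Rightarrow> real \<Rightarrow> real^'n \<Rightarrow> real^'n" where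
  "drift R \<beta> s y = F (closest_point (cball 0 R) y + \<eta> *v \<beta> s)"

lemma drift_inside: "norm y \<le> R \<Longrightarrow> drift R \<beta> s y = F (y + \<eta> *v \<beta> s)"
  by (simp add: drift_def closest_point_self)

lemma closest_point_cball:
  assumes "0 < R"
  shows "norm (closest_point (cball (0::real^'n) R) y) \<le> R"
  using closest_point_in_set[of "cball (0::real^'n) R" y] assms by (auto simp: cball_eq_empty)

lemma closest_point_cball_lipschitz:
  assumes "0 < R"
  shows "norm (closest_point (cball (0::real^'n) R) y - closest_point (cball 0 R) z) \<le> norm (y - z)"
  using closest_point_lipschitz[of "cball (0::real^'n) R" y z] assms by (auto simp: cball_eq_empty dist_norm)

lemma drift_lipschitz:
  assumes R: "0 < R"
  obtains L where "0 \<le> L" "\<And>\<beta> s y z. norm (\<beta> s) \<le> M \<Longrightarrow> norm (drift R \<beta> s y - drift R \<beta> s z) \<le> L * norm (y - z)"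
proof -
  obtain c where c: "0 < c" "\<And>y. norm (\<eta> *v y) \<le> c * norm y" using matrix_vector_norm_bound by blast
  obtain L where L: "0 \<le> L" "\<forall>y\<in>cball 0 (R + c * M). \<forall>z\<in>cball 0 (R + c * M). norm (F y - F z) \<le> L * norm (y - z)"
    using F_lip by blast
  have in_ball: "closest_point (cball 0 R) y + \<eta> *v b \<in> cball 0 (R + c * M)" if "norm b \<le> M" for b y
    using closest_point_cball[OF R, of y] that c
    by (auto intro!: norm_triangle_mono order_trans[OF c(2)])
  have "norm (drift R \<beta> s y - drift R \<beta> s z) \<le> L * norm (y - z)" if "norm (\<beta> s) \<le> M" for \<beta> s y z
  proof -
    have "norm (drift R \<beta> s y - drift R \<beta> s z) \<le> L * norm ((closest_point (cball 0 R) y + \<eta> *v \<beta> s) - (closest_point (cball 0 R) z + \<eta> *v \<beta> s))"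
      unfolding drift_def by (rule L(2)[THEN bspec, THEN bspec, OF in_ball[OF that] in_ball[OF that]])
    also have "\<dots> \<le> L * norm (y - z)"
      using closest_point_cball_lipschitz[OF R, of y z] L by (intro mult_left_mono) auto
    finally show ?thesis .
  qed
  then show ?thesis using L that by blast
qed

lemma drift_bounded:
  assumes R: "0 < R"
  obtains G where "0 < G" "\<And>\<beta> s y. norm (\<beta> s) \<le> M \<Longrightarrow> norm (drift R \<beta> s y) \<le> G"
proof -
  obtain c where c: "0 < c" "\<And>y. norm (\<eta> *v y) \<le> c * norm y" using matrix_vector_norm_bound by blast
  have "compact (F ` cball 0 (R + c * M))"
    by (intro compact_continuous_image F_continuous[where f="\<lambda>x. x"] continuous_on_id compact_cball)
  then obtain G where G: "0 < G" "\<And>y. y \<in> cball 0 (R + c * M) \<Longrightarrow> norm (F y) \<le> G"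
    using compact_imp_bounded[THEN bounded_pos[THEN iffD1]] by (metis imageI)
  have "norm (drift R \<beta> s y) \<le> G" if "norm (\<beta> s) \<le> M" for \<beta> s y
    unfolding drift_def using closest_point_cball[OF R, of y] that c
    by (intro G) (auto intro!: norm_triangle_mono order_trans[OF c(2)])
  then show ?thesis using G that by blast
qed

lemma drift_continuous:
  assumes R: "0 < R"
  shows "continuous_on UNIV (drift R \<beta> s)"
proof -
  have "continuous_on UNIV (closest_point (cball (0::real^'n) R))"
    using assms by (intro continuous_on_closest_point) (auto simp: cball_eq_empty)
  then show ?thesis unfolding drift_def[abs_def] by (intro continuous_intros)
qed

lemma measurable_drift: "0 < R \<Longrightarrow> drift R \<beta> s \<in> borel_measurable borel"
  by (intro borel_measurable_continuous_onI drift_continuous)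

lemma path_bounded:
  fixes \<xi> :: "real \<Rightarrow> real^'n"
  assumes "continuous_on {0..T} \<xi>"
  obtains M where "0 < M" "\<And>s. s \<in> {0..T} \<Longrightarrow> norm (\<xi> s) \<le> M"
proof -
  have "bounded (\<xi> ` {0..T})" by (intro compact_imp_bounded compact_continuous_image assms compact_Icc)
  then obtain B where "0 < B" "\<forall>y\<in>\<xi> ` {0..T}. norm y \<le> B" unfolding bounded_pos by blast
  then show ?thesis using that[of B] by simp
qed

text \<open>Stated for any solution \<open>u\<close> in the ball, not just for \<open>Y\<close>,
  because uniqueness will follow from it. Along \<open>u\<close> the truncated drift is the true
  one, so \<open>u\<close> also solves the truncated equation, to which the error bound
  applies.\<close>

lemma eul_converges_uniform:
  assumes \<omega>: "\<omega> \<in> C0" and \<beta>: "\<beta> \<in> C0" and T: "0 < T" and R: "0 < R"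
    and u: "continuous_on {0..T} u"
    and sol: "\<And>t. t \<in> {0..T} \<Longrightarrow> u t = x + integral {0..t} (\<lambda>s. F (u s + \<eta> *v \<beta> s)) + \<sigma> *v \<omega> t"
    and bound: "\<And>t. t \<in> {0..T} \<Longrightarrow> norm (u t) \<le> R" and e: "0 < e"
  shows "\<forall>\<^sub>F N in sequentially. \<forall>k\<le>N.
     norm (eul (drift R \<beta>) (\<lambda>s. \<sigma> *v \<omega> s) (T / real N) x k - u (real k * (T / real N))) < e"
proof -
  obtain M where M: "0 < M" "\<And>s. s \<in> {0..T} \<Longrightarrow> norm (\<beta> s) \<le> M"
    using path_bounded[of T \<beta>] \<beta> by (auto intro: continuous_intros)
  obtain L where L: "0 \<le> L" "\<And>\<beta> s y z. norm (\<beta> s) \<le> M \<Longrightarrow> norm (drift R \<beta> s y - drift R \<beta> s z) \<le> L * norm (y - z)"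
    using drift_lipschitz[OF R] by blast
  have eq: "drift R \<beta> s (u s) = F (u s + \<eta> *v \<beta> s)" if "s \<in> {0..T}" for s
    using bound that by (simp add: drift_inside)
  show ?thesis
  proof (rule eul_tendsto_uniform[OF T L(1)])
    show "norm (drift R \<beta> s y - drift R \<beta> s z) \<le> L * norm (y - z)" if "s \<in> {0..T}" for s y z
      using L(2) M that by blast
    have "continuous_on {0..T} (\<lambda>s. F (u s + \<eta> *v \<beta> s))" by (intro continuous_intros u \<beta>)
    then show "continuous_on {0..T} (\<lambda>s. drift R \<beta> s (u s))" by (subst continuous_on_cong[OF refl eq])
    show "u t = x + integral {0..t} (\<lambda>s. drift R \<beta> s (u s)) + \<sigma> *v \<omega> t" if "t \<in> {0..T}" for t
    proof -
      have "integral {0..t} (\<lambda>s. drift R \<beta> s (u s)) = integral {0..t} (\<lambda>s. F (u s + \<eta> *v \<beta> s))"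
        by (rule integral_cong, rule eq) (use that in auto)
      then show ?thesis using sol[OF that] by simp
    qed
  qed (use \<omega> e in \<open>auto simp: C0_zero\<close>)
qed

lemma eul_converges:
  assumes \<omega>: "\<omega> \<in> C0" and \<beta>: "\<beta> \<in> C0" and T: "0 < T" and R: "0 < R"
    and u: "continuous_on {0..T} u"
    and sol: "\<And>t. t \<in> {0..T} \<Longrightarrow> u t = x + integral {0..t} (\<lambda>s. F (u s + \<eta> *v \<beta> s)) + \<sigma> *v \<omega> t"
    and bound: "\<And>t. t \<in> {0..T} \<Longrightarrow> norm (u t) \<le> R"
  shows "(\<lambda>N. eul (drift R \<beta>) (\<lambda>s. \<sigma> *v \<omega> s) (T / real N) x N) \<longlonglongrightarrow> u T"
proof (rule tendstoI)
  fix e :: real assume e: "0 < e"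
  have "\<forall>\<^sub>F N in sequentially. \<forall>k\<le>N.
     norm (eul (drift R \<beta>) (\<lambda>s. \<sigma> *v \<omega> s) (T / real N) x k - u (real k * (T / real N))) < e"
    by (rule eul_converges_uniform[OF assms e])
  with eventually_gt_at_top[of 0]
  show "\<forall>\<^sub>F N in sequentially. dist (eul (drift R \<beta>) (\<lambda>s. \<sigma> *v \<omega> s) (T / real N) x N) (u T) < e"
    by eventually_elim (auto simp: dist_norm dest: spec[of _ "_::nat"])
qed

lemma Y_converges:
  assumes \<omega>: "\<omega> \<in> C0" and \<beta>: "\<beta> \<in> C0" and T: "0 < T" and R: "0 < R"
    and bound: "\<And>t. t \<in> {0..T} \<Longrightarrow> norm (Y t \<omega> \<beta> x) \<le> R"
  shows "(\<lambda>N. eul (drift R \<beta>) (\<lambda>s. \<sigma> *v \<omega> s) (T / real N) x N) \<longlonglongrightarrow> Y T \<omega> \<beta> x"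
  by (rule eul_converges[OF \<omega> \<beta> T R Y_cont[OF \<omega> \<beta>] _ bound]) (auto simp: Y_eq[OF \<omega> \<beta>])

section \<open>Uniqueness, cocycle property and measurability of the flow\<close>

lemma phi_0: "\<omega> \<in> C0 \<Longrightarrow> \<beta> \<in> C0 \<Longrightarrow> phi 0 \<omega> \<beta> x = x"
  by (simp add: phi_eq C0_zero)

text \<open>Two solutions are limits of one and the same Euler scheme, run with a radius that bounds
  both.\<close>

lemma phi_unique:
  assumes \<omega>: "\<omega> \<in> C0" and \<beta>: "\<beta> \<in> C0" and T: "0 \<le> T"
    and v: "continuous_on {0..T} v"
    and sol: "\<And>t. t \<in> {0..T} \<Longrightarrow> v t = x + integral {0..t} (\<lambda>s. F (v s)) + \<sigma> *v \<omega> t + \<eta> *v \<beta> t"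
  shows "v T = phi T \<omega> \<beta> x"
proof (cases "T = 0")
  case True
  then show ?thesis using sol[of 0] phi_eq[OF \<omega> \<beta>, of 0 x] by simp
next
  case False
  then have T: "0 < T" using T by simp
  define u where "u t = v t - \<eta> *v \<beta> t" for t
  have u: "continuous_on {0..T} u" unfolding u_def by (intro continuous_intros v \<beta>)
  obtain R1 where R1: "0 < R1" "\<And>s. s \<in> {0..T} \<Longrightarrow> norm (u s) \<le> R1" using path_bounded[OF u] by blast
  obtain R2 where R2: "0 < R2" "\<And>s. s \<in> {0..T} \<Longrightarrow> norm (Y s \<omega> \<beta> x) \<le> R2" using path_bounded[OF Y_cont[OF \<omega> \<beta>]] by blast
  let ?R = "max R1 R2"
  have "(\<lambda>N. eul (drift ?R \<beta>) (\<lambda>s. \<sigma> *v \<omega> s) (T / real N) x N) \<longlonglongrightarrow> u T"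
    by (rule eul_converges[OF \<omega> \<beta> T _ u]) (use sol R1 in \<open>auto simp: u_def intro: le_max_iff_disj[THEN iffD2]\<close>)
  moreover have "(\<lambda>N. eul (drift ?R \<beta>) (\<lambda>s. \<sigma> *v \<omega> s) (T / real N) x N) \<longlonglongrightarrow> Y T \<omega> \<beta> x"
    by (rule Y_converges[OF \<omega> \<beta> T]) (use R1 R2 in \<open>auto intro: le_max_iff_disj[THEN iffD2]\<close>)
  ultimately have "u T = Y T \<omega> \<beta> x" by (rule LIMSEQ_unique)
  then show ?thesis by (simp add: u_def Y_def)
qed

lemma phi_cong:
  assumes "\<omega> \<in> C0" "\<beta> \<in> C0" "\<omega>' \<in> C0" "\<beta>' \<in> C0" "0 \<le> T"
    and "\<And>s. s \<in> {0..T} \<Longrightarrow> \<omega> s = \<omega>' s" "\<And>s. s \<in> {0..T} \<Longrightarrow> \<beta> s = \<beta>' s"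
  shows "phi T \<omega> \<beta> x = phi T \<omega>' \<beta>' x"
proof (rule phi_unique)
  show "continuous_on {0..T} (\<lambda>t. phi t \<omega> \<beta> x)"
    by (rule continuous_on_subset[OF phi_cont]) (use assms in auto)
  show "phi t \<omega> \<beta> x = x + integral {0..t} (\<lambda>s. F (phi s \<omega> \<beta> x)) + \<sigma> *v \<omega>' t + \<eta> *v \<beta>' t" if "t \<in> {0..T}" for t
    using phi_eq[OF assms(1,2), of t x] assms(6,7)[OF that] that by simp
qed (use assms in auto)

text \<open>As a function of \<open>t\<close>, the left side satisfies the integral equation for the
  shifted paths started at \<open>phi s \<omega> \<beta> x\<close>, so uniqueness applies.\<close>

lemma phi_cocycle:
  assumes \<omega>: "\<omega> \<in> C0" and \<beta>: "\<beta> \<in> C0" and s: "0 \<le> s" and t: "0 \<le> t"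
  shows "phi (s + t) \<omega> \<beta> x = phi t (wiener_shift s \<omega>) (wiener_shift s \<beta>) (phi s \<omega> \<beta> x)"
proof (rule phi_unique[where v="\<lambda>t. phi (s + t) \<omega> \<beta> x"])
  show "continuous_on {0..t} (\<lambda>r. phi (s + r) \<omega> \<beta> x)"
    by (rule continuous_on_compose2[OF phi_cont[OF \<omega> \<beta>]]) (use s in \<open>auto intro!: continuous_intros\<close>)
  fix r assume r: "r \<in> {0..t}"
  have cont: "continuous_on {0..s + r} (\<lambda>u. F (phi u \<omega> \<beta> x))"
    by (intro continuous_intros continuous_on_subset[OF phi_cont[OF \<omega> \<beta>]]) auto
  have "integral {0..s + r} (\<lambda>u. F (phi u \<omega> \<beta> x)) =
     integral {0..s} (\<lambda>u. F (phi u \<omega> \<beta> x)) + integral {s..s + r} (\<lambda>u. F (phi u \<omega> \<beta> x))"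
    using Henstock_Kurzweil_Integration.integral_combine[OF s _ integrable_continuous_real[OF cont]] r by simp
  also have "integral {s..s + r} (\<lambda>u. F (phi u \<omega> \<beta> x)) = integral {0..r} (\<lambda>u. F (phi (s + u) \<omega> \<beta> x))"
    using integral_shift[OF continuous_on_subset[OF cont, of "{0 + s..r + s}"]] s
    by (simp add: comp_def add.commute)
  finally show "phi (s + r) \<omega> \<beta> x = phi s \<omega> \<beta> x + integral {0..r} (\<lambda>u. F (phi (s + u) \<omega> \<beta> x)) +
      \<sigma> *v wiener_shift s \<omega> r + \<eta> *v wiener_shift s \<beta> r"
    using phi_eq[OF \<omega> \<beta>, of "s + r" x] phi_eq[OF \<omega> \<beta> s, of x] s r
    by (simp add: wiener_shift_def matrix_vector_mult_diff_distrib add.commute)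
qed (use assms in \<open>auto intro: wiener_shift_C0\<close>)

text \<open>Joint measurability is inherited from the Euler schemes. No radius serves all paths at
  once, hence a second limit over integer radii; for a fixed path the inner limit is the exact value
  as soon as the radius is large enough.\<close>

lemma measurable_phi:
  fixes M :: "'m measure" and x :: "'m \<Rightarrow> real^'n"
  assumes \<omega>: "\<omega> \<in> M \<rightarrow>\<^sub>M path_space" and \<beta>: "\<beta> \<in> M \<rightarrow>\<^sub>M path_space" and x: "x \<in> borel_measurable M" and t: "0 \<le> t"
  shows "(\<lambda>z. phi t (\<omega> z) (\<beta> z) (x z)) \<in> borel_measurable M"
proof (cases "t = 0")
  case True
  have "phi t (\<omega> z) (\<beta> z) (x z) = x z" if "z \<in> space M" for z
    using measurable_space[OF \<omega> that] measurable_space[OF \<beta> that] True by (simp add: phi_0)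
  then show ?thesis using x by (simp cong: measurable_cong)
next
  case False
  then have t: "0 < t" using t by simp
  have b: "(\<lambda>z. \<eta> *v \<beta> z s) \<in> borel_measurable M" for s
    by (rule measurable_compose[OF measurable_compose[OF \<beta> measurable_eval] borel_measurable_matrix_vector])
  have "(\<lambda>z. Y t (\<omega> z) (\<beta> z) (x z)) \<in> borel_measurable M"
  proof (rule borel_measurable_LIMSEQ_metric)
    fix R :: nat
    show "(\<lambda>z. lim (\<lambda>N. eul (drift (real (Suc R)) (\<beta> z)) (\<lambda>s. \<sigma> *v \<omega> z s) (t / real N) (x z) N)) \<in> borel_measurable M"
    proof (intro borel_measurable_lim_metric measurable_eul \<omega> x)
      fix s and y :: "'m \<Rightarrow> real^'n"
      assume y: "y \<in> borel_measurable M"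
      have c1: "continuous_on UNIV (closest_point (cball (0::real^'n) (real (Suc R))))"
        by (intro continuous_on_closest_point) (auto simp: cball_eq_empty)
      have c2: "continuous_on UNIV F" by (intro F_continuous continuous_on_id)
      have "(\<lambda>z. closest_point (cball 0 (real (Suc R))) (y z) + \<eta> *v \<beta> z s) \<in> borel_measurable M"
        by (intro borel_measurable_add b borel_measurable_continuous_on[OF c1 y])
      from borel_measurable_continuous_on[OF c2 this]
      show "(\<lambda>z. drift (real (Suc R)) (\<beta> z) s (y z)) \<in> borel_measurable M" unfolding drift_def .
    qed
  next
    fix z assume z: "z \<in> space M"
    have C: "\<omega> z \<in> C0" "\<beta> z \<in> C0" using measurable_space[OF \<omega> z] measurable_space[OF \<beta> z] by auto
    obtain R where R: "0 < R" "\<And>s. s \<in> {0..t} \<Longrightarrow> norm (Y s (\<omega> z) (\<beta> z) (x z)) \<le> R"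
      using path_bounded[OF Y_cont[OF C]] by blast
    have "\<forall>\<^sub>F n in sequentially. R \<le> real n"
      using filterlim_real_sequentially unfolding filterlim_at_top by blast
    then have "\<forall>\<^sub>F n in sequentially. lim (\<lambda>N. eul (drift (real (Suc n)) (\<beta> z)) (\<lambda>s. \<sigma> *v \<omega> z s) (t / real N) (x z) N) = Y t (\<omega> z) (\<beta> z) (x z)"
    proof eventually_elim
      case (elim n)
      then show ?case by (intro limI Y_converges[OF C t]) (auto intro!: order_trans[OF R(2)])
    qed
    then show "(\<lambda>n. lim (\<lambda>N. eul (drift (real (Suc n)) (\<beta> z)) (\<lambda>s. \<sigma> *v \<omega> z s) (t / real N) (x z) N)) \<longlonglongrightarrow> Y t (\<omega> z) (\<beta> z) (x z)"
      by (rule tendsto_eventually)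
  qed
  from borel_measurable_add[OF this b[of t]] show ?thesis by (simp add: Y_def)
qed

lemma measurable_Y:
  assumes \<omega>: "\<omega> \<in> M \<rightarrow>\<^sub>M path_space" and \<beta>: "\<beta> \<in> M \<rightarrow>\<^sub>M path_space" and x: "x \<in> borel_measurable M" and t: "0 \<le> t"
  shows "(\<lambda>z. Y t (\<omega> z) (\<beta> z) (x z)) \<in> borel_measurable M"
  unfolding Y_def
  by (intro borel_measurable_diff measurable_phi assms
    measurable_compose[OF measurable_compose[OF \<beta> measurable_eval] borel_measurable_matrix_vector])

end

section \<open>Regularity of the transition probabilities\<close>

definition small_paths :: "real \<Rightarrow> real \<Rightarrow> (real \<Rightarrow> real^'n) set" where
  "small_paths T M = {\<xi>\<in>C0. \<forall>s\<in>{0..T}. norm (\<xi> s) \<le> M}"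

text \<open>Continuity lets the uncountable condition be tested at fractions, which gives
  measurability. Fractions with \<open>n = 0\<close> evaluate to time 0 and do no harm.\<close>

lemma small_paths_grid:
  "small_paths T M = {\<xi>\<in>C0. \<forall>i n::nat. real i / real n \<le> T \<longrightarrow> norm (\<xi> (real i / real n)) \<le> M}" (is "_ = ?R")
proof (intro set_eqI iffI)
  fix \<xi> :: "real \<Rightarrow> real^'a" assume "\<xi> \<in> ?R"
  then have \<xi>: "\<xi> \<in> C0" and le: "\<And>i n::nat. real i / real n \<le> T \<Longrightarrow> norm (\<xi> (real i / real n)) \<le> M" by auto
  have "norm (\<xi> s) \<le> M" if s: "s \<in> {0..T}" for s
  proof -
    \<comment> \<open>Rounding down keeps the approximating fractions below \<open>s\<close>, hence
      inside \<open>{0..T}\<close>.\<close>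
    define q where "q n = real (nat \<lfloor>real (Suc n) * s\<rfloor>) / real (Suc n)" for n
    have q: "q n \<le> s" "s - 1 / real (Suc n) \<le> q n" for n
    proof -
      have f: "real (nat \<lfloor>real (Suc n) * s\<rfloor>) = of_int \<lfloor>real (Suc n) * s\<rfloor>" using s by (intro of_nat_nat) simp
      have "of_int \<lfloor>real (Suc n) * s\<rfloor> \<le> real (Suc n) * s" by simp
      then show "q n \<le> s" unfolding q_def f by (subst pos_divide_le_eq) (auto simp: mult.commute)
      have "real (Suc n) * s - 1 \<le> of_int \<lfloor>real (Suc n) * s\<rfloor>" by linarith
      moreover have "(s - 1 / real (Suc n)) * real (Suc n) = real (Suc n) * s - 1" by (simp add: field_simps del: of_nat_Suc)
      ultimately show "s - 1 / real (Suc n) \<le> q n" unfolding q_def f by (subst pos_le_divide_eq) auto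
    qed
    have l: "(\<lambda>n. s - 1 / real (Suc n)) \<longlonglongrightarrow> s"
      using tendsto_diff[OF tendsto_const LIMSEQ_inverse_real_of_nat] by (simp add: inverse_eq_divide)
    have "q \<longlonglongrightarrow> s"
      by (rule tendsto_sandwich[OF _ _ l tendsto_const]) (use q in auto)
    then have "(\<lambda>n. norm (\<xi> (q n))) \<longlonglongrightarrow> norm (\<xi> s)"
      using \<xi> by (intro tendsto_norm continuous_on_tendsto_compose[of UNIV \<xi>]) (auto simp: C0_def)
    moreover have "norm (\<xi> (q n)) \<le> M" for n
      unfolding q_def by (rule le) (use q(1)[of n] s in \<open>auto simp: q_def\<close>)
    ultimately show ?thesis by (intro LIMSEQ_le_const2) auto
  qed
  then show "\<xi> \<in> small_paths T M" using \<xi> by (simp add: small_paths_def)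
qed (auto simp: small_paths_def)

lemma sets_small_paths [measurable]: "small_paths T M \<in> sets path_space"
proof -
  have 1: "{\<xi> \<in> space path_space. norm (\<xi> t) \<le> M} \<in> sets path_space" for t
  proof -
    have "(\<lambda>\<xi>. norm (\<xi> t)) \<in> borel_measurable path_space" by (rule measurable_compose[OF measurable_eval]) measurable
    then show ?thesis by measurable
  qed
  have "{\<xi>\<in>space path_space. \<forall>i n::nat. real i / real n \<le> T \<longrightarrow> norm (\<xi> (real i / real n)) \<le> M} \<in> sets path_space"
  proof (intro sets.sets_Collect_countable_All)
    fix i n :: nat
    show "{\<xi>\<in>space path_space. real i / real n \<le> T \<longrightarrow> norm (\<xi> (real i / real n)) \<le> M} \<in> sets path_space"
      using 1[of "real i / real n"] sets.top[of path_space] by (cases "real i / real n \<le> T") (simp_all del: space_path_space)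
  qed
  then show ?thesis by (simp only: small_paths_grid space_path_space)
qed

lemma (in prob_space) incseq_exhausting:
  assumes "range A \<subseteq> events" "incseq A" "(\<Union>n. A n) = space M" "0 < e"
  shows "\<exists>n. prob (space M - A n) < e"
proof -
  have "(\<lambda>n. prob (A n)) \<longlonglongrightarrow> prob (\<Union>n. A n)" by (rule finite_Lim_measure_incseq[OF assms(1,2)])
  then have "(\<lambda>n. prob (A n)) \<longlonglongrightarrow> 1" by (simp add: assms(3) prob_space)
  then have "\<forall>\<^sub>F n in sequentially. 1 - e < prob (A n)" by (rule order_tendstoD) (use assms in auto)
  then obtain n where "1 - e < prob (A n)" by (auto simp: eventually_sequentially)
  then show ?thesis using assms(1) by (intro exI[of _ n]) (subst prob_compl, auto)
qed

lemma small_paths_large_bound: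
  fixes P :: "(real \<Rightarrow> real^'n) measure"
  assumes P: "wiener_measure P" and e: "0 < e"
  shows "\<exists>M>0. measure P (C0 - small_paths T M) < e"
proof -
  interpret prob_space P using P by (rule wiener_measureD)
  have "\<exists>n. prob (space P - small_paths T (real (Suc n))) < e"
  proof (rule incseq_exhausting[OF _ _ _ e])
    show "range (\<lambda>n. small_paths T (real (Suc n))) \<subseteq> events" by (auto simp: wiener_measureD(3)[OF P])
    show "incseq (\<lambda>n. small_paths T (real (Suc n)) :: (real \<Rightarrow> real^'n) set)"
      by (force simp: incseq_def small_paths_def)
    show "(\<Union>n. small_paths T (real (Suc n))) = space P"
    proof -
      have "\<exists>n. \<xi> \<in> small_paths T (real (Suc n))" if \<xi>: "\<xi> \<in> C0" for \<xi> :: "real \<Rightarrow> real^'n"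
      proof -
        have "bounded (\<xi> ` {0..T})" using \<xi> by (intro compact_imp_bounded compact_continuous_image C0_continuous_on) auto
        then obtain B where "\<forall>y\<in>\<xi> ` {0..T}. norm y \<le> B" unfolding bounded_iff by blast
        then have B: "\<And>s. s \<in> {0..T} \<Longrightarrow> norm (\<xi> s) \<le> B" by blast
        obtain n :: nat where "B \<le> real n" using real_arch_simple by blast
        then show ?thesis using \<xi> B by (intro exI[of _ n]) (force simp: small_paths_def)
      qed
      then show ?thesis by (auto simp: wiener_measureD(2)[OF P] small_paths_def)
    qed
  qed
  then obtain n where "measure P (C0 - small_paths T (real (Suc n))) < e" unfolding wiener_measureD(2)[OF P] ..
  then show ?thesis by (intro exI[of _ "real (Suc n)"]) auto
qed

lemma small_paths_short_time:
  fixes P :: "(real \<Rightarrow> real^'n) measure"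
  assumes P: "wiener_measure P" and e: "0 < e" and M: "0 < M"
  shows "\<exists>T>0. measure P (C0 - small_paths T M) < e"
proof -
  interpret prob_space P using P by (rule wiener_measureD)
  have "\<exists>n. prob (space P - small_paths (1 / real (Suc n)) M) < e"
  proof (rule incseq_exhausting[OF _ _ _ e])
    show "range (\<lambda>n. small_paths (1 / real (Suc n)) M) \<subseteq> events" by (auto simp: wiener_measureD(3)[OF P])
    show "incseq (\<lambda>n. small_paths (1 / real (Suc n)) M :: (real \<Rightarrow> real^'n) set)"
    proof (intro incseq_SucI subsetI)
      fix n and \<xi> :: "real \<Rightarrow> real^'n" assume "\<xi> \<in> small_paths (1 / real (Suc n)) M"
      moreover have "1 / real (Suc (Suc n)) \<le> 1 / real (Suc n)" by (intro divide_left_mono) auto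
      ultimately show "\<xi> \<in> small_paths (1 / real (Suc (Suc n))) M"
        unfolding small_paths_def by (auto simp del: of_nat_Suc)
    qed
    show "(\<Union>n. small_paths (1 / real (Suc n)) M) = space P"
    proof -
      have "\<exists>n. \<xi> \<in> small_paths (1 / real (Suc n)) M" if \<xi>: "\<xi> \<in> C0" for \<xi> :: "real \<Rightarrow> real^'n"
      proof -
        have "isCont \<xi> 0" using \<xi> by (auto simp: C0_def continuous_on_eq_continuous_at)
        then obtain d where d: "0 < d" "\<And>s. dist s 0 < d \<Longrightarrow> dist (\<xi> s) (\<xi> 0) < M"
          using M unfolding continuous_at_eps_delta by blast
        obtain n where "inverse (real (Suc n)) < d" using reals_Archimedean[OF d(1)] by blast
        then have "norm (\<xi> s) \<le> M" if "s \<in> {0..1 / real (Suc n)}" for s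
          using d(2)[of s] that \<xi> by (simp add: dist_norm C0_zero inverse_eq_divide del: of_nat_Suc)
        then show ?thesis using \<xi> by (intro exI[of _ n]) (auto simp: small_paths_def simp del: of_nat_Suc)
      qed
      then show ?thesis by (auto simp: wiener_measureD(2)[OF P] small_paths_def)
    qed
  qed
  then obtain n where "measure P (C0 - small_paths (1 / real (Suc n)) M) < e" unfolding wiener_measureD(2)[OF P] ..
  then show ?thesis by (intro exI[of _ "1 / real (Suc n)"]) auto
qed

text \<open>The scheme is known to converge only on the event \<open>G\<close> where the a priori
  bound holds. Cutting off to \<open>G\<close> before the limit and removing the cutoff after it
  costs \<open>B\<close> times the probability of the complement each time.\<close>

lemma (in prob_space) limit_expectation_bound:
  fixes a :: "nat \<Rightarrow> 'a \<Rightarrow> real"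
  assumes [measurable]: "\<And>n. a n \<in> borel_measurable M" "b \<in> borel_measurable M" "G \<in> events"
    and B: "\<And>n z. z \<in> space M \<Longrightarrow> \<bar>a n z\<bar> \<le> B" "\<And>z. z \<in> space M \<Longrightarrow> \<bar>b z\<bar> \<le> B"
    and lim: "\<And>z. z \<in> G \<Longrightarrow> (\<lambda>n. a n z) \<longlonglongrightarrow> b z"
    and c: "\<forall>\<^sub>F n in sequentially. \<bar>expectation (a n)\<bar> \<le> c"
  shows "\<bar>expectation b\<bar> \<le> c + 2 * B * prob (space M - G)"
proof -
  have split: "\<bar>expectation u - expectation (\<lambda>z. u z * indicator G z)\<bar> \<le> B * prob (space M - G)"
    if [measurable]: "u \<in> borel_measurable M" and u: "\<And>z. z \<in> space M \<Longrightarrow> \<bar>u z\<bar> \<le> B" for u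
  proof -
    have iu: "integrable M u" by (rule integrable_const_bound[of _ B]) (auto intro!: AE_I2 u)
    have iu2: "integrable M (\<lambda>z. u z * indicator G z)"
      by (rule integrable_const_bound[of _ B]) (auto intro!: AE_I2 u simp: abs_mult indicator_def order_trans[OF abs_ge_zero u])
    have "expectation u - expectation (\<lambda>z. u z * indicator G z) = expectation (\<lambda>z. u z - u z * indicator G z)"
      by (simp add: iu iu2)
    also have "\<bar>\<dots>\<bar> \<le> expectation (\<lambda>z. \<bar>u z - u z * indicator G z\<bar>)" by (rule integral_abs_bound)
    also have "\<dots> \<le> expectation (\<lambda>z. B * indicator (space M - G) z)"
    proof (rule integral_mono)
      show "integrable M (\<lambda>z. \<bar>u z - u z * indicator G z\<bar>)" by (intro integrable_abs Bochner_Integration.integrable_diff iu iu2)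
      show "integrable M (\<lambda>z. B * indicator (space M - G) z)"
        by (rule integrable_const_bound[of _ "\<bar>B\<bar>"]) (auto simp: indicator_def)
    qed (auto simp: indicator_def u)
    also have "\<dots> = B * prob (space M - G)" by simp
    finally show ?thesis .
  qed
  have "(\<lambda>n. expectation (\<lambda>z. a n z * indicator G z)) \<longlonglongrightarrow> expectation (\<lambda>z. b z * indicator G z)"
  proof (rule integral_dominated_convergence[where w="\<lambda>_. B"])
    show "AE z in M. (\<lambda>n. a n z * indicator G z) \<longlonglongrightarrow> b z * indicator G z"
      by (intro AE_I2) (auto simp: indicator_def lim)
    show "AE z in M. norm (a n z * indicator G z) \<le> B" for n
      by (intro AE_I2) (auto simp: indicator_def B order_trans[OF abs_ge_zero B(1)])
  qed auto
  then have "(\<lambda>n. \<bar>expectation (\<lambda>z. a n z * indicator G z)\<bar>) \<longlonglongrightarrow> \<bar>expectation (\<lambda>z. b z * indicator G z)\<bar>"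
    by (rule tendsto_rabs)
  then have "\<bar>expectation (\<lambda>z. b z * indicator G z)\<bar> \<le> c + B * prob (space M - G)"
  proof (rule tendsto_upperbound)
    show "\<forall>\<^sub>F n in sequentially. \<bar>expectation (\<lambda>z. a n z * indicator G z)\<bar> \<le> c + B * prob (space M - G)"
      using c     proof eventually_elim
        case (elim n)
        then show ?case using split[OF assms(1)[of n] B(1)] by linarith
      qed
  qed simp
  then show ?thesis using split[OF assms(2) B(2)] by linarith
qed

text \<open>Continuity is required because the Euler values converge only in the state space; the
  common bound 1 makes all estimates uniform over the class. For Borel probability measures on
  \<open>real^'n\<close> this class still controls total variation.\<close>

definition unit_test :: "('a::topological_space \<Rightarrow> real) \<Rightarrow> bool" where
  "unit_test f \<longleftrightarrow> continuous_on UNIV f \<and> (\<forall>x. \<bar>f x\<bar> \<le> 1)"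

lemma unit_testD:
  assumes "unit_test f"
  shows "continuous_on UNIV f" "\<And>x. \<bar>f x\<bar> \<le> 1" "f \<in> borel_measurable borel"
  using assms by (auto simp: unit_test_def borel_measurable_continuous_onI)

lemma unit_test_translate: "unit_test f \<Longrightarrow> unit_test (\<lambda>x. f (x + a))" for a :: "'a::real_normed_vector"
  unfolding unit_test_def
  using continuous_on_compose2[of UNIV f UNIV "\<lambda>x. x + a"] continuous_on_add[OF continuous_on_id continuous_on_const]
  by blast

lemma unit_test_tendsto:
  assumes "unit_test f" "X \<longlonglongrightarrow> x"
  shows "(\<lambda>n. f (X n)) \<longlonglongrightarrow> f x"
  by (rule continuous_on_tendsto_compose[OF unit_testD(1)[OF assms(1)] assms(2)]) auto

lemma eul_zero_drift: "eul (\<lambda>_ _. 0) w h x k = x + (w (real k * h) - w 0)"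
  by (induction k) (auto simp: algebra_simps)

section \<open>Total variation estimates for the transition laws\<close>

context noisy_flow
begin

lemma measurable_Y_wiener:
  assumes P: "wiener_measure P" and "\<beta> \<in> C0" "0 \<le> t"
  shows "(\<lambda>\<omega>. Y t \<omega> \<beta> x) \<in> borel_measurable P" "(\<lambda>\<omega>. phi t \<omega> \<beta> x) \<in> borel_measurable P"
proof -
  have id: "(\<lambda>\<omega>. \<omega>) \<in> P \<rightarrow>\<^sub>M path_space" using wiener_measureD(3)[OF P] by (simp add: measurable_ident_sets)
  show "(\<lambda>\<omega>. Y t \<omega> \<beta> x) \<in> borel_measurable P" "(\<lambda>\<omega>. phi t \<omega> \<beta> x) \<in> borel_measurable P"
    using assms by (auto intro!: measurable_Y measurable_phi id)
qed

lemma measurable_eul_drift: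
  assumes P: "wiener_measure P" and R: "0 < R"
  shows "(\<lambda>\<omega>. eul (drift R \<beta>) (\<lambda>s. \<sigma> *v \<omega> s) h x k) \<in> borel_measurable P"
proof -
  have id: "(\<lambda>\<omega>. \<omega>) \<in> P \<rightarrow>\<^sub>M path_space" using wiener_measureD(3)[OF P] by (simp add: measurable_ident_sets)
  show ?thesis by (intro measurable_eul id) (auto intro: measurable_compose[OF _ measurable_drift[OF R]])
qed

text \<open>The scheme started at \<open>x'\<close> and translated by \<open>- v\<close> at the end
  is compared with the one started at \<open>x\<close>: a correction moving from
  \<open>x' - x\<close> to \<open>v\<close> in \<open>N\<close> equal steps is absorbed by Girsanov
  translations. Paths in \<open>small_paths\<close> keep both flows in one ball, so \<open>K\<close>
  is uniform over \<open>T\<close>, \<open>\<beta>\<close>, the points and \<open>f\<close>; the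
  other paths give the last term.\<close>

lemma shift_estimate:
  assumes P: "wiener_measure P" and T0: "0 < T0"
  obtains K where "0 < K" "\<And>T \<beta> x x' v f m. T0 \<le> T \<Longrightarrow> T \<le> T1 \<Longrightarrow> \<beta> \<in> C0 \<Longrightarrow> (\<And>s. s \<in> {0..T1} \<Longrightarrow> norm (\<beta> s) \<le> M) \<Longrightarrow>
     norm x \<le> r \<Longrightarrow> norm x' \<le> r \<Longrightarrow> norm (x' - x) \<le> m \<Longrightarrow> norm v \<le> m \<Longrightarrow> unit_test f \<Longrightarrow>
     \<bar>(\<integral>\<omega>. f (Y T \<omega> \<beta> x' - v) \<partial>P) - (\<integral>\<omega>. f (Y T \<omega> \<beta> x) \<partial>P)\<bar> \<le> K * m + 4 * measure P (C0 - small_paths T1 M)"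
proof -
  interpret prob_space P using P by (rule wiener_measureD)
  obtain S c where S: "\<And>y. \<sigma> *v S y = y" "0 < c" "\<And>y. norm (S y) \<le> c * norm y"
    using pos_def_right_inverse[OF \<sigma>] by metis
  obtain R where R: "0 < R" "\<And>\<omega> \<beta> x s. \<omega> \<in> C0 \<Longrightarrow> \<beta> \<in> C0 \<Longrightarrow>
    (\<And>s. s \<in> {0..T1} \<Longrightarrow> norm (\<omega> s) \<le> M \<and> norm (\<beta> s) \<le> M) \<Longrightarrow> norm x \<le> r \<Longrightarrow> s \<in> {0..T1} \<Longrightarrow> norm (Y s \<omega> \<beta> x) \<le> R"
    using a_priori_bound by blast
  obtain L where L: "0 \<le> L" "\<And>\<beta> s y z. norm (\<beta> s) \<le> M \<Longrightarrow> norm (drift R \<beta> s y - drift R \<beta> s z) \<le> L * norm (y - z)"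
    using drift_lipschitz[OF R(1)] by blast
  \<comment> \<open>Per unit of time the drifts differ by at most \<open>L * m\<close>, and the
    correction moves by at most \<open>2 * m / T\<close>.\<close>
  define D0 where "D0 = L + 2 / T0"
  have D0: "0 < D0" using L T0 by (simp add: D0_def add_nonneg_pos)
  \<comment> \<open>The factor 6 comes from \<open>eul_total_variation\<close>; the summand 1 keeps
    \<open>K\<close> positive even if the square root vanishes.\<close>
  define K where "K = 6 * (c * D0 * sqrt \<bar>T1\<bar>) + 1"
  have K0: "0 < K" using S D0 by (simp add: K_def add_nonneg_pos)
  have main: "\<bar>(\<integral>\<omega>. f (Y T \<omega> \<beta> x' - v) \<partial>P) - (\<integral>\<omega>. f (Y T \<omega> \<beta> x) \<partial>P)\<bar> \<le> K * m + 4 * measure P (C0 - small_paths T1 M)"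
    if T: "T0 \<le> T" "T \<le> T1" and \<beta>: "\<beta> \<in> C0" and M: "\<And>s. s \<in> {0..T1} \<Longrightarrow> norm (\<beta> s) \<le> M"
      and x: "norm x \<le> r" "norm x' \<le> r" and m: "norm (x' - x) \<le> m" "norm v \<le> m" and f: "unit_test f" for T \<beta> x x' v f m
  \<comment> \<open>For \<open>m = 0\<close> the two integrals coincide, while the Girsanov estimate
    asks for a positive rate \<open>D0 * m\<close>.\<close>
  proof (cases "m = 0")
    case True
    then show ?thesis using m by simp
  next
    case False
    then have m0: "0 < m" using m norm_ge_zero[of v] by linarith
    have Tp: "0 < T" using T T0 by simp
    define g where "g = drift R \<beta>"
    have gm: "g s \<in> borel_measurable borel" for s unfolding g_def by (rule measurable_drift[OF R(1)])
    have em: "(\<lambda>\<omega>. eul g (\<lambda>s. \<sigma> *v \<omega> s) h z k) \<in> borel_measurable P" for h z k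
      unfolding g_def by (rule measurable_eul_drift[OF P R(1)])
    note [measurable] = em unit_testD(3)[OF f] measurable_Y_wiener(1)[OF P \<beta> less_imp_le[OF Tp]]
    \<comment> \<open>Linear interpolation, hence a convex combination of \<open>x' - x\<close> and
      \<open>v\<close> and bounded by \<open>m\<close> throughout.\<close>
    define w where "w N k = (x' - x) - (real k / real N) *\<^sub>R ((x' - x) - v)" for N k :: nat
    have tv: "\<bar>(\<integral>\<xi>. f (eul g (\<lambda>s. \<sigma> *v \<xi> s) (T / N) (x + w N 0) N - w N N) \<partial>P) -
       (\<integral>\<xi>. f (eul g (\<lambda>s. \<sigma> *v \<xi> s) (T / N) x N) \<partial>P)\<bar> \<le> 6 * (c * (D0 * m) * sqrt T)" if N: "0 < N" for N :: nat
    proof (rule eul_total_variation[OF P Tp N gm gm S(1) S(2) _ S(3) _ unit_testD(3)[OF f] unit_testD(2)[OF f]])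
      show "0 < D0 * m" using D0 m0 by simp
      fix k and y :: "real^'n" assume k: "k < N"
      let ?h = "T / real N"
      have h: "0 < ?h" using Tp N by simp
      have "real k * ?h \<le> real N * ?h" using k h by (intro mult_right_mono) auto
      also have "\<dots> = T" using N by simp
      finally have kT: "real k * ?h \<le> T" .
      have "0 \<le> real k * ?h" using h by (intro mult_nonneg_nonneg) auto
      with kT have kh: "real k * ?h \<in> {0..T1}" unfolding atLeastAtMost_iff using T by linarith
      have wk: "norm (w N k) \<le> m"
      proof -
        have "w N k = (1 - real k / real N) *\<^sub>R (x' - x) + (real k / real N) *\<^sub>R v"
          by (simp add: w_def algebra_simps)
        also have "norm \<dots> \<le> (1 - real k / real N) * m + (real k / real N) * m"
          using k m by (intro norm_triangle_mono) (auto simp: divide_le_eq intro!: mult_left_mono)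
        also have "\<dots> = m" by (simp add: algebra_simps)
        finally show ?thesis .
      qed
      have dw: "w N k - w N (Suc k) = (1 / real N) *\<^sub>R ((x' - x) - v)"
        by (simp add: w_def add_divide_distrib algebra_simps)
      have "norm (?h *\<^sub>R (g (real k * ?h) (y + w N k) - g (real k * ?h) y) + (w N k - w N (Suc k))) \<le>
          ?h * (L * m) + (1 / real N) * (2 * m)"
      proof (rule norm_triangle_mono)
        have "norm (g (real k * ?h) (y + w N k) - g (real k * ?h) y) \<le> L * norm (y + w N k - y)"
          unfolding g_def by (rule L(2), rule M, rule kh)
        also have "\<dots> \<le> L * m" using wk L by (simp add: mult_left_mono)
        finally show "norm (?h *\<^sub>R (g (real k * ?h) (y + w N k) - g (real k * ?h) y)) \<le> ?h * (L * m)"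
          using h by (simp only: norm_scaleR abs_of_pos mult_le_cancel_left_pos)
        have "norm ((x' - x) - v) \<le> 2 * m" using norm_triangle_ineq4[of "x' - x" v] m by linarith
        then show "norm (w N k - w N (Suc k)) \<le> (1 / real N) * (2 * m)"
          unfolding dw using N by (simp add: divide_right_mono)
      qed
      also have "\<dots> = ?h * (L * m + 2 * m / T)" using Tp N by (simp add: field_simps)
      also have "\<dots> \<le> ?h * (D0 * m)"
        using h T T0 m0 by (intro mult_left_mono) (auto simp: D0_def distrib_right intro!: divide_left_mono)
      finally show "norm (?h *\<^sub>R (g (real k * ?h) (y + w N k) - g (real k * ?h) y) + w N k - w N (Suc k)) \<le> D0 * m * ?h"
        by (simp add: algebra_simps)
    qed
    have wN: "w N 0 = x' - x" "0 < N \<Longrightarrow> w N N = v" for N by (simp_all add: w_def)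
    define a where "a N \<omega> = f (eul g (\<lambda>s. \<sigma> *v \<omega> s) (T / real N) x' N - v) - f (eul g (\<lambda>s. \<sigma> *v \<omega> s) (T / real N) x N)" for N \<omega>
    define b where "b \<omega> = f (Y T \<omega> \<beta> x' - v) - f (Y T \<omega> \<beta> x)" for \<omega>
    have fi: "integrable P (\<lambda>\<omega>. f (u \<omega>))" if [measurable]: "u \<in> borel_measurable P" for u
      by (rule integrable_const_bound[of _ 1]) (auto intro!: unit_testD(2)[OF f])
    have bound: "\<bar>expectation b\<bar> \<le> 6 * (c * (D0 * m) * sqrt T) + 2 * 2 * prob (space P - small_paths T1 M)"
    proof (rule limit_expectation_bound)
      show "a n \<in> borel_measurable P" for n unfolding a_def by measurable
      show "b \<in> borel_measurable P" unfolding b_def by measurable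
      show "small_paths T1 M \<in> events" by (simp add: wiener_measureD(3)[OF P])
      show "\<bar>a n z\<bar> \<le> 2" "\<bar>b z\<bar> \<le> 2" for n z
        unfolding a_def b_def
        using unit_testD(2)[OF f] by (auto intro!: order_trans[OF abs_triangle_ineq4] order_trans[OF add_mono[OF unit_testD(2)[OF f] unit_testD(2)[OF f]]])
      show "(\<lambda>n. a n z) \<longlonglongrightarrow> b z" if z: "z \<in> small_paths T1 M" for z
      proof -
        have zC: "z \<in> C0" "\<And>s. s \<in> {0..T1} \<Longrightarrow> norm (z s) \<le> M" using z by (auto simp: small_paths_def)
        have bd: "norm (Y t z \<beta> q) \<le> R" if "t \<in> {0..T}" "norm q \<le> r" for t q
          by (rule R(2)[OF zC(1) \<beta> _ that(2)]) (use that T zC M in auto)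
        show ?thesis unfolding a_def b_def g_def
          by (intro tendsto_diff unit_test_tendsto[OF f] tendsto_const Y_converges[OF zC(1) \<beta> Tp R(1)] bd) (use x in auto)
      qed
      show "\<forall>\<^sub>F n in sequentially. \<bar>expectation (a n)\<bar> \<le> 6 * (c * (D0 * m) * sqrt T)"
        using eventually_gt_at_top[of 0]
      proof eventually_elim
        case (elim N)
        show ?case using tv[OF elim] unfolding wN(1) wN(2)[OF elim] a_def
          by (subst Bochner_Integration.integral_diff) (auto intro!: fi)
      qed
    qed
    have E: "expectation b = (\<integral>\<omega>. f (Y T \<omega> \<beta> x' - v) \<partial>P) - (\<integral>\<omega>. f (Y T \<omega> \<beta> x) \<partial>P)"
      unfolding b_def by (subst Bochner_Integration.integral_diff) (auto intro!: fi)
    have "6 * (c * (D0 * m) * sqrt T) \<le> K * m"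
    proof -
      have "c * D0 * sqrt T \<le> c * D0 * sqrt \<bar>T1\<bar>" using S D0 T by (intro mult_left_mono) auto
      then have "6 * (c * D0 * sqrt T) \<le> K" by (simp add: K_def)
      then have "6 * (c * D0 * sqrt T) * m \<le> K * m" using m0 by (intro mult_right_mono) auto
      then show ?thesis by (simp add: algebra_simps)
    qed
    then show ?thesis using bound unfolding E wiener_measureD(2)[OF P] by linarith
  qed
  show ?thesis by (rule that[OF K0 main])
qed

text \<open>The case of equal starting points. First the path bound is made so large that
  exceptional paths contribute at most \<open>e / 2\<close>, then \<open>d\<close> so small,
  depending on that bound through \<open>K\<close>, that the Girsanov term does too. The bound
  \<open>M\<close> on the common noise is merged into \<open>M2\<close>.\<close>

lemma translation_continuity:
  assumes P: "wiener_measure P" and T0: "0 < T0" and e: "0 < e"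
  obtains d where "0 < d" "\<And>T \<beta> x v f. T0 \<le> T \<Longrightarrow> T \<le> T1 \<Longrightarrow> \<beta> \<in> C0 \<Longrightarrow> (\<And>s. s \<in> {0..T1} \<Longrightarrow> norm (\<beta> s) \<le> M) \<Longrightarrow>
     norm x \<le> r \<Longrightarrow> norm v \<le> d \<Longrightarrow> unit_test f \<Longrightarrow>
     \<bar>(\<integral>\<omega>. f (Y T \<omega> \<beta> x + v) \<partial>P) - (\<integral>\<omega>. f (Y T \<omega> \<beta> x) \<partial>P)\<bar> \<le> e"
proof -
  obtain M1 where M1: "0 < M1" "measure P (C0 - small_paths T1 M1) < e / 8"
    using small_paths_large_bound[OF P, of "e / 8" T1] e by auto
  define M2 where "M2 = max M M1"
  interpret prob_space P using P by (rule wiener_measureD)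
  have "measure P (C0 - small_paths T1 M2) \<le> measure P (C0 - small_paths T1 M1)"
  proof (rule finite_measure_mono)
    show "C0 - small_paths T1 M2 \<subseteq> C0 - small_paths T1 M1" by (force simp: small_paths_def M2_def)
    show "C0 - small_paths T1 M1 \<in> events"
      using sets.Diff[OF sets.top sets_small_paths[of T1 M1]] by (simp add: wiener_measureD(3)[OF P])
  qed
  then have M2: "4 * measure P (C0 - small_paths T1 M2) \<le> e / 2" using M1 by simp
  obtain K where K: "0 < K" "\<And>T \<beta> x x' v f m. T0 \<le> T \<Longrightarrow> T \<le> T1 \<Longrightarrow> \<beta> \<in> C0 \<Longrightarrow> (\<And>s. s \<in> {0..T1} \<Longrightarrow> norm (\<beta> s) \<le> M2) \<Longrightarrow>
     norm x \<le> r \<Longrightarrow> norm x' \<le> r \<Longrightarrow> norm (x' - x) \<le> m \<Longrightarrow> norm v \<le> m \<Longrightarrow> unit_test f \<Longrightarrow>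
     \<bar>(\<integral>\<omega>. f (Y T \<omega> \<beta> x' - v) \<partial>P) - (\<integral>\<omega>. f (Y T \<omega> \<beta> x) \<partial>P)\<bar> \<le> K * m + 4 * measure P (C0 - small_paths T1 M2)"
    using shift_estimate[OF P T0] by blast
  show ?thesis
  proof
    show "0 < e / (2 * K)" using e K by simp
    fix T and \<beta> :: "real \<Rightarrow> real^'n" and x v :: "real^'n" and f :: "real^'n \<Rightarrow> real"
    assume T: "T0 \<le> T" "T \<le> T1" and \<beta>: "\<beta> \<in> C0" "\<And>s. s \<in> {0..T1} \<Longrightarrow> norm (\<beta> s) \<le> M"
      and x: "norm x \<le> r" and v: "norm v \<le> e / (2 * K)" and f: "unit_test f"
    have "\<bar>(\<integral>\<omega>. f (Y T \<omega> \<beta> x - (- v)) \<partial>P) - (\<integral>\<omega>. f (Y T \<omega> \<beta> x) \<partial>P)\<bar> \<le> K * (e / (2 * K)) + 4 * measure P (C0 - small_paths T1 M2)"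
      by (rule K(2)[OF T \<beta>(1) _ x x _ _ f]) (use \<beta>(2) v e K(1) in \<open>auto simp: M2_def intro: le_max_iff_disj[THEN iffD2]\<close>)
    then show "\<bar>(\<integral>\<omega>. f (Y T \<omega> \<beta> x + v) \<partial>P) - (\<integral>\<omega>. f (Y T \<omega> \<beta> x) \<partial>P)\<bar> \<le> e"
      using M2 K(1) by simp
  qed
qed

text \<open>The other special case of \<open>shift_estimate\<close>: \<open>v = 0\<close> and
  different starting points. One \<open>d\<close> works for all test functions, so their images
  under the transition operator are equicontinuous, not merely continuous.\<close>

lemma strong_feller:
  assumes P: "wiener_measure P" and \<beta>: "\<beta> \<in> C0" and T: "0 < T" and e: "0 < e"
  obtains d where "0 < d" "\<And>x' f. norm (x' - x) \<le> d \<Longrightarrow> unit_test f \<Longrightarrow>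
     \<bar>(\<integral>\<omega>. f (phi T \<omega> \<beta> x') \<partial>P) - (\<integral>\<omega>. f (phi T \<omega> \<beta> x) \<partial>P)\<bar> \<le> e"
proof -
  obtain M0 where M0: "0 < M0" "\<And>s. s \<in> {0..T} \<Longrightarrow> norm (\<beta> s) \<le> M0"
    using path_bounded[of T \<beta>] \<beta> by (auto intro: continuous_intros)
  obtain M1 where M1: "0 < M1" "measure P (C0 - small_paths T M1) < e / 8"
    using small_paths_large_bound[OF P, of "e / 8" T] e by auto
  define M2 where "M2 = max M0 M1"
  interpret prob_space P using P by (rule wiener_measureD)
  have "measure P (C0 - small_paths T M2) \<le> measure P (C0 - small_paths T M1)"
  proof (rule finite_measure_mono)
    show "C0 - small_paths T M2 \<subseteq> C0 - small_paths T M1" by (force simp: small_paths_def M2_def)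
    show "C0 - small_paths T M1 \<in> events"
      using sets.Diff[OF sets.top sets_small_paths[of T M1]] by (simp add: wiener_measureD(3)[OF P])
  qed
  then have M2: "4 * measure P (C0 - small_paths T M2) \<le> e / 2" using M1 by simp
  obtain K where K: "0 < K" "\<And>T' \<beta> x1 x' v f m. T \<le> T' \<Longrightarrow> T' \<le> T \<Longrightarrow> \<beta> \<in> C0 \<Longrightarrow> (\<And>s. s \<in> {0..T} \<Longrightarrow> norm (\<beta> s) \<le> M2) \<Longrightarrow>
     norm x1 \<le> norm x + 1 \<Longrightarrow> norm x' \<le> norm x + 1 \<Longrightarrow> norm (x' - x1) \<le> m \<Longrightarrow> norm v \<le> m \<Longrightarrow> unit_test f \<Longrightarrow>
     \<bar>(\<integral>\<omega>. f (Y T' \<omega> \<beta> x' - v) \<partial>P) - (\<integral>\<omega>. f (Y T' \<omega> \<beta> x1) \<partial>P)\<bar> \<le> K * m + 4 * measure P (C0 - small_paths T M2)"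
    using shift_estimate[OF P T] by blast
  show ?thesis
  proof
    show "0 < min 1 (e / (2 * K))" using e K by simp
    fix x' :: "real^'n" and f :: "real^'n \<Rightarrow> real"
    assume x: "norm (x' - x) \<le> min 1 (e / (2 * K))" and f: "unit_test f"
    have "norm x' \<le> norm x + 1" using norm_triangle_ineq2[of x' x] x by simp
    moreover have "unit_test (\<lambda>y. f (y + \<eta> *v \<beta> T))" by (rule unit_test_translate[OF f])
    ultimately have "\<bar>(\<integral>\<omega>. f (Y T \<omega> \<beta> x' - 0 + \<eta> *v \<beta> T) \<partial>P) - (\<integral>\<omega>. f (Y T \<omega> \<beta> x + \<eta> *v \<beta> T) \<partial>P)\<bar>
        \<le> K * (e / (2 * K)) + 4 * measure P (C0 - small_paths T M2)"
      by (intro K(2)[of T \<beta> x x' "e / (2 * K)" 0 "\<lambda>y. f (y + \<eta> *v \<beta> T)"] \<beta>)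
        (use M0 x e K(1) in \<open>auto simp: M2_def intro: le_max_iff_disj[THEN iffD2]\<close>)
    then show "\<bar>(\<integral>\<omega>. f (phi T \<omega> \<beta> x') \<partial>P) - (\<integral>\<omega>. f (phi T \<omega> \<beta> x) \<partial>P)\<bar> \<le> e"
      using M2 K(1) by (simp add: Y_def)
  qed
qed

text \<open>The scheme without drift is exactly \<open>y + \<sigma> *v \<omega> h\<close>. The
  truncated drift is bounded by \<open>G\<close>, so by Girsanov switching it on costs only a
  multiple of \<open>sqrt h\<close>, uniformly over starting points in the ball.\<close>

lemma short_time_gaussian:
  assumes P: "wiener_measure P" and e: "0 < e"
  obtains d where "0 < d" "\<And>h \<beta> y f. 0 < h \<Longrightarrow> h \<le> d \<Longrightarrow> \<beta> \<in> C0 \<Longrightarrow> (\<And>s. s \<in> {0..1} \<Longrightarrow> norm (\<beta> s) \<le> M) \<Longrightarrow>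
     norm y \<le> r \<Longrightarrow> unit_test f \<Longrightarrow>
     \<bar>(\<integral>\<omega>. f (Y h \<omega> \<beta> y) \<partial>P) - (\<integral>\<omega>. f (y + \<sigma> *v \<omega> h) \<partial>P)\<bar> \<le> e"
proof -
  interpret prob_space P using P by (rule wiener_measureD)
  obtain S c where S: "\<And>y. \<sigma> *v S y = y" "0 < c" "\<And>y. norm (S y) \<le> c * norm y"
    using pos_def_right_inverse[OF \<sigma>] by metis
  obtain M1 where M1: "0 < M1" "measure P (C0 - small_paths 1 M1) < e / 8"
    using small_paths_large_bound[OF P, of "e / 8" 1] e by auto
  define M2 where "M2 = max M M1"
  obtain R where R: "0 < R" "\<And>\<omega> \<beta> x s. \<omega> \<in> C0 \<Longrightarrow> \<beta> \<in> C0 \<Longrightarrow>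
    (\<And>s. s \<in> {0..1} \<Longrightarrow> norm (\<omega> s) \<le> M2 \<and> norm (\<beta> s) \<le> M2) \<Longrightarrow> norm x \<le> r \<Longrightarrow> s \<in> {0..1} \<Longrightarrow> norm (Y s \<omega> \<beta> x) \<le> R"
    using a_priori_bound by blast
  obtain G where G: "0 < G" "\<And>\<beta> s y. norm (\<beta> s) \<le> M2 \<Longrightarrow> norm (drift R \<beta> s y) \<le> G"
    using drift_bounded[OF R(1)] by blast
  \<comment> \<open>The second entry solves \<open>6 * (c * G * sqrt d) = e / 2\<close>; the cap 1
    keeps \<open>h\<close> in the interval on which the paths are bounded.\<close>
  define d where "d = min 1 ((e / (12 * c * G))\<^sup>2)"
  have d: "0 < d" "d \<le> 1" using e S G by (auto simp: d_def)
  have sq: "6 * (c * G * sqrt h) \<le> e / 2" if "h \<le> d" for h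
  proof -
    have "sqrt h \<le> sqrt ((e / (12 * c * G))\<^sup>2)" by (rule real_sqrt_le_mono) (use that in \<open>simp add: d_def\<close>)
    also have "\<dots> = e / (12 * c * G)" using e S G by simp
    finally have "c * G * sqrt h \<le> c * G * (e / (12 * c * G))" using S G by (intro mult_left_mono) auto
    then show ?thesis using S G by (simp add: field_simps)
  qed
  show ?thesis
  proof
    show "0 < d" by fact
    fix h and \<beta> :: "real \<Rightarrow> real^'n" and y :: "real^'n" and f :: "real^'n \<Rightarrow> real"
    assume h: "0 < h" "h \<le> d" and \<beta>: "\<beta> \<in> C0" "\<And>s. s \<in> {0..1} \<Longrightarrow> norm (\<beta> s) \<le> M"
      and y: "norm y \<le> r" and f: "unit_test f"
    define g where "g = drift R \<beta>"
    have gm: "g s \<in> borel_measurable borel" for s unfolding g_def by (rule measurable_drift[OF R(1)])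
    have em: "(\<lambda>\<omega>. eul g (\<lambda>s. \<sigma> *v \<omega> s) h z k) \<in> borel_measurable P" for h z k
      unfolding g_def by (rule measurable_eul_drift[OF P R(1)])
    have wm: "(\<lambda>\<omega>. \<sigma> *v \<omega> t) \<in> borel_measurable P" for t
      using measurable_compose[OF measurable_eval borel_measurable_matrix_vector]
      by (simp add: measurable_cong_sets[OF wiener_measureD(3)[OF P] refl])
    note [measurable] = em wm unit_testD(3)[OF f] measurable_Y_wiener(1)[OF P \<beta>(1) less_imp_le[OF h(1)]]
    have tv: "\<bar>(\<integral>\<xi>. f (eul g (\<lambda>s. \<sigma> *v \<xi> s) (h / N) (y + 0) N - 0) \<partial>P) -
       (\<integral>\<xi>. f (eul (\<lambda>_ _. 0) (\<lambda>s. \<sigma> *v \<xi> s) (h / N) y N) \<partial>P)\<bar> \<le> 6 * (c * G * sqrt h)" if N: "0 < N" for N :: nat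
    proof (rule eul_total_variation[OF P h(1) N _ gm S(1) S(2) G(1) S(3) _ unit_testD(3)[OF f] unit_testD(2)[OF f], where v="\<lambda>_. 0"])
      fix k and y :: "real^'n" assume k: "k < N"
      have "real k * (h / real N) \<le> real N * (h / real N)" using k h by (intro mult_right_mono) auto
      also have "\<dots> = h" using N by simp
      finally have kh1: "real k * (h / real N) \<le> h" .
      have "0 \<le> real k * (h / real N)" using h by (intro mult_nonneg_nonneg) auto
      with kh1 have kh: "real k * (h / real N) \<in> {0..1}" unfolding atLeastAtMost_iff using h d by linarith
      have "norm (g (real k * (h / real N)) y) \<le> G"
        unfolding g_def using \<beta>(2)[OF kh] by (intro G(2)) (simp add: M2_def)
      then have "(h / real N) * norm (g (real k * (h / real N)) y) \<le> (h / real N) * G" using h by (intro mult_left_mono) auto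
      then show "norm ((h / real N) *\<^sub>R (g (real k * (h / real N)) (y + 0) - 0) + 0 - 0) \<le> G * (h / real N)"
        using h by (simp add: mult.commute)
    qed simp
    define a where "a N \<omega> = f (eul g (\<lambda>s. \<sigma> *v \<omega> s) (h / real N) y N) - f (y + \<sigma> *v \<omega> h)" for N \<omega>
    define b where "b \<omega> = f (Y h \<omega> \<beta> y) - f (y + \<sigma> *v \<omega> h)" for \<omega>
    have fi: "integrable P (\<lambda>\<omega>. f (u \<omega>))" if [measurable]: "u \<in> borel_measurable P" for u
      by (rule integrable_const_bound[of _ 1]) (auto intro!: unit_testD(2)[OF f])
    have iG: "integrable P (\<lambda>\<omega>. f (y + \<sigma> *v \<omega> h))" by (rule fi) measurable
    have iY: "integrable P (\<lambda>\<omega>. f (Y h \<omega> \<beta> y))" by (rule fi) measurable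
    have bound: "\<bar>expectation b\<bar> \<le> 6 * (c * G * sqrt h) + 2 * 2 * prob (space P - small_paths 1 M1)"
    proof (rule limit_expectation_bound)
      show "a n \<in> borel_measurable P" for n unfolding a_def by measurable
      show "b \<in> borel_measurable P" unfolding b_def by measurable
      show "small_paths 1 M1 \<in> events" by (simp add: wiener_measureD(3)[OF P])
      show "\<bar>a n z\<bar> \<le> 2" "\<bar>b z\<bar> \<le> 2" for n z
        unfolding a_def b_def
        using unit_testD(2)[OF f] by (auto intro!: order_trans[OF abs_triangle_ineq4] order_trans[OF add_mono[OF unit_testD(2)[OF f] unit_testD(2)[OF f]]])
      show "(\<lambda>n. a n z) \<longlonglongrightarrow> b z" if z: "z \<in> small_paths 1 M1" for z
      proof -
        have zC: "z \<in> C0" "\<And>s. s \<in> {0..1} \<Longrightarrow> norm (z s) \<le> M1" using z by (auto simp: small_paths_def)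
        have bd: "norm (Y t z \<beta> y) \<le> R" if "t \<in> {0..h}" for t
          by (rule R(2)[OF zC(1) \<beta>(1) _ y]) (use that h d zC \<beta>(2) in \<open>auto simp: M2_def intro: le_max_iff_disj[THEN iffD2]\<close>)
        show ?thesis unfolding a_def b_def g_def
          by (intro tendsto_diff unit_test_tendsto[OF f] tendsto_const Y_converges[OF zC(1) \<beta>(1) h(1) R(1)] bd)
      qed
      show "\<forall>\<^sub>F n in sequentially. \<bar>expectation (a n)\<bar> \<le> 6 * (c * G * sqrt h)"
        using eventually_gt_at_top[of 0]
      proof eventually_elim
        case (elim N)
        have "(\<integral>\<xi>. f (eul (\<lambda>_ _. 0) (\<lambda>s. \<sigma> *v \<xi> s) (h / N) y N) \<partial>P) = (\<integral>\<xi>. f (y + \<sigma> *v \<xi> h) \<partial>P)"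
          using elim wiener_measureD(2)[OF P]
          by (intro Bochner_Integration.integral_cong) (auto simp: eul_zero_drift C0_zero)
        then show ?case using tv[OF elim] unfolding a_def
          by (subst Bochner_Integration.integral_diff[OF fi iG]) auto
      qed
    qed
    have E: "expectation b = (\<integral>\<omega>. f (Y h \<omega> \<beta> y) \<partial>P) - (\<integral>\<omega>. f (y + \<sigma> *v \<omega> h) \<partial>P)"
      unfolding b_def by (subst Bochner_Integration.integral_diff[OF iY iG]) simp
    show "\<bar>(\<integral>\<omega>. f (Y h \<omega> \<beta> y) \<partial>P) - (\<integral>\<omega>. f (y + \<sigma> *v \<omega> h) \<partial>P)\<bar> \<le> e"
      using bound sq[OF h(2)] M1(2) unfolding E wiener_measureD(2)[OF P] by linarith
  qed
qed

text \<open>A fresh path is glued on at time \<open>s\<close>: the flow up to \<open>s\<close> sees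
  only the first path and the restarted flow only the second, while the common noise is merely
  shifted.\<close>

lemma phi_markov:
  assumes P: "wiener_measure P" and \<beta>: "\<beta> \<in> C0" and s: "0 \<le> s" and t: "0 \<le> t"
    and f: "f \<in> borel_measurable borel" and B: "\<And>y. \<bar>f y\<bar> \<le> (B::real)"
  shows "(\<integral>\<omega>. f (phi (s + t) \<omega> \<beta> x) \<partial>P) =
     (\<integral>\<omega>. (\<integral>\<omega>'. f (phi t \<omega>' (wiener_shift s \<beta>) (phi s \<omega> \<beta> x)) \<partial>P) \<partial>P)"
proof -
  have "(\<lambda>\<omega>. phi (s + t) \<omega> \<beta> x) \<in> borel_measurable path_space"
    using \<beta> s t by (intro measurable_phi) auto
  then have "(\<lambda>\<omega>. f (phi (s + t) \<omega> \<beta> x)) \<in> borel_measurable path_space" by (rule measurable_compose[OF _ f])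
  from integral_wiener_concat[OF P s this B]
  have "(\<integral>\<omega>. f (phi (s + t) \<omega> \<beta> x) \<partial>P) = (\<integral>\<omega>. (\<integral>\<omega>'. f (phi (s + t) (path_concat s \<omega> \<omega>') \<beta> x) \<partial>P) \<partial>P)" .
  also have "\<dots> = (\<integral>\<omega>. (\<integral>\<omega>'. f (phi t \<omega>' (wiener_shift s \<beta>) (phi s \<omega> \<beta> x)) \<partial>P) \<partial>P)"
  proof (intro Bochner_Integration.integral_cong refl arg_cong[where f=f])
    fix \<omega> \<omega>' assume "\<omega> \<in> space P" "\<omega>' \<in> space P"
    then have C: "\<omega> \<in> C0" "\<omega>' \<in> C0" by (auto simp: wiener_measureD(2)[OF P])
    note pc = path_concat_C0[OF C s]
    have "phi s (path_concat s \<omega> \<omega>') \<beta> x = phi s \<omega> \<beta> x"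
      by (rule phi_cong) (use C pc \<beta> s in \<open>auto simp: path_concat_def\<close>)
    moreover have "phi t (wiener_shift s (path_concat s \<omega> \<omega>')) (wiener_shift s \<beta>) y = phi t \<omega>' (wiener_shift s \<beta>) y" for y
    proof (rule phi_cong)
      show "wiener_shift s (path_concat s \<omega> \<omega>') u = \<omega>' u" if "u \<in> {0..t}" for u
        using that C(2) by (auto simp: path_concat_def wiener_shift_def C0_zero)
    qed (use C pc \<beta> t in \<open>auto intro: wiener_shift_C0\<close>)
    ultimately show "phi (s + t) (path_concat s \<omega> \<omega>') \<beta> x = phi t \<omega>' (wiener_shift s \<beta>) (phi s \<omega> \<beta> x)"
      by (simp add: phi_cocycle[OF pc \<beta> s t])
  qed
  finally show ?thesis .
qed

end

section \<open>Total variation and densities\<close>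

text \<open>Tests of supremum norm at most 1 make this a bound on the total variation norm; the
  passage from continuous tests to Borel sets is \<open>tv_le_measure\<close>.\<close>

definition tv_le :: "'a::topological_space measure \<Rightarrow> 'a measure \<Rightarrow> real \<Rightarrow> bool" where
  "tv_le M N e \<longleftrightarrow> (\<forall>f. unit_test f \<longrightarrow> \<bar>(\<integral>x. f x \<partial>M) - (\<integral>x. f x \<partial>N)\<bar> \<le> e)"

lemma tv_le_sym: "tv_le M N e \<Longrightarrow> tv_le N M e"
  by (simp add: tv_le_def abs_minus_commute)

lemma tv_le_trans:
  assumes "tv_le M N e" "tv_le N K d"
  shows "tv_le M K (e + d)"
  unfolding tv_le_def
proof (intro allI impI)
  fix f :: "'a \<Rightarrow> real" assume "unit_test f"
  then have "\<bar>(\<integral>x. f x \<partial>M) - (\<integral>x. f x \<partial>N)\<bar> \<le> e" "\<bar>(\<integral>x. f x \<partial>N) - (\<integral>x. f x \<partial>K)\<bar> \<le> d"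
    using assms by (auto simp: tv_le_def)
  then show "\<bar>(\<integral>x. f x \<partial>M) - (\<integral>x. f x \<partial>K)\<bar> \<le> e + d" by linarith
qed

lemma closed_indicator_limit:
  fixes K :: "'a::metric_space set"
  assumes K: "closed K"
  obtains f :: "nat \<Rightarrow> 'a \<Rightarrow> real"
  where "\<And>k. unit_test (f k)" "\<And>k x. indicator K x \<le> f k x" "\<And>k x. f k x \<le> 1" "\<And>x. (\<lambda>k. f k x) \<longlonglongrightarrow> indicator K x"
\<comment> \<open>\<open>infdist\<close> to the empty set is 0, so the formula below would yield 1
  there instead of 0.\<close>
proof (cases "K = {}")
  case True
  show ?thesis by (rule that[of "\<lambda>_ _. 0"]) (auto simp: True unit_test_def)
next
  case False
  define f where "f k x = max 0 (1 - real k * infdist x K)" for k and x :: 'a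
  have fc: "continuous_on UNIV (f k)" for k unfolding f_def by (intro continuous_intros)
  have f01: "0 \<le> f k x" "f k x \<le> 1" for k x by (auto simp: f_def infdist_nonneg)
  show ?thesis
  proof (rule that[of f])
    show "unit_test (f k)" for k using fc f01 by (simp add: unit_test_def)
    show "indicator K x \<le> f k x" for k x using f01[of k x] by (auto simp: indicator_def f_def)
    show "f k x \<le> 1" for k x by (rule f01)
    show "(\<lambda>k. f k x) \<longlonglongrightarrow> indicator K x" for x
    proof (cases "x \<in> K")
      case True
      then show ?thesis by (simp add: f_def)
    next
      case nK: False
      have pos: "0 < infdist x K"
        by (rule infdist_pos_not_in_closed[OF K False nK])
      then obtain k0 :: nat where k0: "1 / infdist x K \<le> real k0" using real_arch_simple by blast
      have "\<forall>\<^sub>F k in sequentially. f k x = 0"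
        using eventually_ge_at_top[of k0]
      proof eventually_elim
        case (elim k)
        then have "1 / infdist x K \<le> real k" using k0 by linarith
        then have "1 \<le> real k * infdist x K" using pos by (simp add: pos_divide_le_eq)
        then show ?case by (simp add: f_def)
      qed
      then show ?thesis using nK by (simp add: tendsto_eventually)
    qed
  qed
qed

text \<open>Inner regularity reduces the claim to compact sets, whose indicators are limits of
  continuous tests from above.\<close>

lemma tv_le_measure:
  fixes M N :: "(real^'n) measure"
  assumes M: "prob_space M" "sets M = sets borel" and N: "prob_space N" "sets N = sets borel"
    and tv: "tv_le M N e" and A: "A \<in> sets borel"
  shows "measure M A \<le> measure N A + e"
proof (rule field_le_epsilon)
  interpret M: prob_space M by fact
  interpret N: prob_space N by fact
  note [measurable_cong] = M(2) N(2)
  have spM: "space M = UNIV" and spN: "space N = UNIV" using sets_eq_imp_space_eq[OF M(2)] sets_eq_imp_space_eq[OF N(2)] by auto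
  have e: "0 \<le> e"
    using tv[unfolded tv_le_def, rule_format, of "\<lambda>_. 0"] by (simp add: unit_test_def)
  fix d :: real assume d: "0 < d"
  have "emeasure M A = (SUP K\<in>{K. K \<subseteq> A \<and> compact K}. emeasure M K)"
    by (rule inner_regular) (use M A in \<open>auto simp: M.emeasure_eq_measure\<close>)
  then have "measure M A \<le> 0 \<or> (\<exists>K. K \<subseteq> A \<and> compact K \<and> measure M A - d < measure M K)"
  proof -
    assume sup: "emeasure M A = (SUP K\<in>{K. K \<subseteq> A \<and> compact K}. emeasure M K)"
    show ?thesis
    proof (cases "measure M A - d < 0")
      case True
      then show ?thesis by (intro disjI2 exI[of _ "{}"]) auto
    next
      case False
      have "ennreal (measure M A - d) < emeasure M A"
        using False d by (simp add: M.emeasure_eq_measure ennreal_less_iff)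
      then obtain K where "K \<subseteq> A" "compact K" "ennreal (measure M A - d) < emeasure M K"
        unfolding sup less_SUP_iff by auto
      then show ?thesis using False by (intro disjI2 exI[of _ K]) (auto simp: M.emeasure_eq_measure ennreal_less_iff)
    qed
  qed
  then show "measure M A \<le> measure N A + e + d"
  proof
    assume "measure M A \<le> 0"
    then show ?thesis using e d measure_nonneg[of N A] by linarith
  next
    assume "\<exists>K. K \<subseteq> A \<and> compact K \<and> measure M A - d < measure M K"
    then obtain K where K: "K \<subseteq> A" "compact K" "measure M A - d < measure M K" by blast
    have Kb [measurable]: "K \<in> sets borel" using K(2) by (simp add: borel_closed compact_imp_closed)
    show ?thesis
    proof -
      obtain f :: "nat \<Rightarrow> real^'n \<Rightarrow> real" where ut: "\<And>k. unit_test (f k)"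
        and f01: "\<And>k x. indicator K x \<le> f k x" "\<And>k x. f k x \<le> 1" and lim: "\<And>x. (\<lambda>k. f k x) \<longlonglongrightarrow> indicator K x"
        using closed_indicator_limit[OF compact_imp_closed[OF K(2)]] by metis
      have [measurable]: "f k \<in> borel_measurable borel" for k by (rule unit_testD(3)[OF ut])
      have int: "integrable M (f k)" "integrable N (f k)" for k
        by (auto intro!: M.integrable_const_bound[of _ 1] N.integrable_const_bound[of _ 1] unit_testD(2)[OF ut])
      have "(\<lambda>k. \<integral>x. f k x \<partial>N) \<longlonglongrightarrow> (\<integral>x. indicator K x \<partial>N)"
        by (rule integral_dominated_convergence[where w="\<lambda>_. 1"]) (use unit_testD(2)[OF ut] lim in auto)
      then have l: "(\<lambda>k. (\<integral>x. f k x \<partial>N) + e) \<longlonglongrightarrow> measure N K + e"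
        using spN by (intro tendsto_add tendsto_const) simp
      have "measure M K \<le> (\<integral>x. f k x \<partial>N) + e" for k
      proof -
        have "measure M K = (\<integral>x. indicator K x \<partial>M)" using spM by simp
        also have "\<dots> \<le> (\<integral>x. f k x \<partial>M)"
        proof (rule integral_mono[OF _ int(1)])
          show "integrable M (indicator K :: _ \<Rightarrow> real)" by (rule M.integrable_const_bound[of _ 1]) (auto simp: indicator_def)
          show "indicator K x \<le> f k x" for x by (rule f01)
        qed
        also have "\<dots> \<le> (\<integral>x. f k x \<partial>N) + e" using tv ut[of k] unfolding tv_le_def by (smt (verit))
        finally show ?thesis .
      qed
      then have "measure M K \<le> measure N K + e" by (intro LIMSEQ_le_const[OF l]) auto
      moreover have "measure N K \<le> measure N A" using K(1) A by (intro N.finite_measure_mono) (auto simp: N)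
      ultimately show ?thesis using K(3) by linarith
    qed
  qed
qed

section \<open>Probability densities and the L1 distance\<close>

lemma prob_density_integrable:
  assumes "prob_density p"
  shows "integrable lborel p" "(\<integral>x. p x \<partial>lborel) = 1"
proof -
  have m [measurable]: "p \<in> borel_measurable borel" and p0: "\<And>x. 0 \<le> p x" and 1: "(\<integral>\<^sup>+x. ennreal (p x) \<partial>lborel) = 1"
    using assms by (auto simp: prob_density_def)
  have "has_bochner_integral lborel p 1"
    by (rule has_bochner_integral_nn_integral) (use p0 1 in auto)
  then show "integrable lborel p" "(\<integral>x. p x \<partial>lborel) = 1" by (auto simp: has_bochner_integral_iff)
qed

lemma prob_density_prob_space:
  assumes "prob_density p"
  shows "prob_space (density lborel (\<lambda>x. ennreal (p x)))"
  using assms by (intro prob_spaceI) (simp add: prob_density_def emeasure_density)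

lemma prob_density_measure:
  assumes p: "prob_density p" and [measurable]: "A \<in> sets borel"
  shows "measure (density lborel (\<lambda>x. ennreal (p x))) A = (\<integral>x. indicator A x * p x \<partial>lborel)"
proof -
  have [measurable]: "p \<in> borel_measurable borel" and p0: "\<And>x. 0 \<le> p x" using p by (auto simp: prob_density_def)
  have "measure (density lborel (\<lambda>x. ennreal (p x))) A = (\<integral>x. indicator A x \<partial>density lborel (\<lambda>x. ennreal (p x)))" by simp
  also have "\<dots> = (\<integral>x. indicator A x * p x \<partial>lborel)" by (subst integral_density) (auto simp: p0 mult.commute)
  finally show ?thesis .
qed

lemma prob_density_integral:
  assumes p: "prob_density p" and [measurable]: "f \<in> borel_measurable borel"
  shows "(\<integral>x. f x \<partial>density lborel (\<lambda>x. ennreal (p x))) = (\<integral>x. f x * p x \<partial>lborel)"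
proof -
  have [measurable]: "p \<in> borel_measurable borel" and p0: "\<And>x. 0 \<le> p x" using p by (auto simp: prob_density_def)
  show ?thesis by (subst integral_density) (auto simp: p0 mult.commute)
qed

text \<open>The L1 distance splits at the set where \<open>q \<le> p\<close>; on it and on its
  complement the measures differ by at most \<open>e\<close>, hence the factor 2.\<close>

lemma tv_le_L1_dist:
  fixes p q :: "real^'n \<Rightarrow> real"
  assumes p: "prob_density p" and q: "prob_density q"
    and tv: "tv_le (density lborel (\<lambda>x. ennreal (p x))) (density lborel (\<lambda>x. ennreal (q x))) e"
  shows "L1_dist p q \<le> ennreal (2 * e)"
proof -
  have [measurable]: "p \<in> borel_measurable borel" "q \<in> borel_measurable borel"
    using p q by (auto simp: prob_density_def)
  note ip = prob_density_integrable(1)[OF p] and iq = prob_density_integrable(1)[OF q]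
  note Pp = prob_density_prob_space[OF p] and Pq = prob_density_prob_space[OF q]
  have main: "(\<integral>x. indicator A x * p x \<partial>lborel) \<le> (\<integral>x. indicator A x * q x \<partial>lborel) + e"
    "(\<integral>x. indicator A x * q x \<partial>lborel) \<le> (\<integral>x. indicator A x * p x \<partial>lborel) + e" if A: "A \<in> sets borel" for A
    using tv_le_measure[OF Pp _ Pq _ tv A] tv_le_measure[OF Pq _ Pp _ tv_le_sym[OF tv] A]
    by (simp_all add: prob_density_measure p q A)
  let ?A = "{x. q x \<le> p x}"
  have A1: "?A \<in> sets borel" by measurable
  then have A: "?A \<in> sets borel" "- ?A \<in> sets borel" by auto
  have int: "integrable lborel (\<lambda>x. indicator B x * p x)" "integrable lborel (\<lambda>x. indicator B x * q x)"
    if [measurable]: "B \<in> sets borel" for B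
    by (rule Bochner_Integration.integrable_bound[OF ip], simp, simp add: indicator_def)
      (rule Bochner_Integration.integrable_bound[OF iq], simp, simp add: indicator_def)
  have "(\<integral>x. \<bar>p x - q x\<bar> \<partial>lborel) =
     (\<integral>x. (indicator ?A x * p x - indicator ?A x * q x) + (indicator (- ?A) x * q x - indicator (- ?A) x * p x) \<partial>lborel)"
    by (intro Bochner_Integration.integral_cong refl) (auto simp: indicator_def)
  also have "\<dots> = ((\<integral>x. indicator ?A x * p x \<partial>lborel) - (\<integral>x. indicator ?A x * q x \<partial>lborel)) +
     ((\<integral>x. indicator (- ?A) x * q x \<partial>lborel) - (\<integral>x. indicator (- ?A) x * p x \<partial>lborel))"
    using int[OF A(1)] int[OF A(2)] by simp
  also have "\<dots> \<le> 2 * e" using main(1)[OF A(1)] main(2)[OF A(2)] by linarith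
  finally have "(\<integral>x. \<bar>p x - q x\<bar> \<partial>lborel) \<le> 2 * e" .
  moreover have "L1_dist p q = ennreal (\<integral>x. \<bar>p x - q x\<bar> \<partial>lborel)"
    unfolding L1_dist_def by (intro nn_integral_eq_integral) (auto intro!: integrable_abs Bochner_Integration.integrable_diff ip iq)
  ultimately show ?thesis by (simp add: ennreal_leI)
qed

lemma ex_prob_density:
  fixes N :: "(real^'n) measure"
  assumes N: "prob_space N" "sets N = sets borel" and ac: "\<And>A. A \<in> null_sets lborel \<Longrightarrow> measure N A = 0"
  shows "\<exists>p. prob_density p \<and> N = density lborel (\<lambda>x. ennreal (p x))"
proof -
  interpret N: prob_space N by fact
  have "absolutely_continuous lborel N"
    unfolding absolutely_continuous_def using ac N
    by (auto simp: null_sets_def N.emeasure_eq_measure)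
  then obtain g where g [measurable]: "g \<in> borel_measurable lborel" and gN: "density lborel g = N"
    using sigma_finite_measure.Radon_Nikodym[OF sigma_finite_lborel, of N] N by auto
  have 1: "(\<integral>\<^sup>+x. g x \<partial>lborel) = 1"
    using N.emeasure_space_1 by (simp add: gN[symmetric] emeasure_density)
  \<comment> \<open>A density with integral 1 is finite almost everywhere, so the conversion to
    \<open>real\<close> changes it on a null set only.\<close>
  have "AE x in lborel. g x \<noteq> \<infinity>" by (rule nn_integral_PInf_AE) (auto simp: 1)
  then have ae: "AE x in lborel. ennreal (enn2real (g x)) = g x"
    by eventually_elim (simp add: less_top)
  then have "(\<integral>\<^sup>+x. ennreal (enn2real (g x)) \<partial>lborel) = 1"
    unfolding 1[symmetric] by (rule nn_integral_cong_AE)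
  moreover have "density lborel (\<lambda>x. ennreal (enn2real (g x))) = density lborel g"
    using ae by (intro density_cong) auto
  ultimately show ?thesis
    by (intro exI[of _ "\<lambda>x. enn2real (g x)"]) (auto simp: prob_density_def gN)
qed

lemma (in prob_space) expectation_split_bound:
  fixes g :: "'a \<Rightarrow> real"
  assumes [measurable]: "g \<in> borel_measurable M" "G \<in> events"
    and a: "0 \<le> a" "\<And>z. z \<in> G \<Longrightarrow> \<bar>g z\<bar> \<le> a" and b: "\<And>z. z \<in> space M \<Longrightarrow> \<bar>g z\<bar> \<le> b"
  shows "\<bar>expectation g\<bar> \<le> a + b * prob (space M - G)"
proof -
  have ig: "integrable M g" by (rule integrable_const_bound[of _ b]) (auto intro!: AE_I2 b)
  have ii: "integrable M (\<lambda>z. b * indicator (space M - G) z :: real)"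
    by (rule integrable_const_bound[of _ "\<bar>b\<bar>"]) (auto simp: indicator_def)
  have "\<bar>expectation g\<bar> \<le> expectation (\<lambda>z. \<bar>g z\<bar>)" by (rule integral_abs_bound)
  also have "\<dots> \<le> expectation (\<lambda>z. a + b * indicator (space M - G) z)"
    using a by (intro integral_mono integrable_abs ig Bochner_Integration.integrable_add ii) (auto simp: indicator_def add_increasing b)
  also have "\<dots> = a + b * prob (space M - G)"
    using ii by (simp add: prob_space)
  finally show ?thesis .
qed

lemma ball_mass:
  fixes \<rho> :: "(real^'n) measure"
  assumes \<rho>: "prob_space \<rho>" "sets \<rho> = sets borel" and e: "0 < e"
  shows "\<exists>r>0. measure \<rho> (space \<rho> - cball 0 r) < e"
proof -
  interpret prob_space \<rho> by fact
  have sp: "space \<rho> = UNIV" using sets_eq_imp_space_eq[OF \<rho>(2)] by simp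
  have "\<exists>n. prob (space \<rho> - cball 0 (real (Suc n))) < e"
  proof (rule incseq_exhausting[OF _ _ _ e])
    show "range (\<lambda>n. cball 0 (real (Suc n))) \<subseteq> events"
      unfolding \<rho>(2) by (intro image_subsetI borel_closed closed_cball)
    show "incseq (\<lambda>n. cball (0::real^'n) (real (Suc n)))" by (auto simp: incseq_def)
    show "(\<Union>n. cball 0 (real (Suc n))) = space \<rho>"
    proof -
      have "\<exists>n. x \<in> cball 0 (real (Suc n))" for x :: "real^'n"
      proof -
        obtain n :: nat where "norm x \<le> real n" using real_arch_simple by blast
        then show ?thesis by (intro exI[of _ n]) simp
      qed
      then show ?thesis unfolding sp by blast
    qed
  qed
  then obtain n where "prob (space \<rho> - cball 0 (real (Suc n))) < e" ..
  then show ?thesis by (intro exI[of _ "real (Suc n)"]) auto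
qed

lemma unit_test_integrable:
  assumes "prob_space M" "u \<in> borel_measurable M" "unit_test f"
  shows "integrable M (\<lambda>z. f (u z))" "\<bar>\<integral>z. f (u z) \<partial>M\<bar> \<le> 1"
proof -
  interpret prob_space M by fact
  have [measurable]: "(\<lambda>z. f (u z)) \<in> borel_measurable M"
    by (rule measurable_compose[OF assms(2) unit_testD(3)[OF assms(3)]])
  show i: "integrable M (\<lambda>z. f (u z))"
    by (rule integrable_const_bound[of _ 1]) (auto intro!: unit_testD(2)[OF assms(3)])
  have "f (u z) \<le> 1" "-1 \<le> f (u z)" for z using unit_testD(2)[OF assms(3), of "u z"] by (auto simp: abs_le_iff)
  then show "\<bar>\<integral>z. f (u z) \<partial>M\<bar> \<le> 1"
    using integral_le_const[OF i, of 1] integral_ge_const[OF i, of "-1"] by (auto simp: abs_le_iff minus_le_iff)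
qed

section \<open>The averaged law of the flow\<close>

locale noisy_law = noisy_flow F \<sigma> \<eta> phi
  for F :: "real^'n \<Rightarrow> real^'n" and \<sigma> \<eta> :: "real^'n^'n"
    and phi :: "real \<Rightarrow> (real \<Rightarrow> real^'n) \<Rightarrow> (real \<Rightarrow> real^'n) \<Rightarrow> real^'n \<Rightarrow> real^'n" +
  fixes P :: "(real \<Rightarrow> real^'n) measure" and \<rho> :: "(real^'n) measure"
  assumes P: "wiener_measure P" and \<rho>: "prob_space \<rho>" "sets \<rho> = sets borel"
begin

sublocale P: prob_space P using P by (rule wiener_measureD)
sublocale R: prob_space \<rho> by (rule \<rho>)
sublocale RP: pair_prob_space \<rho> P ..

lemma space_P [simp]: "space P = C0" by (rule wiener_measureD(2)[OF P])
lemma space_\<rho> [simp]: "space \<rho> = UNIV" using sets_eq_imp_space_eq[OF \<rho>(2)] by simp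

lemma cball_events: "cball 0 r \<in> sets \<rho>"
  unfolding \<rho>(2) by (intro borel_closed closed_cball)

lemma measurable_P [simp]: "f \<in> P \<rightarrow>\<^sub>M N \<longleftrightarrow> f \<in> path_space \<rightarrow>\<^sub>M N"
  by (subst measurable_cong_sets[OF wiener_measureD(3)[OF P] refl]) (rule refl)

lemma measurable_Y_pair:
  assumes "\<beta> \<in> C0" "0 \<le> t"
  shows "(\<lambda>(x, \<omega>). Y t \<omega> \<beta> x) \<in> borel_measurable (\<rho> \<Otimes>\<^sub>M P)"
proof -
  have s: "(\<lambda>z. snd z) \<in> \<rho> \<Otimes>\<^sub>M P \<rightarrow>\<^sub>M path_space"
    using measurable_snd[of \<rho> P] measurable_cong_sets[OF refl wiener_measureD(3)[OF P]] by blast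
  have f: "(\<lambda>z. fst z) \<in> borel_measurable (\<rho> \<Otimes>\<^sub>M P)"
    using measurable_fst[of \<rho> P] measurable_cong_sets[OF refl \<rho>(2)] by blast
  show ?thesis unfolding split_beta' by (intro measurable_Y s f) (use assms in auto)
qed

text \<open>The law of \<open>Y\<close>, not of the flow, with initial value and intrinsic noise
  averaged out and \<open>\<beta>\<close> fixed: its density is the candidate for the random
  Fokker--Planck equation.\<close>

definition law :: "real \<Rightarrow> (real \<Rightarrow> real^'n) \<Rightarrow> (real^'n) measure" where
  "law t \<beta> = distr (\<rho> \<Otimes>\<^sub>M P) borel (\<lambda>(x, \<omega>). Y t \<omega> \<beta> x)"

lemma sets_law [simp]: "sets (law t \<beta>) = sets borel" and space_law [simp]: "space (law t \<beta>) = UNIV"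
  by (simp_all add: law_def)

lemma prob_space_law: "\<beta> \<in> C0 \<Longrightarrow> 0 \<le> t \<Longrightarrow> prob_space (law t \<beta>)"
  unfolding law_def by (intro RP.prob_space_distr measurable_Y_pair)

lemma law_integral:
  fixes f :: "real^'n \<Rightarrow> real"
  assumes \<beta>: "\<beta> \<in> C0" and t: "0 \<le> t" and f: "f \<in> borel_measurable borel" and B: "\<And>y. \<bar>f y\<bar> \<le> B"
  shows "(\<integral>y. f y \<partial>law t \<beta>) = (\<integral>x. (\<integral>\<omega>. f (Y t \<omega> \<beta> x) \<partial>P) \<partial>\<rho>)"
proof -
  have m: "(\<lambda>(x, \<omega>). f (Y t \<omega> \<beta> x)) \<in> borel_measurable (\<rho> \<Otimes>\<^sub>M P)"
    using measurable_compose[OF measurable_Y_pair[OF \<beta> t] f] by (simp add: split_beta')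
  have "(\<integral>y. f y \<partial>law t \<beta>) = (\<integral>z. f (case z of (x, \<omega>) \<Rightarrow> Y t \<omega> \<beta> x) \<partial>(\<rho> \<Otimes>\<^sub>M P))"
    unfolding law_def by (rule integral_distr[OF measurable_Y_pair[OF \<beta> t] f])
  also have "\<dots> = (\<integral>(x, \<omega>). f (Y t \<omega> \<beta> x) \<partial>(\<rho> \<Otimes>\<^sub>M P))" by (simp add: split_beta')
  also have "\<dots> = (\<integral>x. (\<integral>\<omega>. f (Y t \<omega> \<beta> x) \<partial>P) \<partial>\<rho>)"
  proof -
    have "integrable (\<rho> \<Otimes>\<^sub>M P) (\<lambda>(x, \<omega>). f (Y t \<omega> \<beta> x))"
      using m B by (intro RP.integrable_const_bound[of _ B]) (auto intro!: AE_I2)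
    from RP.integral_fst'[OF this] show ?thesis by simp
  qed
  finally show ?thesis .
qed

lemma measurable_inner:
  fixes f :: "real^'n \<Rightarrow> real"
  assumes \<beta>: "\<beta> \<in> C0" and t: "0 \<le> t" and f: "f \<in> borel_measurable borel"
  shows "(\<lambda>x. \<integral>\<omega>. f (Y t \<omega> \<beta> x) \<partial>P) \<in> borel_measurable borel"
proof -
  have m: "(\<lambda>(x, \<omega>). f (Y t \<omega> \<beta> x)) \<in> borel_measurable (\<rho> \<Otimes>\<^sub>M P)"
    using measurable_compose[OF measurable_Y_pair[OF \<beta> t] f] by (simp add: split_beta')
  from P.borel_measurable_lebesgue_integral[OF m] show ?thesis
    by (simp add: measurable_cong_sets[OF \<rho>(2) refl])
qed

text \<open>The estimate for a fixed starting point is uniform on a ball and is averaged over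
  \<open>\<rho>\<close>; the starting points outside the ball have mass below
  \<open>e / 4\<close>.\<close>

lemma law_translation:
  assumes T0: "0 < T0" and e: "0 < e"
  obtains d where "0 < d" "\<And>T \<beta> v f. T0 \<le> T \<Longrightarrow> T \<le> T1 \<Longrightarrow> \<beta> \<in> C0 \<Longrightarrow> (\<And>s. s \<in> {0..T1} \<Longrightarrow> norm (\<beta> s) \<le> M) \<Longrightarrow>
     norm v \<le> d \<Longrightarrow> unit_test f \<Longrightarrow> \<bar>(\<integral>y. f (y + v) \<partial>law T \<beta>) - (\<integral>y. f y \<partial>law T \<beta>)\<bar> \<le> e"
proof -
  obtain r where r: "0 < r" "R.prob (space \<rho> - cball 0 r) < e / 4"
    using ball_mass[OF \<rho>, of "e / 4"] e by auto
  obtain d where d: "0 < d" "\<And>T \<beta> x v f. T0 \<le> T \<Longrightarrow> T \<le> T1 \<Longrightarrow> \<beta> \<in> C0 \<Longrightarrow> (\<And>s. s \<in> {0..T1} \<Longrightarrow> norm (\<beta> s) \<le> M) \<Longrightarrow>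
     norm x \<le> r \<Longrightarrow> norm v \<le> d \<Longrightarrow> unit_test f \<Longrightarrow>
     \<bar>(\<integral>\<omega>. f (Y T \<omega> \<beta> x + v) \<partial>P) - (\<integral>\<omega>. f (Y T \<omega> \<beta> x) \<partial>P)\<bar> \<le> e / 2"
    using translation_continuity[OF P T0, of "e / 2"] e by (metis half_gt_zero)
  show ?thesis
  proof (rule that[OF d(1)])
    fix T and \<beta> :: "real \<Rightarrow> real^'n" and v :: "real^'n" and f :: "real^'n \<Rightarrow> real"
    assume T: "T0 \<le> T" "T \<le> T1" and \<beta>: "\<beta> \<in> C0" and M: "\<And>s. s \<in> {0..T1} \<Longrightarrow> norm (\<beta> s) \<le> M"
      and v: "norm v \<le> d" and f: "unit_test f"
    have T': "0 \<le> T" using T T0 by simp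
    note fv = unit_test_translate[OF f, of v]
    let ?g1 = "\<lambda>x. \<integral>\<omega>. f (Y T \<omega> \<beta> x + v) \<partial>P" and ?g2 = "\<lambda>x. \<integral>\<omega>. f (Y T \<omega> \<beta> x) \<partial>P"
    have gm: "?g1 \<in> borel_measurable \<rho>" "?g2 \<in> borel_measurable \<rho>"
      using measurable_inner[OF \<beta> T' unit_testD(3)[OF fv]] measurable_inner[OF \<beta> T' unit_testD(3)[OF f]]
      by (simp_all add: measurable_cong_sets[OF \<rho>(2) refl])
    have g1: "\<bar>?g1 x\<bar> \<le> 1" and g2: "\<bar>?g2 x\<bar> \<le> 1" for x
      using unit_test_integrable(2)[OF P.prob_space_axioms measurable_Y_wiener(1)[OF P \<beta> T'] f]
        unit_test_integrable(2)[OF P.prob_space_axioms measurable_Y_wiener(1)[OF P \<beta> T'] fv] by auto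
    have i: "integrable \<rho> ?g1" "integrable \<rho> ?g2"
      using gm g1 g2 by (auto intro!: R.integrable_const_bound[of _ 1])
    have "(\<integral>y. f (y + v) \<partial>law T \<beta>) - (\<integral>y. f y \<partial>law T \<beta>) = (\<integral>x. ?g1 x - ?g2 x \<partial>\<rho>)"
      using law_integral[OF \<beta> T' unit_testD(3)[OF fv] unit_testD(2)[OF fv]]
        law_integral[OF \<beta> T' unit_testD(3)[OF f] unit_testD(2)[OF f]] by (simp add: i)
    also have "\<bar>\<dots>\<bar> \<le> e / 2 + 2 * R.prob (space \<rho> - cball 0 r)"
    proof (rule R.expectation_split_bound)
      show "\<bar>?g1 x - ?g2 x\<bar> \<le> e / 2" if "x \<in> cball 0 r" for x
        by (rule d(2)[OF T \<beta> M _ v f]) (use that in auto)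
      show "\<bar>?g1 x - ?g2 x\<bar> \<le> 2" for x using g1[of x] g2[of x] by linarith
    qed (use gm e cball_events in auto)
    finally show "\<bar>(\<integral>y. f (y + v) \<partial>law T \<beta>) - (\<integral>y. f y \<partial>law T \<beta>)\<bar> \<le> e" using r(2) by linarith
  qed
qed

text \<open>For \<open>h > 0\<close>, convolution with the centred Gaussian of covariance
  \<open>h\<close> times \<open>\<sigma> ** transpose \<sigma>\<close>: the law after a short step
  if the drift is ignored.\<close>

definition smear :: "real \<Rightarrow> (real^'n) measure \<Rightarrow> (real^'n) measure" where
  "smear h m = distr (m \<Otimes>\<^sub>M P) borel (\<lambda>(y, \<omega>). y + \<sigma> *v \<omega> h)"

lemma measurable_smear:
  assumes "sets m = sets borel"
  shows "(\<lambda>(y, \<omega>). y + \<sigma> *v \<omega> h) \<in> borel_measurable (m \<Otimes>\<^sub>M P)"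
proof -
  have s: "(\<lambda>z. snd z) \<in> m \<Otimes>\<^sub>M P \<rightarrow>\<^sub>M path_space"
    using measurable_snd[of m P] measurable_cong_sets[OF refl wiener_measureD(3)[OF P]] by blast
  have f: "(\<lambda>z. fst z) \<in> borel_measurable (m \<Otimes>\<^sub>M P)"
    using measurable_fst[of m P] measurable_cong_sets[OF refl assms] by blast
  show ?thesis unfolding split_beta'
    by (intro borel_measurable_add f measurable_compose[OF measurable_compose[OF s measurable_eval] borel_measurable_matrix_vector])
qed

lemma sets_smear [simp]: "sets (smear h m) = sets borel"
  by (simp add: smear_def)

lemma prob_space_smear: "prob_space m \<Longrightarrow> sets m = sets borel \<Longrightarrow> prob_space (smear h m)"
  unfolding smear_def by (intro prob_space.prob_space_distr prob_space_pair measurable_smear P.prob_space_axioms)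

lemma smear_integral:
  fixes f :: "real^'n \<Rightarrow> real"
  assumes m: "prob_space m" "sets m = sets borel" and f: "f \<in> borel_measurable borel" and B: "\<And>y. \<bar>f y\<bar> \<le> B"
  shows "(\<integral>y. f y \<partial>smear h m) = (\<integral>y. (\<integral>\<omega>. f (y + \<sigma> *v \<omega> h) \<partial>P) \<partial>m)"
    "(\<integral>y. f y \<partial>smear h m) = (\<integral>\<omega>. (\<integral>y. f (y + \<sigma> *v \<omega> h) \<partial>m) \<partial>P)"
    "(\<lambda>\<omega>. \<integral>y. f (y + \<sigma> *v \<omega> h) \<partial>m) \<in> borel_measurable P"
proof -
  interpret m: prob_space m by fact
  interpret mP: pair_prob_space m P ..
  have meas: "(\<lambda>(y, \<omega>). f (y + \<sigma> *v \<omega> h)) \<in> borel_measurable (m \<Otimes>\<^sub>M P)"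
    using measurable_compose[OF measurable_smear[OF m(2)] f] by (simp add: split_beta')
  have int: "integrable (m \<Otimes>\<^sub>M P) (\<lambda>(y, \<omega>). f (y + \<sigma> *v \<omega> h))"
    using meas B by (intro mP.integrable_const_bound[of _ B]) (auto intro!: AE_I2)
  have "(\<integral>y. f y \<partial>smear h m) = (\<integral>z. f (case z of (y, \<omega>) \<Rightarrow> y + \<sigma> *v \<omega> h) \<partial>(m \<Otimes>\<^sub>M P))"
    unfolding smear_def by (rule integral_distr[OF measurable_smear[OF m(2)] f])
  then have eq: "(\<integral>y. f y \<partial>smear h m) = (\<integral>(y, \<omega>). f (y + \<sigma> *v \<omega> h) \<partial>(m \<Otimes>\<^sub>M P))" by (simp add: split_beta')
  show "(\<integral>y. f y \<partial>smear h m) = (\<integral>y. (\<integral>\<omega>. f (y + \<sigma> *v \<omega> h) \<partial>P) \<partial>m)"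
    using mP.integral_fst'[OF int] by (simp add: eq)
  show "(\<integral>y. f y \<partial>smear h m) = (\<integral>\<omega>. (\<integral>y. f (y + \<sigma> *v \<omega> h) \<partial>m) \<partial>P)"
    using mP.integral_snd[OF int] by (simp add: eq)
  have "(\<lambda>(\<omega>, y). f (y + \<sigma> *v \<omega> h)) \<in> borel_measurable (P \<Otimes>\<^sub>M m)"
    using measurable_compose[OF measurable_pair_swap' meas] by (simp add: split_beta')
  from m.borel_measurable_lebesgue_integral[OF this]
  show "(\<lambda>\<omega>. \<integral>y. f (y + \<sigma> *v \<omega> h) \<partial>m) \<in> borel_measurable P" by simp
qed

definition shift_le :: "(real^'n) measure \<Rightarrow> real \<Rightarrow> real \<Rightarrow> bool" where
  "shift_le m d e \<longleftrightarrow> (\<forall>v f. norm v \<le> d \<longrightarrow> unit_test f \<longrightarrow> \<bar>(\<integral>y. f (y + v) \<partial>m) - (\<integral>y. f y \<partial>m)\<bar> \<le> e)"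

text \<open>If small translations change \<open>m\<close> little, so does convolution with noise
  that is small with high probability. The threshold depends on the translation modulus but not on
  \<open>m\<close>, which allows uniformity in time later.\<close>

lemma smear_close:
  assumes e: "0 < e" and d: "0 < d"
  obtains \<delta> where "0 < \<delta>" "\<And>h m. 0 < h \<Longrightarrow> h \<le> \<delta> \<Longrightarrow> prob_space m \<Longrightarrow> sets m = sets borel \<Longrightarrow> shift_le m d (e / 2) \<Longrightarrow>
    tv_le (smear h m) m e"
proof -
  obtain c where c: "0 < c" "\<And>y. norm (\<sigma> *v y) \<le> c * norm y" using matrix_vector_norm_bound by blast
  obtain \<delta> where \<delta>: "0 < \<delta>" "P.prob (C0 - small_paths \<delta> (d / c)) < e / 4"
    using small_paths_short_time[OF P, of "e / 4" "d / c"] e d c by auto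
  show ?thesis
  proof (rule that[OF \<delta>(1)])
    fix h m assume h: "0 < h" "h \<le> \<delta>" and m: "prob_space m" "sets m = sets borel" and sh: "shift_le m d (e / 2)"
    interpret m: prob_space m by fact
    show "tv_le (smear h m) m e"
      unfolding tv_le_def
    proof (intro allI impI)
      fix f :: "real^'n \<Rightarrow> real" assume f: "unit_test f"
      note ff = unit_testD(3)[OF f] unit_testD(2)[OF f]
      let ?g = "\<lambda>\<omega>. \<integral>y. f (y + \<sigma> *v \<omega> h) \<partial>m" and ?c = "\<integral>y. f y \<partial>m"
      have um: "(\<lambda>y. y + v) \<in> borel_measurable m" for v
        by (subst measurable_cong_sets[OF m(2) refl]) measurable
      have g: "\<bar>?g \<omega>\<bar> \<le> 1" for \<omega> by (rule unit_test_integrable(2)[OF m(1) um f])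
      have c1: "\<bar>?c\<bar> \<le> 1" using unit_test_integrable(2)[OF m(1) um[of 0] f] by simp
      have gm: "?g \<in> borel_measurable P" by (rule smear_integral(3)[OF m ff])
      have ig: "integrable P ?g" using gm g by (auto intro!: P.integrable_const_bound[of _ 1])
      have "(\<integral>y. f y \<partial>smear h m) - ?c = (\<integral>\<omega>. ?g \<omega> - ?c \<partial>P)"
        using ig P.prob_space by (simp add: smear_integral(2)[OF m ff])
      also have "\<bar>\<dots>\<bar> \<le> e / 2 + 2 * P.prob (space P - small_paths \<delta> (d / c))"
      proof (rule P.expectation_split_bound)
        show "\<bar>?g \<omega> - ?c\<bar> \<le> e / 2" if "\<omega> \<in> small_paths \<delta> (d / c)" for \<omega>
        proof -
          have "norm (\<omega> h) \<le> d / c" using that h by (auto simp: small_paths_def)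
          then have "c * norm (\<omega> h) \<le> d" using c by (simp add: pos_le_divide_eq mult.commute)
          then have "norm (\<sigma> *v \<omega> h) \<le> d" using c(2)[of "\<omega> h"] by linarith
          then show ?thesis using sh f unfolding shift_le_def by blast
        qed
        show "\<bar>?g \<omega> - ?c\<bar> \<le> 2" for \<omega> using g[of \<omega>] c1 by linarith
        show "small_paths \<delta> (d / c) \<in> P.events" by (simp add: wiener_measureD(3)[OF P])
      qed (use gm e in auto)
      finally show "\<bar>(\<integral>y. f y \<partial>smear h m) - ?c\<bar> \<le> e" using \<delta>(2) by simp
    qed
  qed
qed

text \<open>The preimage lies in a linear, hence Lipschitz, image of a translate of
  \<open>A\<close>, and such maps of the space into itself preserve negligible sets.\<close>

lemma null_sets_preimage_\<sigma>:
  assumes "A \<in> null_sets lborel"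
  shows "{z. y + \<sigma> *v z \<in> A} \<in> null_sets lborel"
proof -
  have lin: "linear ((*v) \<sigma>)" by (rule matrix_vector_mul_linear)
  have inj: "inj ((*v) \<sigma>)"
  proof (rule linear_injective_0[OF lin, THEN iffD2], intro allI impI)
    fix x assume "\<sigma> *v x = 0"
    then show "x = 0" using \<sigma> unfolding pos_def_def by (metis inner_zero_right less_irrefl)
  qed
  obtain S where S: "linear S" "S \<circ> (*v) \<sigma> = id"
    using linear_injective_left_inverse[OF lin inj] by blast
  have SS: "S (\<sigma> *v z) = z" for z using S(2) by (metis comp_apply id_apply)
  have [measurable]: "A \<in> sets borel" using assms by (simp add: null_sets_def)
  have "negligible A" using assms by (simp add: negligible_iff_null_sets null_sets_completionI)
  then have "negligible ((+) (- y) ` A)" by (rule negligible_translation)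
  then have "negligible (S ` ((+) (- y) ` A))"
  proof (rule negligible_locally_Lipschitz_image[rotated])
    fix x
    obtain B where "\<And>z. norm (S z) \<le> B * norm z" using linear_bounded[OF S(1)] by blast
    then have "\<forall>z\<in>((+) (- y) ` A) \<inter> UNIV. norm (S z - S x) \<le> B * norm (z - x)"
      by (simp flip: linear_diff[OF S(1)])
    then show "\<exists>T B. open T \<and> x \<in> T \<and> (\<forall>z\<in>((+) (- y) ` A) \<inter> T. norm (S z - S x) \<le> B * norm (z - x))"
      by (intro exI[of _ UNIV] exI[of _ B]) simp
  qed simp
  moreover have "{z. y + \<sigma> *v z \<in> A} \<subseteq> S ` ((+) (- y) ` A)"
  proof
    fix z assume "z \<in> {z. y + \<sigma> *v z \<in> A}"
    then have "S (- y + (y + \<sigma> *v z)) \<in> S ` ((+) (- y) ` A)" by blast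
    then show "z \<in> S ` ((+) (- y) ` A)" by (simp add: SS)
  qed
  ultimately have "negligible {z. y + \<sigma> *v z \<in> A}" by (rule negligible_subset)
  moreover have "{z. y + \<sigma> *v z \<in> A} \<in> sets borel" by measurable
  ultimately show ?thesis by (simp add: negligible_iff_null_sets null_sets_def)
qed

lemma smear_null:
  assumes m: "prob_space m" "sets m = sets borel" and h: "0 < h" and A: "A \<in> null_sets lborel"
  shows "measure (smear h m) A = 0"
proof -
  have Ab: "A \<in> sets borel" using A by (simp add: null_sets_def)
  interpret s: prob_space "smear h m" by (rule prob_space_smear[OF m])
  have im: "indicator A \<in> borel_measurable (borel :: (real^'n) measure)" using Ab by simp
  have "(\<integral>\<omega>. indicator A (y + \<sigma> *v \<omega> h) \<partial>P) = (0::real)" for y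
  proof -
    have mz: "(\<lambda>z. indicator A (y + \<sigma> *v z) :: real) \<in> borel_measurable borel"
      by (rule measurable_compose[OF _ im]) measurable
    have "(\<integral>\<omega>. indicator A (y + \<sigma> *v \<omega> h) \<partial>P) = (\<integral>z. indicator A (y + \<sigma> *v z) \<partial>gauss h :: real)"
      by (rule integral_wiener_marginal[OF P h mz])
    also have "AE z in lborel. y + \<sigma> *v z \<notin> A"
      using null_sets_preimage_\<sigma>[OF A, of y] by (auto dest: AE_not_in)
    then have "AE z in gauss h. y + \<sigma> *v z \<notin> A"
      unfolding gauss_def by (subst AE_density) auto
    then have "AE z in gauss h. indicator A (y + \<sigma> *v z) = (0::real)" by eventually_elim simp
    then have "(\<integral>z. indicator A (y + \<sigma> *v z) \<partial>gauss h) = (0::real)" by (rule integral_eq_zero_AE)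
    finally show ?thesis .
  qed
  moreover have "(\<integral>z. indicator A z \<partial>smear h m) = (\<integral>y. (\<integral>\<omega>. indicator A (y + \<sigma> *v \<omega> h) \<partial>P) \<partial>m :: real)"
    by (rule smear_integral(1)[OF m im, of 1]) (simp add: indicator_def)
  ultimately have "(\<integral>z. indicator A z \<partial>smear h m) = (0::real)" by simp
  then show ?thesis using sets_eq_imp_space_eq[OF sets_smear[of h m]] by simp
qed

text \<open>Continuity under translations makes \<open>m\<close> the total variation limit of its
  Gaussian convolutions, all of which vanish on null sets.\<close>

lemma absolutely_continuous_if_shift:
  assumes m: "prob_space m" "sets m = sets borel" and sh: "\<And>e. 0 < e \<Longrightarrow> \<exists>d>0. shift_le m d e"
    and A: "A \<in> null_sets lborel"
  shows "measure m A = 0"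
proof -
  have Ab: "A \<in> sets borel" using A by (simp add: null_sets_def)
  have "measure m A \<le> 0"
  proof (rule field_le_epsilon)
    fix e :: real assume e: "0 < e"
    obtain d where d: "0 < d" "shift_le m d (e / 2)" using sh[of "e / 2"] e by auto
    obtain \<delta> where \<delta>: "0 < \<delta>" "\<And>h m. 0 < h \<Longrightarrow> h \<le> \<delta> \<Longrightarrow> prob_space m \<Longrightarrow> sets m = sets borel \<Longrightarrow> shift_le m d (e / 2) \<Longrightarrow>
        tv_le (smear h m) m e" using smear_close[OF e d(1)] by blast
    have "tv_le m (smear \<delta> m) e" by (rule tv_le_sym, rule \<delta>(2)[OF \<delta>(1) order_refl m d(2)])
    from tv_le_measure[OF m prob_space_smear[OF m] _ this Ab]
    show "measure m A \<le> 0 + e" using smear_null[OF m \<delta>(1) A] by simp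
  qed
  then show ?thesis by (simp add: measure_le_0_iff)
qed

text \<open>By the Markov property at \<open>s\<close>, the last piece is a short flow started at
  \<open>phi s\<close>, which \<open>short_time_gaussian\<close> compares with a Gaussian step.
  Restricting to small paths and to starting points in a ball makes the comparison uniform in
  \<open>s\<close>.\<close>

lemma law_short_time:
  assumes \<beta>: "\<beta> \<in> C0" and e: "0 < e" and T1: "0 \<le> T1"
  obtains d where "0 < d" "\<And>s h. 0 \<le> s \<Longrightarrow> s \<le> T1 \<Longrightarrow> 0 < h \<Longrightarrow> h \<le> d \<Longrightarrow> tv_le (law (s + h) \<beta>) (smear h (law s \<beta>)) e"
proof -
  obtain c where c: "0 < c" "\<And>y. norm (\<eta> *v y) \<le> c * norm y" using matrix_vector_norm_bound by blast
  obtain M0 where M0: "0 < M0" "\<And>s. s \<in> {0..T1 + 1} \<Longrightarrow> norm (\<beta> s) \<le> M0"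
    using path_bounded[of "T1 + 1" \<beta>] \<beta> by (auto intro: continuous_intros)
  obtain M1 where M1: "0 < M1" "P.prob (C0 - small_paths (T1 + 1) M1) < e / 8"
    using small_paths_large_bound[OF P, of "e / 8" "T1 + 1"] e by auto
  obtain r where r: "0 < r" "R.prob (space \<rho> - cball 0 r) < e / 8"
    using ball_mass[OF \<rho>, of "e / 8"] e by auto
  obtain R where R: "0 < R" "\<And>\<omega> \<beta> x s. \<omega> \<in> C0 \<Longrightarrow> \<beta> \<in> C0 \<Longrightarrow>
    (\<And>s. s \<in> {0..T1 + 1} \<Longrightarrow> norm (\<omega> s) \<le> max M0 M1 \<and> norm (\<beta> s) \<le> max M0 M1) \<Longrightarrow> norm x \<le> r \<Longrightarrow> s \<in> {0..T1 + 1} \<Longrightarrow> norm (Y s \<omega> \<beta> x) \<le> R"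
    using a_priori_bound by blast
  obtain d where d: "0 < d" "\<And>h \<beta> y f. 0 < h \<Longrightarrow> h \<le> d \<Longrightarrow> \<beta> \<in> C0 \<Longrightarrow> (\<And>s. s \<in> {0..1} \<Longrightarrow> norm (\<beta> s) \<le> 2 * M0) \<Longrightarrow>
     norm y \<le> R + c * M0 \<Longrightarrow> unit_test f \<Longrightarrow>
     \<bar>(\<integral>\<omega>. f (Y h \<omega> \<beta> y) \<partial>P) - (\<integral>\<omega>. f (y + \<sigma> *v \<omega> h) \<partial>P)\<bar> \<le> e / 2"
    using short_time_gaussian[OF P, of "e / 2" "2 * M0" "R + c * M0"] e by auto
  show ?thesis
  proof (rule that[of "min 1 d"])
    show "0 < min 1 d" using d by simp
    fix s h :: real assume s: "0 \<le> s" "s \<le> T1" and h: "0 < h" "h \<le> min 1 d"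
    let ?th = "wiener_shift s \<beta>"
    have th: "?th \<in> C0" by (rule wiener_shift_C0[OF \<beta>])
    \<comment> \<open>Shifting subtracts a value of the path and so doubles the bound.\<close>
    have thM: "norm (?th u) \<le> 2 * M0" if "u \<in> {0..1}" for u
    proof -
      have "norm (?th u) \<le> norm (\<beta> (u + s)) + norm (\<beta> s)" unfolding wiener_shift_def by (rule norm_triangle_ineq4)
      moreover have "norm (\<beta> (u + s)) \<le> M0" "norm (\<beta> s) \<le> M0" by (rule M0(2), use that s in simp)+
      ultimately show ?thesis by linarith
    qed
    show "tv_le (law (s + h) \<beta>) (smear h (law s \<beta>)) e"
      unfolding tv_le_def
    proof (intro allI impI)
      fix f :: "real^'n \<Rightarrow> real" assume f: "unit_test f"
      \<comment> \<open>The restart is an identity for the flow, the Gaussian comparison one for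
        \<open>Y\<close>; \<open>f1\<close> and \<open>f2\<close> remove the common noise
        accumulated up to \<open>s + h\<close> and up to \<open>s\<close>.\<close>
      define f1 where "f1 y = f (y + - (\<eta> *v \<beta> (s + h)))" for y
      define f2 where "f2 y = f (y + - (\<eta> *v \<beta> s))" for y
      have f1: "unit_test f1" and f2: "unit_test f2" unfolding f1_def f2_def by (rule unit_test_translate[OF f])+
      define H where "H z = (\<integral>\<omega>'. f2 (Y h \<omega>' ?th z) \<partial>P)" for z
      define K where "K z = (\<integral>\<omega>'. f2 (z + \<sigma> *v \<omega>' h) \<partial>P)" for z
      have Hm: "H \<in> borel_measurable borel" unfolding H_def
        by (rule measurable_inner[OF th less_imp_le[OF h(1)] unit_testD(3)[OF f2]])
      have Km: "K \<in> borel_measurable borel"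
      proof -
        have "(\<lambda>(y, \<omega>). f2 (y + \<sigma> *v \<omega> h)) \<in> borel_measurable (\<rho> \<Otimes>\<^sub>M P)"
          using measurable_compose[OF measurable_smear[OF \<rho>(2)] unit_testD(3)[OF f2]] by (simp add: split_beta')
        from P.borel_measurable_lebesgue_integral[OF this] show ?thesis
          by (simp add: K_def[abs_def] measurable_cong_sets[OF \<rho>(2) refl])
      qed
      have wm: "(\<lambda>\<omega>. z + \<sigma> *v \<omega> h) \<in> borel_measurable P" for z
      proof -
        have "(\<lambda>\<omega>. \<sigma> *v \<omega> h) \<in> borel_measurable path_space"
          by (rule measurable_compose[OF measurable_eval borel_measurable_matrix_vector])
        from borel_measurable_add[OF borel_measurable_const this] show ?thesis by simp
      qed
      have H1: "\<bar>H z\<bar> \<le> 1" for z unfolding H_def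
        by (rule unit_test_integrable(2)[OF P.prob_space_axioms measurable_Y_wiener(1)[OF P th less_imp_le[OF h(1)]] f2])
      have K1: "\<bar>K z\<bar> \<le> 1" for z unfolding K_def
        by (rule unit_test_integrable(2)[OF P.prob_space_axioms wm f2])
      have HK: "\<bar>H z - K z\<bar> \<le> e / 2" if "norm z \<le> R + c * M0" for z
        unfolding H_def K_def by (rule d(2)[OF h(1) _ th thM that f2]) (use h in auto)
      have step1: "(\<integral>\<omega>. f (Y (s + h) \<omega> \<beta> x) \<partial>P) = (\<integral>\<omega>. H (phi s \<omega> \<beta> x) \<partial>P)" for x
      proof -
        have "(\<integral>\<omega>. f (Y (s + h) \<omega> \<beta> x) \<partial>P) = (\<integral>\<omega>. f1 (phi (s + h) \<omega> \<beta> x) \<partial>P)"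
          by (simp add: Y_def f1_def)
        also have "\<dots> = (\<integral>\<omega>. (\<integral>\<omega>'. f1 (phi h \<omega>' ?th (phi s \<omega> \<beta> x)) \<partial>P) \<partial>P)"
          by (rule phi_markov[OF P \<beta> s(1) less_imp_le[OF h(1)] unit_testD(3)[OF f1] unit_testD(2)[OF f1]])
        finally have *: "(\<integral>\<omega>. f (Y (s + h) \<omega> \<beta> x) \<partial>P) =
          (\<integral>\<omega>. (\<integral>\<omega>'. f1 (phi h \<omega>' ?th (phi s \<omega> \<beta> x)) \<partial>P) \<partial>P)" .
        have "f1 (phi h \<omega>' ?th z) = f2 (Y h \<omega>' ?th z)" for \<omega>' z
          by (simp add: f1_def f2_def Y_def wiener_shift_def matrix_vector_mult_diff_distrib add.commute)
        then show ?thesis unfolding * H_def by simp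
      qed
      have lawsh: "(\<integral>y. f y \<partial>law (s + h) \<beta>) = (\<integral>x. (\<integral>\<omega>. H (phi s \<omega> \<beta> x) \<partial>P) \<partial>\<rho>)"
        using law_integral[OF \<beta> _ unit_testD(3)[OF f] unit_testD(2)[OF f], of "s + h"] s h by (simp add: step1)
      let ?k = "\<lambda>y. \<integral>\<omega>'. f (y + \<sigma> *v \<omega>' h) \<partial>P"
      have kK: "?k y = K (y + \<eta> *v \<beta> s)" for y
        unfolding K_def f2_def by (intro Bochner_Integration.integral_cong refl arg_cong[where f=f]) simp
      have km: "?k \<in> borel_measurable borel" unfolding kK by (rule measurable_compose[OF _ Km]) measurable
      have "(\<integral>y. f y \<partial>smear h (law s \<beta>)) = (\<integral>y. ?k y \<partial>law s \<beta>)"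
        by (rule smear_integral(1)[OF prob_space_law[OF \<beta> s(1)] sets_law unit_testD(3)[OF f] unit_testD(2)[OF f]])
      also have "\<dots> = (\<integral>x. (\<integral>\<omega>. ?k (Y s \<omega> \<beta> x) \<partial>P) \<partial>\<rho>)"
        by (rule law_integral[OF \<beta> s(1) km, of 1]) (simp add: kK K1)
      also have "\<dots> = (\<integral>x. (\<integral>\<omega>. K (phi s \<omega> \<beta> x) \<partial>P) \<partial>\<rho>)" by (simp add: kK Y_def)
      finally have sm: "(\<integral>y. f y \<partial>smear h (law s \<beta>)) = (\<integral>x. (\<integral>\<omega>. K (phi s \<omega> \<beta> x) \<partial>P) \<partial>\<rho>)" .
      let ?HH = "\<lambda>x. \<integral>\<omega>. H (phi s \<omega> \<beta> x) \<partial>P" and ?KK = "\<lambda>x. \<integral>\<omega>. K (phi s \<omega> \<beta> x) \<partial>P"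
      have mp: "(\<lambda>\<omega>. phi s \<omega> \<beta> x) \<in> borel_measurable P" for x by (rule measurable_Y_wiener(2)[OF P \<beta> s(1)])
      have bd: "integrable P (\<lambda>\<omega>. u (phi s \<omega> \<beta> x))" "\<bar>\<integral>\<omega>. u (phi s \<omega> \<beta> x) \<partial>P\<bar> \<le> 1"
        "integrable \<rho> (\<lambda>x. \<integral>\<omega>. u (phi s \<omega> \<beta> x) \<partial>P)"
        if u: "u \<in> borel_measurable borel" "\<And>z. \<bar>u z\<bar> \<le> (1::real)" for u x
      proof -
        show i: "integrable P (\<lambda>\<omega>. u (phi s \<omega> \<beta> x))" for x
          by (rule P.integrable_const_bound[of _ 1]) (use u measurable_compose[OF mp u(1)] in auto)
        have u2: "u z \<le> 1" "-1 \<le> u z" for z using u(2)[of z] by (auto simp: abs_le_iff)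
        show b: "\<bar>\<integral>\<omega>. u (phi s \<omega> \<beta> x) \<partial>P\<bar> \<le> 1" for x
          using P.integral_le_const[OF i[of x], of 1] P.integral_ge_const[OF i[of x], of "-1"] u2 by (auto simp: abs_le_iff minus_le_iff)
        have "(\<lambda>y. u (y + \<eta> *v \<beta> s)) \<in> borel_measurable borel" by (rule measurable_compose[OF _ u(1)]) measurable
        from measurable_inner[OF \<beta> s(1) this]
        have "(\<lambda>x. \<integral>\<omega>. u (phi s \<omega> \<beta> x) \<partial>P) \<in> borel_measurable \<rho>"
          by (simp add: Y_def measurable_cong_sets[OF \<rho>(2) refl])
        then show "integrable \<rho> (\<lambda>x. \<integral>\<omega>. u (phi s \<omega> \<beta> x) \<partial>P)"
          by (rule R.integrable_const_bound[of _ 1, rotated]) (use b in auto)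
      qed
      note bH = bd[OF Hm H1] and bK = bd[OF Km K1]
      have "(\<integral>y. f y \<partial>law (s + h) \<beta>) - (\<integral>y. f y \<partial>smear h (law s \<beta>)) = (\<integral>x. ?HH x - ?KK x \<partial>\<rho>)"
        unfolding lawsh sm using bH(3) bK(3) by simp
      \<comment> \<open>Error budget: \<open>e / 2\<close> from the Gaussian comparison, and
        \<open>e / 4\<close> each from exceptional paths and from starting points outside the
        ball.\<close>
      also have "\<bar>\<dots>\<bar> \<le> (e / 2 + 2 * (e / 8)) + 2 * R.prob (space \<rho> - cball 0 r)"
      proof (rule R.expectation_split_bound)
        show "(\<lambda>x. ?HH x - ?KK x) \<in> borel_measurable \<rho>"
          by (intro borel_measurable_diff borel_measurable_integrable bH(3) bK(3))
        show "cball 0 r \<in> R.events" by (rule cball_events)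
        show "0 \<le> e / 2 + 2 * (e / 8)" using e by simp
        show "\<bar>?HH x - ?KK x\<bar> \<le> 2" for x using bH(2)[of x] bK(2)[of x] by linarith
        fix x :: "real^'n" assume x: "x \<in> cball 0 r"
        have "?HH x - ?KK x = (\<integral>\<omega>. H (phi s \<omega> \<beta> x) - K (phi s \<omega> \<beta> x) \<partial>P)" using bH(1)[of x] bK(1)[of x] by simp
        also have "\<bar>\<dots>\<bar> \<le> e / 2 + 2 * P.prob (space P - small_paths (T1 + 1) M1)"
        proof (rule P.expectation_split_bound)
          show "(\<lambda>\<omega>. H (phi s \<omega> \<beta> x) - K (phi s \<omega> \<beta> x)) \<in> borel_measurable P"
            by (intro borel_measurable_diff borel_measurable_integrable bH(1) bK(1))
          show "small_paths (T1 + 1) M1 \<in> P.events" by (simp add: wiener_measureD(3)[OF P])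
          show "\<bar>H (phi s \<omega> \<beta> x) - K (phi s \<omega> \<beta> x)\<bar> \<le> 2" for \<omega> using H1[of "phi s \<omega> \<beta> x"] K1[of "phi s \<omega> \<beta> x"] by linarith
          fix \<omega> :: "real \<Rightarrow> real^'n" assume \<omega>: "\<omega> \<in> small_paths (T1 + 1) M1"
          then have \<omega>C: "\<omega> \<in> C0" "\<And>u. u \<in> {0..T1 + 1} \<Longrightarrow> norm (\<omega> u) \<le> M1" by (auto simp: small_paths_def)
          have "norm (Y s \<omega> \<beta> x) \<le> R"
            by (rule R(2)[OF \<omega>C(1) \<beta>]) (use \<omega>C(2) M0(2) x s in \<open>auto intro: le_max_iff_disj[THEN iffD2]\<close>)
          moreover have "norm (\<eta> *v \<beta> s) \<le> c * M0"
            using M0(2)[of s] s c by (intro order_trans[OF c(2)] mult_left_mono) auto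
          ultimately have "norm (phi s \<omega> \<beta> x) \<le> R + c * M0"
            using norm_triangle_mono[of "Y s \<omega> \<beta> x" R "\<eta> *v \<beta> s" "c * M0"] by (simp add: Y_def)
          then show "\<bar>H (phi s \<omega> \<beta> x) - K (phi s \<omega> \<beta> x)\<bar> \<le> e / 2" by (rule HK)
        qed (use e in auto)
        finally show "\<bar>?HH x - ?KK x\<bar> \<le> e / 2 + 2 * (e / 8)" using M1(2) by simp
      qed
      finally show "\<bar>(\<integral>y. f y \<partial>law (s + h) \<beta>) - (\<integral>y. f y \<partial>smear h (law s \<beta>))\<bar> \<le> e" using r(2) by linarith
    qed
  qed
qed

lemma law_shift_le:
  assumes \<beta>: "\<beta> \<in> C0" and T0: "0 < T0" and e: "0 < e"
  obtains d where "0 < d" "\<And>s. T0 \<le> s \<Longrightarrow> s \<le> T1 \<Longrightarrow> shift_le (law s \<beta>) d e"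
proof -
  obtain M0 where M0: "0 < M0" "\<And>s. s \<in> {0..T1} \<Longrightarrow> norm (\<beta> s) \<le> M0"
    using path_bounded[of "T1" \<beta>] \<beta> by (auto intro: continuous_intros)
  obtain d where d: "0 < d" "\<And>T \<beta> v f. T0 \<le> T \<Longrightarrow> T \<le> T1 \<Longrightarrow> \<beta> \<in> C0 \<Longrightarrow> (\<And>s. s \<in> {0..T1} \<Longrightarrow> norm (\<beta> s) \<le> M0) \<Longrightarrow>
     norm v \<le> d \<Longrightarrow> unit_test f \<Longrightarrow> \<bar>(\<integral>y. f (y + v) \<partial>law T \<beta>) - (\<integral>y. f y \<partial>law T \<beta>)\<bar> \<le> e"
    using law_translation[OF T0 e] by blast
  show ?thesis
    by (rule that[OF d(1)]) (unfold shift_le_def, use d(2) \<beta> M0 in blast)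
qed

text \<open>Two comparisons with the Gaussian step: the short-time estimate on one side, translation
  continuity on the other. The latter is uniform only away from time 0, hence
  \<open>T0\<close>.\<close>

lemma law_continuous_pos:
  assumes \<beta>: "\<beta> \<in> C0" and T0: "0 < T0" and e: "0 < e" and T1: "T0 \<le> T1"
  obtains \<delta> where "0 < \<delta>" "\<And>s h. T0 \<le> s \<Longrightarrow> s \<le> T1 \<Longrightarrow> 0 < h \<Longrightarrow> h \<le> \<delta> \<Longrightarrow> tv_le (law (s + h) \<beta>) (law s \<beta>) e"
proof -
  obtain d where d: "0 < d" "\<And>s. T0 \<le> s \<Longrightarrow> s \<le> T1 \<Longrightarrow> shift_le (law s \<beta>) d (e / 2 / 2)"
    using law_shift_le[OF \<beta> T0, of "e / 2 / 2" T1] e by auto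
  obtain \<delta>1 where \<delta>1: "0 < \<delta>1" "\<And>h m. 0 < h \<Longrightarrow> h \<le> \<delta>1 \<Longrightarrow> prob_space m \<Longrightarrow> sets m = sets borel \<Longrightarrow> shift_le m d (e / 2 / 2) \<Longrightarrow>
    tv_le (smear h m) m (e / 2)" using smear_close[of "e / 2" d] e d(1) by auto
  obtain \<delta>2 where \<delta>2: "0 < \<delta>2" "\<And>s h. 0 \<le> s \<Longrightarrow> s \<le> T1 \<Longrightarrow> 0 < h \<Longrightarrow> h \<le> \<delta>2 \<Longrightarrow> tv_le (law (s + h) \<beta>) (smear h (law s \<beta>)) (e / 2)"
    using law_short_time[OF \<beta>, of "e / 2" T1] e T0 T1 by auto
  show ?thesis
  proof (rule that[of "min \<delta>1 \<delta>2"])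
    show "0 < min \<delta>1 \<delta>2" using \<delta>1 \<delta>2 by simp
    fix s h assume s: "T0 \<le> s" "s \<le> T1" and h: "0 < h" "h \<le> min \<delta>1 \<delta>2"
    have "tv_le (law (s + h) \<beta>) (smear h (law s \<beta>)) (e / 2)" by (rule \<delta>2(2)) (use s h T0 in auto)
    moreover have "tv_le (smear h (law s \<beta>)) (law s \<beta>) (e / 2)"
      by (rule \<delta>1(2)) (use s h T0 \<beta> d(2) in \<open>auto intro: prob_space_law\<close>)
    ultimately show "tv_le (law (s + h) \<beta>) (law s \<beta>) e" using tv_le_trans by fastforce
  qed
qed

end

section \<open>Test functions and Taylor expansion\<close>

lemma smoothD:
  assumes "smooth f"
  shows "f differentiable at x" "continuous_on UNIV f" "smooth (partial_deriv i f)"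
proof -
  have "Ck (Suc k) f" for k using assms unfolding smooth_def by blast
  then have d: "\<And>x. f differentiable at x" and p: "\<And>k i. Ck k (partial_deriv i f)" by auto
  show "f differentiable at x" by (rule d)
  show "smooth (partial_deriv i f)" using p by (simp add: smooth_def)
  show "continuous_on UNIV f" using d
    by (simp add: continuous_at_imp_continuous_on differentiable_imp_continuous_within)
qed

lemma frechet_derivative_eq_grad:
  assumes "f differentiable at x"
  shows "frechet_derivative f (at x) v = grad f x \<bullet> v"
proof -
  have lin: "linear (frechet_derivative f (at x))" by (rule linear_frechet_derivative[OF assms])
  have "v = (\<Sum>i\<in>UNIV. (v $ i) *\<^sub>R axis i 1)"
    by (simp add: vec_eq_iff axis_def if_distrib cong: if_cong)
  then have "frechet_derivative f (at x) v = (\<Sum>i\<in>UNIV. frechet_derivative f (at x) ((v $ i) *\<^sub>R axis i 1))"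
    using linear_sum[OF lin, of "\<lambda>i. (v $ i) *\<^sub>R axis i 1" UNIV] by simp
  also have "\<dots> = grad f x \<bullet> v"
    by (simp add: linear_scale[OF lin] grad_def partial_deriv_def inner_vec_def mult.commute)
  finally show ?thesis .
qed

lemma has_derivative_grad:
  assumes "f differentiable at x"
  shows "(f has_derivative (\<lambda>v. grad f x \<bullet> v)) (at x)"
  using frechet_derivative_works[THEN iffD1, OF assms] by (simp add: frechet_derivative_eq_grad[OF assms, abs_def])

lemma deriv_along_line:
  assumes "\<And>x. f differentiable at x"
  shows "((\<lambda>t. f (y + t *\<^sub>R v)) has_real_derivative (\<Sum>i\<in>UNIV. v $ i * partial_deriv i f (y + t *\<^sub>R v))) (at t)"
proof -
  have "((\<lambda>t. y + t *\<^sub>R v) has_derivative (\<lambda>s. s *\<^sub>R v)) (at t)" by (auto intro!: derivative_eq_intros)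
  from has_derivative_compose[OF this has_derivative_grad[OF assms]]
  have "((\<lambda>t. f (y + t *\<^sub>R v)) has_derivative (\<lambda>s. grad f (y + t *\<^sub>R v) \<bullet> (s *\<^sub>R v))) (at t)" .
  then show ?thesis
    by (rule has_derivative_imp_has_field_derivative)
      (simp add: grad_def inner_vec_def sum_distrib_left algebra_simps)
qed

section \<open>Supports and bounds of test functions\<close>

lemma partial_deriv_zero_outside:
  assumes "x \<notin> closure {x. f x \<noteq> 0}"
  shows "partial_deriv i f x = 0"
proof -
  let ?U = "- closure {x. f x \<noteq> 0}"
  have U: "open ?U" "x \<in> ?U" using assms by auto
  have z: "f y = 0" if "y \<in> ?U" for y using that closure_subset[of "{x. f x \<noteq> 0}"] by auto
  have "((\<lambda>_. 0) has_derivative (\<lambda>_. 0)) (at x)" by simp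
  then have "(f has_derivative (\<lambda>_. 0)) (at x)"
    by (rule has_derivative_transform_within_open[OF _ U]) (rule z[symmetric])
  then have "frechet_derivative f (at x) = (\<lambda>_. 0)" by (rule frechet_derivative_at[symmetric])
  then show ?thesis by (simp add: partial_deriv_def)
qed

lemma partial_deriv_test_function:
  assumes "test_function f"
  shows "test_function (partial_deriv i f)"
proof -
  have K: "compact (closure {x. f x \<noteq> 0})" using assms by (simp add: test_function_def)
  have "{x. partial_deriv i f x \<noteq> 0} \<subseteq> closure {x. f x \<noteq> 0}" using partial_deriv_zero_outside by blast
  then have "closure {x. partial_deriv i f x \<noteq> 0} \<subseteq> closure {x. f x \<noteq> 0}" by (rule closure_minimal) simp
  then have "compact (closure {x. partial_deriv i f x \<noteq> 0})"
    using compact_Int_closed[OF K closed_closure[of "{x. partial_deriv i f x \<noteq> 0}"]] by (simp add: Int_absorb1)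
  then show ?thesis using assms smoothD(3) by (auto simp: test_function_def)
qed

lemma test_function_support:
  assumes "test_function f"
  obtains R where "0 < R" "\<And>x. R < norm x \<Longrightarrow> f x = 0"
proof -
  have "bounded (closure {x. f x \<noteq> 0})" using assms by (simp add: test_function_def compact_imp_bounded)
  then obtain R where R: "0 < R" "\<forall>x\<in>closure {x. f x \<noteq> 0}. norm x \<le> R" unfolding bounded_pos by blast
  have "f x = 0" if "R < norm x" for x
    using R(2) that closure_subset[of "{x. f x \<noteq> 0}"] by (meson linorder_not_le mem_Collect_eq subsetD)
  then show ?thesis using that R(1) by blast
qed

lemma test_function_bounded:
  assumes f: "test_function f"
  obtains B where "0 < B" "\<And>x. \<bar>f x\<bar> \<le> B"
proof -
  obtain R where R: "0 < R" "\<And>x. R < norm x \<Longrightarrow> f x = 0" using test_function_support[OF f] by blast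
  have "continuous_on (cball 0 R) f"
    using f smoothD(2) by (auto simp: test_function_def intro: continuous_on_subset)
  then have "bounded (f ` cball 0 R)" by (intro compact_imp_bounded compact_continuous_image) auto
  then obtain B where B: "0 < B" "\<forall>y\<in>f ` cball 0 R. norm y \<le> B" unfolding bounded_pos by blast
  have "\<bar>f x\<bar> \<le> B" for x
  proof (cases "norm x \<le> R")
    case True then show ?thesis using B(2) by auto
  next
    case False then show ?thesis using R(2)[of x] B(1) by simp
  qed
  then show ?thesis using that B(1) by blast
qed

lemma test_functions_bounded:
  fixes f :: "'i::finite \<Rightarrow> real^'n \<Rightarrow> real"
  assumes "\<And>i. test_function (f i)"
  obtains B where "0 < B" "\<And>i x. \<bar>f i x\<bar> \<le> B"
proof -
  have "\<forall>i. \<exists>B>0. \<forall>x. \<bar>f i x\<bar> \<le> B" using test_function_bounded[OF assms] by metis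
  then obtain b where b: "\<And>i. 0 < b i" "\<And>i x. \<bar>f i x\<bar> \<le> b i" by metis
  have "b i \<le> (\<Sum>i\<in>UNIV. b i)" for i by (rule member_le_sum) (use b(1) in \<open>auto intro: less_imp_le\<close>)
  then have "\<bar>f i x\<bar> \<le> (\<Sum>i\<in>UNIV. b i)" for i x using b(2) order_trans by blast
  moreover have "0 < (\<Sum>i\<in>UNIV. b i)" using b(1) by (intro sum_pos) auto
  ultimately show ?thesis using that by blast
qed

text \<open>On the line through \<open>y\<close> in direction \<open>v\<close> this is Maclaurin's
  theorem of order 3; compact support bounds the third derivatives globally, so \<open>K\<close>
  depends neither on \<open>y\<close> nor on \<open>v\<close>.\<close>

lemma test_function_taylor:
  fixes \<psi> :: "real^'n \<Rightarrow> real"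
  assumes \<psi>: "test_function \<psi>"
  obtains K where "0 \<le> K" "\<And>y v. \<bar>\<psi> (y + v) - (\<psi> y + (\<Sum>i\<in>UNIV. v $ i * partial_deriv i \<psi> y) +
      1/2 * (\<Sum>i\<in>UNIV. \<Sum>j\<in>UNIV. v $ i * v $ j * partial_deriv i (partial_deriv j \<psi>) y))\<bar> \<le> K * norm v ^ 3"
proof -
  have t1: "test_function (partial_deriv j \<psi>)" for j by (rule partial_deriv_test_function[OF \<psi>])
  have t2: "test_function (partial_deriv i (partial_deriv j \<psi>))" for i j by (rule partial_deriv_test_function[OF t1])
  have t3: "test_function (partial_deriv k (partial_deriv i (partial_deriv j \<psi>)))" for k i j by (rule partial_deriv_test_function[OF t2])
  have d: "f differentiable at x" if "test_function f" for f :: "real^'n \<Rightarrow> real" and x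
    using that smoothD(1) by (auto simp: test_function_def)
  obtain B where B: "0 < B" "\<And>p x. \<bar>(case p of (k, i, j) \<Rightarrow> partial_deriv k (partial_deriv i (partial_deriv j \<psi>))) x\<bar> \<le> B"
    using test_functions_bounded[of "\<lambda>p. case p of (k, i, j) \<Rightarrow> partial_deriv k (partial_deriv i (partial_deriv j \<psi>))"] t3
    by (auto split: prod.splits)
  have B3: "\<bar>partial_deriv k (partial_deriv i (partial_deriv j \<psi>)) x\<bar> \<le> B" for k i j x using B(2)[where p="(k, i, j)"] by simp
  define K where "K = real CARD('n) ^ 3 * B"
  have "\<bar>\<psi> (y + v) - (\<psi> y + (\<Sum>i\<in>UNIV. v $ i * partial_deriv i \<psi> y) +
      1/2 * (\<Sum>i\<in>UNIV. \<Sum>j\<in>UNIV. v $ i * v $ j * partial_deriv i (partial_deriv j \<psi>) y))\<bar> \<le> K * norm v ^ 3" for y v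
  proof -
    \<comment> \<open>For \<open>m \<le> 3\<close>, \<open>u m\<close> is the \<open>m\<close>-th
      derivative of \<open>\<psi>\<close> along the line, in the nested form that one more
      differentiation reproduces.\<close>
    define u where "u m t = (if m = (0::nat) then \<psi> (y + t *\<^sub>R v)
      else if m = 1 then (\<Sum>j\<in>UNIV. v $ j * partial_deriv j \<psi> (y + t *\<^sub>R v))
      else if m = 2 then (\<Sum>j\<in>UNIV. v $ j * (\<Sum>i\<in>UNIV. v $ i * partial_deriv i (partial_deriv j \<psi>) (y + t *\<^sub>R v)))
      else (\<Sum>j\<in>UNIV. v $ j * (\<Sum>i\<in>UNIV. v $ i * (\<Sum>k\<in>UNIV. v $ k * partial_deriv k (partial_deriv i (partial_deriv j \<psi>)) (y + t *\<^sub>R v)))))" for m t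
    have D: "(u m has_real_derivative u (Suc m) t) (at t)" if m3: "m < 3" for m t
    proof -
      consider "m = 0" | "m = 1" | "m = 2" using m3 by arith
      then show ?thesis
      proof cases
        case 1
        then show ?thesis using deriv_along_line[OF d[OF \<psi>], of y v t] by (simp add: u_def[abs_def])
      next
        case 2
        have "((\<lambda>t. \<Sum>j\<in>UNIV. v $ j * partial_deriv j \<psi> (y + t *\<^sub>R v)) has_real_derivative
            (\<Sum>j\<in>UNIV. v $ j * (\<Sum>i\<in>UNIV. v $ i * partial_deriv i (partial_deriv j \<psi>) (y + t *\<^sub>R v)))) (at t)"
          by (intro DERIV_sum DERIV_cmult deriv_along_line d t1)
        then show ?thesis using 2 by (simp add: u_def[abs_def])
      next
        case 3
        have "((\<lambda>t. \<Sum>j\<in>UNIV. v $ j * (\<Sum>i\<in>UNIV. v $ i * partial_deriv i (partial_deriv j \<psi>) (y + t *\<^sub>R v))) has_real_derivative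
            (\<Sum>j\<in>UNIV. v $ j * (\<Sum>i\<in>UNIV. v $ i * (\<Sum>k\<in>UNIV. v $ k * partial_deriv k (partial_deriv i (partial_deriv j \<psi>)) (y + t *\<^sub>R v))))) (at t)"
          by (intro DERIV_sum DERIV_cmult deriv_along_line d t2)
        then show ?thesis using 3 by (simp add: u_def[abs_def])
      qed
    qed
    have "\<exists>t>0. t < 1 \<and> u 0 1 = (\<Sum>m<3. u m 0 / fact m * 1 ^ m) + u 3 t / fact 3 * 1 ^ 3"
      by (rule Maclaurin[where diff=u]) (use D in auto)
    then obtain t where t: "u 0 1 = (\<Sum>m<3. u m 0 / fact m) + u 3 t / fact 3" by auto
    have s3: "(\<Sum>m<3. u m 0 / fact m) = u 0 0 + u 1 0 + u 2 0 / 2" by (simp add: eval_nat_numeral)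
    have "u 2 0 = (\<Sum>j\<in>UNIV. \<Sum>i\<in>UNIV. v $ i * v $ j * partial_deriv i (partial_deriv j \<psi>) y)"
      by (simp add: u_def sum_distrib_left algebra_simps)
    also have "\<dots> = (\<Sum>i\<in>UNIV. \<Sum>j\<in>UNIV. v $ i * v $ j * partial_deriv i (partial_deriv j \<psi>) y)" by (rule sum.swap)
    finally have u2: "u 2 0 = \<dots>" .
    have vi: "\<bar>v $ i\<bar> \<le> norm v" for i by (rule component_le_norm_cart)
    have "\<bar>u 3 t\<bar> \<le> (\<Sum>j\<in>(UNIV::'n set). norm v * (\<Sum>i\<in>(UNIV::'n set). norm v * (\<Sum>k\<in>(UNIV::'n set). norm v * B)))"
      unfolding u_def
      by (simp del: sum_constant, intro order_trans[OF sum_abs] sum_mono, simp only: abs_mult, intro mult_mono vi)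
        (intro order_trans[OF sum_abs] sum_mono, simp only: abs_mult, intro mult_mono vi,
         intro order_trans[OF sum_abs] sum_mono, simp only: abs_mult, intro mult_mono vi B3, auto)
    also have "\<dots> = K * norm v ^ 3" by (simp add: K_def power3_eq_cube algebra_simps)
    finally have "\<bar>u 3 t / fact 3\<bar> \<le> K * norm v ^ 3"
      by (simp add: fact_numeral)
    moreover have "\<psi> (y + v) - (\<psi> y + (\<Sum>i\<in>UNIV. v $ i * partial_deriv i \<psi> y) +
      1/2 * (\<Sum>i\<in>UNIV. \<Sum>j\<in>UNIV. v $ i * v $ j * partial_deriv i (partial_deriv j \<psi>) y)) = u 3 t / fact 3"
      using t unfolding s3 u2[symmetric] by (simp add: u_def)
    ultimately show ?thesis by simp
  qed
  moreover have "0 \<le> K" using B(1) by (simp add: K_def)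
  ultimately show ?thesis using that by blast
qed

section \<open>One Gaussian step and the generator\<close>

lemma cube_add_le: "0 \<le> a \<Longrightarrow> 0 \<le> b \<Longrightarrow> (a + b) ^ 3 \<le> 8 * a ^ 3 + 8 * b ^ 3" for a b :: real
proof -
  assume ab: "0 \<le> a" "0 \<le> b"
  have "(a + b) ^ 3 \<le> (2 * max a b) ^ 3" using ab by (intro power_mono) auto
  also have "\<dots> = 8 * (max a b) ^ 3" by (simp add: power_mult_distrib)
  also have "\<dots> \<le> 8 * a ^ 3 + 8 * b ^ 3" using ab by (auto simp: max_def)
  finally show ?thesis .
qed

lemma (in prob_space) has_bochner_integral_const: "has_bochner_integral M (\<lambda>_. c) (c::real)"
  by (simp add: has_bochner_integral_iff prob_space)

text \<open>Ito's formula for one step: first moments of the noise vanish, second moments produce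
  the diffusion term, and everything else has order \<open>sqrt h ^ 3\<close>, small enough to be
  summed over about \<open>1 / h\<close> steps.\<close>

lemma gauss_step_expansion:
  fixes \<psi> :: "real^'n \<Rightarrow> real" and \<sigma> :: "real^'n^'n"
  assumes \<psi>: "test_function \<psi>" and G: "0 \<le> G"
  obtains C where "0 \<le> C" "\<And>h y b. 0 < h \<Longrightarrow> h \<le> 1 \<Longrightarrow> norm b \<le> G \<Longrightarrow>
    \<bar>(\<integral>z. \<psi> (y + h *\<^sub>R b + \<sigma> *v z) \<partial>gauss h) - (\<psi> y + h * (grad \<psi> y \<bullet> b +
      1/2 * (\<Sum>i\<in>UNIV. \<Sum>j\<in>UNIV. (\<sigma> ** transpose \<sigma>) $ i $ j * partial_deriv i (partial_deriv j \<psi>) y)))\<bar> \<le> C * sqrt h ^ 3"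
proof -
  let ?D = "\<lambda>i j. partial_deriv i (partial_deriv j \<psi>)"
  obtain K where K: "0 \<le> K" "\<And>y v. \<bar>\<psi> (y + v) - (\<psi> y + (\<Sum>i\<in>UNIV. v $ i * partial_deriv i \<psi> y) +
      1/2 * (\<Sum>i\<in>UNIV. \<Sum>j\<in>UNIV. v $ i * v $ j * ?D i j y))\<bar> \<le> K * norm v ^ 3"
    using test_function_taylor[OF \<psi>] by blast
  obtain c where c: "0 < c" "\<And>z. norm (\<sigma> *v z) \<le> c * norm z" using matrix_vector_norm_bound by blast
  obtain C3 where C3: "C3 \<ge> 0" "\<And>h. 0 < h \<Longrightarrow> integrable (gauss h) (\<lambda>z::real^'n. norm z ^ 3)"
    "\<And>h. 0 < h \<Longrightarrow> (\<integral>z. norm (z::real^'n) ^ 3 \<partial>gauss h) \<le> C3 * sqrt h ^ 3"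
    using gauss_moment3 by metis
  have t2: "test_function (?D i j)" for i j by (intro partial_deriv_test_function \<psi>)
  obtain B where B: "0 < B" "\<And>p x. \<bar>(case p of (i, j) \<Rightarrow> ?D i j) x\<bar> \<le> B"
    using test_functions_bounded[of "\<lambda>p. case p of (i, j) \<Rightarrow> ?D i j"] t2 by (auto split: prod.splits)
  have B2: "\<bar>?D i j x\<bar> \<le> B" for i j x using B(2)[where p="(i, j)"] by simp
  obtain B0 where B0: "0 < B0" "\<And>x. \<bar>\<psi> x\<bar> \<le> B0" using test_function_bounded[OF \<psi>] by blast
  \<comment> \<open>The first summand is the cubic Taylor remainder, split into a drift and a noise
    part; the second is the square of the drift in the quadratic term.\<close>
  define C where "C = K * (8 * G ^ 3 + 8 * c ^ 3 * C3) + 1/2 * (real CARD('n) ^ 2 * (G ^ 2 * B))"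
  have "\<bar>(\<integral>z. \<psi> (y + h *\<^sub>R b + \<sigma> *v z) \<partial>gauss h) - (\<psi> y + h * (grad \<psi> y \<bullet> b +
      1/2 * (\<Sum>i\<in>UNIV. \<Sum>j\<in>UNIV. (\<sigma> ** transpose \<sigma>) $ i $ j * ?D i j y)))\<bar> \<le> C * sqrt h ^ 3"
    if h: "0 < h" "h \<le> 1" and b: "norm b \<le> G" for h y b
  proof -
    interpret prob_space "gauss h :: (real^'n) measure" by (rule prob_space_gauss[OF h(1)])
    define v where "v z = h *\<^sub>R b + \<sigma> *v z" for z
    have vm [measurable]: "v \<in> borel_measurable borel" unfolding v_def by measurable
    have \<psi>m [measurable]: "\<psi> \<in> borel_measurable borel"
      using \<psi> smoothD(2) by (auto simp: test_function_def intro: borel_measurable_continuous_onI)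
    define Tay where "Tay z = \<psi> y + (\<Sum>i\<in>UNIV. v z $ i * partial_deriv i \<psi> y) +
      1/2 * (\<Sum>i\<in>UNIV. \<Sum>j\<in>UNIV. v z $ i * v z $ j * ?D i j y)" for z
    have m1: "has_bochner_integral (gauss h) (\<lambda>z. (\<sigma> *v z) $ i) 0" for i
    proof -
      have "has_bochner_integral (gauss h) (\<lambda>z. \<Sum>k\<in>UNIV. \<sigma> $ i $ k * z $ k) (\<Sum>k\<in>UNIV. \<sigma> $ i $ k * 0)"
        by (intro has_bochner_integral_sum has_bochner_integral_mult_right gauss_moment1 h)
      then show ?thesis by (simp add: matrix_vector_mult_def)
    qed
    have m2: "has_bochner_integral (gauss h) (\<lambda>z. (\<sigma> *v z) $ i * (\<sigma> *v z) $ j) (h * (\<sigma> ** transpose \<sigma>) $ i $ j)" for i j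
    proof -
      have "has_bochner_integral (gauss h) (\<lambda>z. \<Sum>k\<in>UNIV. \<Sum>l\<in>UNIV. (\<sigma> $ i $ k * \<sigma> $ j $ l) * (z $ k * z $ l))
         (\<Sum>k\<in>UNIV. \<Sum>l\<in>UNIV. (\<sigma> $ i $ k * \<sigma> $ j $ l) * (if k = l then h else 0))"
        by (intro has_bochner_integral_sum has_bochner_integral_mult_right gauss_moment2 h)
      moreover have "(\<Sum>k\<in>UNIV. \<Sum>l\<in>UNIV. (\<sigma> $ i $ k * \<sigma> $ j $ l) * (if k = l then h else 0)) = h * (\<sigma> ** transpose \<sigma>) $ i $ j"
        by (simp add: matrix_matrix_mult_def transpose_def sum_distrib_left if_distrib mult.commute cong: if_cong)
      moreover have "(\<Sum>k\<in>UNIV. \<Sum>l\<in>UNIV. (\<sigma> $ i $ k * \<sigma> $ j $ l) * (z $ k * z $ l)) = (\<sigma> *v z) $ i * (\<sigma> *v z) $ j" for z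
        by (simp add: matrix_vector_mult_def sum_product algebra_simps)
      ultimately show ?thesis by simp
    qed
    have v1: "has_bochner_integral (gauss h) (\<lambda>z. v z $ i) (h * b $ i)" for i
      using has_bochner_integral_add[OF has_bochner_integral_const[of "h * b $ i"] m1[of i]] prob_space
      by (simp add: v_def)
    have v2: "has_bochner_integral (gauss h) (\<lambda>z. v z $ i * v z $ j) (h\<^sup>2 * (b $ i * b $ j) + h * (\<sigma> ** transpose \<sigma>) $ i $ j)" for i j
    proof -
      have "has_bochner_integral (gauss h)
         (\<lambda>z. h\<^sup>2 * (b $ i * b $ j) + (h * b $ i * (\<sigma> *v z) $ j + (h * b $ j * (\<sigma> *v z) $ i + (\<sigma> *v z) $ i * (\<sigma> *v z) $ j)))
         (h\<^sup>2 * (b $ i * b $ j) + (h * b $ i * 0 + (h * b $ j * 0 + h * (\<sigma> ** transpose \<sigma>) $ i $ j)))"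
        by (intro has_bochner_integral_add has_bochner_integral_const has_bochner_integral_mult_right m1 m2)
      moreover have "h\<^sup>2 * (b $ i * b $ j) + (h * b $ i * (\<sigma> *v z) $ j + (h * b $ j * (\<sigma> *v z) $ i + (\<sigma> *v z) $ i * (\<sigma> *v z) $ j)) = v z $ i * v z $ j" for z
        by (simp add: v_def power2_eq_square algebra_simps)
      ultimately show ?thesis by simp
    qed
    have "has_bochner_integral (gauss h) Tay (\<psi> y + (\<Sum>i\<in>UNIV. (h * b $ i) * partial_deriv i \<psi> y) +
      1/2 * (\<Sum>i\<in>UNIV. \<Sum>j\<in>UNIV. (h\<^sup>2 * (b $ i * b $ j) + h * (\<sigma> ** transpose \<sigma>) $ i $ j) * ?D i j y))"
      unfolding Tay_def
      by (intro has_bochner_integral_add has_bochner_integral_sum has_bochner_integral_mult_right[of "1/2"]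
        has_bochner_integral_mult_left has_bochner_integral_const v1 v2)
    note A1 = this
    have A2: "(\<Sum>i\<in>UNIV. (h * b $ i) * partial_deriv i \<psi> y) = h * (grad \<psi> y \<bullet> b)"
      by (simp add: grad_def inner_vec_def sum_distrib_left algebra_simps)
    have A3: "1/2 * (\<Sum>i\<in>UNIV. \<Sum>j\<in>UNIV. (h\<^sup>2 * (b $ i * b $ j) + h * (\<sigma> ** transpose \<sigma>) $ i $ j) * ?D i j y) =
       1/2 * (h\<^sup>2 * (\<Sum>i\<in>UNIV. \<Sum>j\<in>UNIV. (b $ i * b $ j) * ?D i j y)) +
       h * (1/2 * (\<Sum>i\<in>UNIV. \<Sum>j\<in>UNIV. (\<sigma> ** transpose \<sigma>) $ i $ j * ?D i j y))"
      by (simp add: sum.distrib sum_distrib_left algebra_simps)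
    have A4: "\<psi> y + h * g + (p + h * q) = \<psi> y + h * (g + q) + p" for p q g
      by (simp add: algebra_simps)
    have Tay: "has_bochner_integral (gauss h) Tay (\<psi> y + h * (grad \<psi> y \<bullet> b +
      1/2 * (\<Sum>i\<in>UNIV. \<Sum>j\<in>UNIV. (\<sigma> ** transpose \<sigma>) $ i $ j * ?D i j y)) +
      1/2 * (h\<^sup>2 * (\<Sum>i\<in>UNIV. \<Sum>j\<in>UNIV. (b $ i * b $ j) * ?D i j y)))"
      using A1 unfolding A2 A3 A4 .
    have s0: "0 \<le> sqrt h" "sqrt h \<le> 1" "(sqrt h)\<^sup>2 = h" using h by auto
    \<comment> \<open>Here \<open>h \<le> 1\<close> enters: the orders \<open>h\<^sup>2\<close> and
      \<open>h ^ 3\<close> are absorbed into \<open>sqrt h ^ 3\<close>.\<close>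
    have h3: "h ^ 3 \<le> sqrt h ^ 3" "h\<^sup>2 \<le> sqrt h ^ 3"
    proof -
      have "h * h \<le> 1 * h" using h by (intro mult_right_mono) auto
      then have "h \<le> sqrt h" using h by (intro real_le_rsqrt) (simp add: power2_eq_square)
      then show "h ^ 3 \<le> sqrt h ^ 3" using h by (intro power_mono) auto
      have "h\<^sup>2 = sqrt h ^ 3 * sqrt h" using s0(3) by (metis power2_eq_square power3_eq_cube mult.assoc)
      also have "\<dots> \<le> sqrt h ^ 3 * 1" using s0 by (intro mult_left_mono) auto
      finally show "h\<^sup>2 \<le> sqrt h ^ 3" by simp
    qed
    have "\<bar>\<Sum>i\<in>UNIV. \<Sum>j\<in>UNIV. (b $ i * b $ j) * ?D i j y\<bar> \<le> (\<Sum>i\<in>(UNIV::'n set). \<Sum>j\<in>(UNIV::'n set). (G * G) * B)"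
    proof (intro order_trans[OF sum_abs] sum_mono)
      fix i j
      have "\<bar>b $ i\<bar> \<le> G" "\<bar>b $ j\<bar> \<le> G" using component_le_norm_cart[of b] b by (auto intro: order_trans)
      then show "\<bar>(b $ i * b $ j) * ?D i j y\<bar> \<le> (G * G) * B"
        unfolding abs_mult using G by (intro mult_mono B2) auto
    qed
    also have "\<dots> = real CARD('n) ^ 2 * (G ^ 2 * B)" by (simp add: power2_eq_square)
    finally have S2: "\<bar>\<Sum>i\<in>UNIV. \<Sum>j\<in>UNIV. (b $ i * b $ j) * ?D i j y\<bar> \<le> real CARD('n) ^ 2 * (G ^ 2 * B)" .
    have "\<bar>1/2 * (h\<^sup>2 * (\<Sum>i\<in>UNIV. \<Sum>j\<in>UNIV. (b $ i * b $ j) * ?D i j y))\<bar> = 1/2 * (h\<^sup>2 * \<bar>\<Sum>i\<in>UNIV. \<Sum>j\<in>UNIV. (b $ i * b $ j) * ?D i j y\<bar>)"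
      by (simp add: abs_mult)
    also have "\<dots> \<le> 1/2 * (sqrt h ^ 3 * (real CARD('n) ^ 2 * (G ^ 2 * B)))"
      using h3 S2 s0 by (intro mult_left_mono mult_mono) auto
    finally have E2: "\<bar>1/2 * (h\<^sup>2 * (\<Sum>i\<in>UNIV. \<Sum>j\<in>UNIV. (b $ i * b $ j) * ?D i j y))\<bar> \<le> 1/2 * (sqrt h ^ 3 * (real CARD('n) ^ 2 * (G ^ 2 * B)))" .
    have v3: "norm (v z) ^ 3 \<le> 8 * h ^ 3 * G ^ 3 + 8 * c ^ 3 * norm z ^ 3" for z
    proof -
      have "norm (v z) \<le> h * G + c * norm z"
        unfolding v_def using b h c(2)[of z] by (intro norm_triangle_mono) (auto intro: mult_left_mono)
      then have "norm (v z) ^ 3 \<le> (h * G + c * norm z) ^ 3" by (intro power_mono) auto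
      also have "\<dots> \<le> 8 * (h * G) ^ 3 + 8 * (c * norm z) ^ 3" using h G c by (intro cube_add_le) auto
      finally show ?thesis by (simp add: power_mult_distrib)
    qed
    have i\<psi>: "integrable (gauss h) (\<lambda>z. \<psi> (y + v z))"
      by (rule integrable_const_bound[of _ B0]) (use B0 in auto)
    have iT: "integrable (gauss h) Tay" using Tay by (simp add: has_bochner_integral_iff)
    have hb3: "has_bochner_integral (gauss h) (\<lambda>z::real^'n. K * (8 * h ^ 3 * G ^ 3 + 8 * c ^ 3 * norm z ^ 3))
        (K * (8 * h ^ 3 * G ^ 3 + 8 * c ^ 3 * (\<integral>z. norm (z::real^'n) ^ 3 \<partial>gauss h)))"
      using has_bochner_integral_integrable[OF C3(2)[OF h(1)]]
      by (intro has_bochner_integral_mult_right[of K] has_bochner_integral_mult_right[of "8 * c ^ 3"] has_bochner_integral_add has_bochner_integral_const)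
    then have i3: "integrable (gauss h) (\<lambda>z::real^'n. K * (8 * h ^ 3 * G ^ 3 + 8 * c ^ 3 * norm z ^ 3))"
      by (simp only: has_bochner_integral_iff)
    have "\<bar>(\<integral>z. \<psi> (y + v z) \<partial>gauss h) - (\<integral>z. Tay z \<partial>gauss h)\<bar> = \<bar>\<integral>z. \<psi> (y + v z) - Tay z \<partial>gauss h\<bar>"
      using i\<psi> iT by simp
    also have "\<dots> \<le> (\<integral>z. \<bar>\<psi> (y + v z) - Tay z\<bar> \<partial>gauss h)" by (rule integral_abs_bound)
    also have "\<dots> \<le> (\<integral>z. K * (8 * h ^ 3 * G ^ 3 + 8 * c ^ 3 * norm (z::real^'n) ^ 3) \<partial>gauss h)"
    proof (rule integral_mono[OF _ i3])
      show "integrable (gauss h) (\<lambda>z. \<bar>\<psi> (y + v z) - Tay z\<bar>)" by (intro integrable_abs Bochner_Integration.integrable_diff i\<psi> iT)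
      show "\<bar>\<psi> (y + v z) - Tay z\<bar> \<le> K * (8 * h ^ 3 * G ^ 3 + 8 * c ^ 3 * norm z ^ 3)" for z
        unfolding Tay_def by (rule order_trans[OF K(2) mult_left_mono[OF v3 K(1)]])
    qed
    also have "\<dots> = K * (8 * h ^ 3 * G ^ 3 + 8 * c ^ 3 * (\<integral>z. norm (z::real^'n) ^ 3 \<partial>gauss h))"
      using hb3 by (simp only: has_bochner_integral_iff)
    also have "\<dots> \<le> K * (8 * sqrt h ^ 3 * G ^ 3 + 8 * c ^ 3 * (C3 * sqrt h ^ 3))"
      using h3 C3(3)[OF h(1)] c G K(1) by (intro mult_left_mono add_mono mult_right_mono) auto
    finally have E1: "\<bar>(\<integral>z. \<psi> (y + v z) \<partial>gauss h) - (\<integral>z. Tay z \<partial>gauss h)\<bar> \<le> K * (8 * G ^ 3 + 8 * c ^ 3 * C3) * sqrt h ^ 3"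
      by (simp add: algebra_simps)
    have "C * sqrt h ^ 3 = K * (8 * G ^ 3 + 8 * c ^ 3 * C3) * sqrt h ^ 3 + 1/2 * (sqrt h ^ 3 * (real CARD('n) ^ 2 * (G ^ 2 * B)))"
      unfolding C_def by (simp only: distrib_right mult.assoc mult.commute[of "sqrt h ^ 3"])
    moreover have "(\<integral>z. \<psi> (y + h *\<^sub>R b + \<sigma> *v z) \<partial>gauss h) = (\<integral>z. \<psi> (y + v z) \<partial>gauss h)" by (simp add: v_def add.assoc)
    moreover have "(\<integral>z. Tay z \<partial>gauss h) = \<psi> y + h * (grad \<psi> y \<bullet> b +
      1/2 * (\<Sum>i\<in>UNIV. \<Sum>j\<in>UNIV. (\<sigma> ** transpose \<sigma>) $ i $ j * ?D i j y)) +
      1/2 * (h\<^sup>2 * (\<Sum>i\<in>UNIV. \<Sum>j\<in>UNIV. (b $ i * b $ j) * ?D i j y))" using Tay by (simp add: has_bochner_integral_iff)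
    ultimately show ?thesis using E1 E2 by linarith
  qed
  moreover have "0 \<le> C" using K C3(1) c G B(1) by (simp add: C_def)
  ultimately show ?thesis using that by blast
qed

lemma riemann_sum_tendsto:
  fixes f :: "real \<Rightarrow> real"
  assumes T: "0 < T" and f: "continuous_on {0..T} f"
  shows "(\<lambda>N. T / real N * (\<Sum>k<N. f (real k * (T / real N)))) \<longlonglongrightarrow> integral {0..T} f"
proof (rule tendstoI)
  fix e :: real assume e: "0 < e"
  have "uniformly_continuous_on {0..T} f" by (rule compact_uniformly_continuous[OF f]) simp
  then obtain d where d: "0 < d" "\<And>s s'. s \<in> {0..T} \<Longrightarrow> s' \<in> {0..T} \<Longrightarrow> dist s' s < d \<Longrightarrow> dist (f s') (f s) < e / (2 * T)"
    unfolding uniformly_continuous_on_def using e T by (metis divide_pos_pos mult_pos_pos zero_less_numeral)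
  have "(\<lambda>N. T / real N) \<longlonglongrightarrow> 0" by (rule lim_const_over_n)
  then have "\<forall>\<^sub>F N in sequentially. T / real N < d" using d(1) by (rule order_tendstoD)
  then show "\<forall>\<^sub>F N in sequentially. dist (T / real N * (\<Sum>k<N. f (real k * (T / real N)))) (integral {0..T} f) < e"
    using eventually_gt_at_top[of 0]
  proof eventually_elim
    case (elim N)
    define h where "h = T / real N"
    have h: "0 < h" "real N * h = T" "h < d" using elim T by (auto simp: h_def)
    have kT: "real k * h \<le> T" if "k \<le> N" for k using mult_right_mono[of "real k" "real N" h] that h by auto
    have k0: "0 \<le> real k * h" for k using h(1) by (intro mult_nonneg_nonneg) auto
    have "k \<le> N \<Longrightarrow> \<bar>h * (\<Sum>j<k. f (real j * h)) - integral {0..real k * h} f\<bar> \<le> real k * h * (e / (2 * T))" for k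
    proof (induction k)
      case (Suc k)
      let ?a = "real k * h" and ?b = "real (Suc k) * h"
      have ab: "?a \<le> ?b" "?b - ?a = h" using h(1) by (auto simp: algebra_simps)
      have bT: "?b \<le> T" using kT[OF Suc.prems] .
      have int: "f integrable_on {0..?b}"
        by (rule integrable_continuous_real[OF continuous_on_subset[OF f]]) (use bT in auto)
      have split: "integral {0..?b} f = integral {0..?a} f + integral {?a..?b} f"
        using Henstock_Kurzweil_Integration.integral_combine[OF k0 ab(1) int] by simp
      have cab: "continuous_on {?a..?b} f"
        by (rule continuous_on_subset[OF f]) (use bT k0[of k] in \<open>auto intro: order_trans\<close>)
      have "norm (integral {?a..?b} (\<lambda>s. f ?a - f s)) \<le> (e / (2 * T)) * (?b - ?a)"
      proof (rule integral_bound[OF ab(1)])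
        show "continuous_on {?a..?b} (\<lambda>s. f ?a - f s)" by (intro continuous_intros cab)
        fix s assume s: "s \<in> {?a..?b}"
        then have "s \<in> {0..T}" "?a \<in> {0..T}" "dist ?a s < d" using k0[of k] ab bT h(3) unfolding atLeastAtMost_iff dist_real_def by linarith+
        then show "norm (f ?a - f s) \<le> e / (2 * T)" using d(2)[of s ?a] by (simp add: dist_norm)
      qed
      moreover have "integral {?a..?b} (\<lambda>s. f ?a - f s) = h * f ?a - integral {?a..?b} f"
        using ab by (subst Henstock_Kurzweil_Integration.integral_diff)
          (simp_all add: integrable_continuous_real[OF cab] integrable_const_ivl del: of_nat_Suc)
      ultimately have "\<bar>h * f ?a - integral {?a..?b} f\<bar> \<le> (e / (2 * T)) * h" using ab(2) by simp
      moreover have "\<bar>h * (\<Sum>j<k. f (real j * h)) - integral {0..?a} f\<bar> \<le> ?a * (e / (2 * T))" using Suc by simp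
      moreover have "?b * (e / (2 * T)) = ?a * (e / (2 * T)) + (e / (2 * T)) * h" by (simp add: algebra_simps add_divide_distrib)
      moreover have "h * (\<Sum>j<Suc k. f (real j * h)) = h * (\<Sum>j<k. f (real j * h)) + h * f ?a" by (simp add: algebra_simps)
      ultimately show ?case unfolding split by linarith
    qed simp
    from this[of N] have "\<bar>h * (\<Sum>j<N. f (real j * h)) - integral {0..T} f\<bar> \<le> T * (e / (2 * T))" using h(2) by simp
    also have "\<dots> < e" using e T by simp
    finally show ?case by (simp add: dist_real_def h_def)
  qed
qed

text \<open>Fubini by left Riemann sums: finite sums commute with the expectation, and dominated
  convergence passes to the limit. Continuity in time takes the place of joint
  measurability.\<close>

lemma (in prob_space) integral_time_swap:
  fixes f :: "real \<Rightarrow> 'a \<Rightarrow> real"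
  assumes T: "0 < T" and cont: "\<And>z. z \<in> space M \<Longrightarrow> continuous_on {0..T} (\<lambda>s. f s z)"
    and meas: "\<And>s. s \<in> {0..T} \<Longrightarrow> f s \<in> borel_measurable M"
    and B: "\<And>s z. s \<in> {0..T} \<Longrightarrow> z \<in> space M \<Longrightarrow> \<bar>f s z\<bar> \<le> B"
  shows "continuous_on {0..T} (\<lambda>s. expectation (f s))"
    "(\<lambda>z. integral {0..T} (\<lambda>s. f s z)) \<in> borel_measurable M"
    "expectation (\<lambda>z. integral {0..T} (\<lambda>s. f s z)) = integral {0..T} (\<lambda>s. expectation (f s))"
proof -
  define r where "r N z = T / real N * (\<Sum>k<N. f (real k * (T / real N)) z)" for N z
  have grid: "real k * (T / real N) \<in> {0..T}" if "k < N" for k N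
  proof -
    have h: "0 < T / real N" using T that by simp
    have "real k * (T / real N) \<le> real N * (T / real N)" using that h by (intro mult_right_mono) auto
    also have "\<dots> = T" using that by simp
    finally have 1: "real k * (T / real N) \<le> T" .
    have "0 \<le> real k * (T / real N)" using h by (intro mult_nonneg_nonneg) auto
    with 1 show ?thesis by simp
  qed
  have rm: "r N \<in> borel_measurable M" for N
    unfolding r_def by (intro borel_measurable_times borel_measurable_const borel_measurable_sum meas grid) auto
  have rl: "(\<lambda>N. r N z) \<longlonglongrightarrow> integral {0..T} (\<lambda>s. f s z)" if "z \<in> space M" for z
    unfolding r_def by (rule riemann_sum_tendsto[OF T cont[OF that]])
  have rB: "\<bar>r N z\<bar> \<le> T * B" if z: "z \<in> space M" for N z
  proof (cases "N = 0")
    case True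
    have "0 \<le> B" using B[of 0 z] z T by simp
    then show ?thesis using True T by (simp add: r_def)
  next
    case False
    have "\<bar>\<Sum>k<N. f (real k * (T / real N)) z\<bar> \<le> (\<Sum>k<N. B)"
      by (intro order_trans[OF sum_abs] sum_mono B grid z) auto
    then have "\<bar>r N z\<bar> \<le> T / real N * (real N * B)" unfolding r_def abs_mult using T by (intro mult_mono) auto
    then show ?thesis using False by simp
  qed
  have fi: "integrable M (f s)" if "s \<in> {0..T}" for s
    by (rule integrable_const_bound[of _ B]) (use B meas that in auto)
  show c: "continuous_on {0..T} (\<lambda>s. expectation (f s))"
    unfolding continuous_on_sequentially
  proof (intro ballI allI impI, elim conjE)
    fix x a assume x: "\<forall>n. x n \<in> {0..T}" and a: "a \<in> {0..T}" and l: "x \<longlonglongrightarrow> a"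
    show "((\<lambda>s. expectation (f s)) \<circ> x) \<longlonglongrightarrow> expectation (f a)"
      unfolding comp_def
    proof (rule integral_dominated_convergence[where w="\<lambda>_. B"])
      show "AE z in M. (\<lambda>n. f (x n) z) \<longlonglongrightarrow> f a z"
      proof (rule AE_I2)
        fix z assume z: "z \<in> space M"
        show "(\<lambda>n. f (x n) z) \<longlonglongrightarrow> f a z"
          using continuous_on_tendsto_compose[OF cont[OF z] l a] x by auto
      qed
    qed (use x a meas B in auto)
  qed
  show "(\<lambda>z. integral {0..T} (\<lambda>s. f s z)) \<in> borel_measurable M"
    by (rule borel_measurable_LIMSEQ_real[OF rl rm])
  have "(\<lambda>N. expectation (r N)) \<longlonglongrightarrow> expectation (\<lambda>z. integral {0..T} (\<lambda>s. f s z))"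
    by (rule integral_dominated_convergence[where w="\<lambda>_. T * B"])
      (use rm rl rB borel_measurable_LIMSEQ_real[OF rl rm] in auto)
  moreover have "expectation (r N) = T / real N * (\<Sum>k<N. expectation (f (real k * (T / real N))))" for N
  proof -
    have "expectation (\<lambda>z. \<Sum>k<N. f (real k * (T / real N)) z) = (\<Sum>k<N. expectation (f (real k * (T / real N))))"
      by (rule Bochner_Integration.integral_sum) (use fi grid in auto)
    then show ?thesis unfolding r_def by simp
  qed
  ultimately have "(\<lambda>N. T / real N * (\<Sum>k<N. expectation (f (real k * (T / real N))))) \<longlonglongrightarrow> expectation (\<lambda>z. integral {0..T} (\<lambda>s. f s z))"
    by simp
  from LIMSEQ_unique[OF this riemann_sum_tendsto[OF T c]]
  show "expectation (\<lambda>z. integral {0..T} (\<lambda>s. f s z)) = integral {0..T} (\<lambda>s. expectation (f s))" .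
qed

section \<open>The weak Fokker--Planck equation for the averaged law\<close>

lemma partial_deriv2_zero_outside:
  assumes "x \<notin> closure {x. f x \<noteq> 0}"
  shows "partial_deriv i (partial_deriv j f) x = 0"
proof (rule partial_deriv_zero_outside)
  have "{x. partial_deriv j f x \<noteq> 0} \<subseteq> closure {x. f x \<noteq> 0}" using partial_deriv_zero_outside by blast
  then have "closure {x. partial_deriv j f x \<noteq> 0} \<subseteq> closure {x. f x \<noteq> 0}" by (rule closure_minimal) simp
  then show "x \<notin> closure {x. partial_deriv j f x \<noteq> 0}" using assms by blast
qed

lemma continuous_on_grad:
  assumes "smooth f"
  shows "continuous_on UNIV (grad f)"
  unfolding grad_def[abs_def] by (intro continuous_on_vec_lambda smoothD(2) smoothD(3) assms)

lemma integral_bounded: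
  fixes f :: "real \<Rightarrow> real"
  assumes T: "0 \<le> T" and f: "continuous_on {0..T} f" and B: "\<And>s. s \<in> {0..T} \<Longrightarrow> \<bar>f s\<bar> \<le> B"
  shows "\<bar>integral {0..T} f\<bar> \<le> T * B"
  using integral_bound[OF T f, of B] B by (simp add: mult.commute)

context noisy_flow
begin

text \<open>\<open>fp_generator\<close> with \<open>F\<close> in place of \<open>- grad V\<close>:
  the generator of \<open>Y\<close> at a moment when the common noise contributes the displacement
  \<open>b\<close>.\<close>

definition gen :: "(real^'n \<Rightarrow> real) \<Rightarrow> real^'n \<Rightarrow> real^'n \<Rightarrow> real" where
  "gen \<psi> b y = grad \<psi> y \<bullet> F (y + b) +
     1/2 * (\<Sum>i\<in>UNIV. \<Sum>j\<in>UNIV. (\<sigma> ** transpose \<sigma>) $ i $ j * partial_deriv i (partial_deriv j \<psi>) y)"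

lemma gen_zero_outside: "y \<notin> closure {x. \<psi> x \<noteq> 0} \<Longrightarrow> gen \<psi> b y = 0"
  by (simp add: gen_def grad_def inner_vec_def partial_deriv_zero_outside partial_deriv2_zero_outside)

lemma gen_continuous:
  assumes \<psi>: "test_function \<psi>" and \<beta>: "\<beta> \<in> C0"
  shows "continuous_on (S \<times> UNIV) (\<lambda>(s, y). gen \<psi> (\<eta> *v \<beta> s) y)"
proof -
  have sm: "smooth \<psi>" using \<psi> by (simp add: test_function_def)
  have g: "continuous_on (S \<times> UNIV) (\<lambda>z. grad \<psi> (snd z))"
    by (rule continuous_on_compose2[OF continuous_on_grad[OF sm] continuous_on_snd[OF continuous_on_id]]) auto
  have p: "continuous_on (S \<times> UNIV) (\<lambda>z. partial_deriv i (partial_deriv j \<psi>) (snd z))" for i j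
    by (rule continuous_on_compose2[OF smoothD(2)[OF smoothD(3)[OF smoothD(3)[OF sm]]] continuous_on_snd[OF continuous_on_id]]) auto
  have b: "continuous_on (S \<times> UNIV) (\<lambda>z. \<beta> (fst z))"
    by (rule continuous_on_compose2[OF C0_continuous_on[OF \<beta>, of UNIV] continuous_on_fst[OF continuous_on_id]]) auto
  have "continuous_on (S \<times> UNIV) (\<lambda>z. gen \<psi> (\<eta> *v \<beta> (fst z)) (snd z))"
    unfolding gen_def
    by (intro continuous_on_add continuous_on_inner g F_continuous continuous_on_mult_vec b
      continuous_on_snd continuous_on_id continuous_on_mult continuous_on_sum p continuous_on_const)
  then show ?thesis by (simp add: split_beta')
qed

lemma gen_continuous_snd:
  assumes \<psi>: "test_function \<psi>" and \<beta>: "\<beta> \<in> C0"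
  shows "continuous_on UNIV (gen \<psi> (\<eta> *v \<beta> s))"
proof -
  have p: "continuous_on UNIV (\<lambda>y::real^'n. (s, y))" by (intro continuous_on_Pair continuous_on_const continuous_on_id)
  have "range (\<lambda>y::real^'n. (s, y)) \<subseteq> {s} \<times> UNIV" by auto
  from continuous_on_compose2[OF gen_continuous[OF \<psi> \<beta>] p this] show ?thesis by simp
qed

lemma gen_continuous_along:
  assumes \<psi>: "test_function \<psi>" and \<beta>: "\<beta> \<in> C0" and u: "continuous_on A u"
  shows "continuous_on A (\<lambda>s. gen \<psi> (\<eta> *v \<beta> s) (u s))"
proof -
  have p: "continuous_on A (\<lambda>s. (s, u s))" by (intro continuous_on_Pair continuous_on_id u)
  have "(\<lambda>s. (s, u s)) ` A \<subseteq> A \<times> UNIV" by auto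
  from continuous_on_compose2[OF gen_continuous[OF \<psi> \<beta>] p this] show ?thesis by simp
qed

text \<open>Off the support of \<open>\<psi>\<close> the generator vanishes however fast
  \<open>F\<close> grows, so only a compact set of times and states matters.\<close>

lemma gen_bounded:
  assumes \<psi>: "test_function \<psi>" and \<beta>: "\<beta> \<in> C0"
  obtains B where "0 < B" "\<And>s y. s \<in> {0..T} \<Longrightarrow> \<bar>gen \<psi> (\<eta> *v \<beta> s) y\<bar> \<le> B"
proof -
  let ?K = "closure {x. \<psi> x \<noteq> 0}"
  have "compact ({0..T} \<times> ?K)" using \<psi> by (intro compact_Times) (auto simp: test_function_def)
  then have "bounded ((\<lambda>(s, y). gen \<psi> (\<eta> *v \<beta> s) y) ` ({0..T} \<times> ?K))"
    by (intro compact_imp_bounded compact_continuous_image continuous_on_subset[OF gen_continuous[OF \<psi> \<beta>, of "{0..T}"]]) auto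
  then obtain B where B: "0 < B" "\<forall>z\<in>(\<lambda>(s, y). gen \<psi> (\<eta> *v \<beta> s) y) ` ({0..T} \<times> ?K). norm z \<le> B"
    unfolding bounded_pos by blast
  have "\<bar>gen \<psi> (\<eta> *v \<beta> s) y\<bar> \<le> B" if "s \<in> {0..T}" for s y
  proof (cases "y \<in> ?K")
    case True
    then have "gen \<psi> (\<eta> *v \<beta> s) y \<in> (\<lambda>(s, y). gen \<psi> (\<eta> *v \<beta> s) y) ` ({0..T} \<times> ?K)"
      using that by (intro image_eqI[of _ _ "(s, y)"]) auto
    then show ?thesis using B(2) by auto
  next
    case False
    then show ?thesis using B(1) by (simp add: gen_zero_outside)
  qed
  then show ?thesis using that B(1) by blast
qed

text \<open>The one-step expansions telescope: \<open>N\<close> errors of order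
  \<open>sqrt h ^ 3\<close> with \<open>N * h = T\<close> add up to order \<open>sqrt h\<close>. The
  condition \<open>T \<le> real N\<close> says that the step is at most 1.\<close>

lemma euler_expansion:
  assumes P: "wiener_measure P" and \<psi>: "test_function \<psi>" and R: "0 < R"
    and supp: "\<And>x. x \<in> closure {x. \<psi> x \<noteq> 0} \<Longrightarrow> norm x \<le> R"
    and \<beta>: "\<beta> \<in> C0" and T: "0 < T"
  obtains C where "0 \<le> C" "\<And>N. T \<le> real N \<Longrightarrow>
    \<bar>\<integral>\<omega>. \<psi> (eul (drift R \<beta>) (\<lambda>s. \<sigma> *v \<omega> s) (T / real N) x N) - \<psi> x -
      T / real N * (\<Sum>k<N. gen \<psi> (\<eta> *v \<beta> (real k * (T / real N))) (eul (drift R \<beta>) (\<lambda>s. \<sigma> *v \<omega> s) (T / real N) x k)) \<partial>P\<bar>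
     \<le> C * sqrt (T / real N)"
proof -
  interpret prob_space P using P by (rule wiener_measureD)
  obtain M0 where M0: "0 < M0" "\<And>s. s \<in> {0..T} \<Longrightarrow> norm (\<beta> s) \<le> M0"
    using path_bounded[of T \<beta>] \<beta> by (auto intro: continuous_intros)
  obtain G where G: "0 < G" "\<And>\<beta> s y. norm (\<beta> s) \<le> M0 \<Longrightarrow> norm (drift R \<beta> s y) \<le> G"
    using drift_bounded[OF R] by blast
  obtain C where C: "0 \<le> C" "\<And>h y b. 0 < h \<Longrightarrow> h \<le> 1 \<Longrightarrow> norm b \<le> G \<Longrightarrow>
    \<bar>(\<integral>z. \<psi> (y + h *\<^sub>R b + \<sigma> *v z) \<partial>gauss h) - (\<psi> y + h * (grad \<psi> y \<bullet> b +
      1/2 * (\<Sum>i\<in>UNIV. \<Sum>j\<in>UNIV. (\<sigma> ** transpose \<sigma>) $ i $ j * partial_deriv i (partial_deriv j \<psi>) y)))\<bar> \<le> C * sqrt h ^ 3"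
    using gauss_step_expansion[OF \<psi> less_imp_le[OF G(1)]] by blast
  obtain B where B: "0 < B" "\<And>s y. s \<in> {0..T} \<Longrightarrow> \<bar>gen \<psi> (\<eta> *v \<beta> s) y\<bar> \<le> B"
    using gen_bounded[OF \<psi> \<beta>] by blast
  obtain B0 where B0: "0 < B0" "\<And>x. \<bar>\<psi> x\<bar> \<le> B0" using test_function_bounded[OF \<psi>] by blast
  have \<psi>m: "\<psi> \<in> borel_measurable borel"
    using \<psi> smoothD(2) by (auto simp: test_function_def intro: borel_measurable_continuous_onI)
  have genm: "gen \<psi> (\<eta> *v \<beta> s) \<in> borel_measurable borel" for s
    by (rule borel_measurable_continuous_onI[OF gen_continuous_snd[OF \<psi> \<beta>]])
  \<comment> \<open>On the support of \<open>\<psi>\<close> the drift is not truncated, and off it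
    the gradient of \<open>\<psi>\<close> vanishes; so the truncated scheme has the true generator
    on \<open>\<psi>\<close>.\<close>
  have gen_drift: "gen \<psi> (\<eta> *v \<beta> s) y = grad \<psi> y \<bullet> drift R \<beta> s y +
      1/2 * (\<Sum>i\<in>UNIV. \<Sum>j\<in>UNIV. (\<sigma> ** transpose \<sigma>) $ i $ j * partial_deriv i (partial_deriv j \<psi>) y)" for s y
  proof (cases "y \<in> closure {x. \<psi> x \<noteq> 0}")
    case True
    then show ?thesis using supp[of y] by (simp add: gen_def drift_inside)
  next
    case False
    then show ?thesis by (simp add: gen_def grad_def inner_vec_def partial_deriv_zero_outside)
  qed
  have "\<bar>\<integral>\<omega>. \<psi> (eul (drift R \<beta>) (\<lambda>s. \<sigma> *v \<omega> s) (T / real N) x N) - \<psi> x -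
      T / real N * (\<Sum>k<N. gen \<psi> (\<eta> *v \<beta> (real k * (T / real N))) (eul (drift R \<beta>) (\<lambda>s. \<sigma> *v \<omega> s) (T / real N) x k)) \<partial>P\<bar>
     \<le> C * T * sqrt (T / real N)" if N: "T \<le> real N" for N
  proof -
    define h where "h = T / real N"
    have Np: "0 < N" using N T by (cases N) auto
    have h: "0 < h" "h \<le> 1" "real N * h = T" using N T Np by (auto simp: h_def)
    define e where "e k \<omega> = eul (drift R \<beta>) (\<lambda>s. \<sigma> *v \<omega> s) h x k" for k \<omega>
    have em: "e k \<in> borel_measurable P" for k unfolding e_def by (rule measurable_eul_drift[OF P R])
    have grid: "real k * h \<in> {0..T}" if "k \<le> N" for k
    proof -
      have "real k * h \<le> real N * h" using that h by (intro mult_right_mono) auto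
      moreover have "0 \<le> real k * h" using h by (intro mult_nonneg_nonneg) auto
      ultimately show ?thesis using h(3) by simp
    qed
    define \<Gamma> where "\<Gamma> k \<omega> = gen \<psi> (\<eta> *v \<beta> (real k * h)) (e k \<omega>)" for k \<omega>
    have \<Gamma>i: "integrable P (\<Gamma> k)" if "k \<le> N" for k
    proof (rule integrable_const_bound[of _ B])
      show "\<Gamma> k \<in> borel_measurable P" unfolding \<Gamma>_def by (rule measurable_compose[OF em genm])
    qed (use B(2)[OF grid[OF that]] in \<open>auto simp: \<Gamma>_def\<close>)
    have \<psi>i: "integrable P (\<lambda>\<omega>. \<psi> (e k \<omega>))" for k
      by (rule integrable_const_bound[of _ B0]) (use B0 measurable_compose[OF em \<psi>m] in auto)
    have step: "\<bar>(\<integral>\<omega>. \<psi> (e (Suc k) \<omega>) \<partial>P) - (\<integral>\<omega>. \<psi> (e k \<omega>) \<partial>P) - h * (\<integral>\<omega>. \<Gamma> k \<omega> \<partial>P)\<bar> \<le> C * sqrt h ^ 3" if k: "k < N" for k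
    proof -
      define I where "I y = (\<integral>z. \<psi> (y + h *\<^sub>R drift R \<beta> (real k * h) y + \<sigma> *v z) \<partial>gauss h)" for y
      interpret G: prob_space "gauss h :: (real^'n) measure" by (rule prob_space_gauss[OF h(1)])
      have dm: "drift R \<beta> s \<in> borel_measurable borel" for s by (rule measurable_drift[OF R])
      have Fm: "(\<lambda>(y, z). \<psi> (y + h *\<^sub>R drift R \<beta> (real k * h) y + \<sigma> *v z)) \<in> borel_measurable (borel \<Otimes>\<^sub>M borel)"
      proof -
        note [measurable] = dm \<psi>m
        show ?thesis by measurable
      qed
      have "(\<integral>\<omega>. \<psi> (e (Suc k) \<omega>) \<partial>P) = (\<integral>\<omega>. (\<lambda>y z. \<psi> (y + h *\<^sub>R drift R \<beta> (real k * h) y + \<sigma> *v z)) (e k \<omega>) (\<omega> (real (Suc k) * h) - \<omega> (real k * h)) \<partial>P)"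
        by (simp add: e_def matrix_vector_mult_diff_distrib)
      also have "\<dots> = (\<integral>\<omega>. I (e k \<omega>) \<partial>P)"
        unfolding e_def I_def by (rule eul_step_integral[OF P h(1) dm Fm, of B0]) (use B0 in auto)
      finally have 1: "(\<integral>\<omega>. \<psi> (e (Suc k) \<omega>) \<partial>P) = (\<integral>\<omega>. I (e k \<omega>) \<partial>P)" .
      have Ib: "\<bar>I y - \<psi> y - h * gen \<psi> (\<eta> *v \<beta> (real k * h)) y\<bar> \<le> C * sqrt h ^ 3" for y
      proof -
        have "norm (drift R \<beta> (real k * h) y) \<le> G" using k by (intro G M0(2) grid) auto
        from C(2)[OF h(1,2) this, of y] show ?thesis unfolding I_def gen_drift by (simp add: diff_diff_eq)
      qed
      have Im: "(\<lambda>\<omega>. I (e k \<omega>)) \<in> borel_measurable P"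
      proof -
        have "(\<lambda>(y, z). \<psi> (y + h *\<^sub>R drift R \<beta> (real k * h) y + \<sigma> *v z)) \<in> borel_measurable (borel \<Otimes>\<^sub>M gauss h)"
          using Fm by (simp cong: measurable_cong_sets sets_pair_measure_cong)
        then have "I \<in> borel_measurable borel" unfolding I_def[abs_def] by (rule G.borel_measurable_lebesgue_integral)
        then show ?thesis by (rule measurable_compose[OF em])
      qed
      have IB: "\<bar>I y\<bar> \<le> C * sqrt h ^ 3 + B0 + h * B" for y
      proof -
        have "\<bar>h * gen \<psi> (\<eta> *v \<beta> (real k * h)) y\<bar> \<le> h * B"
          unfolding abs_mult using h k by (intro mult_mono B(2) grid) auto
        then show ?thesis using Ib[of y] B0(2)[of y] by linarith
      qed
      have Ii: "integrable P (\<lambda>\<omega>. I (e k \<omega>))"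
        by (rule integrable_const_bound[OF _ Im]) (use IB in auto)
      have "(\<integral>\<omega>. I (e k \<omega>) \<partial>P) - (\<integral>\<omega>. \<psi> (e k \<omega>) \<partial>P) - h * (\<integral>\<omega>. \<Gamma> k \<omega> \<partial>P) = (\<integral>\<omega>. I (e k \<omega>) - \<psi> (e k \<omega>) - h * \<Gamma> k \<omega> \<partial>P)"
        using Ii \<psi>i \<Gamma>i[OF less_imp_le[OF k]] by simp
      \<comment> \<open>The exceptional set is empty here, so this is just the uniform bound on the
        integrand.\<close>
      also have "\<bar>\<dots>\<bar> \<le> C * sqrt h ^ 3 + (C * sqrt h ^ 3) * prob (space P - space P)"
      proof (rule expectation_split_bound)
        show "(\<lambda>\<omega>. I (e k \<omega>) - \<psi> (e k \<omega>) - h * \<Gamma> k \<omega>) \<in> borel_measurable P"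
          using Ii \<psi>i \<Gamma>i[OF less_imp_le[OF k]] by (intro borel_measurable_integrable) simp
      qed (use Ib C(1) h in \<open>auto simp: \<Gamma>_def\<close>)
      finally show ?thesis unfolding 1 by simp
    qed
    have tel: "k \<le> N \<Longrightarrow> \<bar>(\<integral>\<omega>. \<psi> (e k \<omega>) \<partial>P) - \<psi> x - h * (\<Sum>j<k. \<integral>\<omega>. \<Gamma> j \<omega> \<partial>P)\<bar> \<le> real k * (C * sqrt h ^ 3)" for k
    proof (induction k)
      case 0
      then show ?case by (simp add: e_def prob_space)
    next
      case (Suc k)
      have "\<bar>(\<integral>\<omega>. \<psi> (e k \<omega>) \<partial>P) - \<psi> x - h * (\<Sum>j<k. \<integral>\<omega>. \<Gamma> j \<omega> \<partial>P)\<bar> \<le> real k * (C * sqrt h ^ 3)" using Suc by simp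
      moreover have "h * (\<Sum>j<Suc k. \<integral>\<omega>. \<Gamma> j \<omega> \<partial>P) = h * (\<Sum>j<k. \<integral>\<omega>. \<Gamma> j \<omega> \<partial>P) + h * (\<integral>\<omega>. \<Gamma> k \<omega> \<partial>P)" by (simp add: algebra_simps)
      moreover have "real (Suc k) * (C * sqrt h ^ 3) = real k * (C * sqrt h ^ 3) + C * sqrt h ^ 3" by (simp add: algebra_simps)
      ultimately show ?case using step[of k] Suc.prems by linarith
    qed
    have "(\<integral>\<omega>. \<psi> (e N \<omega>) - \<psi> x - h * (\<Sum>k<N. \<Gamma> k \<omega>) \<partial>P) = (\<integral>\<omega>. \<psi> (e N \<omega>) \<partial>P) - \<psi> x - h * (\<Sum>j<N. \<integral>\<omega>. \<Gamma> j \<omega> \<partial>P)"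
    proof -
      have si: "integrable P (\<lambda>\<omega>. \<Sum>k<N. \<Gamma> k \<omega>)" by (intro Bochner_Integration.integrable_sum \<Gamma>i) auto
      have "(\<integral>\<omega>. (\<Sum>k<N. \<Gamma> k \<omega>) \<partial>P) = (\<Sum>j<N. \<integral>\<omega>. \<Gamma> j \<omega> \<partial>P)"
        by (rule Bochner_Integration.integral_sum) (auto intro: \<Gamma>i)
      then show ?thesis using si \<psi>i[of N] by (simp add: prob_space)
    qed
    also have "\<bar>\<dots>\<bar> \<le> real N * (C * sqrt h ^ 3)" by (rule tel) simp
    also have "\<dots> = C * T * sqrt h"
    proof -
      have "sqrt h ^ 3 = h * sqrt h" using h by (simp add: power3_eq_cube)
      then have "real N * (C * sqrt h ^ 3) = C * (real N * h) * sqrt h" by (simp only: mult_ac)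
      then show ?thesis by (simp only: h(3))
    qed
    finally show ?thesis by (simp add: e_def \<Gamma>_def h_def)
  qed
  then show ?thesis using that[of "C * T"] C(1) T by simp
qed

text \<open>The mesh in \<open>euler_expansion\<close> tends to 0. Paths that may leave the ball are
  discarded at a cost below any \<open>e\<close>, with a radius depending on \<open>e\<close>; the
  defect \<open>expectation b\<close> does not involve the radius and is therefore 0.\<close>

lemma ito_formula:
  assumes P: "wiener_measure P" and \<psi>: "test_function \<psi>" and \<beta>: "\<beta> \<in> C0" and T: "0 < T"
  shows "(\<integral>\<omega>. \<psi> (Y T \<omega> \<beta> x) \<partial>P) = \<psi> x + integral {0..T} (\<lambda>s. \<integral>\<omega>. gen \<psi> (\<eta> *v \<beta> s) (Y s \<omega> \<beta> x) \<partial>P)"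
proof -
  interpret prob_space P using P by (rule wiener_measureD)
  obtain B where B: "0 < B" "\<And>s y. s \<in> {0..T} \<Longrightarrow> \<bar>gen \<psi> (\<eta> *v \<beta> s) y\<bar> \<le> B"
    using gen_bounded[OF \<psi> \<beta>] by blast
  obtain B0 where B0: "0 < B0" "\<And>x. \<bar>\<psi> x\<bar> \<le> B0" using test_function_bounded[OF \<psi>] by blast
  have \<psi>c: "continuous_on UNIV \<psi>" using \<psi> smoothD(2) by (auto simp: test_function_def)
  have \<psi>m: "\<psi> \<in> borel_measurable borel" by (rule borel_measurable_continuous_onI[OF \<psi>c])
  have genm: "gen \<psi> (\<eta> *v \<beta> s) \<in> borel_measurable borel" for s
    by (rule borel_measurable_continuous_onI[OF gen_continuous_snd[OF \<psi> \<beta>]])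
  define \<Gamma> where "\<Gamma> s \<omega> = gen \<psi> (\<eta> *v \<beta> s) (Y s \<omega> \<beta> x)" for s \<omega>
  have \<Gamma>c: "continuous_on {0..T} (\<lambda>s. \<Gamma> s \<omega>)" if "\<omega> \<in> C0" for \<omega>
    unfolding \<Gamma>_def by (rule gen_continuous_along[OF \<psi> \<beta> Y_cont[OF that \<beta>]])
  have \<Gamma>m: "\<Gamma> s \<in> borel_measurable P" if "s \<in> {0..T}" for s
    unfolding \<Gamma>_def using that by (intro measurable_compose[OF measurable_Y_wiener(1)[OF P \<beta>] genm]) auto
  have \<Gamma>B: "\<bar>\<Gamma> s \<omega>\<bar> \<le> B" if "s \<in> {0..T}" for s \<omega> unfolding \<Gamma>_def using B(2)[OF that] .
  have sw: "(\<lambda>\<omega>. integral {0..T} (\<lambda>s. \<Gamma> s \<omega>)) \<in> borel_measurable P"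
    "expectation (\<lambda>\<omega>. integral {0..T} (\<lambda>s. \<Gamma> s \<omega>)) = integral {0..T} (\<lambda>s. expectation (\<Gamma> s))"
    using integral_time_swap[OF T, of \<Gamma> B] \<Gamma>c \<Gamma>m \<Gamma>B by (auto simp: wiener_measureD(2)[OF P])
  have IB: "\<bar>integral {0..T} (\<lambda>s. \<Gamma> s \<omega>)\<bar> \<le> T * B" if "\<omega> \<in> C0" for \<omega>
    by (rule integral_bounded[OF less_imp_le[OF T] \<Gamma>c[OF that] \<Gamma>B])
  define b where "b \<omega> = \<psi> (Y T \<omega> \<beta> x) - \<psi> x - integral {0..T} (\<lambda>s. \<Gamma> s \<omega>)" for \<omega>
  have Ym: "(\<lambda>\<omega>. \<psi> (Y T \<omega> \<beta> x)) \<in> borel_measurable P"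
    by (rule measurable_compose[OF measurable_Y_wiener(1)[OF P \<beta> less_imp_le[OF T]] \<psi>m])
  have bm: "b \<in> borel_measurable P" unfolding b_def
    by (intro borel_measurable_diff Ym sw(1) borel_measurable_const)
  \<comment> \<open>Bounds the defect and its discretisation alike: two values of
    \<open>\<psi>\<close> and one time integral of the generator.\<close>
  define D where "D = 2 * B0 + T * B"
  have D: "0 < D" using B B0 T by (simp add: D_def add_pos_pos)
  have "\<bar>expectation b\<bar> \<le> 0"
  proof (rule field_le_epsilon)
    fix e :: real assume e: "0 < e"
    obtain M0 where M0: "0 < M0" "\<And>s. s \<in> {0..T} \<Longrightarrow> norm (\<beta> s) \<le> M0"
      using path_bounded[of T \<beta>] \<beta> by (auto intro: continuous_intros)
    obtain M1 where M1: "0 < M1" "prob (C0 - small_paths T M1) < e / (4 * D)"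
      using small_paths_large_bound[OF P, of "e / (4 * D)" T] e D by auto
    obtain R1 where R1: "0 < R1" "\<And>\<omega> \<beta> z s. \<omega> \<in> C0 \<Longrightarrow> \<beta> \<in> C0 \<Longrightarrow>
      (\<And>s. s \<in> {0..T} \<Longrightarrow> norm (\<omega> s) \<le> max M0 M1 \<and> norm (\<beta> s) \<le> max M0 M1) \<Longrightarrow> norm z \<le> norm x \<Longrightarrow> s \<in> {0..T} \<Longrightarrow> norm (Y s \<omega> \<beta> z) \<le> R1"
      using a_priori_bound[of T "max M0 M1" "norm x"] by blast
    have "bounded (closure {x. \<psi> x \<noteq> 0})" using \<psi> by (simp add: test_function_def compact_imp_bounded)
    then obtain R2 where R2: "0 < R2" "\<forall>x\<in>closure {x. \<psi> x \<noteq> 0}. norm x \<le> R2" unfolding bounded_pos by blast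
    \<comment> \<open>Large enough for the support of \<open>\<psi>\<close> and for all
      non-exceptional paths started at \<open>x\<close>.\<close>
    define R where "R = max R1 R2"
    have R: "0 < R" using R1 by (simp add: R_def less_max_iff_disj)
    obtain C where C: "0 \<le> C" "\<And>N. T \<le> real N \<Longrightarrow>
      \<bar>\<integral>\<omega>. \<psi> (eul (drift R \<beta>) (\<lambda>s. \<sigma> *v \<omega> s) (T / real N) x N) - \<psi> x -
        T / real N * (\<Sum>k<N. gen \<psi> (\<eta> *v \<beta> (real k * (T / real N))) (eul (drift R \<beta>) (\<lambda>s. \<sigma> *v \<omega> s) (T / real N) x k)) \<partial>P\<bar>
       \<le> C * sqrt (T / real N)"
      using euler_expansion[OF P \<psi> R _ \<beta> T, of x] R2 by (auto simp: R_def intro: le_max_iff_disj[THEN iffD2])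
    define E where "E N k \<omega> = eul (drift R \<beta>) (\<lambda>s. \<sigma> *v \<omega> s) (T / real N) x k" for N k \<omega>
    have Em: "E N k \<in> borel_measurable P" for N k unfolding E_def by (rule measurable_eul_drift[OF P R])
    define a where "a N \<omega> = \<psi> (E N N \<omega>) - \<psi> x - T / real N * (\<Sum>k<N. gen \<psi> (\<eta> *v \<beta> (real k * (T / real N))) (E N k \<omega>))" for N \<omega>
    have grid: "real k * (T / real N) \<in> {0..T}" if "k < N" for k N
    proof -
      have h: "0 < T / real N" using T that by simp
      have "real k * (T / real N) \<le> real N * (T / real N)" using that h by (intro mult_right_mono) auto
      also have "\<dots> = T" using that by simp
      finally have 1: "real k * (T / real N) \<le> T" .
      have "0 \<le> real k * (T / real N)" using h by (intro mult_nonneg_nonneg) auto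
      with 1 show ?thesis by simp
    qed
    have "\<bar>expectation b\<bar> \<le> e / 2 + 2 * D * prob (space P - small_paths T M1)"
    proof (rule limit_expectation_bound[where a=a])
      show "a N \<in> borel_measurable P" for N
        unfolding a_def
        by (intro borel_measurable_diff borel_measurable_times borel_measurable_sum borel_measurable_const
          measurable_compose[OF Em \<psi>m] measurable_compose[OF Em genm])
      show "b \<in> borel_measurable P" by (rule bm)
      show "small_paths T M1 \<in> events" by (simp add: wiener_measureD(3)[OF P])
      show "\<bar>b \<omega>\<bar> \<le> D" if "\<omega> \<in> space P" for \<omega>
        using B0(2)[of x] B0(2)[of "Y T \<omega> \<beta> x"] IB[of \<omega>] that
        unfolding b_def D_def wiener_measureD(2)[OF P] by linarith
      show "\<bar>a N \<omega>\<bar> \<le> D" for N \<omega>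
      proof -
        have "\<bar>T / real N * (\<Sum>k<N. gen \<psi> (\<eta> *v \<beta> (real k * (T / real N))) (E N k \<omega>))\<bar> \<le> T * B"
        proof (cases "N = 0")
          case True then show ?thesis using T B by simp
        next
          case False
          have "\<bar>\<Sum>k<N. gen \<psi> (\<eta> *v \<beta> (real k * (T / real N))) (E N k \<omega>)\<bar> \<le> (\<Sum>k<N. B)"
            by (intro order_trans[OF sum_abs] sum_mono B grid) auto
          then have "\<bar>T / real N * (\<Sum>k<N. gen \<psi> (\<eta> *v \<beta> (real k * (T / real N))) (E N k \<omega>))\<bar> \<le> T / real N * (real N * B)"
            unfolding abs_mult using T by (intro mult_mono) auto
          then show ?thesis using False by simp
        qed
        then show ?thesis using B0(2)[of x] B0(2)[of "E N N \<omega>"] unfolding a_def D_def by linarith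
      qed
      show "\<forall>\<^sub>F N in sequentially. \<bar>expectation (a N)\<bar> \<le> e / 2"
      proof -
        have "(\<lambda>N. T / real N) \<longlonglongrightarrow> 0" by (rule lim_const_over_n)
        then have "(\<lambda>N. C * sqrt (T / real N)) \<longlonglongrightarrow> C * sqrt 0" by (intro tendsto_intros)
        then have "\<forall>\<^sub>F N in sequentially. C * sqrt (T / real N) < e / 2" by (rule order_tendstoD) (use e in simp)
        moreover have "\<forall>\<^sub>F N in sequentially. T \<le> real N"
          using filterlim_real_sequentially unfolding filterlim_at_top by blast
        ultimately show ?thesis
        proof eventually_elim
          case (elim N)
          show ?case using C(2)[OF elim(2)] elim(1) unfolding a_def E_def by linarith
        qed
      qed
      fix \<omega> :: "real \<Rightarrow> real^'n" assume \<omega>: "\<omega> \<in> small_paths T M1"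
      then have \<omega>C: "\<omega> \<in> C0" "\<And>s. s \<in> {0..T} \<Longrightarrow> norm (\<omega> s) \<le> M1" by (auto simp: small_paths_def)
      have YR: "norm (Y s \<omega> \<beta> x) \<le> R" if "s \<in> {0..T}" for s
      proof -
        have "norm (Y s \<omega> \<beta> x) \<le> R1"
          by (rule R1(2)[OF \<omega>C(1) \<beta> _ order_refl that]) (use \<omega>C(2) M0(2) in \<open>auto intro: le_max_iff_disj[THEN iffD2]\<close>)
        then show ?thesis by (simp add: R_def)
      qed
      have unif: "\<forall>\<^sub>F N in sequentially. \<forall>k\<le>N. norm (E N k \<omega> - Y (real k * (T / real N)) \<omega> \<beta> x) < d" if "0 < d" for d
        unfolding E_def by (rule eul_converges_uniform[OF \<omega>C(1) \<beta> T R Y_cont[OF \<omega>C(1) \<beta>] Y_eq[OF \<omega>C(1) \<beta>] YR that]) auto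
      have l1: "(\<lambda>N. \<psi> (E N N \<omega>)) \<longlonglongrightarrow> \<psi> (Y T \<omega> \<beta> x)"
        unfolding E_def
        by (rule continuous_on_tendsto_compose[OF \<psi>c Y_converges[OF \<omega>C(1) \<beta> T R YR]]) auto
      define r where "r N = T / real N * (\<Sum>k<N. \<Gamma> (real k * (T / real N)) \<omega>)" for N
      have l2: "r \<longlonglongrightarrow> integral {0..T} (\<lambda>s. \<Gamma> s \<omega>)"
        unfolding r_def by (rule riemann_sum_tendsto[OF T \<Gamma>c[OF \<omega>C(1)]])
      \<comment> \<open>Replacing Euler values by exact ones in the sum uses uniform continuity of
        the generator on a compact set; the radius \<open>R + 1\<close> leaves room for the error of
        the scheme.\<close>
      have l3: "(\<lambda>N. T / real N * (\<Sum>k<N. gen \<psi> (\<eta> *v \<beta> (real k * (T / real N))) (E N k \<omega>)) - r N) \<longlonglongrightarrow> 0"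
      proof (rule tendstoI)
        fix \<epsilon> :: real assume \<epsilon>: "0 < \<epsilon>"
        let ?K = "{0..T} \<times> cball (0::real^'n) (R + 1)"
        have "uniformly_continuous_on ?K (\<lambda>(s, y). gen \<psi> (\<eta> *v \<beta> s) y)"
          by (intro compact_uniformly_continuous compact_Times continuous_on_subset[OF gen_continuous[OF \<psi> \<beta>, of "{0..T}"]]) auto
        then obtain d where d: "0 < d" "\<And>z z'. z \<in> ?K \<Longrightarrow> z' \<in> ?K \<Longrightarrow> dist z' z < d \<Longrightarrow>
            dist ((\<lambda>(s, y). gen \<psi> (\<eta> *v \<beta> s) y) z') ((\<lambda>(s, y). gen \<psi> (\<eta> *v \<beta> s) y) z) < \<epsilon> / (2 * T)"
          unfolding uniformly_continuous_on_def using \<epsilon> T by (metis divide_pos_pos mult_pos_pos zero_less_numeral)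
        have "0 < min d 1" using d by simp
        from unif[OF this] eventually_gt_at_top[of 0]
        show "\<forall>\<^sub>F N in sequentially. dist (T / real N * (\<Sum>k<N. gen \<psi> (\<eta> *v \<beta> (real k * (T / real N))) (E N k \<omega>)) - r N) 0 < \<epsilon>"
        proof eventually_elim
          case (elim N)
          have each: "\<bar>gen \<psi> (\<eta> *v \<beta> (real k * (T / real N))) (E N k \<omega>) - \<Gamma> (real k * (T / real N)) \<omega>\<bar> \<le> \<epsilon> / (2 * T)" if k: "k < N" for k
          proof -
            let ?s = "real k * (T / real N)"
            have n: "norm (E N k \<omega> - Y ?s \<omega> \<beta> x) < min d 1" using elim(1) k by simp
            have yR: "norm (Y ?s \<omega> \<beta> x) \<le> R" by (rule YR[OF grid[OF k]])
            have "norm (E N k \<omega>) \<le> R + 1" using norm_triangle_ineq2[of "E N k \<omega>" "Y ?s \<omega> \<beta> x"] n yR by linarith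
            then have "(?s, E N k \<omega>) \<in> ?K" "(?s, Y ?s \<omega> \<beta> x) \<in> ?K" using grid[OF k] yR by (auto simp del: times_divide_eq_right)
            moreover have "dist (?s, E N k \<omega>) (?s, Y ?s \<omega> \<beta> x) < d" using n by (simp add: dist_Pair_Pair dist_norm)
            ultimately show ?thesis using d(2)[of "(?s, Y ?s \<omega> \<beta> x)" "(?s, E N k \<omega>)"] by (simp add: \<Gamma>_def dist_real_def)
          qed
          have "T / real N * (\<Sum>k<N. gen \<psi> (\<eta> *v \<beta> (real k * (T / real N))) (E N k \<omega>)) - r N =
             T / real N * (\<Sum>k<N. gen \<psi> (\<eta> *v \<beta> (real k * (T / real N))) (E N k \<omega>) - \<Gamma> (real k * (T / real N)) \<omega>)"
            by (simp add: r_def sum_subtractf right_diff_distrib)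
          also have "\<bar>\<dots>\<bar> \<le> T / real N * (\<Sum>k<N. \<epsilon> / (2 * T))"
            unfolding abs_mult using T
            by (intro mult_mono order_trans[OF sum_abs] sum_mono each) (auto intro!: sum_nonneg)
          also have "\<dots> = \<epsilon> / 2" using elim(2) T by simp
          also have "\<dots> < \<epsilon>" using \<epsilon> by simp
          finally show ?case by (simp add: dist_real_def)
        qed
      qed
      have "(\<lambda>N. T / real N * (\<Sum>k<N. gen \<psi> (\<eta> *v \<beta> (real k * (T / real N))) (E N k \<omega>))) \<longlonglongrightarrow> integral {0..T} (\<lambda>s. \<Gamma> s \<omega>)"
        using tendsto_add[OF l3 l2] by simp
      then show "(\<lambda>N. a N \<omega>) \<longlonglongrightarrow> b \<omega>"
        unfolding a_def b_def by (intro tendsto_diff l1 tendsto_const)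
    qed
    moreover have "2 * D * prob (space P - small_paths T M1) \<le> e / 2"
    proof -
      have "2 * D * prob (C0 - small_paths T M1) \<le> 2 * D * (e / (4 * D))" using M1(2) D by (intro mult_left_mono) auto
      then show ?thesis using D by (simp add: wiener_measureD(2)[OF P])
    qed
    ultimately show "\<bar>expectation b\<bar> \<le> 0 + e" by linarith
  qed
  then have "expectation b = 0" by simp
  moreover have "expectation b = (\<integral>\<omega>. \<psi> (Y T \<omega> \<beta> x) \<partial>P) - \<psi> x - integral {0..T} (\<lambda>s. expectation (\<Gamma> s))"
  proof -
    have i1: "integrable P (\<lambda>\<omega>. \<psi> (Y T \<omega> \<beta> x))" by (rule integrable_const_bound[of _ B0]) (use B0 Ym in auto)
    have i2: "integrable P (\<lambda>\<omega>. integral {0..T} (\<lambda>s. \<Gamma> s \<omega>))"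
      by (rule integrable_const_bound[of _ "T * B"]) (use IB sw(1) in \<open>auto simp: wiener_measureD(2)[OF P]\<close>)
    show ?thesis unfolding b_def sw(2)[symmetric] using i1 i2 by (simp add: prob_space)
  qed
  ultimately show ?thesis by (simp add: \<Gamma>_def[abs_def])
qed

end

context noisy_law
begin

text \<open>Ito's formula averaged over the starting point. \<open>integral_time_swap\<close> over
  the noise supplies continuity in time, and over \<open>\<rho>\<close> the exchange of the
  integrals.\<close>

lemma law_weak_equation:
  assumes \<psi>: "test_function \<psi>" and \<beta>: "\<beta> \<in> C0" and T: "0 < T"
  shows "(\<integral>y. \<psi> y \<partial>law T \<beta>) = (\<integral>y. \<psi> y \<partial>\<rho>) + integral {0..T} (\<lambda>s. \<integral>y. gen \<psi> (\<eta> *v \<beta> s) y \<partial>law s \<beta>)"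
proof -
  obtain B where B: "0 < B" "\<And>s y. s \<in> {0..T} \<Longrightarrow> \<bar>gen \<psi> (\<eta> *v \<beta> s) y\<bar> \<le> B"
    using gen_bounded[OF \<psi> \<beta>] by blast
  obtain B0 where B0: "0 < B0" "\<And>x. \<bar>\<psi> x\<bar> \<le> B0" using test_function_bounded[OF \<psi>] by blast
  have \<psi>m: "\<psi> \<in> borel_measurable borel"
    using \<psi> smoothD(2) by (auto simp: test_function_def intro: borel_measurable_continuous_onI)
  have genm: "gen \<psi> (\<eta> *v \<beta> s) \<in> borel_measurable borel" for s
    by (rule borel_measurable_continuous_onI[OF gen_continuous_snd[OF \<psi> \<beta>]])
  define g where "g s x = (\<integral>\<omega>. gen \<psi> (\<eta> *v \<beta> s) (Y s \<omega> \<beta> x) \<partial>P)" for s x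
  have gl: "(\<integral>y. gen \<psi> (\<eta> *v \<beta> s) y \<partial>law s \<beta>) = (\<integral>x. g s x \<partial>\<rho>)" if "s \<in> {0..T}" for s
    unfolding g_def using that by (intro law_integral[OF \<beta> _ genm B(2)]) auto
  have gm: "g s \<in> borel_measurable \<rho>" if "s \<in> {0..T}" for s
    using measurable_inner[OF \<beta> _ genm, of s] that by (simp add: g_def[abs_def] measurable_cong_sets[OF \<rho>(2) refl])
  have gc: "continuous_on {0..T} (\<lambda>s. g s x)" for x
    unfolding g_def
  proof (rule P.integral_time_swap(1)[OF T])
    show "continuous_on {0..T} (\<lambda>s. gen \<psi> (\<eta> *v \<beta> s) (Y s \<omega> \<beta> x))" if "\<omega> \<in> space P" for \<omega>
      using that by (intro gen_continuous_along[OF \<psi> \<beta>] Y_cont \<beta>) simp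
    show "(\<lambda>\<omega>. gen \<psi> (\<eta> *v \<beta> s) (Y s \<omega> \<beta> x)) \<in> borel_measurable P" if "s \<in> {0..T}" for s
      using that by (intro measurable_compose[OF measurable_Y_wiener(1)[OF P \<beta>] genm]) auto
  qed (rule B(2))
  have gB: "\<bar>g s x\<bar> \<le> B" if s: "s \<in> {0..T}" for s x
  proof -
    have "\<bar>g s x\<bar> \<le> B + B * P.prob (space P - space P)"
      unfolding g_def
    proof (rule P.expectation_split_bound)
      show "(\<lambda>\<omega>. gen \<psi> (\<eta> *v \<beta> s) (Y s \<omega> \<beta> x)) \<in> borel_measurable P"
        using s by (intro measurable_compose[OF measurable_Y_wiener(1)[OF P \<beta>] genm]) auto
    qed (use B(1) B(2)[OF s] sets.top[of P] in auto)
    then show ?thesis by simp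
  qed
  note sw = R.integral_time_swap[OF T gc gm gB]
  have ito: "(\<integral>\<omega>. \<psi> (Y T \<omega> \<beta> x) \<partial>P) = \<psi> x + integral {0..T} (\<lambda>s. g s x)" for x
    unfolding g_def by (rule ito_formula[OF P \<psi> \<beta> T])
  have i1: "integrable \<rho> \<psi>"
    by (rule R.integrable_const_bound[of _ B0]) (use B0 \<psi>m in \<open>auto simp: measurable_cong_sets[OF \<rho>(2) refl]\<close>)
  have i2: "integrable \<rho> (\<lambda>x. integral {0..T} (\<lambda>s. g s x))"
    by (rule R.integrable_const_bound[of _ "T * B"])
      (use sw(2) integral_bounded[OF less_imp_le[OF T] gc gB] in auto)
  have "(\<integral>y. \<psi> y \<partial>law T \<beta>) = (\<integral>x. \<psi> x + integral {0..T} (\<lambda>s. g s x) \<partial>\<rho>)"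
    using law_integral[OF \<beta> less_imp_le[OF T] \<psi>m B0(2)] by (simp add: ito)
  also have "\<dots> = (\<integral>y. \<psi> y \<partial>\<rho>) + integral {0..T} (\<lambda>s. \<integral>x. g s x \<partial>\<rho>)"
    using i1 i2 sw(3) by simp
  also have "integral {0..T} (\<lambda>s. \<integral>x. g s x \<partial>\<rho>) = integral {0..T} (\<lambda>s. \<integral>y. gen \<psi> (\<eta> *v \<beta> s) y \<partial>law s \<beta>)"
    by (rule integral_cong) (simp add: gl)
  finally show ?thesis .
qed

lemma law_0:
  assumes "\<beta> \<in> C0"
  shows "law 0 \<beta> = \<rho>"
proof -
  have "law 0 \<beta> = distr (\<rho> \<Otimes>\<^sub>M P) borel fst"
    unfolding law_def by (rule distr_cong) (auto simp: space_pair_measure Y_0 assms)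
  also have "\<dots> = distr (\<rho> \<Otimes>\<^sub>M P) \<rho> fst" by (rule distr_cong) (auto simp: \<rho>)
  also have "\<dots> = \<rho>" by (rule P.distr_pair_fst)
  finally show ?thesis .
qed

end

section \<open>Kernels\<close>

text \<open>On a compact set carrying almost all of \<open>\<mu>\<close>, equicontinuity replaces
  every \<open>h\<close> by a combination of one finite partition of unity with coefficients of
  modulus at most 1. Convergence for these finitely many tests is then uniform in
  \<open>h\<close>.\<close>

lemma weak_convergence_equicontinuous:
  fixes \<nu> :: "nat \<Rightarrow> (real^'n) measure" and \<mu> :: "(real^'n) measure" and H :: "(real^'n \<Rightarrow> real) set"
  assumes \<nu>: "\<And>n. prob_space (\<nu> n)" "\<And>n. sets (\<nu> n) = sets borel"
    and \<mu>: "prob_space \<mu>" "sets \<mu> = sets borel"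
    and conv: "\<And>f. unit_test f \<Longrightarrow> (\<lambda>n. \<integral>x. f x \<partial>\<nu> n) \<longlonglongrightarrow> (\<integral>x. f x \<partial>\<mu>)"
    and H: "\<And>h. h \<in> H \<Longrightarrow> unit_test h"
    and eq: "\<And>x e. 0 < e \<Longrightarrow> \<exists>d>0. \<forall>h\<in>H. \<forall>y. dist y x < d \<longrightarrow> \<bar>h y - h x\<bar> \<le> e"
    and e: "0 < e"
  shows "\<forall>\<^sub>F n in sequentially. \<forall>h\<in>H. \<bar>(\<integral>x. h x \<partial>\<nu> n) - (\<integral>x. h x \<partial>\<mu>)\<bar> \<le> e"
proof -
  interpret M: prob_space \<mu> by fact
  \<comment> \<open>Six shares: the oscillation of \<open>h\<close> under each of the two measures,
    the mass off the compact set counted once for \<open>\<mu>\<close> and twice for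
    \<open>\<nu> n\<close>, and the finite sum.\<close>
  define e6 where "e6 = e / 6"
  have e6: "0 < e6" using e by (simp add: e6_def)
  obtain r where r: "0 < r" "M.prob (space \<mu> - cball 0 r) < e6" using ball_mass[OF \<mu> e6] by blast
  let ?K = "cball (0::real^'n) r"
  have "\<forall>x. \<exists>d>0. \<forall>h\<in>H. \<forall>y. dist y x < d \<longrightarrow> \<bar>h y - h x\<bar> \<le> e6" using eq[OF e6] by blast
  then obtain \<delta> where \<delta>: "\<And>x. 0 < \<delta> x" "\<And>x h y. h \<in> H \<Longrightarrow> dist y x < \<delta> x \<Longrightarrow> \<bar>h y - h x\<bar> \<le> e6" by metis
  have "compact ?K" "\<And>x. x \<in> ?K \<Longrightarrow> open (ball x (\<delta> x))" "?K \<subseteq> (\<Union>x\<in>?K. ball x (\<delta> x))" using \<delta>(1) by auto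
  then obtain X where X: "X \<subseteq> ?K" "finite X" "?K \<subseteq> (\<Union>x\<in>X. ball x (\<delta> x))"
    by (rule compactE_image) 
  define g where "g x y = max 0 (\<delta> x - dist y x)" for x y
  have gc: "continuous_on A (g x)" for A x unfolding g_def by (intro continuous_intros)
  have g0: "0 \<le> g x y" for x y by (simp add: g_def)
  define S where "S y = (\<Sum>x\<in>X. g x y)" for y
  have Sc: "continuous_on A S" for A unfolding S_def by (intro continuous_intros gc)
  have S0: "0 \<le> S y" for y unfolding S_def by (intro sum_nonneg g0)
  have Spos: "0 < S y" if "y \<in> ?K" for y
  proof -
    from X(3) that obtain x where x: "x \<in> X" "y \<in> ball x (\<delta> x)" by blast
    then have "0 < g x y" by (simp add: g_def dist_commute)
    also have "\<dots> \<le> S y" unfolding S_def by (rule member_le_sum) (use x g0 X in auto)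
    finally show ?thesis .
  qed
  have "0 \<in> ?K" using r by simp
  then obtain y0 where y0: "y0 \<in> ?K" "\<And>y. y \<in> ?K \<Longrightarrow> S y0 \<le> S y"
    using continuous_attains_inf[OF compact_cball _ Sc, of 0 r] by blast
  \<comment> \<open>A positive minimum of \<open>S\<close> on the compact set; dividing by
    \<open>max m (S y)\<close> normalises there and stays continuous everywhere.\<close>
  define m where "m = S y0"
  have m: "0 < m" using Spos[OF y0(1)] by (simp add: m_def)
  define \<zeta> where "\<zeta> x y = g x y / max m (S y)" for x y
  have \<zeta>c: "continuous_on UNIV (\<zeta> x)" for x
    unfolding \<zeta>_def using m by (intro continuous_intros gc Sc) (auto simp: max_def)
  have \<zeta>0: "0 \<le> \<zeta> x y" for x y unfolding \<zeta>_def using m g0 by (intro divide_nonneg_pos) auto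
  have \<zeta>sum: "(\<Sum>x\<in>X. \<zeta> x y) = S y / max m (S y)" for y by (simp add: \<zeta>_def S_def sum_divide_distrib)
  have \<zeta>sum1: "(\<Sum>x\<in>X. \<zeta> x y) \<le> 1" for y unfolding \<zeta>sum using m by (simp add: divide_le_eq)
  have \<zeta>1: "\<zeta> x y \<le> 1" if "x \<in> X" for x y
    by (rule order_trans[OF _ \<zeta>sum1[of y]], rule member_le_sum) (use that \<zeta>0 X in auto)
  \<comment> \<open>The part of 1 left uncovered by the partition. It vanishes on the compact set
    and, being a continuous test itself, carries the smallness of the outer mass from
    \<open>\<mu>\<close> over to \<open>\<nu> n\<close>; this is how tightness of the sequence
    enters.\<close>
  define \<zeta>' where "\<zeta>' y = 1 - (\<Sum>x\<in>X. \<zeta> x y)" for y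
  have \<zeta>'01: "0 \<le> \<zeta>' y" "\<zeta>' y \<le> 1" for y using \<zeta>sum1[of y] sum_nonneg[of X "\<lambda>x. \<zeta> x y"] \<zeta>0 by (auto simp: \<zeta>'_def)
  have ut': "unit_test \<zeta>'" using \<zeta>'01 unfolding unit_test_def \<zeta>'_def by (auto intro!: continuous_intros \<zeta>c)
  have ut: "unit_test (\<zeta> x)" if "x \<in> X" for x
    using \<zeta>1[OF that] \<zeta>0 \<zeta>c by (simp add: unit_test_def)
  have \<zeta>'K: "\<zeta>' y = 0" if "y \<in> ?K" for y
    using y0(2)[OF that] m Spos[OF that] by (simp add: \<zeta>'_def \<zeta>sum m_def)
  have \<mu>\<zeta>': "(\<integral>y. \<zeta>' y \<partial>\<mu>) \<le> e6"
  proof -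
    have "\<bar>\<integral>y. \<zeta>' y \<partial>\<mu>\<bar> \<le> 0 + 1 * M.prob (space \<mu> - ?K)"
    proof (rule M.expectation_split_bound)
      show "\<zeta>' \<in> borel_measurable \<mu>" using unit_testD(3)[OF ut'] by (simp add: measurable_cong_sets[OF \<mu>(2) refl])
      show "?K \<in> M.events" unfolding \<mu>(2) by (intro borel_closed closed_cball)
    qed (use \<zeta>'K \<zeta>'01 in auto)
    then show ?thesis using r(2) by linarith
  qed
  have each: "\<bar>(\<integral>y. h y \<partial>N) - (\<Sum>x\<in>X. h x * (\<integral>y. \<zeta> x y \<partial>N))\<bar> \<le> e6 + (\<integral>y. \<zeta>' y \<partial>N)"
    if N: "prob_space N" "sets N = sets borel" and h: "h \<in> H" for h and N :: "(real^'n) measure"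
  proof -
    interpret N: prob_space N by fact
    have idm: "(\<lambda>x. x) \<in> borel_measurable N" by (simp add: measurable_cong_sets[OF N(2) refl])
    note int = unit_test_integrable(1)[OF N(1) idm]
    have sint: "integrable N (\<lambda>y. \<Sum>x\<in>X. h x * \<zeta> x y)"
      by (intro Bochner_Integration.integrable_sum integrable_mult_right int ut)
    have bnd: "\<bar>h y - (\<Sum>x\<in>X. h x * \<zeta> x y)\<bar> \<le> e6 + \<zeta>' y" for y
    proof -
      have "h y - (\<Sum>x\<in>X. h x * \<zeta> x y) = (\<Sum>x\<in>X. (h y - h x) * \<zeta> x y) + h y * \<zeta>' y"
        by (simp add: \<zeta>'_def algebra_simps sum_subtractf sum_distrib_left)
      moreover have "\<bar>\<Sum>x\<in>X. (h y - h x) * \<zeta> x y\<bar> \<le> (\<Sum>x\<in>X. e6 * \<zeta> x y)"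
      proof (intro order_trans[OF sum_abs] sum_mono)
        fix x assume "x \<in> X"
        show "\<bar>(h y - h x) * \<zeta> x y\<bar> \<le> e6 * \<zeta> x y"
        proof (cases "dist y x < \<delta> x")
          case True
          then show ?thesis unfolding abs_mult using \<delta>(2)[OF h True] \<zeta>0[of x y] by (auto intro: mult_right_mono)
        next
          case False
          then show ?thesis by (simp add: \<zeta>_def g_def)
        qed
      qed
      moreover have "(\<Sum>x\<in>X. e6 * \<zeta> x y) \<le> e6 * 1" unfolding sum_distrib_left[symmetric]
        using e6 \<zeta>sum1[of y] by (intro mult_left_mono) auto
      moreover have "\<bar>h y * \<zeta>' y\<bar> \<le> 1 * \<zeta>' y" unfolding abs_mult
        using \<zeta>'01[of y] unit_testD(2)[OF H[OF h], of y] by (intro mult_mono) auto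
      ultimately show ?thesis by linarith
    qed
    have "(\<integral>y. h y \<partial>N) - (\<Sum>x\<in>X. h x * (\<integral>y. \<zeta> x y \<partial>N)) = (\<integral>y. h y - (\<Sum>x\<in>X. h x * \<zeta> x y) \<partial>N)"
    proof -
      have "(\<integral>y. (\<Sum>x\<in>X. h x * \<zeta> x y) \<partial>N) = (\<Sum>x\<in>X. \<integral>y. h x * \<zeta> x y \<partial>N)"
        by (rule Bochner_Integration.integral_sum) (intro integrable_mult_right int ut)
      then show ?thesis using int[OF H[OF h]] sint by simp
    qed
    also have "\<bar>\<dots>\<bar> \<le> (\<integral>y. \<bar>h y - (\<Sum>x\<in>X. h x * \<zeta> x y)\<bar> \<partial>N)" by (rule integral_abs_bound)
    also have "\<dots> \<le> (\<integral>y. e6 + \<zeta>' y \<partial>N)"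
      by (intro integral_mono integrable_abs Bochner_Integration.integrable_diff Bochner_Integration.integrable_add
        int[OF H[OF h]] sint int[OF ut'] N.integrable_const bnd)
    also have "\<dots> = e6 + (\<integral>y. \<zeta>' y \<partial>N)" using int[OF ut'] by (simp add: N.prob_space)
    finally show ?thesis .
  qed
  have "(\<lambda>n. \<Sum>x\<in>X. \<bar>(\<integral>y. \<zeta> x y \<partial>\<nu> n) - (\<integral>y. \<zeta> x y \<partial>\<mu>)\<bar>) \<longlonglongrightarrow> (\<Sum>x\<in>X. \<bar>(\<integral>y. \<zeta> x y \<partial>\<mu>) - (\<integral>y. \<zeta> x y \<partial>\<mu>)\<bar>)"
    by (intro tendsto_sum tendsto_rabs tendsto_diff tendsto_const conv ut)
  then have "(\<lambda>n. \<Sum>x\<in>X. \<bar>(\<integral>y. \<zeta> x y \<partial>\<nu> n) - (\<integral>y. \<zeta> x y \<partial>\<mu>)\<bar>) \<longlonglongrightarrow> 0" by simp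
  then have ev1: "\<forall>\<^sub>F n in sequentially. (\<Sum>x\<in>X. \<bar>(\<integral>y. \<zeta> x y \<partial>\<nu> n) - (\<integral>y. \<zeta> x y \<partial>\<mu>)\<bar>) < e6"
    using e6 by (rule order_tendstoD)
  have "\<forall>\<^sub>F n in sequentially. (\<integral>y. \<zeta>' y \<partial>\<nu> n) < 2 * e6"
    using conv[OF ut'] by (rule order_tendstoD) (use \<mu>\<zeta>' e6 in linarith)
  with ev1 show ?thesis
  proof eventually_elim
    case (elim n)
    show ?case
    proof
      fix h assume h: "h \<in> H"
      have "\<bar>(\<Sum>x\<in>X. h x * (\<integral>y. \<zeta> x y \<partial>\<nu> n)) - (\<Sum>x\<in>X. h x * (\<integral>y. \<zeta> x y \<partial>\<mu>))\<bar> =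
          \<bar>\<Sum>x\<in>X. h x * ((\<integral>y. \<zeta> x y \<partial>\<nu> n) - (\<integral>y. \<zeta> x y \<partial>\<mu>))\<bar>"
        by (simp add: sum_subtractf right_diff_distrib)
      also have "\<dots> \<le> (\<Sum>x\<in>X. \<bar>(\<integral>y. \<zeta> x y \<partial>\<nu> n) - (\<integral>y. \<zeta> x y \<partial>\<mu>)\<bar>)"
      proof (intro order_trans[OF sum_abs] sum_mono)
        fix x
        show "\<bar>h x * ((\<integral>y. \<zeta> x y \<partial>\<nu> n) - (\<integral>y. \<zeta> x y \<partial>\<mu>))\<bar> \<le> \<bar>(\<integral>y. \<zeta> x y \<partial>\<nu> n) - (\<integral>y. \<zeta> x y \<partial>\<mu>)\<bar>"
          unfolding abs_mult using unit_testD(2)[OF H[OF h], of x] by (intro mult_left_le_one_le) auto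
      qed
      finally have "\<bar>(\<Sum>x\<in>X. h x * (\<integral>y. \<zeta> x y \<partial>\<nu> n)) - (\<Sum>x\<in>X. h x * (\<integral>y. \<zeta> x y \<partial>\<mu>))\<bar> \<le> e6" using elim(1) by linarith
      then show "\<bar>(\<integral>x. h x \<partial>\<nu> n) - (\<integral>x. h x \<partial>\<mu>)\<bar> \<le> e"
        using each[OF \<nu> h, of n] each[OF \<mu> h] elim(2) \<mu>\<zeta>' unfolding e6_def by linarith
    qed
  qed
qed

text \<open>Closed sets are stable under intersection and generate the Borel sets, and their
  indicators are limits of continuous tests.\<close>

lemma measurable_prob_algebra_unit_test:
  fixes \<kappa> :: "'z \<Rightarrow> (real^'n) measure"
  assumes \<kappa>: "\<And>z. z \<in> space M \<Longrightarrow> prob_space (\<kappa> z)" "\<And>z. z \<in> space M \<Longrightarrow> sets (\<kappa> z) = sets borel"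
    and meas: "\<And>f. unit_test f \<Longrightarrow> (\<lambda>z. \<integral>x. f x \<partial>\<kappa> z) \<in> borel_measurable M"
  shows "\<kappa> \<in> M \<rightarrow>\<^sub>M prob_algebra borel"
proof (rule measurable_prob_algebra_generated[of borel UNIV "Collect closed"])
  show "sets (borel :: (real^'n) measure) = sigma_sets UNIV (Collect closed)"
    unfolding borel_eq_closed by (rule sets_measure_of) simp
  show "Int_stable (Collect closed :: (real^'n) set set)" by (auto simp: Int_stable_def)
  fix A :: "(real^'n) set" assume "A \<in> Collect closed"
  then obtain f :: "nat \<Rightarrow> real^'n \<Rightarrow> real" where f: "\<And>k. unit_test (f k)" "\<And>x. (\<lambda>k. f k x) \<longlonglongrightarrow> indicator A x"
    using closed_indicator_limit[of A] by (metis mem_Collect_eq)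
  have Ab: "A \<in> sets borel" using \<open>A \<in> Collect closed\<close> by (intro borel_closed) simp
  have "(\<lambda>z. measure (\<kappa> z) A) \<in> borel_measurable M"
  proof (rule borel_measurable_LIMSEQ_real[OF _ meas[OF f(1)]])
    fix z assume z: "z \<in> space M"
    interpret prob_space "\<kappa> z" by (rule \<kappa>[OF z])
    have sp: "space (\<kappa> z) = UNIV" using sets_eq_imp_space_eq[OF \<kappa>(2)[OF z]] by simp
    have "(\<lambda>k. \<integral>x. f k x \<partial>\<kappa> z) \<longlonglongrightarrow> (\<integral>x. indicator A x \<partial>\<kappa> z)"
    proof (rule integral_dominated_convergence[where w="\<lambda>_. 1"])
      show "indicator A \<in> borel_measurable (\<kappa> z)" using Ab \<kappa>(2)[OF z] by simp
      show "f k \<in> borel_measurable (\<kappa> z)" for k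
        using unit_testD(3)[OF f(1)] by (simp add: measurable_cong_sets[OF \<kappa>(2)[OF z] refl])
    qed (use f(2) unit_testD(2)[OF f(1)] in auto)
    then show "(\<lambda>k. \<integral>x. f k x \<partial>\<kappa> z) \<longlonglongrightarrow> measure (\<kappa> z) A" by (simp add: sp)
  qed
  then have "(\<lambda>z. ennreal (measure (\<kappa> z) A)) \<in> borel_measurable M" by simp
  moreover have "emeasure (\<kappa> z) A = ennreal (measure (\<kappa> z) A)" if "z \<in> space M" for z
    using finite_measure.emeasure_eq_measure[OF prob_space.finite_measure[OF \<kappa>(1)[OF that]]] .
  ultimately show "(\<lambda>z. emeasure (\<kappa> z) A) \<in> borel_measurable M" by (simp cong: measurable_cong)
qed (use \<kappa> in auto)

lemma kernel_bind_integral: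
  fixes f :: "real^'n \<Rightarrow> real"
  assumes M: "prob_space M" and \<kappa>: "\<kappa> \<in> M \<rightarrow>\<^sub>M prob_algebra borel" and f: "unit_test f"
  shows "(\<integral>x. f x \<partial>(M \<bind> \<kappa>)) = (\<integral>z. (\<integral>x. f x \<partial>\<kappa> z) \<partial>M)"
proof (rule integral_bind[where B=1 and B'=1 and K=borel])
  interpret prob_space M by fact
  show "finite_measure M" by (rule finite_measure_axioms)
  show "\<kappa> \<in> M \<rightarrow>\<^sub>M subprob_algebra borel" by (rule measurable_prob_algebraD[OF \<kappa>])
  show "AE z in M. emeasure (\<kappa> z) (space (\<kappa> z)) \<le> ennreal 1"
  proof (rule AE_I2)
    fix z assume "z \<in> space M"
    then have "prob_space (\<kappa> z)" using measurable_space[OF \<kappa>] by (auto simp: space_prob_algebra)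
    then show "emeasure (\<kappa> z) (space (\<kappa> z)) \<le> ennreal 1" by (simp add: prob_space.emeasure_space_1)
  qed
qed (use unit_testD[OF f] in auto)

lemma prob_space_kernel:
  assumes "\<kappa> \<in> M \<rightarrow>\<^sub>M prob_algebra N" "z \<in> space M"
  shows "prob_space (\<kappa> z)" "sets (\<kappa> z) = sets N"
  using measurable_space[OF assms] by (auto simp: space_prob_algebra)

lemma measures_eq_if_unit_test:
  fixes M N :: "(real^'n) measure"
  assumes M: "prob_space M" "sets M = sets borel" and N: "prob_space N" "sets N = sets borel"
    and eq: "\<And>f. unit_test f \<Longrightarrow> (\<integral>x. f x \<partial>M) = (\<integral>x. f x \<partial>N)"
  shows "M = N"
proof (rule measure_eqI)
  show "sets M = sets N" using M N by simp
  fix A assume "A \<in> sets M"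
  then have A: "A \<in> sets borel" using M by simp
  have "tv_le M N 0" "tv_le N M 0" using eq by (auto simp: tv_le_def)
  from tv_le_measure[OF M N this(1) A] tv_le_measure[OF N M this(2) A]
  have "measure M A = measure N A" by simp
  then show "emeasure M A = emeasure N A"
    by (simp add: finite_measure.emeasure_eq_measure prob_space.finite_measure M(1) N(1))
qed

text \<open>Finite intersections of a countable base. Countability turns an identity that holds
  almost everywhere for each set into one that holds almost everywhere for all sets at once.\<close>

lemma countable_borel_generator:
  obtains E :: "'a::second_countable_topology set set"
  where "countable E" "Int_stable E" "UNIV \<in> E" "sets borel = sigma_sets UNIV E" "E \<subseteq> sets borel"
proof -
  obtain B :: "'a set set" where B: "countable B" "topological_basis B" using ex_countable_basis by blast
  define E where "E = Inter ` {S. finite S \<and> S \<subseteq> B}"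
  have bo: "b \<in> sets borel" if "b \<in> B" for b using topological_basis_open[OF B(2) that] by simp
  have Eb: "E \<subseteq> sets borel"
  proof
    fix A assume "A \<in> E"
    then obtain S where S: "finite S" "S \<subseteq> B" "A = \<Inter> S" by (auto simp: E_def)
    have "open A" unfolding S(3) using S B by (intro open_Inter) (auto intro: topological_basis_open)
    then show "A \<in> sets borel" by simp
  qed
  have "countable E" unfolding E_def by (intro countable_image countable_Collect_finite_subset B)
  moreover have "Int_stable E"
  proof (rule Int_stableI)
    fix a b assume "a \<in> E" "b \<in> E"
    then obtain S S' where S: "finite S" "S \<subseteq> B" "a = \<Inter> S" "finite S'" "S' \<subseteq> B" "b = \<Inter> S'" by (auto simp: E_def)
    then show "a \<inter> b \<in> E" unfolding E_def by (intro image_eqI[of _ _ "S \<union> S'"]) auto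
  qed
  moreover have "UNIV \<in> E" unfolding E_def by (intro image_eqI[of _ _ "{}"]) auto
  moreover have "sets borel = sigma_sets UNIV E"
  proof
    have "B \<subseteq> E" unfolding E_def by (auto intro!: image_eqI[of _ _ "{_}"])
    then have "sigma_sets UNIV B \<subseteq> sigma_sets UNIV E" by (rule sigma_sets_mono')
    moreover have "sets borel = sigma_sets UNIV B"
      unfolding borel_eq_countable_basis[OF B] by (rule sets_measure_of) simp
    ultimately show "sets borel \<subseteq> sigma_sets UNIV E" by simp
    show "sigma_sets UNIV E \<subseteq> sets borel"
      using sets.sigma_sets_subset[OF Eb] by simp
  qed
  ultimately show ?thesis using Eb that by blast
qed

text \<open>Radon--Nikodym is applied on the product space, for a jointly measurable density.\<close>

lemma kernel_density:
  fixes \<kappa> :: "'z \<Rightarrow> (real^'n) measure"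
  assumes M: "prob_space M" and \<kappa>: "\<kappa> \<in> M \<rightarrow>\<^sub>M prob_algebra borel"
    and ac: "AE z in M. \<forall>A\<in>null_sets lborel. measure (\<kappa> z) A = 0"
  obtains p where "(\<lambda>(z, x). p z x) \<in> borel_measurable (M \<Otimes>\<^sub>M lborel)" "\<And>z x. 0 \<le> p z x"
    "AE z in M. prob_density (p z) \<and> \<kappa> z = density lborel (\<lambda>x. ennreal (p z x))"
proof -
  interpret M: prob_space M by fact
  interpret P: pair_sigma_finite M "lborel :: (real^'n) measure" ..
  note kp = prob_space_kernel[OF \<kappa>]
  \<comment> \<open>The joint law of \<open>z\<close> drawn from \<open>M\<close> and a point drawn
    from \<open>\<kappa> z\<close>.\<close>
  define J where "J = M \<bind> (\<lambda>z. return M z \<Otimes>\<^sub>M \<kappa> z)"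
  have ret: "return M \<in> M \<rightarrow>\<^sub>M prob_algebra M"
    by (rule measurable_prob_algebraI) (auto intro: prob_space_return)
  have Jk: "(\<lambda>z. return M z \<Otimes>\<^sub>M \<kappa> z) \<in> M \<rightarrow>\<^sub>M prob_algebra (M \<Otimes>\<^sub>M borel)"
    by (rule measurable_pair_prob[OF ret \<kappa>])
  have Msp: "M \<in> space (prob_algebra M)" by (simp add: space_prob_algebra M)
  have setsJ: "sets J = sets (M \<Otimes>\<^sub>M lborel)"
    unfolding J_def sets_bind'[OF Msp Jk] by (rule sets_pair_measure_cong) simp_all
  have emJ: "emeasure J X = (\<integral>\<^sup>+z. emeasure (\<kappa> z) (Pair z -` X) \<partial>M)" if X: "X \<in> sets (M \<Otimes>\<^sub>M borel)" for X
  proof -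
    have "emeasure J X = (\<integral>\<^sup>+z. emeasure (return M z \<Otimes>\<^sub>M \<kappa> z) X \<partial>M)"
      unfolding J_def by (rule emeasure_bind_prob_algebra[OF Msp Jk X])
    also have "\<dots> = (\<integral>\<^sup>+z. emeasure (\<kappa> z) (Pair z -` X) \<partial>M)"
    proof (rule nn_integral_cong)
      fix z assume z: "z \<in> space M"
      interpret k: prob_space "\<kappa> z" by (rule kp[OF z])
      have X': "X \<in> sets (return M z \<Otimes>\<^sub>M \<kappa> z)"
        using X sets_pair_measure_cong[OF sets_return[of M z] kp(2)[OF z]] by simp
      have m: "(\<lambda>x. emeasure (\<kappa> z) (Pair x -` X)) \<in> borel_measurable M"
        using k.measurable_emeasure_Pair[OF X'] by (simp add: measurable_cong_sets[OF sets_return refl])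
      show "emeasure (return M z \<Otimes>\<^sub>M \<kappa> z) X = emeasure (\<kappa> z) (Pair z -` X)"
        by (simp add: k.emeasure_pair_measure_alt[OF X'] nn_integral_return[OF z m])
    qed
    finally show ?thesis .
  qed
  have lb: "sets (M \<Otimes>\<^sub>M (lborel :: (real^'n) measure)) = sets (M \<Otimes>\<^sub>M borel)" by (rule sets_pair_measure_cong) simp_all
  have "absolutely_continuous (M \<Otimes>\<^sub>M lborel) J"
    unfolding absolutely_continuous_def
  proof
    fix X assume "X \<in> null_sets (M \<Otimes>\<^sub>M (lborel :: (real^'n) measure))"
    then have X: "X \<in> sets (M \<Otimes>\<^sub>M (lborel :: (real^'n) measure))" "emeasure (M \<Otimes>\<^sub>M lborel) X = 0" by auto
    have "(\<integral>\<^sup>+z. emeasure lborel (Pair z -` X) \<partial>M) = 0"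
      using X(2) by (simp add: lborel.emeasure_pair_measure_alt[OF X(1)])
    then have "AE z in M. emeasure lborel (Pair z -` X) = 0"
      by (subst (asm) nn_integral_0_iff_AE[OF lborel.measurable_emeasure_Pair[OF X(1)]])
    then have "AE z in M. emeasure (\<kappa> z) (Pair z -` X) = 0"
      using ac AE_space
    proof eventually_elim
      case (elim z)
      have "Pair z -` X \<in> null_sets lborel" using elim(1) sets_Pair1[OF X(1), of z] by (simp add: null_sets_def)
      then have "measure (\<kappa> z) (Pair z -` X) = 0" using elim(2) by blast
      then show ?case by (simp add: finite_measure.emeasure_eq_measure[OF prob_space.finite_measure[OF kp(1)[OF elim(3)]]])
    qed
    then have "emeasure J X = 0" using X(1) unfolding lb by (simp add: emJ nn_integral_0_iff_AE cong: nn_integral_cong_AE)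
    then show "X \<in> null_sets J" using X(1) setsJ by (simp add: null_sets_def)
  qed
  then obtain g where g: "g \<in> borel_measurable (M \<Otimes>\<^sub>M (lborel :: (real^'n) measure))" and gJ: "density (M \<Otimes>\<^sub>M lborel) g = J"
    using P.Radon_Nikodym[of J] setsJ by auto
  have gz: "(\<lambda>x. g (z, x)) \<in> borel_measurable lborel" if "z \<in> space M" for z
    by (rule measurable_compose[OF measurable_Pair1'[OF that] g])
  \<comment> \<open>For fixed \<open>A\<close> both sides are densities of the same finite measure
    with respect to \<open>M\<close>; the exceptional null set still depends on
    \<open>A\<close>.\<close>
  have rect: "AE z in M. (\<integral>\<^sup>+x. g (z, x) * indicator A x \<partial>lborel) = emeasure (\<kappa> z) A" if A: "A \<in> sets borel" for A
  proof (rule M.density_unique_finite_measure)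
    have gA: "(\<lambda>z. g z * indicator A (snd z)) \<in> borel_measurable (M \<Otimes>\<^sub>M (lborel :: (real^'n) measure))"
      using g A by (intro borel_measurable_times_ennreal measurable_compose[OF measurable_snd borel_measurable_indicator]) auto
    from lborel.borel_measurable_nn_integral_fst[OF gA]
    show "(\<lambda>z. \<integral>\<^sup>+x. g (z, x) * indicator A x \<partial>lborel) \<in> borel_measurable M" by simp
    show "(\<lambda>z. emeasure (\<kappa> z) A) \<in> borel_measurable M"
      by (rule measurable_emeasure_kernel[OF measurable_prob_algebraD[OF \<kappa>] A])
    fix B assume B: "B \<in> sets M"
    have BA: "B \<times> A \<in> sets (M \<Otimes>\<^sub>M borel)" using A B by simp
    have "(\<integral>\<^sup>+z. (\<integral>\<^sup>+x. g (z, x) * indicator A x \<partial>lborel) * indicator B z \<partial>M) =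
        (\<integral>\<^sup>+z. (\<integral>\<^sup>+x. g (z, x) * indicator (B \<times> A) (z, x) \<partial>lborel) \<partial>M)"
      by (intro nn_integral_cong) (auto simp: indicator_def)
    also have "\<dots> = (\<integral>\<^sup>+z. g z * indicator (B \<times> A) z \<partial>(M \<Otimes>\<^sub>M lborel))"
    proof -
      have "(\<lambda>z. g z * indicator (B \<times> A) z) \<in> borel_measurable (M \<Otimes>\<^sub>M (lborel :: (real^'n) measure))"
        using g BA by (intro borel_measurable_times_ennreal borel_measurable_indicator) (auto simp: lb)
      from lborel.nn_integral_fst[OF this] show ?thesis by simp
    qed
    also have "\<dots> = emeasure J (B \<times> A)"
      unfolding gJ[symmetric] using g BA by (subst emeasure_density) (auto simp: lb)
    also have "\<dots> = (\<integral>\<^sup>+z. emeasure (\<kappa> z) A * indicator B z \<partial>M)"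
      unfolding emJ[OF BA] by (intro nn_integral_cong) (auto simp: indicator_def)
    finally show "(\<integral>\<^sup>+z. (\<integral>\<^sup>+x. g (z, x) * indicator A x \<partial>lborel) * indicator B z \<partial>M) = (\<integral>\<^sup>+z. emeasure (\<kappa> z) A * indicator B z \<partial>M)" .
  qed auto
  obtain E :: "(real^'n) set set" where E: "countable E" "Int_stable E" "UNIV \<in> E" "sets borel = sigma_sets UNIV E" "E \<subseteq> sets borel"
    using countable_borel_generator by blast
  \<comment> \<open>Only countably many null sets are joined, and an intersection-stable generator
    containing the whole space determines a finite measure.\<close>
  have "AE z in M. \<forall>A\<in>E. (\<integral>\<^sup>+x. g (z, x) * indicator A x \<partial>lborel) = emeasure (\<kappa> z) A"
    by (rule AE_ball_countable'[OF rect E(1)]) (use E(5) in auto)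
  then have dens: "AE z in M. density lborel (\<lambda>x. g (z, x)) = \<kappa> z"
    using AE_space
  proof eventually_elim
    case (elim z)
    show ?case
    proof (rule measure_eqI_generator_eq[OF E(2), where \<Omega>=UNIV and A="\<lambda>_. UNIV"])
      show "emeasure (density lborel (\<lambda>x. g (z, x))) UNIV \<noteq> \<infinity>"
        using elim(1) E(3) gz[OF elim(2)] prob_space.emeasure_space_1[OF kp(1)[OF elim(2)]] sets_eq_imp_space_eq[OF kp(2)[OF elim(2)]]
        by (subst emeasure_density) auto
    next
      fix A assume A: "A \<in> E"
      show "emeasure (density lborel (\<lambda>x. g (z, x))) A = emeasure (\<kappa> z) A"
        using elim(1) A E(5) gz[OF elim(2)] by (subst emeasure_density) auto
    qed (use E kp(2)[OF elim(2)] in auto)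
  qed
  define p where "p z x = enn2real (g (z, x))" for z x
  show ?thesis
  proof
    show "(\<lambda>(z, x). p z x) \<in> borel_measurable (M \<Otimes>\<^sub>M lborel)"
      unfolding p_def using g by (simp add: split_beta')
    show "0 \<le> p z x" for z x by (simp add: p_def)
    show "AE z in M. prob_density (p z) \<and> \<kappa> z = density lborel (\<lambda>x. ennreal (p z x))"
      using dens AE_space
    proof eventually_elim
      case (elim z)
      interpret k: prob_space "\<kappa> z" by (rule kp[OF elim(2)])
      have spk: "space (\<kappa> z) = UNIV" using sets_eq_imp_space_eq[OF kp(2)[OF elim(2)]] by simp
      note [measurable] = gz[OF elim(2)]
      have 1: "(\<integral>\<^sup>+x. g (z, x) \<partial>lborel) = 1"
        using k.emeasure_space_1 unfolding elim(1)[symmetric] by (simp add: emeasure_density)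
      have "AE x in lborel. g (z, x) \<noteq> \<infinity>" by (rule nn_integral_PInf_AE) (auto simp: 1)
      then have ae: "AE x in lborel. ennreal (p z x) = g (z, x)"
        by eventually_elim (simp add: less_top p_def)
      have pm: "p z \<in> borel_measurable borel" unfolding p_def[abs_def] using gz[OF elim(2)] by simp
      have "(\<integral>\<^sup>+x. ennreal (p z x) \<partial>lborel) = 1"
        unfolding 1[symmetric] using ae by (rule nn_integral_cong_AE)
      moreover have "density lborel (\<lambda>x. ennreal (p z x)) = density lborel (\<lambda>x. g (z, x))"
        using ae pm by (intro density_cong) auto
      ultimately show ?case using pm elim(1) by (auto simp: prob_density_def p_def)
    qed
  qed
qed

section \<open>Identification with the stochastic Fokker--Planck flow\<close>

lemma ennreal_tendsto_0I:
  fixes f :: "'a \<Rightarrow> ennreal"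
  assumes "\<And>e::real. 0 < e \<Longrightarrow> \<forall>\<^sub>F x in F. f x \<le> ennreal e"
  shows "(f \<longlongrightarrow> 0) F"
proof (rule order_tendstoI)
  fix a :: ennreal assume "0 < a"
  then obtain b where b: "0 < b" "b < a" using dense by blast
  then obtain e where e: "0 < e" "ennreal e < a" by (cases b) auto
  show "\<forall>\<^sub>F x in F. f x < a"
    using assms[OF e(1)] by eventually_elim (use e(2) in \<open>auto intro: le_less_trans\<close>)
qed simp

lemma wiener_shift_shift: "wiener_shift a (wiener_shift b \<xi>) = wiener_shift (a + b) \<xi>"
  by (simp add: wiener_shift_def fun_eq_iff add.assoc)

locale stationary_flow = noisy_law F \<sigma> \<eta> phi PW \<rho>
  for F :: "real^'n \<Rightarrow> real^'n" and \<sigma> \<eta> :: "real^'n^'n"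
    and phi :: "real \<Rightarrow> (real \<Rightarrow> real^'n) \<Rightarrow> (real \<Rightarrow> real^'n) \<Rightarrow> real^'n \<Rightarrow> real^'n"
    and PW :: "(real \<Rightarrow> real^'n) measure" and \<rho> :: "(real^'n) measure" +
  fixes V :: "real^'n \<Rightarrow> real" and PB :: "(real \<Rightarrow> real^'n) measure" and p0 :: "real^'n \<Rightarrow> real"
    and Phi :: "real \<Rightarrow> (real \<Rightarrow> real^'n) \<Rightarrow> (real^'n \<Rightarrow> real) \<Rightarrow> real^'n \<Rightarrow> real"
  assumes FV: "F = (\<lambda>y. - grad V y)"
    and PB: "wiener_measure PB"
    and stationary: "stationary_measure PW PB phi \<rho>"
    and p0: "prob_density p0" and \<rho>_density: "\<rho> = density lborel (\<lambda>x. ennreal (p0 x))"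
    and Phi: "stochastic_fp_flow V \<sigma> \<eta> Phi"
begin

sublocale B: prob_space PB using PB by (rule wiener_measureD)
sublocale WB: pair_prob_space PW PB ..
sublocale RWB: pair_prob_space \<rho> "PW \<Otimes>\<^sub>M PB" ..

lemma space_PB [simp]: "space PB = C0" by (rule wiener_measureD(2)[OF PB])

lemma measurable_PB [simp]: "f \<in> PB \<rightarrow>\<^sub>M N \<longleftrightarrow> f \<in> path_space \<rightarrow>\<^sub>M N"
  by (subst measurable_cong_sets[OF wiener_measureD(3)[OF PB] refl]) (rule refl)

lemma into_paths: "f \<in> M \<rightarrow>\<^sub>M PW \<Longrightarrow> f \<in> M \<rightarrow>\<^sub>M path_space" "f \<in> M \<rightarrow>\<^sub>M PB \<Longrightarrow> f \<in> M \<rightarrow>\<^sub>M path_space"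
  using measurable_cong_sets[OF refl wiener_measureD(3)[OF P]] measurable_cong_sets[OF refl wiener_measureD(3)[OF PB]] by blast+

lemma into_\<rho>: "f \<in> M \<rightarrow>\<^sub>M \<rho> \<Longrightarrow> f \<in> borel_measurable M"
  using measurable_cong_sets[OF refl \<rho>(2)] by blast

text \<open>The law of the flow itself for fixed common noise, called X_t(beta) in the
  overview.\<close>

definition xlaw :: "real \<Rightarrow> (real \<Rightarrow> real^'n) \<Rightarrow> (real^'n) measure" where
  "xlaw t \<beta> = distr (law t \<beta>) borel (\<lambda>y. y + \<eta> *v \<beta> t)"

lemma measurable_law_shift: "(\<lambda>y. y + c) \<in> borel_measurable (law t \<beta>)"
  by (subst measurable_cong_sets[OF sets_law refl]) measurable

lemma sets_xlaw [simp]: "sets (xlaw t \<beta>) = sets borel" and space_xlaw [simp]: "space (xlaw t \<beta>) = UNIV"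
  by (simp_all add: xlaw_def)

lemma prob_space_xlaw: "\<beta> \<in> C0 \<Longrightarrow> 0 \<le> t \<Longrightarrow> prob_space (xlaw t \<beta>)"
  unfolding xlaw_def by (intro prob_space.prob_space_distr prob_space_law measurable_law_shift)

lemma xlaw_integral:
  fixes f :: "real^'n \<Rightarrow> real"
  assumes \<beta>: "\<beta> \<in> C0" and t: "0 \<le> t" and f: "unit_test f"
  shows "(\<integral>y. f y \<partial>xlaw t \<beta>) = (\<integral>x. (\<integral>\<omega>. f (phi t \<omega> \<beta> x) \<partial>PW) \<partial>\<rho>)"
    "(\<integral>y. f y \<partial>xlaw t \<beta>) = (\<integral>\<omega>. (\<integral>x. f (phi t \<omega> \<beta> x) \<partial>\<rho>) \<partial>PW)"
proof -
  note f' = unit_test_translate[OF f, of "\<eta> *v \<beta> t"]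
  have "(\<integral>y. f y \<partial>xlaw t \<beta>) = (\<integral>y. f (y + \<eta> *v \<beta> t) \<partial>law t \<beta>)"
    unfolding xlaw_def by (rule integral_distr[OF measurable_law_shift unit_testD(3)[OF f]])
  also have "\<dots> = (\<integral>x. (\<integral>\<omega>. f (Y t \<omega> \<beta> x + \<eta> *v \<beta> t) \<partial>PW) \<partial>\<rho>)"
    by (rule law_integral[OF \<beta> t unit_testD(3)[OF f'] unit_testD(2)[OF f']])
  finally show 1: "(\<integral>y. f y \<partial>xlaw t \<beta>) = (\<integral>x. (\<integral>\<omega>. f (phi t \<omega> \<beta> x) \<partial>PW) \<partial>\<rho>)" by (simp add: Y_def)
  have "(\<lambda>(x, \<omega>). f (phi t \<omega> \<beta> x)) \<in> borel_measurable (\<rho> \<Otimes>\<^sub>M PW)"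
    using measurable_compose[OF measurable_Y_pair[OF \<beta> t] unit_testD(3)[OF f']] by (simp add: split_beta' Y_def)
  then have int: "integrable (\<rho> \<Otimes>\<^sub>M PW) (\<lambda>(x, \<omega>). f (phi t \<omega> \<beta> x))"
    using unit_testD(2)[OF f] by (intro RP.integrable_const_bound[of _ 1]) (auto intro!: AE_I2)
  show "(\<integral>y. f y \<partial>xlaw t \<beta>) = (\<integral>\<omega>. (\<integral>x. f (phi t \<omega> \<beta> x) \<partial>\<rho>) \<partial>PW)"
    unfolding 1 using RP.integral_fst'[OF int] RP.integral_snd[OF int] by simp
qed

lemma measurable_phi_triple:
  assumes "0 \<le> t"
  shows "(\<lambda>z. phi t (fst (snd z)) (snd (snd z)) (fst z)) \<in> borel_measurable (\<rho> \<Otimes>\<^sub>M (PW \<Otimes>\<^sub>M PB))"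
proof (rule measurable_phi[OF _ _ _ assms])
  show "(\<lambda>z. fst (snd z)) \<in> \<rho> \<Otimes>\<^sub>M (PW \<Otimes>\<^sub>M PB) \<rightarrow>\<^sub>M path_space"
    by (rule into_paths(1)) (rule measurable_compose[OF measurable_snd measurable_fst])
  show "(\<lambda>z. snd (snd z)) \<in> \<rho> \<Otimes>\<^sub>M (PW \<Otimes>\<^sub>M PB) \<rightarrow>\<^sub>M path_space"
    by (rule into_paths(2)) (rule measurable_compose[OF measurable_snd measurable_snd])
  show "fst \<in> borel_measurable (\<rho> \<Otimes>\<^sub>M (PW \<Otimes>\<^sub>M PB))" by (rule into_\<rho>) (rule measurable_fst)
qed

lemma stationary_distr:
  assumes t: "0 \<le> t"
  shows "distr (\<rho> \<Otimes>\<^sub>M (PW \<Otimes>\<^sub>M PB)) borel (\<lambda>z. phi t (fst (snd z)) (snd (snd z)) (fst z)) = \<rho>" (is "distr ?M borel ?f = _")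
proof (rule measure_eqI)
  show "sets (distr ?M borel ?f) = sets \<rho>" by (simp add: \<rho>(2))
  fix A assume "A \<in> sets (distr ?M borel ?f)"
  then have A: "A \<in> sets borel" by simp
  note fm = measurable_phi_triple[OF t]
  have X: "?f -` A \<inter> space ?M \<in> sets ?M" by (rule measurable_sets[OF fm A])
  have "emeasure (distr ?M borel ?f) A = emeasure ?M (?f -` A \<inter> space ?M)" by (rule emeasure_distr[OF fm A])
  also have "\<dots> = (\<integral>\<^sup>+x. emeasure (PW \<Otimes>\<^sub>M PB) (Pair x -` (?f -` A \<inter> space ?M)) \<partial>\<rho>)"
    by (rule WB.P.emeasure_pair_measure_alt[OF X])
  also have "\<dots> = (\<integral>\<^sup>+x. emeasure (PW \<Otimes>\<^sub>M PB) {(\<omega>, \<beta>) \<in> space (PW \<Otimes>\<^sub>M PB). phi t \<omega> \<beta> x \<in> A} \<partial>\<rho>)"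
    by (intro nn_integral_cong arg_cong[where f="emeasure (PW \<Otimes>\<^sub>M PB)"]) (auto simp: space_pair_measure)
  also have "\<dots> = emeasure \<rho> A" using stationary t A by (simp add: stationary_measure_def)
  finally show "emeasure (distr ?M borel ?f) A = emeasure \<rho> A" .
qed

text \<open>Fubini for the initial value and both noises: stationarity under the two noises together
  says that \<open>\<rho>\<close> is the average of the laws given the common noise.\<close>

lemma stationary_integral:
  assumes t: "0 \<le> t" and f: "unit_test f"
  shows "(\<lambda>\<beta>. \<integral>y. f y \<partial>xlaw t \<beta>) \<in> borel_measurable PB"
    "(\<integral>y. f y \<partial>\<rho>) = (\<integral>\<beta>. (\<integral>y. f y \<partial>xlaw t \<beta>) \<partial>PB)"
proof -
  let ?u = "\<lambda>z. f (phi t (fst (snd z)) (snd (snd z)) (fst z))"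
  have um: "?u \<in> borel_measurable (\<rho> \<Otimes>\<^sub>M (PW \<Otimes>\<^sub>M PB))"
    by (rule measurable_compose[OF measurable_phi_triple[OF t] unit_testD(3)[OF f]])
  have ui: "integrable (\<rho> \<Otimes>\<^sub>M (PW \<Otimes>\<^sub>M PB)) (\<lambda>(x, w). f (phi t (fst w) (snd w) x))"
    using um unit_testD(2)[OF f] by (intro RWB.integrable_const_bound[of _ 1]) (auto intro!: AE_I2 simp: split_beta')
  define h where "h w = (\<integral>x. f (phi t (fst w) (snd w) x) \<partial>\<rho>)" for w
  have hm: "h \<in> borel_measurable (PW \<Otimes>\<^sub>M PB)"
  proof -
    have "(\<lambda>(w, x). f (phi t (fst w) (snd w) x)) \<in> borel_measurable ((PW \<Otimes>\<^sub>M PB) \<Otimes>\<^sub>M \<rho>)"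
      using measurable_compose[OF measurable_pair_swap' um] by (simp add: split_beta')
    from R.borel_measurable_lebesgue_integral[OF this] show ?thesis by (simp add: h_def[abs_def])
  qed
  have h1: "\<bar>h w\<bar> \<le> 1" if "w \<in> space (PW \<Otimes>\<^sub>M PB)" for w
  proof -
    have "(\<lambda>x. phi t (fst w) (snd w) x) \<in> borel_measurable \<rho>"
      using that by (intro measurable_phi measurable_const into_\<rho> t measurable_ident_sets refl) (auto simp: space_pair_measure)
    from unit_test_integrable(2)[OF R.prob_space_axioms this f] show ?thesis by (simp add: h_def)
  qed
  have hi: "integrable (PW \<Otimes>\<^sub>M PB) (\<lambda>(\<omega>, \<beta>). h (\<omega>, \<beta>))"
    using hm h1 by (intro WB.integrable_const_bound[of _ 1]) (auto intro!: AE_I2)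
  have hx: "(\<integral>\<omega>. h (\<omega>, \<beta>) \<partial>PW) = (\<integral>y. f y \<partial>xlaw t \<beta>)" if "\<beta> \<in> C0" for \<beta>
    using xlaw_integral(2)[OF that t f] by (simp add: h_def)
  have "(\<lambda>(\<beta>, \<omega>). h (\<omega>, \<beta>)) \<in> borel_measurable (PB \<Otimes>\<^sub>M PW)"
    using measurable_compose[OF measurable_pair_swap' hm] by (simp add: split_beta')
  from P.borel_measurable_lebesgue_integral[OF this]
  have "(\<lambda>\<beta>. \<integral>\<omega>. h (\<omega>, \<beta>) \<partial>PW) \<in> borel_measurable PB" .
  then show "(\<lambda>\<beta>. \<integral>y. f y \<partial>xlaw t \<beta>) \<in> borel_measurable PB"
    by (rule measurable_cong[THEN iffD1, rotated]) (simp add: hx)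
  have "(\<integral>y. f y \<partial>\<rho>) = (\<integral>y. f y \<partial>distr (\<rho> \<Otimes>\<^sub>M (PW \<Otimes>\<^sub>M PB)) borel (\<lambda>z. phi t (fst (snd z)) (snd (snd z)) (fst z)))"
    by (simp only: stationary_distr[OF t])
  also have "\<dots> = (\<integral>z. ?u z \<partial>(\<rho> \<Otimes>\<^sub>M (PW \<Otimes>\<^sub>M PB)))"
    by (rule integral_distr[OF measurable_phi_triple[OF t] unit_testD(3)[OF f]])
  also have "\<dots> = (\<integral>w. h w \<partial>(PW \<Otimes>\<^sub>M PB))"
    using RWB.integral_snd[OF ui] by (simp add: h_def split_beta')
  also have "\<dots> = (\<integral>\<beta>. (\<integral>\<omega>. h (\<omega>, \<beta>) \<partial>PW) \<partial>PB)"
    using WB.integral_snd[OF hi] by simp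
  also have "\<dots> = (\<integral>\<beta>. (\<integral>y. f y \<partial>xlaw t \<beta>) \<partial>PB)"
    by (rule Bochner_Integration.integral_cong) (simp_all add: hx)
  finally show "(\<integral>y. f y \<partial>\<rho>) = (\<integral>\<beta>. (\<integral>y. f y \<partial>xlaw t \<beta>) \<partial>PB)" .
qed

text \<open>Since \<open>\<rho>\<close> is itself an averaged time-one law, it inherits continuity under translations.\<close>

lemma \<rho>_shift_le:
  assumes e: "0 < e"
  shows "\<exists>d>0. shift_le \<rho> d e"
proof -
  obtain M where M: "0 < M" "B.prob (C0 - small_paths 1 M) < e / 4"
    using small_paths_large_bound[OF PB, of "e / 4" 1] e by auto
  obtain d where d: "0 < d" "\<And>T \<beta> v f. 1 \<le> T \<Longrightarrow> T \<le> 1 \<Longrightarrow> \<beta> \<in> C0 \<Longrightarrow> (\<And>s. s \<in> {0..1} \<Longrightarrow> norm (\<beta> s) \<le> M) \<Longrightarrow>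
     norm v \<le> d \<Longrightarrow> unit_test f \<Longrightarrow> \<bar>(\<integral>y. f (y + v) \<partial>law T \<beta>) - (\<integral>y. f y \<partial>law T \<beta>)\<bar> \<le> e / 2"
    using law_translation[of 1 "e / 2" 1 M] e by auto
  have "shift_le \<rho> d e"
    unfolding shift_le_def
  proof (intro allI impI)
    fix v :: "real^'n" and f :: "real^'n \<Rightarrow> real" assume v: "norm v \<le> d" and f: "unit_test f"
    note fv = unit_test_translate[OF f, of v]
    let ?a = "\<lambda>\<beta>. \<integral>y. f (y + v) \<partial>xlaw 1 \<beta>" and ?b = "\<lambda>\<beta>. \<integral>y. f y \<partial>xlaw 1 \<beta>"
    have ab1: "\<bar>\<integral>y. g y \<partial>xlaw 1 \<beta>\<bar> \<le> 1" if "unit_test g" "\<beta> \<in> C0" for g \<beta>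
      using unit_test_integrable(2)[OF prob_space_xlaw[OF that(2)] _ that(1), of 1 "\<lambda>x. x"]
      by (simp add: measurable_cong_sets[OF sets_xlaw refl])
    have m: "?a \<in> borel_measurable PB" "?b \<in> borel_measurable PB"
      using stationary_integral(1)[OF _ fv, of 1] stationary_integral(1)[OF _ f, of 1] by simp_all
    have i: "integrable PB ?a" "integrable PB ?b"
      using m ab1[OF fv] ab1[OF f] by (auto intro!: B.integrable_const_bound[of _ 1])
    have "(\<integral>y. f (y + v) \<partial>\<rho>) - (\<integral>y. f y \<partial>\<rho>) = (\<integral>\<beta>. ?a \<beta> - ?b \<beta> \<partial>PB)"
      using stationary_integral(2)[OF _ fv, of 1] stationary_integral(2)[OF _ f, of 1] i by simp
    also have "\<bar>\<dots>\<bar> \<le> e / 2 + 2 * B.prob (space PB - small_paths 1 M)"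
    proof (rule B.expectation_split_bound)
      show "(\<lambda>\<beta>. ?a \<beta> - ?b \<beta>) \<in> borel_measurable PB" by (intro borel_measurable_diff m)
      show "small_paths 1 M \<in> B.events" by (simp add: wiener_measureD(3)[OF PB])
      show "\<bar>?a \<beta> - ?b \<beta>\<bar> \<le> 2" if "\<beta> \<in> space PB" for \<beta>
        using ab1[OF fv, of \<beta>] ab1[OF f, of \<beta>] that unfolding space_PB by linarith
      fix \<beta> :: "real \<Rightarrow> real^'n" assume "\<beta> \<in> small_paths 1 M"
      then have \<beta>: "\<beta> \<in> C0" "\<And>s. s \<in> {0..1} \<Longrightarrow> norm (\<beta> s) \<le> M" by (auto simp: small_paths_def)
      \<comment> \<open>Translating by \<open>v\<close> commutes with adding the common noise, which
        is therefore absorbed into the test function.\<close>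
      let ?f = "\<lambda>y. f (y + \<eta> *v \<beta> 1)"
      have "?a \<beta> = (\<integral>y. ?f (y + v) \<partial>law 1 \<beta>)"
        unfolding xlaw_def by (subst integral_distr[OF measurable_law_shift unit_testD(3)[OF fv]]) (simp add: add_ac)
      moreover have "?b \<beta> = (\<integral>y. ?f y \<partial>law 1 \<beta>)"
        unfolding xlaw_def by (rule integral_distr[OF measurable_law_shift unit_testD(3)[OF f]])
      ultimately show "\<bar>?a \<beta> - ?b \<beta>\<bar> \<le> e / 2"
        using d(2)[OF _ _ \<beta> v unit_test_translate[OF f]] by simp
    qed (use e in simp)
    finally show "\<bar>(\<integral>y. f (y + v) \<partial>\<rho>) - (\<integral>y. f y \<partial>\<rho>)\<bar> \<le> e" using M(2) by simp
  qed
  then show ?thesis using d(1) by blast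
qed

text \<open>At \<open>t = 0\<close> the translation continuity comes from stationarity, through
  \<open>\<rho>_shift_le\<close>. For \<open>t > 0\<close> the step size is uniform over
  \<open>[t / 2, t]\<close>, because for \<open>s < t\<close> the estimate starts from the moving
  time \<open>s\<close>.\<close>

lemma law_continuous:
  assumes \<beta>: "\<beta> \<in> C0" and t: "0 \<le> t" and e: "0 < e"
  shows "\<exists>\<delta>>0. \<forall>s\<ge>0. \<bar>s - t\<bar> < \<delta> \<longrightarrow> tv_le (law s \<beta>) (law t \<beta>) e"
proof (cases "t = 0")
  case True
  obtain d where d: "0 < d" "shift_le \<rho> d (e / 2 / 2)" using \<rho>_shift_le[of "e / 2 / 2"] e by auto
  obtain \<delta>1 where \<delta>1: "0 < \<delta>1" "\<And>h m. 0 < h \<Longrightarrow> h \<le> \<delta>1 \<Longrightarrow> prob_space m \<Longrightarrow> sets m = sets borel \<Longrightarrow> shift_le m d (e / 2 / 2) \<Longrightarrow>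
    tv_le (smear h m) m (e / 2)" using smear_close[of "e / 2" d] e d(1) by auto
  obtain \<delta>2 where \<delta>2: "0 < \<delta>2" "\<And>s h. 0 \<le> s \<Longrightarrow> s \<le> 0 \<Longrightarrow> 0 < h \<Longrightarrow> h \<le> \<delta>2 \<Longrightarrow> tv_le (law (s + h) \<beta>) (smear h (law s \<beta>)) (e / 2)"
    using law_short_time[OF \<beta>, of "e / 2" 0] e by auto
  have "tv_le (law s \<beta>) (law t \<beta>) e" if s: "0 \<le> s" "\<bar>s - t\<bar> < min \<delta>1 \<delta>2" for s
  proof (cases "s = 0")
    case True
    then show ?thesis using \<open>t = 0\<close> e by (simp add: tv_le_def)
  next
    case False
    then have h: "0 < s" "s \<le> \<delta>1" "s \<le> \<delta>2" using s True by auto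
    have "tv_le (law (0 + s) \<beta>) (smear s (law 0 \<beta>)) (e / 2)" by (rule \<delta>2(2)) (use h in auto)
    moreover have "tv_le (smear s \<rho>) \<rho> (e / 2)" by (rule \<delta>1(2)[OF h(1,2) \<rho> d(2)])
    ultimately show ?thesis using tv_le_trans[of "law s \<beta>" "smear s \<rho>" "e / 2" \<rho> "e / 2"] True by (simp add: law_0[OF \<beta>])
  qed
  then show ?thesis using \<delta>1(1) \<delta>2(1) by (intro exI[of _ "min \<delta>1 \<delta>2"]) auto
next
  case False
  then have t: "0 < t" using t by simp
  obtain \<delta> where \<delta>: "0 < \<delta>" "\<And>s h. t / 2 \<le> s \<Longrightarrow> s \<le> t \<Longrightarrow> 0 < h \<Longrightarrow> h \<le> \<delta> \<Longrightarrow> tv_le (law (s + h) \<beta>) (law s \<beta>) e"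
    using law_continuous_pos[OF \<beta>, of "t / 2" e t] t e by auto
  have "tv_le (law s \<beta>) (law t \<beta>) e" if s: "\<bar>s - t\<bar> < min \<delta> (t / 2)" for s
  proof -
    consider "s = t" | "t < s" | "s < t" by linarith
    then show ?thesis
    proof cases
      case 1
      then show ?thesis using e by (simp add: tv_le_def)
    next
      case 2
      then show ?thesis using \<delta>(2)[of t "s - t"] s t by simp
    next
      case 3
      have "t / 2 \<le> s" using s by linarith
      then have "tv_le (law (s + (t - s)) \<beta>) (law s \<beta>) e" using 3 s by (intro \<delta>(2)) auto
      then show ?thesis by (simp add: tv_le_sym)
    qed
  qed
  then show ?thesis using \<delta>(1) t by (intro exI[of _ "min \<delta> (t / 2)"]) auto
qed

section \<open>Densities and the stochastic Fokker--Planck flow\<close>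

lemma law_density:
  assumes \<beta>: "\<beta> \<in> C0" and t: "0 < t"
  shows "\<exists>p. prob_density p \<and> law t \<beta> = density lborel (\<lambda>x. ennreal (p x))"
proof (rule ex_prob_density[OF prob_space_law[OF \<beta>] sets_law])
  show "measure (law t \<beta>) A = 0" if "A \<in> null_sets lborel" for A
  proof (rule absolutely_continuous_if_shift[OF prob_space_law[OF \<beta>] sets_law _ that])
    fix e :: real assume "0 < e"
    then obtain d where "0 < d" "shift_le (law t \<beta>) d e"
      using law_shift_le[OF \<beta> t, of e t] by blast
    then show "\<exists>d>0. shift_le (law t \<beta>) d e" by blast
  qed (use t in simp)
qed (use t in simp)

text \<open>At time 0 the given density is taken, so that the initial condition holds exactly. At
  later times any representative will do, since the equation and the L1 continuity see only classes
  modulo null sets.\<close>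

definition q :: "(real \<Rightarrow> real^'n) \<Rightarrow> real \<Rightarrow> real^'n \<Rightarrow> real" where
  "q \<beta> t = (if t = 0 then p0 else (SOME p. prob_density p \<and> law t \<beta> = density lborel (\<lambda>x. ennreal (p x))))"

lemma q_density:
  assumes \<beta>: "\<beta> \<in> C0" and t: "0 \<le> t"
  shows "prob_density (q \<beta> t)" "law t \<beta> = density lborel (\<lambda>x. ennreal (q \<beta> t x))"
proof -
  have "prob_density (q \<beta> t) \<and> law t \<beta> = density lborel (\<lambda>x. ennreal (q \<beta> t x))"
  proof (cases "t = 0")
    case True
    have q0: "q \<beta> t = p0" using True by (simp add: q_def)
    show ?thesis unfolding q0 unfolding True law_0[OF \<beta>] using p0 \<rho>_density by (rule conjI)
  next
    case False
    then have "\<exists>p. prob_density p \<and> law t \<beta> = density lborel (\<lambda>x. ennreal (p x))" using law_density[OF \<beta>] t by simp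
    from someI_ex[OF this] show ?thesis using False by (simp add: q_def)
  qed
  then show "prob_density (q \<beta> t)" "law t \<beta> = density lborel (\<lambda>x. ennreal (q \<beta> t x))" by auto
qed

lemma fp_generator_eq_gen: "fp_generator V \<sigma> h \<psi> x = gen \<psi> h x"
  unfolding fp_generator_def gen_def by (simp add: FV)

text \<open>L1 continuity is total variation continuity of \<open>law\<close>, and the weak equation
  is \<open>law_weak_equation\<close> written with densities.\<close>

lemma q_fp_solution:
  assumes \<beta>: "\<beta> \<in> C0"
  shows "fp_solution V \<sigma> \<eta> \<beta> p0 (q \<beta>)"
  unfolding fp_solution_def
proof (intro conjI allI impI)
  fix t :: real assume t: "0 \<le> t"
  show "prob_density (q \<beta> t)" by (rule q_density(1)[OF \<beta> t])
  show "((\<lambda>s. L1_dist (q \<beta> s) (q \<beta> t)) \<longlongrightarrow> 0) (at t within {0..})"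
  proof (rule ennreal_tendsto_0I)
    fix e :: real assume e: "0 < e"
    obtain \<delta> where \<delta>: "0 < \<delta>" "\<And>s. 0 \<le> s \<Longrightarrow> \<bar>s - t\<bar> < \<delta> \<Longrightarrow> tv_le (law s \<beta>) (law t \<beta>) (e / 2)"
      using law_continuous[OF \<beta> t, of "e / 2"] e by auto
    have "L1_dist (q \<beta> s) (q \<beta> t) \<le> ennreal e" if s: "0 \<le> s" "dist s t < \<delta>" for s
      using tv_le_L1_dist[OF q_density(1)[OF \<beta> s(1)] q_density(1)[OF \<beta> t], of "e / 2"] \<delta>(2)[of s] s
      by (simp add: q_density(2)[OF \<beta> s(1)] q_density(2)[OF \<beta> t] dist_real_def)
    then show "\<forall>\<^sub>F s in at t within {0..}. L1_dist (q \<beta> s) (q \<beta> t) \<le> ennreal e"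
      unfolding eventually_at using \<delta>(1) by auto
  qed
next
  show "AE x in lborel. q \<beta> 0 x = p0 x" by (simp add: q_def)
next
  fix \<psi> :: "real^'n \<Rightarrow> real" and t :: real assume \<psi>: "test_function \<psi>" and t: "0 \<le> t"
  have \<psi>m: "\<psi> \<in> borel_measurable borel"
    using \<psi> smoothD(2) by (auto simp: test_function_def intro: borel_measurable_continuous_onI)
  have genm: "gen \<psi> (\<eta> *v \<beta> s) \<in> borel_measurable borel" for s
    by (rule borel_measurable_continuous_onI[OF gen_continuous_snd[OF \<psi> \<beta>]])
  have I: "(\<integral>x. f x * q \<beta> s x \<partial>lborel) = (\<integral>y. f y \<partial>law s \<beta>)" if "0 \<le> s" "f \<in> borel_measurable borel" for f s
    using prob_density_integral[OF q_density(1)[OF \<beta> that(1)] that(2)] by (simp add: q_density(2)[OF \<beta> that(1)])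
  show "(\<integral>x. \<psi> x * q \<beta> t x \<partial>lborel) = (\<integral>x. \<psi> x * p0 x \<partial>lborel) +
        integral {0..t} (\<lambda>s. \<integral>x. fp_generator V \<sigma> (\<eta> *v \<beta> s) \<psi> x * q \<beta> s x \<partial>lborel)"
  proof (cases "t = 0")
    case True
    then show ?thesis by (simp add: q_def)
  next
    case False
    then have "0 < t" using t by simp
    have "integral {0..t} (\<lambda>s. \<integral>x. fp_generator V \<sigma> (\<eta> *v \<beta> s) \<psi> x * q \<beta> s x \<partial>lborel) =
        integral {0..t} (\<lambda>s. \<integral>y. gen \<psi> (\<eta> *v \<beta> s) y \<partial>law s \<beta>)"
      by (rule integral_cong) (simp add: fp_generator_eq_gen I genm)
    moreover have "(\<integral>x. \<psi> x * p0 x \<partial>lborel) = (\<integral>y. \<psi> y \<partial>\<rho>)"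
      using I[of 0 \<psi>] \<psi>m by (simp add: q_def law_0[OF \<beta>])
    ultimately show ?thesis using law_weak_equation[OF \<psi> \<beta> \<open>0 < t\<close>] I[OF t \<psi>m] by simp
  qed
qed

text \<open>The uniqueness clause of \<open>stochastic_fp_flow\<close> identifies \<open>q\<close>
  with the solution defining \<open>Phi\<close>, up to null sets; the translation built into
  \<open>Phi\<close> is the one from \<open>law\<close> to \<open>xlaw\<close>.\<close>

lemma Phi_xlaw:
  assumes \<beta>: "\<beta> \<in> C0" and t: "0 \<le> t"
  shows "prob_density (Phi t \<beta> p0)" "xlaw t \<beta> = density lborel (\<lambda>x. ennreal (Phi t \<beta> p0 x))"
proof -
  obtain u where u: "fp_solution V \<sigma> \<eta> \<beta> p0 u"
    "\<forall>q'. fp_solution V \<sigma> \<eta> \<beta> p0 q' \<longrightarrow> (\<forall>t\<ge>0. AE x in lborel. q' t x = u t x)"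
    "\<forall>t\<ge>0. \<forall>x. Phi t \<beta> p0 x = u t (x - \<eta> *v \<beta> t)"
    using Phi[unfolded stochastic_fp_flow_def, THEN bspec, OF \<beta>, THEN spec, THEN mp, OF p0]
    by (elim exE conjE) (rule that)
  have ae: "AE x in lborel. q \<beta> t x = u t x" using u(2)[THEN spec, THEN mp, OF q_fp_solution[OF \<beta>], THEN spec, THEN mp, OF t] .
  have ud: "prob_density (u t)" using u(1) t by (simp add: fp_solution_def)
  have um: "u t \<in> borel_measurable borel" using ud by (simp add: prob_density_def)
  have qm: "q \<beta> t \<in> borel_measurable borel" using q_density(1)[OF \<beta> t] by (simp add: prob_density_def)
  define c where "c = \<eta> *v \<beta> t"
  have Pc: "Phi t \<beta> p0 = (\<lambda>x. u t (x - c))" using u(3) t by (auto simp: c_def)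
  have lawu: "law t \<beta> = density lborel (\<lambda>x. ennreal (u t x))"
    unfolding q_density(2)[OF \<beta> t] using ae um qm by (intro density_cong) auto
  have Pm: "(\<lambda>x. u t (x - c)) \<in> borel_measurable borel" by (rule measurable_compose[OF _ um]) measurable
  have tr: "(\<integral>\<^sup>+x. ennreal (u t (x - c)) * indicator A x \<partial>lborel) = (\<integral>\<^sup>+x. ennreal (u t x) * indicator A (x + c) \<partial>lborel)"
    if A: "A \<in> sets borel" for A
  proof -
    have "(\<lambda>x. ennreal (u t (x - c)) * indicator A x) \<in> borel_measurable borel" using Pm A by measurable
    from nn_integral_lborel_translate[OF this, of c] show ?thesis by simp
  qed
  show "prob_density (Phi t \<beta> p0)"
    using ud Pm tr[of UNIV] by (simp add: Pc prob_density_def)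
  show "xlaw t \<beta> = density lborel (\<lambda>x. ennreal (Phi t \<beta> p0 x))"
  proof (rule measure_eqI)
    fix A assume "A \<in> sets (xlaw t \<beta>)"
    then have A: "A \<in> sets borel" by simp
    have iA: "(\<lambda>x. indicator A (x + c) :: ennreal) \<in> borel_measurable borel"
      by (rule measurable_compose[OF _ borel_measurable_indicator[OF A]]) measurable
    have "emeasure (xlaw t \<beta>) A = (\<integral>\<^sup>+x. indicator A (x + c) \<partial>law t \<beta>)"
      unfolding xlaw_def c_def[symmetric] by (rule emeasure_distr_indicator[OF measurable_law_shift A])
    also have "\<dots> = (\<integral>\<^sup>+x. ennreal (u t x) * indicator A (x + c) \<partial>lborel)"
      unfolding lawu by (subst nn_integral_density) (use um iA in auto)
    also have "\<dots> = emeasure (density lborel (\<lambda>x. ennreal (Phi t \<beta> p0 x))) A"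
      unfolding Pc using Pm A by (subst emeasure_density) (auto simp: tr)
    finally show "emeasure (xlaw t \<beta>) A = emeasure (density lborel (\<lambda>x. ennreal (Phi t \<beta> p0 x))) A" .
  qed simp
qed

end

section \<open>Pullback limits\<close>

text \<open>The full-measure set \<open>G\<close> on which the limit exists is a parameter, so that it can be
  chosen measurable.\<close>

locale pullback_flow = stationary_flow F \<sigma> \<eta> phi PW \<rho> V PB p0 Phi
  for F :: "real^'n \<Rightarrow> real^'n" and \<sigma> \<eta> phi PW \<rho> V PB p0 Phi +
  fixes \<mu> :: "(real \<Rightarrow> real^'n) \<Rightarrow> (real \<Rightarrow> real^'n) \<Rightarrow> (real^'n) measure" and G
  assumes G: "G \<in> sets (PW \<Otimes>\<^sub>M PB)" "AE z in PW \<Otimes>\<^sub>M PB. z \<in> G"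
    and \<mu>: "\<And>\<omega> \<beta>. (\<omega>, \<beta>) \<in> G \<Longrightarrow> prob_space (\<mu> \<omega> \<beta>)" "\<And>\<omega> \<beta>. (\<omega>, \<beta>) \<in> G \<Longrightarrow> sets (\<mu> \<omega> \<beta>) = sets borel"
      "\<And>\<omega> \<beta>. (\<omega>, \<beta>) \<in> G \<Longrightarrow>
         weak_limit (\<lambda>\<tau>. distr \<rho> borel (phi \<tau> (wiener_shift (-\<tau>) \<omega>) (wiener_shift (-\<tau>) \<beta>))) (\<mu> \<omega> \<beta>) at_top"
begin

lemma G_paths: "(\<omega>, \<beta>) \<in> G \<Longrightarrow> \<omega> \<in> C0 \<and> \<beta> \<in> C0"
  using sets.sets_into_space[OF G(1)] by (auto simp: space_pair_measure)

text \<open>A version of \<open>\<mu>\<close> that is a probability measure everywhere and will be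
  measurable; off \<open>G\<close> the value \<open>\<rho>\<close> is an arbitrary default.\<close>

definition K :: "(real \<Rightarrow> real^'n) \<times> (real \<Rightarrow> real^'n) \<Rightarrow> (real^'n) measure" where
  "K z = (if z \<in> G then \<mu> (fst z) (snd z) else \<rho>)"

text \<open>The measure mu_beta of the claim as a composition with a kernel, a form that carries
  measurability in \<open>\<beta>\<close>; it agrees with \<open>mixture\<close> for almost every
  \<open>\<beta>\<close>.\<close>

definition limit_law :: "(real \<Rightarrow> real^'n) \<Rightarrow> (real^'n) measure" where
  "limit_law \<beta> = PW \<bind> (\<lambda>\<omega>. K (\<omega>, \<beta>))"

definition pull :: "(real^'n \<Rightarrow> real) \<Rightarrow> real \<Rightarrow> (real \<Rightarrow> real^'n) \<times> (real \<Rightarrow> real^'n) \<Rightarrow> real" where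
  "pull f \<tau> z = (\<integral>x. f (phi \<tau> (wiener_shift (-\<tau>) (fst z)) (wiener_shift (-\<tau>) (snd z)) x) \<partial>\<rho>)"

lemma measurable_phi_init:
  assumes "\<omega> \<in> C0" "\<beta> \<in> C0" "0 \<le> t"
  shows "phi t \<omega> \<beta> \<in> borel_measurable \<rho>"
proof -
  have "(\<lambda>x. phi t \<omega> \<beta> x) \<in> borel_measurable \<rho>"
    using assms by (intro measurable_phi measurable_const into_\<rho> measurable_ident_sets refl) auto
  then show ?thesis .
qed

lemma measurable_pull:
  assumes f: "unit_test f" and t: "0 \<le> t"
  shows "pull f t \<in> borel_measurable (PW \<Otimes>\<^sub>M PB)"
proof -
  let ?N = "(PW \<Otimes>\<^sub>M PB) \<Otimes>\<^sub>M \<rho>"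
  have "(\<lambda>y. phi t (wiener_shift (-t) (fst (fst y))) (wiener_shift (-t) (snd (fst y))) (snd y)) \<in> borel_measurable ?N"
  proof (rule measurable_phi[OF _ _ _ t])
    show "(\<lambda>y. wiener_shift (-t) (fst (fst y))) \<in> ?N \<rightarrow>\<^sub>M path_space"
      by (rule measurable_compose[OF into_paths(1) measurable_wiener_shift])
        (rule measurable_compose[OF measurable_fst measurable_fst])
    show "(\<lambda>y. wiener_shift (-t) (snd (fst y))) \<in> ?N \<rightarrow>\<^sub>M path_space"
      by (rule measurable_compose[OF into_paths(2) measurable_wiener_shift])
        (rule measurable_compose[OF measurable_fst measurable_snd])
    show "snd \<in> borel_measurable ?N" by (rule into_\<rho>) (rule measurable_snd)
  qed
  from measurable_compose[OF this unit_testD(3)[OF f]]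
  have "(\<lambda>(z, x). f (phi t (wiener_shift (-t) (fst z)) (wiener_shift (-t) (snd z)) x)) \<in> borel_measurable ?N"
    by (simp add: split_beta')
  from R.borel_measurable_lebesgue_integral[OF this] show ?thesis by (simp add: pull_def[abs_def])
qed

lemma pull_bound:
  assumes "unit_test f" "fst z \<in> C0" "snd z \<in> C0" "0 \<le> t"
  shows "\<bar>pull f t z\<bar> \<le> 1"
  unfolding pull_def using assms
  by (intro unit_test_integrable(2)[OF R.prob_space_axioms] measurable_phi_init wiener_shift_C0)

lemma pull_tendsto:
  assumes f: "unit_test f" and z: "(\<omega>, \<beta>) \<in> G"
  shows "((\<lambda>\<tau>. pull f \<tau> (\<omega>, \<beta>)) \<longlongrightarrow> (\<integral>x. f x \<partial>K (\<omega>, \<beta>))) at_top"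
proof -
  have "continuous_on UNIV f \<and> bounded (range f)"
    using unit_testD[OF f] by (auto simp: bounded_iff)
  then have "((\<lambda>\<tau>. \<integral>x. f x \<partial>distr \<rho> borel (phi \<tau> (wiener_shift (-\<tau>) \<omega>) (wiener_shift (-\<tau>) \<beta>))) \<longlongrightarrow> (\<integral>x. f x \<partial>\<mu> \<omega> \<beta>)) at_top"
    using \<mu>(3)[OF z] unfolding weak_limit_def by blast
  moreover have "\<forall>\<^sub>F \<tau> in at_top. (\<integral>x. f x \<partial>distr \<rho> borel (phi \<tau> (wiener_shift (-\<tau>) \<omega>) (wiener_shift (-\<tau>) \<beta>))) = pull f \<tau> (\<omega>, \<beta>)"
    using eventually_ge_at_top[of 0]
  proof eventually_elim
    case (elim \<tau>)
    have "phi \<tau> (wiener_shift (-\<tau>) \<omega>) (wiener_shift (-\<tau>) \<beta>) \<in> borel_measurable \<rho>"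
      using G_paths[OF z] elim by (intro measurable_phi_init wiener_shift_C0) auto
    from integral_distr[OF this unit_testD(3)[OF f]] show ?case by (simp add: pull_def)
  qed
  ultimately have "((\<lambda>\<tau>. pull f \<tau> (\<omega>, \<beta>)) \<longlongrightarrow> (\<integral>x. f x \<partial>\<mu> \<omega> \<beta>)) at_top"
    by (rule Lim_transform_eventually)
  then show ?thesis using z by (simp add: K_def)
qed

lemma K_prob: "prob_space (K z)" "sets (K z) = sets borel"
  using \<mu>(1,2)[of "fst z" "snd z"] R.prob_space_axioms \<rho>(2) by (auto simp: K_def)

text \<open>On \<open>G\<close>, integrals of tests against \<open>K\<close> are limits along
  integer times of the measurable functions \<open>pull f\<close>; weak convergence thus supplies
  the measurability.\<close>

lemma measurable_K: "K \<in> PW \<Otimes>\<^sub>M PB \<rightarrow>\<^sub>M prob_algebra borel"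
proof (rule measurable_prob_algebra_unit_test[OF K_prob])
  fix f :: "real^'n \<Rightarrow> real" assume f: "unit_test f"
  show "(\<lambda>z. \<integral>x. f x \<partial>K z) \<in> borel_measurable (PW \<Otimes>\<^sub>M PB)"
  proof (rule borel_measurable_LIMSEQ_real)
    show "(\<lambda>z. if z \<in> G then pull f (real n) z else \<integral>x. f x \<partial>\<rho>) \<in> borel_measurable (PW \<Otimes>\<^sub>M PB)" for n
      by (rule measurable_If_set[OF measurable_pull[OF f] borel_measurable_const]) (use G(1) in \<open>auto simp: sets.Int_space_eq2\<close>)
    fix z
    show "(\<lambda>n. if z \<in> G then pull f (real n) z else \<integral>x. f x \<partial>\<rho>) \<longlonglongrightarrow> (\<integral>x. f x \<partial>K z)"
    proof (cases "z \<in> G")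
      case True
      then have "(fst z, snd z) \<in> G" by simp
      from filterlim_compose[OF pull_tendsto[OF f this] filterlim_real_sequentially]
      show ?thesis using True by simp
    qed (simp add: K_def)
  qed
qed

lemma measurable_K_Pair: "\<beta> \<in> C0 \<Longrightarrow> (\<lambda>\<omega>. K (\<omega>, \<beta>)) \<in> PW \<rightarrow>\<^sub>M prob_algebra borel"
  by (rule measurable_compose[OF measurable_Pair2' measurable_K]) simp

lemma measurable_limit_law: "limit_law \<in> PB \<rightarrow>\<^sub>M prob_algebra borel"
proof -
  have "(\<lambda>(\<beta>, \<omega>). K (\<omega>, \<beta>)) \<in> PB \<Otimes>\<^sub>M PW \<rightarrow>\<^sub>M prob_algebra borel"
    using measurable_compose[OF measurable_pair_swap' measurable_K] by (simp add: split_beta')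
  moreover have "(\<lambda>_. PW) \<in> PB \<rightarrow>\<^sub>M prob_algebra PW"
    by (rule measurable_const) (simp add: space_prob_algebra P.prob_space_axioms)
  ultimately have "(\<lambda>\<beta>. PW \<bind> (\<lambda>\<omega>. K (\<omega>, \<beta>))) \<in> PB \<rightarrow>\<^sub>M prob_algebra borel"
    by (rule measurable_bind_prob_space2[rotated])
  then show ?thesis unfolding limit_law_def[abs_def] .
qed

lemma limit_law_prob:
  assumes "\<beta> \<in> C0" shows "prob_space (limit_law \<beta>)" "sets (limit_law \<beta>) = sets borel"
  using prob_space_kernel[OF measurable_limit_law, of \<beta>] assms by auto

lemma limit_law_integral:
  assumes \<beta>: "\<beta> \<in> C0" and f: "unit_test f"
  shows "(\<integral>x. f x \<partial>limit_law \<beta>) = (\<integral>\<omega>. (\<integral>x. f x \<partial>K (\<omega>, \<beta>)) \<partial>PW)"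
  unfolding limit_law_def by (rule kernel_bind_integral[OF P.prob_space_axioms measurable_K_Pair[OF \<beta>] f])

definition good :: "(real \<Rightarrow> real^'n) \<Rightarrow> bool" where
  "good \<beta> \<longleftrightarrow> \<beta> \<in> C0 \<and> (AE \<omega> in PW. (\<omega>, \<beta>) \<in> G)"

text \<open>Fubini for the complement of \<open>G\<close>, after exchanging the factors so that the
  common noise comes first.\<close>

lemma AE_good: "AE \<beta> in PB. good \<beta>"
proof -
  interpret WB': pair_prob_space PB PW ..
  have "AE z in PB \<Otimes>\<^sub>M PW. (snd z, fst z) \<in> G"
  proof (rule AE_distrD[where f="\<lambda>z. (snd z, fst z)" and P="\<lambda>z. z \<in> G"])
    show "(\<lambda>z. (snd z, fst z)) \<in> PB \<Otimes>\<^sub>M PW \<rightarrow>\<^sub>M PW \<Otimes>\<^sub>M PB"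
      using measurable_pair_swap'[of PB PW] by (simp add: split_beta')
    have "distr (PB \<Otimes>\<^sub>M PW) (PW \<Otimes>\<^sub>M PB) (\<lambda>z. (snd z, fst z)) = PW \<Otimes>\<^sub>M PB"
      using WB.distr_pair_swap by (simp add: split_beta')
    then show "AE z in distr (PB \<Otimes>\<^sub>M PW) (PW \<Otimes>\<^sub>M PB) (\<lambda>z. (snd z, fst z)). z \<in> G" by (rule ssubst) (rule G(2))
  qed
  then have "AE \<beta> in PB. AE \<omega> in PW. (snd (\<beta>, \<omega>), fst (\<beta>, \<omega>)) \<in> G"
    by (rule WB'.AE_pair)
  moreover have "AE \<beta> in PB. \<beta> \<in> C0" using AE_space[of PB] by simp
  ultimately show ?thesis by eventually_elim (simp add: good_def)
qed

lemma AE_good_shift: "AE \<beta> in PB. good (wiener_shift s \<beta>)"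
proof (rule AE_distrD[where f="wiener_shift s" and P=good])
  show "wiener_shift s \<in> PB \<rightarrow>\<^sub>M path_space" by simp
  show "AE \<beta> in distr PB path_space (wiener_shift s). good \<beta>"
    unfolding wiener_shift_invariant[OF PB] by (rule AE_good)
qed

lemma mixture_eq_limit_law:
  assumes \<beta>: "good \<beta>"
  shows "mixture PW (\<lambda>\<omega>. \<mu> \<omega> \<beta>) = limit_law \<beta>"
proof -
  have C: "\<beta> \<in> C0" and ae: "AE \<omega> in PW. (\<omega>, \<beta>) \<in> G" using \<beta> by (auto simp: good_def)
  have e: "(\<integral>\<^sup>+\<omega>. emeasure (\<mu> \<omega> \<beta>) A \<partial>PW) = emeasure (limit_law \<beta>) A" for A
  proof -
    have "(\<integral>\<^sup>+\<omega>. emeasure (\<mu> \<omega> \<beta>) A \<partial>PW) = (\<integral>\<^sup>+\<omega>. emeasure (K (\<omega>, \<beta>)) A \<partial>PW)"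
      using ae by (intro nn_integral_cong_AE) (auto simp: K_def)
    also have "\<dots> = emeasure (limit_law \<beta>) A"
    \<comment> \<open>\<open>mixture\<close> is built from a set function on all sets, so the two
      functions are matched on non-Borel sets as well, where both vanish.\<close>
    proof (cases "A \<in> sets borel")
      case True
      have "PW \<in> space (prob_algebra PW)" by (simp add: space_prob_algebra P.prob_space_axioms)
      from emeasure_bind_prob_algebra[OF this measurable_K_Pair[OF C] True] show ?thesis by (simp add: limit_law_def)
    next
      case False
      then show ?thesis using K_prob(2) limit_law_prob(2)[OF C] by (simp add: emeasure_notin_sets)
    qed
    finally show ?thesis .
  qed
  have sp: "space (limit_law \<beta>) = UNIV" using sets_eq_imp_space_eq[OF limit_law_prob(2)[OF C]] by simp
  show ?thesis unfolding mixture_def e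
    using measure_of_of_measure[of "limit_law \<beta>"] by (simp add: sp limit_law_prob(2)[OF C])
qed

text \<open>The intrinsic noise is integrated out, so by invariance of its law it may be shifted
  along with \<open>\<beta>\<close>; this turns the forward law into an average of
  pullbacks.\<close>

lemma xlaw_pull:
  assumes \<beta>: "\<beta> \<in> C0" and t: "0 \<le> t" and f: "unit_test f"
  shows "(\<integral>y. f y \<partial>xlaw t (wiener_shift (-t) \<beta>)) = (\<integral>\<omega>. pull f t (\<omega>, \<beta>) \<partial>PW)"
proof -
  let ?\<beta> = "wiener_shift (-t) \<beta>"
  define h where "h \<omega> = (\<integral>x. f (phi t \<omega> ?\<beta> x) \<partial>\<rho>)" for \<omega>
  have b: "?\<beta> \<in> C0" by (rule wiener_shift_C0[OF \<beta>])
  have hm: "h \<in> borel_measurable path_space"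
  proof -
    have "(\<lambda>y. phi t (fst y) ?\<beta> (snd y)) \<in> borel_measurable (PW \<Otimes>\<^sub>M \<rho>)"
      by (rule measurable_phi[OF into_paths(1)[OF measurable_fst] measurable_const into_\<rho>[OF measurable_snd] t]) (simp add: b)
    from measurable_compose[OF this unit_testD(3)[OF f]]
    have "(\<lambda>(\<omega>, x). f (phi t \<omega> ?\<beta> x)) \<in> borel_measurable (PW \<Otimes>\<^sub>M \<rho>)" by (simp add: split_beta')
    from R.borel_measurable_lebesgue_integral[OF this] show ?thesis by (simp add: h_def[abs_def])
  qed
  have sm: "wiener_shift (-t) \<in> PW \<rightarrow>\<^sub>M path_space" by simp
  have "(\<integral>y. f y \<partial>xlaw t ?\<beta>) = (\<integral>\<omega>. h \<omega> \<partial>PW)" unfolding h_def by (rule xlaw_integral(2)[OF b t f])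
  also have "\<dots> = (\<integral>\<omega>. h \<omega> \<partial>distr PW path_space (wiener_shift (-t)))"
    by (simp only: wiener_shift_invariant[OF P])
  also have "\<dots> = (\<integral>\<omega>. h (wiener_shift (-t) \<omega>) \<partial>PW)" by (rule integral_distr[OF sm hm])
  finally show ?thesis by (simp add: h_def pull_def)
qed

text \<open>Dominated convergence over the intrinsic noise, with dominating constant 1; it works
  along sequences, hence \<open>X\<close>.\<close>

lemma xlaw_tendsto:
  assumes \<beta>: "good \<beta>" and X: "filterlim X at_top sequentially" "\<And>n. 0 \<le> X n" and f: "unit_test f"
  shows "(\<lambda>n. \<integral>y. f y \<partial>xlaw (X n) (wiener_shift (- X n) \<beta>)) \<longlonglongrightarrow> (\<integral>y. f y \<partial>limit_law \<beta>)"
proof -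
  have C: "\<beta> \<in> C0" and ae: "AE \<omega> in PW. (\<omega>, \<beta>) \<in> G" using \<beta> by (auto simp: good_def)
  have Pm: "(\<lambda>\<omega>. (\<omega>, \<beta>)) \<in> PW \<rightarrow>\<^sub>M PW \<Otimes>\<^sub>M PB" by (rule measurable_Pair2') (simp add: C)
  have Km: "(\<lambda>z. \<integral>x. f x \<partial>K z) \<in> borel_measurable (PW \<Otimes>\<^sub>M PB)"
    by (rule measurable_compose[OF measurable_prob_algebraD[OF measurable_K] integral_measurable_subprob_algebra[OF unit_testD(3)[OF f]]])
  show ?thesis
    unfolding xlaw_pull[OF C X(2) f] limit_law_integral[OF C f]
  proof (rule integral_dominated_convergence)
    show "(\<lambda>\<omega>. \<integral>x. f x \<partial>K (\<omega>, \<beta>)) \<in> borel_measurable PW" by (rule measurable_compose[OF Pm Km])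
    show "(\<lambda>\<omega>. pull f (X n) (\<omega>, \<beta>)) \<in> borel_measurable PW" for n
      by (rule measurable_compose[OF Pm measurable_pull[OF f X(2)]])
    show "integrable PW (\<lambda>_. 1::real)" by simp
    show "AE \<omega> in PW. (\<lambda>n. pull f (X n) (\<omega>, \<beta>)) \<longlonglongrightarrow> (\<integral>x. f x \<partial>K (\<omega>, \<beta>))"
      using ae by eventually_elim (rule filterlim_compose[OF pull_tendsto[OF f] X(1)])
    show "AE \<omega> in PW. norm (pull f (X n) (\<omega>, \<beta>)) \<le> 1" for n
      using pull_bound[OF f _ _ X(2)] C by (intro AE_I2) simp
  qed
qed

lemma xlaw_markov:
  assumes \<beta>: "\<beta> \<in> C0" and t: "0 \<le> t" and f: "unit_test f"
    and g: "unit_test (\<lambda>y. \<integral>\<omega>. f (phi 1 \<omega> (wiener_shift t \<beta>) y) \<partial>PW)"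
  shows "(\<integral>y. f y \<partial>xlaw (t + 1) \<beta>) = (\<integral>y. (\<integral>\<omega>. f (phi 1 \<omega> (wiener_shift t \<beta>) y) \<partial>PW) \<partial>xlaw t \<beta>)"
proof -
  have "(\<integral>y. f y \<partial>xlaw (t + 1) \<beta>) = (\<integral>x. (\<integral>\<omega>. f (phi (t + 1) \<omega> \<beta> x) \<partial>PW) \<partial>\<rho>)"
    using t by (intro xlaw_integral(1) \<beta> f) auto
  also have "\<dots> = (\<integral>x. (\<integral>\<omega>. (\<integral>\<omega>'. f (phi 1 \<omega>' (wiener_shift t \<beta>) (phi t \<omega> \<beta> x)) \<partial>PW) \<partial>PW) \<partial>\<rho>)"
    by (subst phi_markov[OF P \<beta> t _ unit_testD(3,2)[OF f]]) simp_all
  also have "\<dots> = (\<integral>y. (\<integral>\<omega>. f (phi 1 \<omega> (wiener_shift t \<beta>) y) \<partial>PW) \<partial>xlaw t \<beta>)"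
    by (rule xlaw_integral(1)[OF \<beta> t g, symmetric])
  finally show ?thesis .
qed

text \<open>The strong Feller property upgrades weak convergence to convergence in total variation: the
  functions tested at time \<open>t\<close> become equicontinuous when moved back to time \<open>t - 1\<close>.\<close>

lemma xlaw_tv_convergent:
  assumes \<beta>: "good \<beta>" "good (wiener_shift (-1) \<beta>)"
    and X: "filterlim X at_top sequentially" "\<And>n. 1 \<le> X n" and e: "0 < e"
  shows "\<forall>\<^sub>F n in sequentially. tv_le (xlaw (X n) (wiener_shift (- X n) \<beta>)) (limit_law \<beta>) e"
proof -
  let ?b = "wiener_shift (-1) \<beta>"
  have C: "\<beta> \<in> C0" "?b \<in> C0" using \<beta> by (auto simp: good_def)
  \<comment> \<open>The last unit of time as an operator on tests. Whatever \<open>n\<close> is, the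
    common noise it sees is the shift of \<open>\<beta>\<close> by \<open>-1\<close>, because the
    pullback fixes the end of the time interval and moves its start.\<close>
  define \<kappa> where "\<kappa> f y = (\<integral>\<omega>. f (phi 1 \<omega> ?b y) \<partial>PW)" for f :: "real^'n \<Rightarrow> real" and y
  have \<kappa>_eq: "\<exists>d>0. \<forall>h\<in>{\<kappa> f |f. unit_test f}. \<forall>y. dist y x < d \<longrightarrow> \<bar>h y - h x\<bar> \<le> e" if e: "0 < e" for x e
  proof -
    obtain d where d: "0 < d" "\<And>x' f. norm (x' - x) \<le> d \<Longrightarrow> unit_test f \<Longrightarrow>
       \<bar>(\<integral>\<omega>. f (phi 1 \<omega> ?b x') \<partial>PW) - (\<integral>\<omega>. f (phi 1 \<omega> ?b x) \<partial>PW)\<bar> \<le> e"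
      using strong_feller[OF P C(2), of 1 e x] e by auto
    show ?thesis using d(1) d(2)[OF less_imp_le] by (intro exI[of _ d] conjI) (auto simp: \<kappa>_def dist_norm)
  qed
  have \<kappa>_unit: "unit_test (\<kappa> f)" if f: "unit_test f" for f
    unfolding unit_test_def
  proof (intro conjI allI)
    show "continuous_on UNIV (\<kappa> f)"
      unfolding continuous_on_iff
    proof (intro ballI allI impI)
      fix x :: "real^'n" and e :: real assume "0 < e"
      with \<kappa>_eq[of "e / 2" x] f obtain d where "0 < d" "\<And>y. dist y x < d \<Longrightarrow> \<bar>\<kappa> f y - \<kappa> f x\<bar> \<le> e / 2" by auto
      then show "\<exists>d>0. \<forall>y\<in>UNIV. dist y x < d \<longrightarrow> dist (\<kappa> f y) (\<kappa> f x) < e"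
        using \<open>0 < e\<close> by (intro exI[of _ d]) (force simp: dist_real_def)
    qed
    show "\<bar>\<kappa> f y\<bar> \<le> 1" for y
    proof -
      have "(\<lambda>\<omega>. phi 1 \<omega> ?b y) \<in> borel_measurable PW"
        using C by (intro measurable_phi measurable_const into_paths(1) measurable_ident_sets refl) auto
      from unit_test_integrable(2)[OF P.prob_space_axioms this f] show ?thesis by (simp add: \<kappa>_def)
    qed
  qed
  define \<nu> where "\<nu> n = xlaw (X n - 1) (wiener_shift (- (X n - 1)) ?b)" for n
  have X1: "0 \<le> X n - 1" for n using X(2)[of n] by simp
  have X1_top: "filterlim (\<lambda>n. X n - 1) at_top sequentially"
    using filterlim_tendsto_add_at_top[OF tendsto_const X(1), of "-1"] by simp
  have move: "(\<integral>y. f y \<partial>xlaw (X n) (wiener_shift (- X n) \<beta>)) = (\<integral>y. \<kappa> f y \<partial>\<nu> n)" if f: "unit_test f" for f n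
  proof -
    let ?c = "wiener_shift (- X n) \<beta>"
    have s: "wiener_shift (X n - 1) ?c = ?b" by (simp add: wiener_shift_shift)
    have "wiener_shift (- (X n - 1)) ?b = ?c" by (simp add: wiener_shift_shift)
    then have \<nu>: "\<nu> n = xlaw (X n - 1) ?c" by (simp add: \<nu>_def)
    have "(\<integral>y. f y \<partial>xlaw (X n - 1 + 1) ?c) = (\<integral>y. (\<integral>\<omega>. f (phi 1 \<omega> (wiener_shift (X n - 1) ?c) y) \<partial>PW) \<partial>xlaw (X n - 1) ?c)"
      by (rule xlaw_markov[OF wiener_shift_C0[OF C(1)] X1 f]) (use \<kappa>_unit[OF f] in \<open>simp add: s \<kappa>_def[abs_def]\<close>)
    then show ?thesis by (simp add: s \<nu> \<kappa>_def)
  qed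
  \<comment> \<open>The limit inherits the one-step relation, as both sides are limits of the same
    sequence; this uses \<open>good\<close> at \<open>\<beta>\<close> and at its shift.\<close>
  have lim: "(\<integral>y. f y \<partial>limit_law \<beta>) = (\<integral>y. \<kappa> f y \<partial>limit_law ?b)" if f: "unit_test f" for f
  proof (rule LIMSEQ_unique)
    show "(\<lambda>n. \<integral>y. \<kappa> f y \<partial>\<nu> n) \<longlonglongrightarrow> (\<integral>y. f y \<partial>limit_law \<beta>)"
      unfolding move[OF f, symmetric]
      by (rule xlaw_tendsto[OF \<beta>(1) X(1) _ f]) (rule order_trans[OF zero_le_one X(2)])
    show "(\<lambda>n. \<integral>y. \<kappa> f y \<partial>\<nu> n) \<longlonglongrightarrow> (\<integral>y. \<kappa> f y \<partial>limit_law ?b)"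
      unfolding \<nu>_def by (rule xlaw_tendsto[OF \<beta>(2) X1_top X1 \<kappa>_unit[OF f]])
  qed
  have "\<forall>\<^sub>F n in sequentially. \<forall>h\<in>{\<kappa> f |f. unit_test f}. \<bar>(\<integral>x. h x \<partial>\<nu> n) - (\<integral>x. h x \<partial>limit_law ?b)\<bar> \<le> e"
  proof (rule weak_convergence_equicontinuous[OF _ _ limit_law_prob[OF C(2)] _ _ \<kappa>_eq e])
    show "prob_space (\<nu> n)" for n unfolding \<nu>_def by (rule prob_space_xlaw[OF wiener_shift_C0[OF C(2)] X1])
    show "sets (\<nu> n) = sets borel" for n by (simp add: \<nu>_def)
    show "(\<lambda>n. \<integral>y. f y \<partial>\<nu> n) \<longlonglongrightarrow> (\<integral>y. f y \<partial>limit_law ?b)" if "unit_test f" for f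
      unfolding \<nu>_def by (rule xlaw_tendsto[OF \<beta>(2) X1_top X1 that])
    show "unit_test h" if "h \<in> {\<kappa> f |f. unit_test f}" for h using that \<kappa>_unit by auto
  qed
  then show ?thesis
    by eventually_elim (auto simp: tv_le_def move lim)
qed

text \<open>The laws before the limit have densities, and vanishing on a null set survives a limit
  in total variation.\<close>

lemma limit_law_null:
  assumes \<beta>: "good \<beta>" "good (wiener_shift (-1) \<beta>)" and A: "A \<in> null_sets lborel"
  shows "measure (limit_law \<beta>) A = 0"
proof -
  have C: "\<beta> \<in> C0" using \<beta> by (auto simp: good_def)
  have Ab: "A \<in> sets borel" using A by auto
  have "measure (limit_law \<beta>) A \<le> 0"
  proof (rule field_le_epsilon)
    fix e :: real assume e: "0 < e"
    \<comment> \<open>\<open>max 1\<close> because the total variation convergence is stated for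
      times of at least 1.\<close>
    have "filterlim (\<lambda>n. max 1 (real n)) at_top sequentially"
      by (rule filterlim_at_top_mono[OF filterlim_real_sequentially]) simp
    from xlaw_tv_convergent[OF \<beta> this _ e]
    obtain n where "tv_le (xlaw (max 1 (real n)) (wiener_shift (- max 1 (real n)) \<beta>)) (limit_law \<beta>) e"
      using eventually_happens'[OF sequentially_bot] by auto
    moreover define t where "t = max 1 (real n)"
    ultimately have tv: "tv_le (xlaw t (wiener_shift (-t) \<beta>)) (limit_law \<beta>) e" by simp
    have t: "0 \<le> t" by (simp add: t_def)
    have b: "wiener_shift (-t) \<beta> \<in> C0" by (rule wiener_shift_C0[OF C])
    have "emeasure (xlaw t (wiener_shift (-t) \<beta>)) A = 0"
      unfolding Phi_xlaw(2)[OF b t]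
      by (rule absolutely_continuousD[OF absolutely_continuousI_density null_setsD2[OF A] null_setsD1[OF A]])
        (use Phi_xlaw(1)[OF b t] in \<open>simp add: prob_density_def\<close>)
    then have "measure (xlaw t (wiener_shift (-t) \<beta>)) A = 0" by (simp add: measure_def)
    then show "measure (limit_law \<beta>) A \<le> 0 + e"
      using tv_le_measure[OF limit_law_prob[OF C] prob_space_xlaw[OF b t] sets_xlaw tv_le_sym[OF tv] Ab] by simp
  qed
  then show ?thesis by (simp add: measure_le_0_iff)
qed

text \<open>The L1 distance of densities is controlled by total variation. Convergence along the
  reals follows from that along all sequences tending to infinity, each raised to at least 1 without
  changing its tail.\<close>

lemma Phi_tendsto:
  assumes \<beta>: "good \<beta>" "good (wiener_shift (-1) \<beta>)"
    and p: "prob_density p" "limit_law \<beta> = density lborel (\<lambda>x. ennreal (p x))"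
  shows "((\<lambda>\<tau>. L1_dist (Phi \<tau> (wiener_shift (-\<tau>) \<beta>) p0) p) \<longlongrightarrow> 0) at_top"
proof (rule tendsto_at_topI_sequentially)
  fix X :: "nat \<Rightarrow> real" assume X: "filterlim X at_top sequentially"
  have C: "\<beta> \<in> C0" using \<beta> by (auto simp: good_def)
  have X': "filterlim (\<lambda>n. max 1 (X n)) at_top sequentially"
    by (rule filterlim_at_top_mono[OF X]) simp
  show "(\<lambda>n. L1_dist (Phi (X n) (wiener_shift (- X n) \<beta>) p0) p) \<longlonglongrightarrow> 0"
  proof (rule ennreal_tendsto_0I)
    fix e :: real assume "0 < e"
    then have "0 < e / 2" by simp
    from xlaw_tv_convergent[OF \<beta> X' _ this]
    have "\<forall>\<^sub>F n in sequentially. tv_le (xlaw (max 1 (X n)) (wiener_shift (- max 1 (X n)) \<beta>)) (limit_law \<beta>) (e / 2)" by simp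
    moreover have "\<forall>\<^sub>F n in sequentially. 1 \<le> X n" using X by (simp add: filterlim_at_top)
    ultimately show "\<forall>\<^sub>F n in sequentially. L1_dist (Phi (X n) (wiener_shift (- X n) \<beta>) p0) p \<le> ennreal e"
    proof eventually_elim
      case (elim n)
      then have m: "max 1 (X n) = X n" by simp
      have b: "wiener_shift (- X n) \<beta> \<in> C0" by (rule wiener_shift_C0[OF C])
      have t: "0 \<le> X n" using elim(2) by simp
      have "L1_dist (Phi (X n) (wiener_shift (- X n) \<beta>) p0) p \<le> ennreal (2 * (e / 2))"
        by (rule tv_le_L1_dist[OF Phi_xlaw(1)[OF b t] p(1)])
          (use elim(1) in \<open>simp only: m Phi_xlaw(2)[OF b t] p(2)\<close>)
      then show ?case by simp
    qed
  qed
qed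

text \<open>The shifted common noise again has law \<open>PB\<close>, so by stationarity the average
  of the laws at time \<open>n\<close> is \<open>\<rho>\<close> for every \<open>n\<close>, while
  dominated convergence gives the average of \<open>limit_law\<close> in the limit.\<close>

lemma limit_law_average: "PB \<bind> limit_law = \<rho>"
proof (rule measures_eq_if_unit_test)
  have PBs: "PB \<in> space (prob_algebra PB)" by (simp add: space_prob_algebra B.prob_space_axioms)
  show "prob_space (PB \<bind> limit_law)" "sets (PB \<bind> limit_law) = sets borel"
    using prob_space_bind'[OF PBs measurable_limit_law] sets_bind'[OF PBs measurable_limit_law] by auto
  show "prob_space \<rho>" "sets \<rho> = sets borel" by (rule \<rho>)+
  fix f :: "real^'n \<Rightarrow> real" assume f: "unit_test f"
  let ?I = "\<lambda>n \<beta>. \<integral>y. f y \<partial>xlaw (real n) (wiener_shift (- real n) \<beta>)"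
  have sm: "wiener_shift s \<in> PB \<rightarrow>\<^sub>M path_space" for s by simp
  have xm: "(\<lambda>\<beta>. \<integral>y. f y \<partial>xlaw (real n) \<beta>) \<in> borel_measurable path_space" for n
    using stationary_integral(1)[OF _ f, of "real n"] by simp
  have "(\<integral>y. f y \<partial>(PB \<bind> limit_law)) = (\<integral>\<beta>. (\<integral>y. f y \<partial>limit_law \<beta>) \<partial>PB)"
    by (rule kernel_bind_integral[OF B.prob_space_axioms measurable_limit_law f])
  moreover have "(\<lambda>n. \<integral>\<beta>. ?I n \<beta> \<partial>PB) \<longlonglongrightarrow> (\<integral>\<beta>. (\<integral>y. f y \<partial>limit_law \<beta>) \<partial>PB)"
  proof (rule integral_dominated_convergence)
    show "(\<lambda>\<beta>. \<integral>y. f y \<partial>limit_law \<beta>) \<in> borel_measurable PB"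
      by (rule measurable_compose[OF measurable_prob_algebraD[OF measurable_limit_law] integral_measurable_subprob_algebra[OF unit_testD(3)[OF f]]])
    show "?I n \<in> borel_measurable PB" for n by (rule measurable_compose[OF sm xm])
    show "integrable PB (\<lambda>_. 1::real)" by simp
    show "AE \<beta> in PB. (\<lambda>n. ?I n \<beta>) \<longlonglongrightarrow> (\<integral>y. f y \<partial>limit_law \<beta>)"
      using AE_good by eventually_elim (rule xlaw_tendsto[OF _ filterlim_real_sequentially _ f], simp_all)
    show "AE \<beta> in PB. norm (?I n \<beta>) \<le> 1" for n
    proof (rule AE_I2)
      fix \<beta> :: "real \<Rightarrow> real^'n" assume "\<beta> \<in> space PB"
      then have "prob_space (xlaw (real n) (wiener_shift (- real n) \<beta>))" by (intro prob_space_xlaw wiener_shift_C0) auto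
      from unit_test_integrable(2)[OF this _ f, of "\<lambda>x. x"] show "norm (?I n \<beta>) \<le> 1"
        by (simp add: measurable_cong_sets[OF sets_xlaw refl])
    qed
  qed
  moreover have "(\<integral>\<beta>. ?I n \<beta> \<partial>PB) = (\<integral>y. f y \<partial>\<rho>)" for n
  proof -
    have "(\<integral>\<beta>. ?I n \<beta> \<partial>PB) = (\<integral>\<beta>. (\<integral>y. f y \<partial>xlaw (real n) \<beta>) \<partial>distr PB path_space (wiener_shift (- real n)))"
      by (rule integral_distr[OF sm xm, symmetric])
    also have "\<dots> = (\<integral>y. f y \<partial>\<rho>)"
      unfolding wiener_shift_invariant[OF PB] by (rule stationary_integral(2)[OF _ f, symmetric]) simp
    finally show ?thesis .
  qed
  ultimately show "(\<integral>y. f y \<partial>(PB \<bind> limit_law)) = (\<integral>y. f y \<partial>\<rho>)"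
    by (simp add: LIMSEQ_const_iff)
qed

text \<open>Tonelli, made possible by joint measurability of \<open>p\<close>, gives the averaged
  measure the density \<open>g\<close>; uniqueness of densities then compares \<open>g\<close> with
  \<open>p0\<close> almost everywhere.\<close>

lemma average_density:
  assumes pm: "(\<lambda>(\<beta>, x). p \<beta> x) \<in> borel_measurable (PB \<Otimes>\<^sub>M lborel)"
    and nonneg: "\<And>\<beta> x. 0 \<le> p \<beta> x"
    and p: "AE \<beta> in PB. prob_density (p \<beta>) \<and> limit_law \<beta> = density lborel (\<lambda>x. ennreal (p \<beta> x))"
  shows "AE x in lborel. has_bochner_integral PB (\<lambda>\<beta>. p \<beta> x) (p0 x)"
proof -
  interpret BL: pair_sigma_finite PB "lborel :: (real^'n) measure" ..
  define g where "g x = (\<integral>\<^sup>+\<beta>. ennreal (p \<beta> x) \<partial>PB)" for x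
  have pm': "(\<lambda>z. ennreal (p (fst z) (snd z))) \<in> borel_measurable (PB \<Otimes>\<^sub>M lborel)"
    using measurable_compose[OF pm measurable_ennreal] by (simp add: split_beta')
  have swap: "(\<lambda>(x, \<beta>). ennreal (p \<beta> x)) \<in> borel_measurable (lborel \<Otimes>\<^sub>M PB)"
    using measurable_compose[OF measurable_pair_swap' pm'] by (simp add: split_beta')
  have gm: "g \<in> borel_measurable lborel"
    using B.borel_measurable_nn_integral[OF swap] by (simp add: g_def[abs_def])
  have p0m: "(\<lambda>x. ennreal (p0 x)) \<in> borel_measurable lborel" using p0 by (simp add: prob_density_def)
  have "density lborel g = density lborel (\<lambda>x. ennreal (p0 x))"
    unfolding \<rho>_density[symmetric]
  proof (rule measure_eqI)
    show "sets (density lborel g) = sets \<rho>" by (simp add: \<rho>(2))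
    fix A assume "A \<in> sets (density lborel g)"
    then have A: "A \<in> sets borel" by simp
    have iA: "(\<lambda>x. indicator A x :: ennreal) \<in> borel_measurable lborel" using A by simp
    have "emeasure \<rho> A = (\<integral>\<^sup>+\<beta>. emeasure (limit_law \<beta>) A \<partial>PB)"
    proof -
      have "PB \<in> space (prob_algebra PB)" by (simp add: space_prob_algebra B.prob_space_axioms)
      from emeasure_bind_prob_algebra[OF this measurable_limit_law A] show ?thesis by (simp add: limit_law_average)
    qed
    also have "\<dots> = (\<integral>\<^sup>+\<beta>. (\<integral>\<^sup>+x. ennreal (p \<beta> x) * indicator A x \<partial>lborel) \<partial>PB)"
    proof (rule nn_integral_cong_AE)
      show "AE \<beta> in PB. emeasure (limit_law \<beta>) A = (\<integral>\<^sup>+x. ennreal (p \<beta> x) * indicator A x \<partial>lborel)"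
        using p by eventually_elim (use A in \<open>auto simp: prob_density_def emeasure_density\<close>)
    qed
    also have "\<dots> = (\<integral>\<^sup>+x. (\<integral>\<^sup>+\<beta>. ennreal (p \<beta> x) * indicator A x \<partial>PB) \<partial>lborel)"
    proof -
      have "(\<lambda>z. ennreal (p (fst z) (snd z)) * indicator A (snd z)) \<in> borel_measurable (PB \<Otimes>\<^sub>M lborel)"
        by (rule borel_measurable_times_ennreal[OF pm' measurable_compose[OF measurable_snd iA]])
      then have "(\<lambda>(\<beta>, x). ennreal (p \<beta> x) * indicator A x) \<in> borel_measurable (PB \<Otimes>\<^sub>M lborel)"
        by (simp add: split_beta')
      from BL.Fubini'[OF this] show ?thesis by simp
    qed
    also have "\<dots> = (\<integral>\<^sup>+x. g x * indicator A x \<partial>lborel)"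
    proof (rule nn_integral_cong)
      fix x :: "real^'n"
      have "(\<lambda>\<beta>. ennreal (p \<beta> x)) \<in> borel_measurable PB"
        using measurable_compose[OF measurable_Pair2'[of x lborel PB] pm'] by simp
      then show "(\<integral>\<^sup>+\<beta>. ennreal (p \<beta> x) * indicator A x \<partial>PB) = g x * indicator A x"
        unfolding g_def by (rule nn_integral_multc)
    qed
    also have "\<dots> = emeasure (density lborel g) A" using gm A by (simp add: emeasure_density)
    finally show "emeasure (density lborel g) A = emeasure \<rho> A" by simp
  qed
  then have ae1: "AE x in lborel. g x = ennreal (p0 x)"
    by (intro sigma_finite_measure.density_unique[OF sigma_finite_lborel gm p0m])
  then show ?thesis
  proof eventually_elim
    case (elim x)
    show ?case
    proof (rule has_bochner_integral_nn_integral)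
      show "(\<lambda>\<beta>. p \<beta> x) \<in> borel_measurable PB"
        using measurable_compose[OF measurable_Pair2'[of x lborel PB] pm] by simp
      show "AE \<beta> in PB. 0 \<le> p \<beta> x" by (simp add: nonneg)
      show "0 \<le> p0 x" using p0 by (simp add: prob_density_def)
      show "(\<integral>\<^sup>+\<beta>. ennreal (p \<beta> x) \<partial>PB) = ennreal (p0 x)" using elim by (simp add: g_def)
    qed
  qed
qed

text \<open>Total variation convergence looks back one unit of time, so the exceptional set is
  enlarged by the noises whose shift by \<open>-1\<close> is not good.\<close>

lemma pullback_density:
  "\<exists>p :: (real \<Rightarrow> real^'n) \<Rightarrow> real^'n \<Rightarrow> real.
     (\<lambda>(\<beta>, x). p \<beta> x) \<in> borel_measurable (PB \<Otimes>\<^sub>M lborel) \<and>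
     (AE \<beta> in PB.
        prob_space (mixture PW (\<lambda>\<omega>. \<mu> \<omega> \<beta>)) \<and>
        prob_density (p \<beta>) \<and>
        mixture PW (\<lambda>\<omega>. \<mu> \<omega> \<beta>) = density lborel (\<lambda>x. ennreal (p \<beta> x)) \<and>
        ((\<lambda>\<tau>. L1_dist (Phi \<tau> (wiener_shift (-\<tau>) \<beta>) p0) (p \<beta>)) \<longlongrightarrow> 0) at_top) \<and>
     (AE x in lborel. has_bochner_integral PB (\<lambda>\<beta>. p \<beta> x) (p0 x))"
proof -
  have "AE \<beta> in PB. \<forall>A\<in>null_sets lborel. measure (limit_law \<beta>) A = 0"
    using AE_good AE_good_shift[of "-1"] by eventually_elim (blast intro: limit_law_null)
  then obtain p where p: "(\<lambda>(\<beta>, x). p \<beta> x) \<in> borel_measurable (PB \<Otimes>\<^sub>M lborel)" "\<And>\<beta> x. 0 \<le> p \<beta> x"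
    "AE \<beta> in PB. prob_density (p \<beta>) \<and> limit_law \<beta> = density lborel (\<lambda>x. ennreal (p \<beta> x))"
    by (rule kernel_density[OF B.prob_space_axioms measurable_limit_law]) (rule that)
  show ?thesis
  proof (intro exI[of _ p] conjI p(1) average_density[OF p])
    show "AE \<beta> in PB.
        prob_space (mixture PW (\<lambda>\<omega>. \<mu> \<omega> \<beta>)) \<and>
        prob_density (p \<beta>) \<and>
        mixture PW (\<lambda>\<omega>. \<mu> \<omega> \<beta>) = density lborel (\<lambda>x. ennreal (p \<beta> x)) \<and>
        ((\<lambda>\<tau>. L1_dist (Phi \<tau> (wiener_shift (-\<tau>) \<beta>) p0) (p \<beta>)) \<longlongrightarrow> 0) at_top"
      using AE_good AE_good_shift[of "-1"] p(3)
    proof eventually_elim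
      case (elim \<beta>)
      have m: "mixture PW (\<lambda>\<omega>. \<mu> \<omega> \<beta>) = limit_law \<beta>" by (rule mixture_eq_limit_law[OF elim(1)])
      have C: "\<beta> \<in> C0" using elim(1) by (simp add: good_def)
      show ?case unfolding m
        using limit_law_prob(1)[OF C] elim(3) Phi_tendsto[OF elim(1,2)] by blast
    qed
  qed
qed

end

section \<open>Local Lipschitz bounds for the gradient, and the conclusion\<close>

lemma smooth_Lipschitz_on_cball:
  fixes f :: "real^'n \<Rightarrow> real"
  assumes f: "smooth f"
  shows "\<exists>L\<ge>0. \<forall>y\<in>cball 0 R. \<forall>z\<in>cball 0 R. \<bar>f y - f z\<bar> \<le> L * norm (y - z)"
proof -
  note d = smoothD(1)[OF f] and c = smoothD(2)[OF smoothD(3)[OF f]]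
  have "continuous_on UNIV (grad f)" unfolding grad_def by (intro continuous_on_vec_lambda c)
  then have "compact (grad f ` cball 0 R)"
    by (intro compact_continuous_image compact_cball) (rule continuous_on_subset, auto)
  from compact_imp_bounded[OF this] obtain L where L: "0 < L" "\<forall>y\<in>grad f ` cball 0 R. norm y \<le> L"
    unfolding bounded_pos by (elim exE conjE)
  have "\<bar>f y - f z\<bar> \<le> L * norm (y - z)" if "y \<in> cball 0 R" "z \<in> cball 0 R" for y z
  proof -
    have "norm (f y - f z) \<le> L * norm (y - z)"
    proof (rule differentiable_bound[where f'="\<lambda>x h. grad f x \<bullet> h", OF convex_cball _ _ that])
      fix x :: "real^'n" assume x: "x \<in> cball 0 R"
      show "(f has_derivative (\<lambda>h. grad f x \<bullet> h)) (at x within cball 0 R)"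
        using has_derivative_grad[OF d] by (rule has_derivative_at_withinI)
      show "onorm (\<lambda>h. grad f x \<bullet> h) \<le> L"
      proof (rule onorm_bound)
        show "norm (grad f x \<bullet> h) \<le> L * norm h" for h
          using Cauchy_Schwarz_ineq2[of "grad f x" h] mult_right_mono[OF bspec[OF L(2) imageI[OF x]] norm_ge_zero[of h]]
          by simp
      qed (use L(1) in simp)
    qed
    then show ?thesis by simp
  qed
  then show ?thesis using L(1) by (intro exI[of _ L]) auto
qed

lemma grad_Lipschitz_on_cball:
  fixes V :: "real^'n \<Rightarrow> real"
  assumes V: "smooth V"
  shows "\<exists>L\<ge>0. \<forall>y\<in>cball 0 R. \<forall>z\<in>cball 0 R. norm (grad V y - grad V z) \<le> L * norm (y - z)"
proof -
  have "\<forall>i. \<exists>L\<ge>0. \<forall>y\<in>cball 0 R. \<forall>z\<in>cball 0 R. \<bar>partial_deriv i V y - partial_deriv i V z\<bar> \<le> L * norm (y - z)"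
    using smooth_Lipschitz_on_cball[OF smoothD(3)[OF V]] by (rule allI)
  then obtain L where L: "\<And>i. 0 \<le> L i"
    "\<And>i y z. y \<in> cball 0 R \<Longrightarrow> z \<in> cball 0 R \<Longrightarrow> \<bar>partial_deriv i V y - partial_deriv i V z\<bar> \<le> L i * norm (y - z)"
    by metis
  have "norm (grad V y - grad V z) \<le> (\<Sum>i\<in>UNIV. L i) * norm (y - z)" if "y \<in> cball 0 R" "z \<in> cball 0 R" for y z
  proof -
    have "norm (grad V y - grad V z) \<le> (\<Sum>i\<in>UNIV. \<bar>(grad V y - grad V z) $ i\<bar>)" by (rule norm_le_l1_cart)
    also have "\<dots> \<le> (\<Sum>i\<in>UNIV. L i * norm (y - z))" using L(2)[OF that] by (intro sum_mono) (simp add: grad_def)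
    finally show ?thesis by (simp add: sum_distrib_right)
  qed
  then show ?thesis using L(1) by (intro exI[of _ "\<Sum>i\<in>UNIV. L i"] conjI sum_nonneg) auto
qed

theorem proposition4p4:
  fixes V :: "real^'n \<Rightarrow> real"
    and \<sigma> \<eta> :: "real^'n^'n"
    and PW PB :: "(real \<Rightarrow> real^'n) measure"
    and phi :: "real \<Rightarrow> (real \<Rightarrow> real^'n) \<Rightarrow> (real \<Rightarrow> real^'n) \<Rightarrow> real^'n \<Rightarrow> real^'n"
    and Phi :: "real \<Rightarrow> (real \<Rightarrow> real^'n) \<Rightarrow> (real^'n \<Rightarrow> real) \<Rightarrow> real^'n \<Rightarrow> real"
    and \<rho> :: "(real^'n) measure"
    and p\<^sub>\<rho> :: "real^'n \<Rightarrow> real"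
    and \<mu> :: "(real \<Rightarrow> real^'n) \<Rightarrow> (real \<Rightarrow> real^'n) \<Rightarrow> (real^'n) measure"
  assumes V: "smooth V"
    and sigma: "pos_def \<sigma>"
    and eta: "pos_def \<eta>"
    and growth: "\<exists>C>0. \<forall>x b. (grad V (x + \<eta> *v b) \<bullet> x) * norm x ^ 2 \<ge>
                   1/2 * norm x ^ 6 - C * norm b ^ 6"
    and PW: "wiener_measure PW"
    and PB: "wiener_measure PB"
    and phi: "sde_flow V \<sigma> \<eta> phi"
    and Phi: "stochastic_fp_flow V \<sigma> \<eta> Phi"
    and stationary: "stationary_measure PW PB phi \<rho>"
    and density_rho: "prob_density p\<^sub>\<rho>" "\<rho> = density lborel (\<lambda>x. ennreal (p\<^sub>\<rho> x))"
    and mu: "AE (\<omega>, \<beta>) in PW \<Otimes>\<^sub>M PB.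
               prob_space (\<mu> \<omega> \<beta>) \<and> sets (\<mu> \<omega> \<beta>) = sets borel \<and>
               weak_limit (\<lambda>\<tau>. distr \<rho> borel (phi \<tau> (wiener_shift (-\<tau>) \<omega>) (wiener_shift (-\<tau>) \<beta>)))
                 (\<mu> \<omega> \<beta>) at_top"
  shows "\<exists>p :: (real \<Rightarrow> real^'n) \<Rightarrow> real^'n \<Rightarrow> real.
           (\<lambda>(\<beta>, x). p \<beta> x) \<in> borel_measurable (PB \<Otimes>\<^sub>M lborel) \<and>
           (AE \<beta> in PB.
              prob_space (mixture PW (\<lambda>\<omega>. \<mu> \<omega> \<beta>)) \<and>
              prob_density (p \<beta>) \<and>
              mixture PW (\<lambda>\<omega>. \<mu> \<omega> \<beta>) = density lborel (\<lambda>x. ennreal (p \<beta> x)) \<and>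
              ((\<lambda>\<tau>. L1_dist (Phi \<tau> (wiener_shift (-\<tau>) \<beta>) p\<^sub>\<rho>) (p \<beta>)) \<longlongrightarrow> 0) at_top) \<and>
           (AE x in lborel. has_bochner_integral PB (\<lambda>\<beta>. p \<beta> x) (p\<^sub>\<rho> x))"
proof -
  let ?F = "\<lambda>y. - grad V y"
  have rp: "prob_space \<rho>" and rs: "sets \<rho> = sets borel"
    using stationary unfolding stationary_measure_def by (simp_all only:)
  interpret noisy_flow ?F \<sigma> \<eta> phi
  proof
    show "\<exists>L\<ge>0. \<forall>y\<in>cball 0 R. \<forall>z\<in>cball 0 R. norm (?F y - ?F z) \<le> L * norm (y - z)" for R
      using grad_Lipschitz_on_cball[OF V, of R] by (simp add: norm_minus_commute)
    obtain C where C: "0 < C" "\<And>x b. (grad V (x + \<eta> *v b) \<bullet> x) * norm x ^ 2 \<ge> 1/2 * norm x ^ 6 - C * norm b ^ 6"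
      using growth by blast
    have "?F (x + \<eta> *v b) \<bullet> x * norm x ^ 2 \<le> C * norm b ^ 6" for x b
      using C(2)[of x b] zero_le_power[OF norm_ge_zero, of x 6]
      unfolding inner_minus_left mult_minus_left by linarith
    then show "\<exists>C>0. \<forall>x b. ?F (x + \<eta> *v b) \<bullet> x * norm x ^ 2 \<le> C * norm b ^ 6" using C(1) by blast
    fix \<omega> \<beta> :: "real \<Rightarrow> real^'n" and x assume p: "\<omega> \<in> C0" "\<beta> \<in> C0"
    show "continuous_on {0..} (\<lambda>t. phi t \<omega> \<beta> x)" using phi p unfolding sde_flow_def by blast
    fix t :: real assume "0 \<le> t"
    then show "phi t \<omega> \<beta> x = x + integral {0..t} (\<lambda>s. ?F (phi s \<omega> \<beta> x)) + \<sigma> *v \<omega> t + \<eta> *v \<beta> t"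
      using phi p unfolding sde_flow_def by (simp add: integral_neg)
  qed (rule sigma eta)+
  interpret noisy_law ?F \<sigma> \<eta> phi PW \<rho>
    by (intro noisy_law.intro noisy_law_axioms.intro noisy_flow_axioms PW rp rs)
  interpret stationary_flow ?F \<sigma> \<eta> phi PW \<rho> V PB p\<^sub>\<rho> Phi
    by (intro stationary_flow.intro stationary_flow_axioms.intro noisy_law_axioms refl PB stationary density_rho Phi)
  \<comment> \<open>The set on which \<open>mu\<close> fails may not be measurable; a measurable
    null set \<open>N\<close> covers it, and the complement of \<open>N\<close> serves as
    \<open>G\<close>.\<close>
  obtain N where N: "{z \<in> space (PW \<Otimes>\<^sub>M PB). \<not> (case z of (\<omega>, \<beta>) \<Rightarrow> prob_space (\<mu> \<omega> \<beta>) \<and> sets (\<mu> \<omega> \<beta>) = sets borel \<and>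
       weak_limit (\<lambda>\<tau>. distr \<rho> borel (phi \<tau> (wiener_shift (-\<tau>) \<omega>) (wiener_shift (-\<tau>) \<beta>))) (\<mu> \<omega> \<beta>) at_top)} \<subseteq> N"
    "emeasure (PW \<Otimes>\<^sub>M PB) N = 0" "N \<in> sets (PW \<Otimes>\<^sub>M PB)"
    using mu by (rule AE_E)
  have outside: "{z \<in> S. \<not> Q z} \<subseteq> N \<Longrightarrow> z \<in> S - N \<Longrightarrow> Q z" for S Q N and z :: "(real \<Rightarrow> real^'n) \<times> (real \<Rightarrow> real^'n)"
    by blast
  note * = outside[OF N(1), of "(\<omega>, \<beta>)" for \<omega> \<beta>, unfolded case_prod_conv]
  interpret pullback_flow ?F \<sigma> \<eta> phi PW \<rho> V PB p\<^sub>\<rho> Phi \<mu> "space (PW \<Otimes>\<^sub>M PB) - N"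
  proof (intro pullback_flow.intro pullback_flow_axioms.intro stationary_flow_axioms)
    show "space (PW \<Otimes>\<^sub>M PB) - N \<in> sets (PW \<Otimes>\<^sub>M PB)" using N(3) by (rule sets.compl_sets)
    show "AE z in PW \<Otimes>\<^sub>M PB. z \<in> space (PW \<Otimes>\<^sub>M PB) - N"
      using AE_not_in[of N "PW \<Otimes>\<^sub>M PB"] N(2,3) AE_space by (auto simp: null_sets_def)
  qed (erule *[THEN conjunct1] *[THEN conjunct2, THEN conjunct1] *[THEN conjunct2, THEN conjunct2])+
  show ?thesis by (rule pullback_density)
qed

end
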